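(* Let $\{Y_k\}$ be a fourth-order stationary sequence with $EY_k=0$, autocovariances $\gamma_j=\mathrm{Cov}(Y_0,Y_j)$ and fourth-order cumulants $\kappa(h,r,s)$, satisfying: (a) $n^{-1/2}\sum_{1\le j\le nt}Y_j\xrightarrow{d}\sigma W(t)$ in $D[0,1]$ for some $\sigma>0$, where $W$ is a standard Wiener process; (b) $\sum_j|\gamma_j|<\infty$; (c) $\sup_h\sum_{r,s}|\kappa(h,r,s)|<\infty$. For each $n$ let the observations $X_1,\dots,X_n$ be given by $X_i=\mu+Y_i$ for $1\le i\le k^*$ and $X_i=\mu+\Delta+Y_i$ for $k^*<i\le n$, where $\mu$ is a constant and $k^*=k^*(n)$, $\Delta=\Delta(n)$ satisfy $k^*=[n\theta]$ for some $0<\theta<1$, $n\Delta^2\to\infty$, $\Delta^2|\hat k-k^*|=O_P(1)$ and $q(n)\Delta^2=O(1)$, where $\hat k$ is the change-point estimator and $q$ the bandwidth described in the context. Suppose $q(n)$ is nondecreasing, $\sup_{k\ge0}q(2^{k+1})/q(2^k)<\infty$, $q(n)\to\infty$ and $q(n)(\log n)^4=O(n)$. Then $$(T_{n,1},T_{n,2})\xrightarrow{d}\Big(\sup_{0\le t\le1}|B^{(1)}(t)|,\ \sup_{0\le t\le1}|B^{(2)}(t)|\Big),$$ where $B^{(1)}$ and $B^{(2)}$ are independent Brownian bridges.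
   Context: A sequence is fourth-order stationary if it has finite fourth moments and all its joint moments of order at most four are invariant under time shifts. For a fourth-order stationary mean-zero sequence $\{Y_k\}$ the fourth-order cumulant is $\kappa(h,r,s)=E[Y_kY_{k+h}Y_{k+r}Y_{k+s}]-(\gamma_h\gamma_{r-s}+\gamma_r\gamma_{h-s}+\gamma_s\gamma_{h-r})$. The bandwidth $q(n)$ is a sequence of positive integers, and the Bartlett weights are $\omega_j(q)=1-j/(q+1)$. The change-point estimator is $\hat k=\min\{k:\max_{1\le i\le n}|\sum_{1\le j\le i}X_j-\frac in\sum_{1\le j\le n}X_j|=|\sum_{1\le j\le k}X_j-\frac kn\sum_{1\le j\le n}X_j|\}$. Let $\bar X_k=\frac1k\sum_{1\le i\le k}X_i$ and $\tilde X_k=\frac1{n-k}\sum_{k<i\le n}X_i$. Define $s_{n,1}^2=\frac1{\hat k}\sum_{1\le i\le\hat k}(X_i-\bar X_{\hat k})^2+2\sum_{1\le j\le q(\hat k)}\omega_j(q(\hat k))\frac1{\hat k}\sum_{1\le i\le\hat k-j}(X_i-\bar X_{\hat k})(X_{i+j}-\bar X_{\hat k})$, $s_{n,2}^2=\frac1{n-\hat k}\sum_{\hat k<i\le n}(X_i-\tilde X_{\hat k})^2+2\sum_{1\le j\le q(n-\hat k)}\omega_j(q(n-\hat k))\frac1{n-\hat k}\sum_{\hat k<i\le n-j}(X_i-\tilde X_{\hat k})(X_{i+j}-\tilde X_{\hat k})$, $T_{n,1}=\frac1{s_{n,1}}\hat k^{-1/2}\max_{1\le k\le\hat k}|\sum_{1\le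 i\le k}X_i-\frac k{\hat k}\sum_{1\le i\le\hat k}X_i|$ and $T_{n,2}=\frac1{s_{n,2}}(n-\hat k)^{-1/2}\max_{\hat k<k\le n}|\sum_{\hat k<i\le k}X_i-\frac{k-\hat k}{n-\hat k}\sum_{\hat k<i\le n}X_i|$. *)

theory Defs
  imports "HOL-Probability.Probability"
begin

definition fourth_order_stationary :: "'a measure \<Rightarrow> (int \<Rightarrow> 'a \<Rightarrow> real) \<Rightarrow> bool" where
  "fourth_order_stationary M Y \<longleftrightarrow>
     (\<forall>k. Y k \<in> borel_measurable M \<and> integrable M (\<lambda>\<omega>. (Y k \<omega>) ^ 4)) \<and>
     (\<forall>ks::int list. \<forall>h::int. length ks \<le> 4 \<longrightarrow>
        (\<integral>\<omega>. prod_list (map (\<lambda>k. Y (k + h) \<omega>) ks) \<partial>M)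
        = (\<integral>\<omega>. prod_list (map (\<lambda>k. Y k \<omega>) ks) \<partial>M))"

definition autocov :: "'a measure \<Rightarrow> (int \<Rightarrow> 'a \<Rightarrow> real) \<Rightarrow> int \<Rightarrow> real" where
  "autocov M Y j = (\<integral>\<omega>. Y 0 \<omega> * Y j \<omega> \<partial>M)"

definition cumulant4 :: "'a measure \<Rightarrow> (int \<Rightarrow> 'a \<Rightarrow> real) \<Rightarrow> int \<Rightarrow> int \<Rightarrow> int \<Rightarrow> real" where
  "cumulant4 M Y h r s =
     (\<integral>\<omega>. Y 0 \<omega> * Y h \<omega> * Y r \<omega> * Y s \<omega> \<partial>M)
     - (autocov M Y h * autocov M Y (r - s) + autocov M Y r * autocov M Y (h - s)
        + autocov M Y s * autocov M Y (h - r))"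

definition centered_normal :: "'c measure \<Rightarrow> ('c \<Rightarrow> real) \<Rightarrow> real \<Rightarrow> bool" where
  "centered_normal N X v \<longleftrightarrow>
     (v = 0 \<and> X \<in> borel_measurable N \<and> (AE \<omega> in N. X \<omega> = 0)) \<or>
     (v > 0 \<and> distributed N lborel X (\<lambda>x. ennreal (normal_density 0 (sqrt v) x)))"

definition gaussian_process01 ::
    "'c measure \<Rightarrow> (real \<Rightarrow> 'c \<Rightarrow> real) \<Rightarrow> (real \<Rightarrow> real \<Rightarrow> real) \<Rightarrow> bool" where
  "gaussian_process01 N B c \<longleftrightarrow>
     (\<forall>t\<in>{0..1}. B t \<in> borel_measurable N) \<and>
     (\<forall>\<omega>\<in>space N. continuous_on {0..1} (\<lambda>t. B t \<omega>)) \<and>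
     (\<forall>(ts::real list) (as::real list). length ts = length as \<and> set ts \<subseteq> {0..1} \<longrightarrow>
        centered_normal N (\<lambda>\<omega>. \<Sum>i<length ts. as ! i * B (ts ! i) \<omega>)
          (\<Sum>i<length ts. \<Sum>j<length ts. as ! i * as ! j * c (ts ! i) (ts ! j)))"

definition wiener_process01 :: "'c measure \<Rightarrow> (real \<Rightarrow> 'c \<Rightarrow> real) \<Rightarrow> bool" where
  "wiener_process01 N W \<longleftrightarrow> gaussian_process01 N W (\<lambda>s t. min s t)"

definition brownian_bridge :: "'c measure \<Rightarrow> (real \<Rightarrow> 'c \<Rightarrow> real) \<Rightarrow> bool" where
  "brownian_bridge N B \<longleftrightarrow> gaussian_process01 N B (\<lambda>s t. min s t - s * t)"

text \<open>path of a process on [0,1], as a random element of the product space\<close>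
definition path01 :: "(real \<Rightarrow> 'c \<Rightarrow> real) \<Rightarrow> 'c \<Rightarrow> real \<Rightarrow> real" where
  "path01 B \<omega> = (\<lambda>t\<in>{0..1}. B t \<omega>)"

definition cadlag01 :: "(real \<Rightarrow> real) set" where
  "cadlag01 = {x. (\<forall>t\<in>{0..<1}. (x \<longlongrightarrow> x t) (at_right t)) \<and>
                  (\<forall>t\<in>{0<..1}. \<exists>l. (x \<longlongrightarrow> l) (at_left t))}"

definition time_changes01 :: "(real \<Rightarrow> real) set" where
  "time_changes01 = {l. continuous_on {0..1} l \<and> strict_mono_on {0..1} l \<and> l 0 = 0 \<and> l 1 = 1}"

definition skorokhod_dist :: "(real \<Rightarrow> real) \<Rightarrow> (real \<Rightarrow> real) \<Rightarrow> real" where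
  "skorokhod_dist x y = (INF l\<in>time_changes01.
      max (SUP t\<in>{0..1}. \<bar>l t - t\<bar>) (SUP t\<in>{0..1}. \<bar>x t - y (l t)\<bar>))"

definition skorokhod_continuous :: "((real \<Rightarrow> real) \<Rightarrow> real) \<Rightarrow> bool" where
  "skorokhod_continuous F \<longleftrightarrow>
     (\<forall>x\<in>cadlag01. \<forall>e>0. \<exists>d>0. \<forall>y\<in>cadlag01. skorokhod_dist x y < d \<longrightarrow> \<bar>F x - F y\<bar> < e)"

definition conv_dist_D01 ::
  "'a measure \<Rightarrow> (nat \<Rightarrow> 'a \<Rightarrow> real \<Rightarrow> real) \<Rightarrow> 'c measure \<Rightarrow> ('c \<Rightarrow> real \<Rightarrow> real) \<Rightarrow> bool" where
  "conv_dist_D01 M Z N Zl \<longleftrightarrow>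
     (\<forall>F. (\<exists>C. \<forall>x\<in>cadlag01. \<bar>F x\<bar> \<le> C) \<and> skorokhod_continuous F \<longrightarrow>
        (\<lambda>n. \<integral>\<omega>. F (Z n \<omega>) \<partial>M) \<longlonglongrightarrow> (\<integral>\<omega>. F (Zl \<omega>) \<partial>N))"

definition conv_dist_R2 ::
  "'a measure \<Rightarrow> (nat \<Rightarrow> 'a \<Rightarrow> real \<times> real) \<Rightarrow> 'c measure \<Rightarrow> ('c \<Rightarrow> real \<times> real) \<Rightarrow> bool" where
  "conv_dist_R2 M Z N Zl \<longleftrightarrow>
     (\<forall>f::real \<times> real \<Rightarrow> real. continuous_on UNIV f \<and> bounded (range f) \<longrightarrow>
        (\<lambda>n. \<integral>\<omega>. f (Z n \<omega>) \<partial>M) \<longlonglongrightarrow> (\<integral>\<omega>. f (Zl \<omega>) \<partial>N))"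

definition psum :: "(nat \<Rightarrow> real) \<Rightarrow> nat \<Rightarrow> nat \<Rightarrow> real" where
  "psum x a b = (\<Sum>i\<in>{a<..b}. x i)"

definition cusum_dev :: "(nat \<Rightarrow> real) \<Rightarrow> nat \<Rightarrow> nat \<Rightarrow> real" where
  "cusum_dev x n i = \<bar>psum x 0 i - real i / real n * psum x 0 n\<bar>"

definition khat :: "(nat \<Rightarrow> real) \<Rightarrow> nat \<Rightarrow> nat" where
  "khat x n = (LEAST k. k \<in> {1..n} \<and> cusum_dev x n k = Max (cusum_dev x n ` {1..n}))"

definition bartlett :: "nat \<Rightarrow> nat \<Rightarrow> real" where
  "bartlett q j = 1 - real j / (real q + 1)"

definition lrv_block :: "(nat \<Rightarrow> real) \<Rightarrow> nat \<Rightarrow> nat \<Rightarrow> nat \<Rightarrow> real" where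
  "lrv_block x a b qq =
     (let m = real (b - a); xb = psum x a b / m in
       (1 / m) * (\<Sum>i\<in>{a<..b}. (x i - xb)\<^sup>2)
       + 2 * (\<Sum>j\<in>{1..qq}. bartlett qq j * ((1 / m) *
              (\<Sum>i\<in>{a<..b - j}. (x i - xb) * (x (i + j) - xb)))))"

definition T_n1 :: "(nat \<Rightarrow> nat) \<Rightarrow> (nat \<Rightarrow> real) \<Rightarrow> nat \<Rightarrow> real" where
  "T_n1 q x n = (let k = khat x n in
     (1 / sqrt (lrv_block x 0 k (q k))) * (1 / sqrt (real k)) *
     Max ((\<lambda>k'. \<bar>psum x 0 k' - real k' / real k * psum x 0 k\<bar>) ` {1..k}))"

definition T_n2 :: "(nat \<Rightarrow> nat) \<Rightarrow> (nat \<Rightarrow> real) \<Rightarrow> nat \<Rightarrow> real" where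
  "T_n2 q x n = (let k = khat x n in
     (1 / sqrt (lrv_block x k n (q (n - k)))) * (1 / sqrt (real (n - k))) *
     Max ((\<lambda>k'. \<bar>psum x k k' - real (k' - k) / real (n - k) * psum x k n\<bar>) ` {k<..n}))"

end

theory Submission
  imports Defs
begin

text \<open>
  Replacing the estimated change point by \<open>\<theta> n\<close>, the CUSUM maxima of the two blocks are, up to errors
  controlled by the modulus of continuity of the normalized partial sum path, functionals of that path which
  are continuous in the supremum norm. The Skorokhod convergence in the assumption extends to such
  functionals because the limit has continuous paths: a functional \<open>G\<close> is approximated from below by its
  inf-convolutions \<open>inf\<^sub>y (G y + c d(x, y))\<close>, which are Lipschitz for the Skorokhod distance \<open>d\<close>. For the
  Wiener process the functionals are suprema of two independent Brownian bridges, since the two blocks have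
  disjoint increments.

  The Bartlett estimator has to be controlled simultaneously for all possible values of the estimated change
  point. Averaging over the truncation point turns it into a mean of partial sums in the block length, whose
  increments have variance proportional to their length by the summability of covariances and cumulants; the
  Rademacher--Menshov inequality then costs only a factor \<open>(log n)\<^sup>2\<close>. The second block is treated by time
  reversal. As the Bartlett estimator is a mean of squares of window sums, its square root is a seminorm, and
  so centering and the misclassified observations do not matter. Its limit is the variance in the functional
  central limit theorem because the squares of the normalized sums are bounded in second mean.
\<close>

section \<open>The Skorokhod distance\<close>

text \<open>The bridge functionals evaluate the path at the fixed time \<open>\<theta>\<close>, and
  evaluation at an interior time is not Skorokhod continuous; the assumed convergence cannot be
  applied to them directly. The second obstacle is that \<open>khat\<close> is computed from the
  same data as the statistics, so nothing may be conditioned on it: every bound has to hold on one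
  event for all block lengths k with c n \<le> k \<le> n. For the Bartlett estimator, Cauchy-Schwarz
  over the truncation point and the maximal inequality bound the second moment of the deviation by
  the order of q^3 (log n)^2 n / (n q)^2 = q (log n)^2 / n; the doubling condition makes q(n) and
  q(c n) comparable there. A misclassified stretch of length d adds d \<Delta>^2 = O_P(1) to a sum
  of squares, which the estimator multiplies by about q / n, and d |\<Delta>| to a partial sum,
  which relative to sqrt n is O_P(1) / (|\<Delta>| sqrt n). The Wiener process and the two bridges
  live on unrelated probability spaces, so their laws are compared by expectations of cosines of
  linear forms.\<close>

lemma time_change_id: "(\<lambda>t. t) \<in> time_changes01"
  by (auto simp: time_changes01_def strict_mono_on_def)

lemma time_change_range:
  assumes "l \<in> time_changes01" "t \<in> {0..1}"
  shows "l t \<in> {0..1}"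
proof -
  have m: "mono_on {0..1} l"
    using assms(1) by (auto simp: time_changes01_def intro: strict_mono_on_imp_mono_on)
  have "l 0 \<le> l t" "l t \<le> l 1" using assms(2) by (auto intro!: mono_onD[OF m])
  then show ?thesis using assms(1) by (auto simp: time_changes01_def)
qed

lemma time_change_image:
  assumes "l \<in> time_changes01"
  shows "l ` {0..1} = {0..1}"
proof
  show "l ` {0..1} \<subseteq> {0..1}" using time_change_range[OF assms] by blast
  show "{0..1} \<subseteq> l ` {0..1}"
  proof
    fix y :: real assume y: "y \<in> {0..1}"
    have "\<exists>x\<ge>0. x \<le> 1 \<and> l x = y"
      using assms y by (intro IVT') (auto simp: time_changes01_def)
    then show "y \<in> l ` {0..1}" by auto
  qed
qed

lemma time_change_comp:
  assumes "l \<in> time_changes01" "m \<in> time_changes01"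
  shows "(\<lambda>t. m (l t)) \<in> time_changes01"
proof -
  have c: "continuous_on {0..1} l" "continuous_on {0..1} m" and sm: "strict_mono_on {0..1} l" "strict_mono_on {0..1} m"
    using assms by (simp_all add: time_changes01_def)
  have "continuous_on {0..1} (\<lambda>t. m (l t))"
    by (rule continuous_on_compose2[OF c(2,1)]) (simp add: time_change_image[OF assms(1)])
  moreover have "strict_mono_on {0..1} (\<lambda>t. m (l t))"
  proof (rule strict_mono_onI)
    fix r s :: real assume rs: "r \<in> {0..1}" "s \<in> {0..1}" "r < s"
    show "m (l r) < m (l s)"
      by (rule strict_mono_onD[OF sm(2)]) (use time_change_range[OF assms(1)] rs strict_mono_onD[OF sm(1)] in simp_all)
  qed
  ultimately show ?thesis using assms by (simp add: time_changes01_def)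
qed

text \<open>A continuous injection of a compact interval has a continuous inverse; the inverse is
  increasing because \<open>l\<close> would otherwise reverse an inequality. Symmetry of the
  distance rests on this.\<close>

lemma time_change_inverse:
  assumes "l \<in> time_changes01"
  obtains m where "m \<in> time_changes01" "\<And>t. t \<in> {0..1} \<Longrightarrow> l (m t) = t" "\<And>t. t \<in> {0..1} \<Longrightarrow> m (l t) = t"
proof -
  define m where "m = the_inv_into {0..1} l"
  have inj: "inj_on l {0..1}"
    using assms strict_mono_on_imp_inj_on by (auto simp: time_changes01_def)
  have mono: "mono_on {0..1} l"
    using assms by (auto simp: time_changes01_def intro: strict_mono_on_imp_mono_on)
  have im: "l ` {0..1} = {0..1}" by (rule time_change_image[OF assms])
  have lm: "l (m t) = t" if "t \<in> {0..1}" for t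
    unfolding m_def by (rule f_the_inv_into_f[OF inj]) (use that im in simp)
  have ml: "m (l t) = t" if "t \<in> {0..1}" for t
    unfolding m_def using the_inv_into_f_f[OF inj that] .
  have mr: "m t \<in> {0..1}" if "t \<in> {0..1}" for t
    unfolding m_def by (rule the_inv_into_into[OF inj]) (use that im in simp_all)
  have "continuous_on (l ` {0..1}) m"
    by (rule continuous_on_inv) (use assms ml in \<open>simp_all add: time_changes01_def\<close>)
  moreover have "strict_mono_on {0..1} m"
    unfolding strict_mono_on_def
  proof clarify
    fix r s :: real assume rs: "r \<in> {0..1}" "s \<in> {0..1}" "r < s"
    show "m r < m s"
    proof (rule ccontr)
      assume "\<not> m r < m s"
      then have "m s \<le> m r" by simp
      then have "l (m s) \<le> l (m r)"
        using mono_onD[OF mono mr mr] rs by simp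
      then show False using lm[OF rs(1)] lm[OF rs(2)] rs(3) by simp
    qed
  qed
  moreover have "m 0 = 0" "m 1 = 1"
    using ml[of 0] ml[of 1] assms by (auto simp: time_changes01_def)
  ultimately have "m \<in> time_changes01" using im by (auto simp: time_changes01_def)
  then show ?thesis by (rule that[of m]) (simp_all add: lm ml)
qed

text \<open>Bisection (\<open>Bolzano\<close>): boundedness passes to the union of adjacent
  intervals, and near each \<open>s\<close> it follows from the one-sided limits, the value at
  \<open>s\<close> itself being added by hand. At an endpoint of the unit interval the missing side
  is empty.\<close>

lemma cadlag01_bounded:
  assumes x: "x \<in> cadlag01"
  obtains B where "\<And>t. t \<in> {0..1} \<Longrightarrow> \<bar>x t\<bar> \<le> B"
proof -
  have "\<exists>B. \<forall>t\<in>{0..1}\<inter>{0..1}. \<bar>x t\<bar> \<le> B"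
  proof (rule Bolzano[where P="\<lambda>a b. \<exists>B. \<forall>t\<in>{a..b}\<inter>{0..1}. \<bar>x t\<bar> \<le> B"], goal_cases)
    case 1 show ?case by simp
  next
    case (2 a b c)
    then obtain B1 B2 where "\<forall>t\<in>{a..b} \<inter> {0..1}. \<bar>x t\<bar> \<le> B1" "\<forall>t\<in>{b..c} \<inter> {0..1}. \<bar>x t\<bar> \<le> B2"
      by blast
    then have "\<forall>t\<in>{a..c} \<inter> {0..1}. \<bar>x t\<bar> \<le> max B1 B2"
      by (auto simp: le_max_iff_disj)
    then show ?case by blast
  next
    case (3 s)
    have "\<exists>dr>0. \<exists>Br. \<forall>t\<in>{s<..<s+dr}\<inter>{0..1}. \<bar>x t\<bar> \<le> Br"
    proof (cases "s < 1")
      case True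
      then have "(x \<longlongrightarrow> x s) (at_right s)" using x 3 by (auto simp: cadlag01_def)
      then have "eventually (\<lambda>t. dist (x t) (x s) < 1) (at_right s)"
        by (rule tendstoD) simp
      then obtain b where "b > s" "\<And>t. t > s \<Longrightarrow> t < b \<Longrightarrow> dist (x t) (x s) < 1"
        unfolding eventually_at_right_field by auto
      then show ?thesis
        by (intro exI[of _ "b - s"] conjI exI[of _ "\<bar>x s\<bar> + 1"]) (force simp: dist_real_def)+
    next
      case False
      then show ?thesis using 3 by (intro exI[of _ 1]) auto
    qed
    then obtain dr Br where r: "dr > 0" "\<And>t. t\<in>{s<..<s+dr}\<inter>{0..1} \<Longrightarrow> \<bar>x t\<bar> \<le> Br" by blast
    have "\<exists>dl>0. \<exists>Bl. \<forall>t\<in>{s-dl<..<s}\<inter>{0..1}. \<bar>x t\<bar> \<le> Bl"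
    proof (cases "0 < s")
      case True
      then have "s \<in> {0<..1}" using 3 by simp
      then obtain c where "(x \<longlongrightarrow> c) (at_left s)" using x unfolding cadlag01_def by blast
      then have "eventually (\<lambda>t. dist (x t) c < 1) (at_left s)"
        by (rule tendstoD) simp
      then obtain b where "b < s" "\<And>t. t > b \<Longrightarrow> t < s \<Longrightarrow> dist (x t) c < 1"
        unfolding eventually_at_left_field by auto
      then show ?thesis
        by (intro exI[of _ "s - b"] conjI exI[of _ "\<bar>c\<bar> + 1"]) (force simp: dist_real_def)+
    next
      case False
      then show ?thesis using 3 by (intro exI[of _ 1]) auto
    qed
    then obtain dl Bl where l: "dl > 0" "\<And>t. t\<in>{s-dl<..<s}\<inter>{0..1} \<Longrightarrow> \<bar>x t\<bar> \<le> Bl" by blast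
    show ?case
    proof (rule exI[of _ "min dr dl"], intro conjI allI impI)
      fix a b :: real assume ab: "a \<le> s \<and> s \<le> b \<and> b - a < min dr dl"
      show "\<exists>B. \<forall>t\<in>{a..b} \<inter> {0..1}. \<bar>x t\<bar> \<le> B"
      proof (intro exI[of _ "max \<bar>x s\<bar> (max Br Bl)"] ballI)
        fix t assume t: "t \<in> {a..b} \<inter> {0..1}"
        consider "t = s" | "t > s" | "t < s" by linarith
        then show "\<bar>x t\<bar> \<le> max \<bar>x s\<bar> (max Br Bl)"
          by cases (use r(2)[of t] l(2)[of t] ab t in auto)
      qed
    qed (use r l in auto)
  qed
  then obtain B where "\<forall>t\<in>{0..1}\<inter>{0..1}. \<bar>x t\<bar> \<le> B" ..
  then show ?thesis by (intro that[of B]) auto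
qed

text \<open>A real-valued \<open>SUP\<close> says something only over a bounded set; together with
  \<open>time_change_bdd\<close> this makes the suprema inside \<open>skorokhod_dist\<close>
  usable.\<close>

lemma cadlag01_bdd_diff:
  assumes "x \<in> cadlag01" "y \<in> cadlag01" "l \<in> time_changes01"
  shows "bdd_above ((\<lambda>t. \<bar>x t - y (l t)\<bar>) ` {0..1})"
proof -
  obtain B1 where B1: "\<And>t. t \<in> {0..1} \<Longrightarrow> \<bar>x t\<bar> \<le> B1" using cadlag01_bounded[OF assms(1)] by blast
  obtain B2 where B2: "\<And>t. t \<in> {0..1} \<Longrightarrow> \<bar>y t\<bar> \<le> B2" using cadlag01_bounded[OF assms(2)] by blast
  show ?thesis
  proof (intro bdd_aboveI2[where M="B1 + B2"])
    fix t :: real assume t: "t \<in> {0..1}"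
    show "\<bar>x t - y (l t)\<bar> \<le> B1 + B2"
      using B1[OF t] B2[OF time_change_range[OF assms(3) t]] by linarith
  qed
qed

lemma time_change_bdd:
  assumes "l \<in> time_changes01"
  shows "bdd_above ((\<lambda>t. \<bar>l t - t\<bar>) ` {0..1})"
  by (intro bdd_aboveI2[where M=1]) (use time_change_range[OF assms] in force)

lemma time_change_sup_nonneg:
  assumes "l \<in> time_changes01"
  shows "0 \<le> (SUP t\<in>{0..1}. \<bar>l t - t\<bar>)"
  by (rule cSUP_upper2[OF time_change_bdd[OF assms], of 0]) auto

lemma skorokhod_dist_nonneg: "0 \<le> skorokhod_dist x y"
  unfolding skorokhod_dist_def
  by (intro cINF_greatest) (use time_change_id time_change_sup_nonneg in \<open>auto simp: le_max_iff_disj\<close>)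

lemma skorokhod_dist_leI:
  assumes "l \<in> time_changes01" "\<And>t. t \<in> {0..1} \<Longrightarrow> \<bar>l t - t\<bar> \<le> d" "\<And>t. t \<in> {0..1} \<Longrightarrow> \<bar>x t - y (l t)\<bar> \<le> d"
  shows "skorokhod_dist x y \<le> d"
proof -
  have "skorokhod_dist x y \<le> max (SUP t\<in>{0..1}. \<bar>l t - t\<bar>) (SUP t\<in>{0..1}. \<bar>x t - y (l t)\<bar>)"
    unfolding skorokhod_dist_def
    by (intro cINF_lower bdd_belowI2[where m=0])
      (use assms(1) time_change_sup_nonneg in \<open>auto simp: le_max_iff_disj\<close>)
  also have "\<dots> \<le> d"
    by (intro max.boundedI cSUP_least) (use assms in auto)
  finally show ?thesis .
qed

lemma skorokhod_dist_lessD: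
  assumes "x \<in> cadlag01" "y \<in> cadlag01" "skorokhod_dist x y < d"
  obtains l where "l \<in> time_changes01" "\<And>t. t \<in> {0..1} \<Longrightarrow> \<bar>l t - t\<bar> < d" "\<And>t. t \<in> {0..1} \<Longrightarrow> \<bar>x t - y (l t)\<bar> < d"
proof -
  obtain l where l: "l \<in> time_changes01"
    and *: "max (SUP t\<in>{0..1}. \<bar>l t - t\<bar>) (SUP t\<in>{0..1}. \<bar>x t - y (l t)\<bar>) < d"
    using cInf_lessD[OF _ assms(3)[unfolded skorokhod_dist_def]] time_change_id by blast
  have "\<bar>l t - t\<bar> < d" "\<bar>x t - y (l t)\<bar> < d" if "t \<in> {0..1}" for t
    using * cSUP_upper[OF that time_change_bdd[OF l]] cSUP_upper[OF that cadlag01_bdd_diff[OF assms(1,2) l]]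
    by auto
  then show ?thesis using that l by blast
qed

text \<open>The inverse time change exchanges the roles of \<open>x\<close> and \<open>y\<close>.
  The slack \<open>e\<close> is there because the infimum need not be attained.\<close>

lemma skorokhod_dist_sym_le:
  assumes "x \<in> cadlag01" "y \<in> cadlag01"
  shows "skorokhod_dist y x \<le> skorokhod_dist x y"
proof (rule field_le_epsilon)
  fix e :: real assume "e > 0"
  then have "skorokhod_dist x y < skorokhod_dist x y + e" by simp
  then obtain l where l: "l \<in> time_changes01" "\<And>t. t \<in> {0..1} \<Longrightarrow> \<bar>l t - t\<bar> < skorokhod_dist x y + e"
    "\<And>t. t \<in> {0..1} \<Longrightarrow> \<bar>x t - y (l t)\<bar> < skorokhod_dist x y + e"
    using skorokhod_dist_lessD[OF assms] by metis
  obtain m where m: "m \<in> time_changes01" "\<And>t. t \<in> {0..1} \<Longrightarrow> l (m t) = t"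
    using time_change_inverse[OF l(1)] by metis
  show "skorokhod_dist y x \<le> skorokhod_dist x y + e"
  proof (rule skorokhod_dist_leI[OF m(1)])
    fix t :: real assume t: "t \<in> {0..1}"
    show "\<bar>m t - t\<bar> \<le> skorokhod_dist x y + e" "\<bar>y t - x (m t)\<bar> \<le> skorokhod_dist x y + e"
      using l(2,3)[OF time_change_range[OF m(1) t]] m(2)[OF t] by (auto simp: abs_minus_commute)
  qed
qed

lemma skorokhod_dist_triangle:
  assumes "x \<in> cadlag01" "y \<in> cadlag01" "z \<in> cadlag01"
  shows "skorokhod_dist x z \<le> skorokhod_dist x y + skorokhod_dist y z"
proof (rule field_le_epsilon)
  fix e :: real assume e: "e > 0"
  then have "skorokhod_dist x y < skorokhod_dist x y + e/2" "skorokhod_dist y z < skorokhod_dist y z + e/2" by auto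
  then obtain l m where l: "l \<in> time_changes01" "\<And>t. t \<in> {0..1} \<Longrightarrow> \<bar>l t - t\<bar> < skorokhod_dist x y + e/2"
    "\<And>t. t \<in> {0..1} \<Longrightarrow> \<bar>x t - y (l t)\<bar> < skorokhod_dist x y + e/2"
    and m: "m \<in> time_changes01" "\<And>t. t \<in> {0..1} \<Longrightarrow> \<bar>m t - t\<bar> < skorokhod_dist y z + e/2"
    "\<And>t. t \<in> {0..1} \<Longrightarrow> \<bar>y t - z (m t)\<bar> < skorokhod_dist y z + e/2"
    using skorokhod_dist_lessD[OF assms(1,2)] skorokhod_dist_lessD[OF assms(2,3)] by metis
  show "skorokhod_dist x z \<le> skorokhod_dist x y + skorokhod_dist y z + e"
  proof (rule skorokhod_dist_leI[OF time_change_comp[OF l(1) m(1)]])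
    fix t :: real assume t: "t \<in> {0..1}"
    note lt = time_change_range[OF l(1) t]
    show "\<bar>m (l t) - t\<bar> \<le> skorokhod_dist x y + skorokhod_dist y z + e"
      "\<bar>x t - z (m (l t))\<bar> \<le> skorokhod_dist x y + skorokhod_dist y z + e"
      using l(2,3)[OF t] m(2,3)[OF lt] by linarith+
  qed
qed

lemma skorokhod_dist_le_sup:
  assumes "0 \<le> d" "\<And>t. t \<in> {0..1} \<Longrightarrow> \<bar>x t - y t\<bar> \<le> d"
  shows "skorokhod_dist x y \<le> d"
  by (rule skorokhod_dist_leI[OF time_change_id]) (use assms in auto)

lemma continuous_in_cadlag01:
  assumes "continuous_on {0..1} x"
  shows "x \<in> cadlag01"
proof -
  have "(x \<longlongrightarrow> x t) (at_right t)" if "t \<in> {0..<1}" for t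
  proof -
    have "(x \<longlongrightarrow> x t) (at t within {0..1})" using assms that by (auto simp: continuous_on_def)
    then have "(x \<longlongrightarrow> x t) (at t within {t..1})"
      using that by (auto elim: tendsto_within_subset)
    then show ?thesis using at_within_Icc_at_right[of t 1] that by auto
  qed
  moreover have "(x \<longlongrightarrow> x t) (at_left t)" if "t \<in> {0<..1}" for t
  proof -
    have "(x \<longlongrightarrow> x t) (at t within {0..1})" using assms that by (auto simp: continuous_on_def)
    then have "(x \<longlongrightarrow> x t) (at t within {0..t})"
      using that by (auto elim: tendsto_within_subset)
    then show ?thesis using at_within_Icc_at_left[of 0 t] that by auto
  qed
  ultimately show ?thesis unfolding cadlag01_def by blast
qed

lemma step_in_cadlag01: "(\<lambda>t. V (nat \<lfloor>real m * t\<rfloor>)) \<in> cadlag01"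
proof (cases "m = 0")
  case True then show ?thesis by (auto simp: cadlag01_def)
next
  case False
  then have m: "real m > 0" by simp
  have r: "((\<lambda>t. V (nat \<lfloor>real m * t\<rfloor>)) \<longlongrightarrow> V (nat \<lfloor>real m * t\<rfloor>)) (at_right t)" for t
  proof (rule tendsto_eventually, unfold eventually_at_right_field, intro exI conjI allI impI)
    show "t < (real_of_int \<lfloor>real m * t\<rfloor> + 1) / real m" using m by (simp add: pos_less_divide_eq mult.commute)
    fix s assume "t < s" "s < (real_of_int \<lfloor>real m * t\<rfloor> + 1) / real m"
    then have "real m * t < real m * s" "real m * s < real_of_int \<lfloor>real m * t\<rfloor> + 1"
      using m by (auto simp: pos_less_divide_eq mult.commute)
    then have "\<lfloor>real m * s\<rfloor> = \<lfloor>real m * t\<rfloor>" by linarith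
    then show "V (nat \<lfloor>real m * s\<rfloor>) = V (nat \<lfloor>real m * t\<rfloor>)" by simp
  qed
  \<comment> \<open>Just left of \<open>t\<close> the floor equals the ceiling at \<open>t\<close>
    minus one. At grid points this differs from the floor at \<open>t\<close>, which is the jump of
    the path.\<close>
  have l: "((\<lambda>t. V (nat \<lfloor>real m * t\<rfloor>)) \<longlongrightarrow> V (nat (\<lceil>real m * t\<rceil> - 1))) (at_left t)" for t
  proof (rule tendsto_eventually, unfold eventually_at_left_field, intro exI conjI allI impI)
    show "(real_of_int \<lceil>real m * t\<rceil> - 1) / real m < t" using m by (simp add: pos_divide_less_eq mult.commute) linarith
    fix s assume "s < t" "(real_of_int \<lceil>real m * t\<rceil> - 1) / real m < s"
    then have "real m * s < real m * t" "real_of_int \<lceil>real m * t\<rceil> - 1 < real m * s"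
      using m by (auto simp: pos_divide_less_eq mult.commute)
    then have "\<lfloor>real m * s\<rfloor> = \<lceil>real m * t\<rceil> - 1" by linarith
    then show "V (nat \<lfloor>real m * s\<rfloor>) = V (nat (\<lceil>real m * t\<rceil> - 1))" by simp
  qed
  show ?thesis using r l by (auto simp: cadlag01_def)
qed

section \<open>Weak convergence against functionals continuous in the supremum norm\<close>

text \<open>Continuity in the uniform topology on cadlag paths, a weaker demand than
  \<open>skorokhod_continuous\<close>: evaluation at a fixed interior time satisfies it, although a
  time change can carry a jump across that time.\<close>

definition supnorm_continuous :: "((real \<Rightarrow> real) \<Rightarrow> real) \<Rightarrow> bool" where
  "supnorm_continuous F \<longleftrightarrow> (\<forall>x\<in>cadlag01. \<forall>e>0. \<exists>d>0. \<forall>y\<in>cadlag01.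
     (\<forall>t\<in>{0..1}. \<bar>x t - y t\<bar> < d) \<longrightarrow> \<bar>F x - F y\<bar> < e)"

lemma supnorm_continuousD:
  assumes "supnorm_continuous F" "x \<in> cadlag01" "e > 0"
  obtains d where "d > 0" "\<And>y. y \<in> cadlag01 \<Longrightarrow> (\<And>t. t \<in> {0..1} \<Longrightarrow> \<bar>x t - y t\<bar> < d) \<Longrightarrow> \<bar>F x - F y\<bar> < e"
  using assms unfolding supnorm_continuous_def by metis

lemma skorokhod_continuous_imp_supnorm_continuous:
  assumes "skorokhod_continuous F"
  shows "supnorm_continuous F"
  unfolding supnorm_continuous_def
proof (intro ballI allI impI)
  fix x and e :: real assume x: "x \<in> cadlag01" "e > 0"
  then obtain d where d: "d > 0" "\<And>y. y \<in> cadlag01 \<Longrightarrow> skorokhod_dist x y < d \<Longrightarrow> \<bar>F x - F y\<bar> < e"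
    using assms unfolding skorokhod_continuous_def by meson
  show "\<exists>d>0. \<forall>y\<in>cadlag01. (\<forall>t\<in>{0..1}. \<bar>x t - y t\<bar> < d) \<longrightarrow> \<bar>F x - F y\<bar> < e"
  proof (intro exI[of _ "d/2"] conjI ballI impI)
    fix y assume y: "y \<in> cadlag01" "\<forall>t\<in>{0..1}. \<bar>x t - y t\<bar> < d/2"
    have "skorokhod_dist x y \<le> d/2"
      by (rule skorokhod_dist_le_sup) (use d y in \<open>auto intro: less_imp_le\<close>)
    then show "\<bar>F x - F y\<bar> < e" using d y by auto
  qed (use d in auto)
qed

text \<open>A time change close to the identity moves a uniformly continuous path little, so a path
  that is Skorokhod close to a continuous one is also uniformly close to it.\<close>

lemma supnorm_continuous_imp_skorokhod_at_continuous:
  assumes F: "supnorm_continuous F" and x: "continuous_on {0..1} x" and e: "e > 0"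
  obtains d where "d > 0" "\<And>y. y \<in> cadlag01 \<Longrightarrow> skorokhod_dist x y < d \<Longrightarrow> \<bar>F x - F y\<bar> < e"
proof -
  have xc: "x \<in> cadlag01" by (rule continuous_in_cadlag01[OF x])
  obtain d where d: "d > 0" "\<And>y. y \<in> cadlag01 \<Longrightarrow> (\<And>t. t \<in> {0..1} \<Longrightarrow> \<bar>x t - y t\<bar> < d) \<Longrightarrow> \<bar>F x - F y\<bar> < e"
    using supnorm_continuousD[OF F xc e] by metis
  have "uniformly_continuous_on {0..1} x"
    by (rule compact_uniformly_continuous[OF x]) simp
  then obtain r where r: "r > 0" "\<And>s t. s \<in> {0..1} \<Longrightarrow> t \<in> {0..1} \<Longrightarrow> dist s t < r \<Longrightarrow> dist (x s) (x t) < d/2"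
    using d(1) unfolding uniformly_continuous_on_def by (metis half_gt_zero)
  show ?thesis
  proof (rule that[of "min r (d/2)"])
    fix y assume y: "y \<in> cadlag01" "skorokhod_dist x y < min r (d/2)"
    obtain l where l: "l \<in> time_changes01" "\<And>t. t \<in> {0..1} \<Longrightarrow> \<bar>l t - t\<bar> < min r (d/2)"
      "\<And>t. t \<in> {0..1} \<Longrightarrow> \<bar>x t - y (l t)\<bar> < min r (d/2)"
      using skorokhod_dist_lessD[OF xc y] by metis
    show "\<bar>F x - F y\<bar> < e"
    proof (rule d(2)[OF y(1)])
      fix s :: real assume "s \<in> {0..1}"
      then obtain t where t: "t \<in> {0..1}" "s = l t" using time_change_image[OF l(1)] by (metis imageE)
      have "dist (x t) (x (l t)) < d/2"
        by (rule r(2)) (use t l(2)[OF t(1)] time_change_range[OF l(1) t(1)] in \<open>simp_all add: dist_real_def abs_minus_commute\<close>)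
      then have "\<bar>x t - x s\<bar> < d/2" "\<bar>x t - y s\<bar> < d/2" using l(3)[OF t(1)] t(2) by (auto simp: dist_real_def)
      then show "\<bar>x s - y s\<bar> < d" by linarith
    qed
  qed (use r d in auto)
qed

lemma nat_floor_le:
  assumes "t \<le> 1"
  shows "nat \<lfloor>real m * t\<rfloor> \<le> m"
proof -
  have "real m * t \<le> real m" using assms by (simp add: mult_left_le)
  then show ?thesis by linarith
qed

text \<open>\<open>F\<close> carries no measurability assumption. A step path with \<open>m\<close>
  steps is determined on the unit interval by \<open>V 0\<close>, ..., \<open>V m\<close>, and
  \<open>F\<close> depends continuously on these coordinates, hence in a Borel way.\<close>

lemma measurable_supnorm_continuous_step:
  assumes F: "supnorm_continuous F" and V: "\<And>i. V i \<in> borel_measurable M"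
  shows "(\<lambda>\<omega>. F (\<lambda>t. V (nat \<lfloor>real m * t\<rfloor>) \<omega>)) \<in> borel_measurable M"
proof -
  define g where "g v = F (\<lambda>t. v (nat \<lfloor>real m * t\<rfloor>))" for v :: "nat \<Rightarrow> real"
  have "continuous_on UNIV g"
    unfolding continuous_on_sequentially o_def
  proof (clarify, rule tendstoI)
    fix u and v :: "nat \<Rightarrow> real" and e :: real assume uv: "u \<longlonglongrightarrow> v" and e: "0 < e"
    obtain d where d: "d > 0" "\<And>y. y \<in> cadlag01 \<Longrightarrow> (\<And>t. t \<in> {0..1} \<Longrightarrow> \<bar>v (nat \<lfloor>real m * t\<rfloor>) - y t\<bar> < d) \<Longrightarrow>
        \<bar>F (\<lambda>t. v (nat \<lfloor>real m * t\<rfloor>)) - F y\<bar> < e"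
      using supnorm_continuousD[OF F step_in_cadlag01 e] by metis
    have "(\<lambda>n. u n i) \<longlonglongrightarrow> v i" for i
      using continuous_on_tendsto_compose[OF continuous_on_product_coordinates[of i] uv] by simp
    then have "\<forall>i\<in>{..m}. eventually (\<lambda>n. dist (u n i) (v i) < d) sequentially"
      using d(1) by (auto intro: tendstoD)
    then have "eventually (\<lambda>n. \<forall>i\<in>{..m}. dist (u n i) (v i) < d) sequentially"
      by (rule eventually_ball_finite[rotated]) simp
    then show "eventually (\<lambda>n. dist (g (u n)) (g v) < e) sequentially"
    proof eventually_elim
      case (elim n)
      have "\<bar>F (\<lambda>t. v (nat \<lfloor>real m * t\<rfloor>)) - F (\<lambda>t. u n (nat \<lfloor>real m * t\<rfloor>))\<bar> < e"
      proof (rule d(2)[OF step_in_cadlag01])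
        fix t :: real assume "t \<in> {0..1}"
        then show "\<bar>v (nat \<lfloor>real m * t\<rfloor>) - u n (nat \<lfloor>real m * t\<rfloor>)\<bar> < d"
          using elim nat_floor_le[of t m] by (auto simp: dist_real_def abs_minus_commute)
      qed
      then show ?case by (simp add: g_def dist_real_def abs_minus_commute)
    qed
  qed
  then have "g \<in> borel_measurable borel" by (rule borel_measurable_continuous_onI)
  moreover have "(\<lambda>\<omega> i. V i \<omega>) \<in> M \<rightarrow>\<^sub>M borel"
    by (rule measurable_coordinatewise_then_product) (rule V)
  ultimately have "(\<lambda>\<omega>. g (\<lambda>i. V i \<omega>)) \<in> borel_measurable M" by (rule measurable_compose[rotated])
  then show ?thesis by (simp add: g_def)
qed

text \<open>The path is sampled at the left grid point, and uniform continuity makes the resulting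
  step path uniformly close. The \<open>min 1\<close> keeps every sampling time in the unit
  interval, where the variables \<open>B t\<close> of the next lemma are known to be
  measurable.\<close>

lemma step_approx_tendsto:
  assumes F: "supnorm_continuous F" and x: "continuous_on {0..1} x"
  shows "(\<lambda>m. F (\<lambda>t. x (min 1 (real (nat \<lfloor>real m * t\<rfloor>) / real m)))) \<longlonglongrightarrow> F x"
proof (rule tendstoI)
  fix e :: real assume e: "e > 0"
  obtain d where d: "d > 0" "\<And>y. y \<in> cadlag01 \<Longrightarrow> (\<And>t. t \<in> {0..1} \<Longrightarrow> \<bar>x t - y t\<bar> < d) \<Longrightarrow> \<bar>F x - F y\<bar> < e"
    using supnorm_continuousD[OF F continuous_in_cadlag01[OF x] e] by metis
  have "uniformly_continuous_on {0..1} x"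
    by (rule compact_uniformly_continuous[OF x]) simp
  then obtain r where r: "r > 0" "\<And>s t. s \<in> {0..1} \<Longrightarrow> t \<in> {0..1} \<Longrightarrow> dist s t < r \<Longrightarrow> dist (x s) (x t) < d"
    using d(1) unfolding uniformly_continuous_on_def by metis
  have "eventually (\<lambda>m. m > nat \<lceil>1 / r\<rceil>) sequentially" by (rule eventually_gt_at_top)
  then show "eventually (\<lambda>m. dist (F (\<lambda>t. x (min 1 (real (nat \<lfloor>real m * t\<rfloor>) / real m)))) (F x) < e) sequentially"
  proof eventually_elim
    case (elim m)
    then have m: "real m > 1 / r" by linarith
    then have m0: "real m > 0" using r(1) less_trans[of 0 "1/r" "real m"] by simp
    then have mr: "1 / real m < r" using m r(1) by (simp add: field_simps)
    have "\<bar>F x - F (\<lambda>t. (\<lambda>i. x (min 1 (real i / real m))) (nat \<lfloor>real m * t\<rfloor>))\<bar> < e"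
    proof (rule d(2)[OF step_in_cadlag01])
      fix t :: real assume t: "t \<in> {0..1}"
      define s where "s = real (nat \<lfloor>real m * t\<rfloor>) / real m"
      have nn: "0 \<le> real m * t" using t by simp
      have "real (nat \<lfloor>real m * t\<rfloor>) \<le> real m * t" "real m * t < real (nat \<lfloor>real m * t\<rfloor>) + 1"
        using nn by linarith+
      then have s: "s \<le> t" "t < s + 1 / real m" "0 \<le> s"
        using m0 by (auto simp: s_def field_simps)
      then have "dist t s < r" using mr by (auto simp: dist_real_def)
      then have "dist (x t) (x s) < d" by (intro r(2)) (use s t in auto)
      moreover have "min 1 s = s" using s t by auto
      ultimately show "\<bar>x t - x (min 1 (real (nat \<lfloor>real m * t\<rfloor>) / real m))\<bar> < d"
        by (simp add: s_def[symmetric] dist_real_def)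
    qed
    then show ?case by (simp add: dist_real_def abs_minus_commute)
  qed
qed

lemma measurable_supnorm_continuous_continuous:
  assumes F: "supnorm_continuous F"
    and B: "\<And>t. t \<in> {0..1} \<Longrightarrow> B t \<in> borel_measurable N"
    and c: "\<And>\<omega>. \<omega> \<in> space N \<Longrightarrow> continuous_on {0..1} (\<lambda>t. B t \<omega>)"
  shows "(\<lambda>\<omega>. F (\<lambda>t. B t \<omega>)) \<in> borel_measurable N"
proof (rule borel_measurable_LIMSEQ_real)
  show "(\<lambda>m. F (\<lambda>t. B (min 1 (real (nat \<lfloor>real m * t\<rfloor>) / real m)) \<omega>)) \<longlonglongrightarrow> F (\<lambda>t. B t \<omega>)" if "\<omega> \<in> space N" for \<omega>
    using step_approx_tendsto[OF F c[OF that]] .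
  show "(\<lambda>\<omega>. F (\<lambda>t. B (min 1 (real (nat \<lfloor>real m * t\<rfloor>) / real m)) \<omega>)) \<in> borel_measurable N" for m
    using measurable_supnorm_continuous_step[OF F, of "\<lambda>i. B (min 1 (real i / real m))" N m] B by auto
qed

section \<open>Lipschitz minorants and the extension of weak convergence\<close>

text \<open>The Pasch-Hausdorff envelope: on cadlag paths, the largest \<open>c\<close>-Lipschitz
  minorant of \<open>G\<close> for the Skorokhod distance.\<close>

definition inf_conv :: "((real \<Rightarrow> real) \<Rightarrow> real) \<Rightarrow> real \<Rightarrow> (real \<Rightarrow> real) \<Rightarrow> real" where
  "inf_conv G c x = (INF y\<in>cadlag01. G y + c * skorokhod_dist x y)"

context
  fixes G :: "(real \<Rightarrow> real) \<Rightarrow> real" and C c :: real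
  assumes bound: "\<And>x. x \<in> cadlag01 \<Longrightarrow> \<bar>G x\<bar> \<le> C" and c: "c \<ge> 0"
begin

lemma inf_conv_bdd: "bdd_below ((\<lambda>y. G y + c * skorokhod_dist x y) ` cadlag01)"
proof (rule bdd_belowI2[where m="-C"])
  fix y assume "y \<in> cadlag01"
  from bound[OF this] show "-C \<le> G y + c * skorokhod_dist x y"
    using mult_nonneg_nonneg[OF c skorokhod_dist_nonneg[of x y]] by linarith
qed

lemma cadlag01_nonempty: "cadlag01 \<noteq> {}"
  using continuous_in_cadlag01[of "\<lambda>_. 0"] by auto

lemma inf_conv_lower: "y \<in> cadlag01 \<Longrightarrow> inf_conv G c x \<le> G y + c * skorokhod_dist x y"
  unfolding inf_conv_def by (rule cINF_lower[OF inf_conv_bdd])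

lemma inf_conv_greatest:
  "(\<And>y. y \<in> cadlag01 \<Longrightarrow> b \<le> G y + c * skorokhod_dist x y) \<Longrightarrow> b \<le> inf_conv G c x"
  unfolding inf_conv_def by (rule cINF_greatest[OF cadlag01_nonempty])

lemma inf_conv_le:
  assumes "x \<in> cadlag01" shows "inf_conv G c x \<le> G x"
proof -
  have "skorokhod_dist x x \<le> 0" by (rule skorokhod_dist_le_sup) auto
  then have "skorokhod_dist x x = 0" using skorokhod_dist_nonneg[of x x] by simp
  then show ?thesis using inf_conv_lower[OF assms, of x] by simp
qed

lemma inf_conv_abs_le:
  assumes "x \<in> cadlag01" shows "\<bar>inf_conv G c x\<bar> \<le> C"
proof -
  have "-C \<le> inf_conv G c x"
  proof (rule inf_conv_greatest)
    fix y assume "y \<in> cadlag01"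
    from bound[OF this] show "-C \<le> G y + c * skorokhod_dist x y"
      using mult_nonneg_nonneg[OF c skorokhod_dist_nonneg[of x y]] by linarith
  qed
  then show ?thesis using inf_conv_le[OF assms] bound[OF assms] by auto
qed

lemma inf_conv_lipschitz:
  assumes "x \<in> cadlag01" "y \<in> cadlag01"
  shows "inf_conv G c x \<le> inf_conv G c y + c * skorokhod_dist x y"
proof -
  have "inf_conv G c x - c * skorokhod_dist x y \<le> inf_conv G c y"
  proof (rule inf_conv_greatest)
    fix z assume z: "z \<in> cadlag01"
    have "inf_conv G c x \<le> G z + c * skorokhod_dist x z" by (rule inf_conv_lower[OF z])
    also have "\<dots> \<le> G z + c * (skorokhod_dist x y + skorokhod_dist y z)"
      using skorokhod_dist_triangle[OF assms z] c by (simp add: mult_left_mono)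
    finally show "inf_conv G c x - c * skorokhod_dist x y \<le> G z + c * skorokhod_dist y z"
      by (simp add: algebra_simps)
  qed
  then show ?thesis by simp
qed

lemma inf_conv_skorokhod_continuous: "skorokhod_continuous (inf_conv G c)"
  unfolding skorokhod_continuous_def
proof (intro ballI allI impI)
  fix x and e :: real assume x: "x \<in> cadlag01" and e: "e > 0"
  show "\<exists>d>0. \<forall>y\<in>cadlag01. skorokhod_dist x y < d \<longrightarrow> \<bar>inf_conv G c x - inf_conv G c y\<bar> < e"
  \<comment> \<open>The denominator is \<open>c + 1\<close> because \<open>c\<close> may be
    0.\<close>
  proof (intro exI[of _ "e / (c + 1)"] conjI ballI impI)
    fix y assume y: "y \<in> cadlag01" "skorokhod_dist x y < e / (c + 1)"
    have 1: "(c + 1) * skorokhod_dist x y < e" using y(2) c by (simp add: pos_less_divide_eq mult.commute)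
    have 2: "c * skorokhod_dist y x \<le> c * skorokhod_dist x y"
      using skorokhod_dist_sym_le[OF x y(1)] c by (simp add: mult_left_mono)
    show "\<bar>inf_conv G c x - inf_conv G c y\<bar> < e"
      using inf_conv_lipschitz[OF x y(1)] inf_conv_lipschitz[OF y(1) x] 1 2 skorokhod_dist_nonneg[of x y]
      by (simp add: algebra_simps abs_less_iff)
  qed (use e c in auto)
qed

end

text \<open>Competitors \<open>y\<close> near the continuous path \<open>x\<close> have
  \<open>G y\<close> close to \<open>G x\<close>. Competitors at distance at least \<open>d\<close>
  pay a penalty of at least \<open>k d\<close>, which exceeds the oscillation \<open>2 C\<close> of
  \<open>G\<close> for large \<open>k\<close>.\<close>

lemma inf_conv_tendsto:
  assumes bound: "\<And>x. x \<in> cadlag01 \<Longrightarrow> \<bar>G x\<bar> \<le> C"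
    and G: "supnorm_continuous G" and x: "continuous_on {0..1} x"
  shows "(\<lambda>k. inf_conv G (real k) x) \<longlonglongrightarrow> G x"
proof (rule tendstoI)
  fix e :: real assume e: "e > 0"
  have xc: "x \<in> cadlag01" by (rule continuous_in_cadlag01[OF x])
  obtain d where d: "d > 0" "\<And>y. y \<in> cadlag01 \<Longrightarrow> skorokhod_dist x y < d \<Longrightarrow> \<bar>G x - G y\<bar> < e/2"
    using supnorm_continuous_imp_skorokhod_at_continuous[OF G x half_gt_zero[OF e]] by metis
  have "eventually (\<lambda>k. k > nat \<lceil>2 * C / d\<rceil>) sequentially" by (rule eventually_gt_at_top)
  then show "eventually (\<lambda>k. dist (inf_conv G (real k) x) (G x) < e) sequentially"
  proof eventually_elim
    case (elim k)
    then have "real k > 2 * C / d" by linarith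
    then have k: "2 * C < real k * d" using d(1) by (simp add: pos_divide_less_eq mult.commute)
    have "G x - e/2 \<le> inf_conv G (real k) x"
    proof (rule inf_conv_greatest[OF bound])
      fix y assume y: "y \<in> cadlag01"
      show "G x - e/2 \<le> G y + real k * skorokhod_dist x y"
      proof (cases "skorokhod_dist x y < d")
        case True
        then show ?thesis using d(2)[OF y True] mult_nonneg_nonneg[OF of_nat_0_le_iff[of k] skorokhod_dist_nonneg[of x y]]
          by linarith
      next
        case False
        then have "real k * d \<le> real k * skorokhod_dist x y" by (simp add: mult_left_mono)
        then show ?thesis using k bound[OF xc] bound[OF y] e by linarith
      qed
    qed auto
    moreover have "inf_conv G (real k) x \<le> G x" using inf_conv_le[OF bound _ xc, where c="real k"] by simp
    ultimately show ?case using e by (simp add: dist_real_def)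
  qed
qed

text \<open>One half of a portmanteau argument: the envelopes are admissible test functionals below
  \<open>G\<close>, and by dominated convergence under the limit law some envelope loses less than
  \<open>e\<close>. Along \<open>n\<close> the comparison \<open>inf_conv \<le> G\<close> is used,
  which holds at discontinuous paths as well.\<close>

lemma conv_dist_D01_liminf:
  assumes M: "prob_space M" and N: "prob_space N"
    and conv: "conv_dist_D01 M (\<lambda>n \<omega> t. V n (nat \<lfloor>real n * t\<rfloor>) \<omega>) N (\<lambda>\<omega> t. B t \<omega>)"
    and V: "\<And>n i. V n i \<in> borel_measurable M"
    and B: "\<And>t. t \<in> {0..1} \<Longrightarrow> B t \<in> borel_measurable N"
    and c: "\<And>\<omega>. \<omega> \<in> space N \<Longrightarrow> continuous_on {0..1} (\<lambda>t. B t \<omega>)"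
    and G: "supnorm_continuous G" and bound: "\<And>x. x \<in> cadlag01 \<Longrightarrow> \<bar>G x\<bar> \<le> C"
    and e: "e > 0"
  shows "eventually (\<lambda>n. (\<integral>\<omega>. G (\<lambda>t. B t \<omega>) \<partial>N) - e < (\<integral>\<omega>. G (\<lambda>t. V n (nat \<lfloor>real n * t\<rfloor>) \<omega>) \<partial>M)) sequentially"
proof -
  interpret M: prob_space M by fact
  interpret N: prob_space N by fact
  define F where "F k = inf_conv G (real k)" for k :: nat
  have Fs: "skorokhod_continuous (F k)" for k
    unfolding F_def by (rule inf_conv_skorokhod_continuous[OF bound]) auto
  have Fb: "\<bar>F k x\<bar> \<le> C" if "x \<in> cadlag01" for k x
    unfolding F_def by (rule inf_conv_abs_le[OF bound _ that]) auto
  have Bc: "(\<lambda>t. B t \<omega>) \<in> cadlag01" if "\<omega> \<in> space N" for \<omega>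
    by (rule continuous_in_cadlag01[OF c[OF that]])
  have Fm: "(\<lambda>\<omega>. F k (\<lambda>t. B t \<omega>)) \<in> borel_measurable N" for k
    by (rule measurable_supnorm_continuous_continuous[OF skorokhod_continuous_imp_supnorm_continuous[OF Fs] B c])
  have Gm: "(\<lambda>\<omega>. G (\<lambda>t. B t \<omega>)) \<in> borel_measurable N"
    by (rule measurable_supnorm_continuous_continuous[OF G B c])
  have "(\<lambda>k. \<integral>\<omega>. F k (\<lambda>t. B t \<omega>) \<partial>N) \<longlonglongrightarrow> (\<integral>\<omega>. G (\<lambda>t. B t \<omega>) \<partial>N)"
  proof (rule integral_dominated_convergence[where w="\<lambda>_. C"])
    show "AE \<omega> in N. (\<lambda>k. F k (\<lambda>t. B t \<omega>)) \<longlonglongrightarrow> G (\<lambda>t. B t \<omega>)"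
      unfolding F_def by (intro AE_I2 inf_conv_tendsto[OF bound G c])
  qed (use Fm Gm Fb Bc in auto)
  then have "eventually (\<lambda>k. (\<integral>\<omega>. G (\<lambda>t. B t \<omega>) \<partial>N) - e < (\<integral>\<omega>. F k (\<lambda>t. B t \<omega>) \<partial>N)) sequentially"
    using e by (intro order_tendstoD) auto
  then obtain k where k: "(\<integral>\<omega>. G (\<lambda>t. B t \<omega>) \<partial>N) - e < (\<integral>\<omega>. F k (\<lambda>t. B t \<omega>) \<partial>N)"
    using eventually_happens by force
  have conv_k: "(\<lambda>n. \<integral>\<omega>. F k (\<lambda>t. V n (nat \<lfloor>real n * t\<rfloor>) \<omega>) \<partial>M) \<longlonglongrightarrow> (\<integral>\<omega>. F k (\<lambda>t. B t \<omega>) \<partial>N)"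
    using conv[unfolded conv_dist_D01_def, THEN spec[of _ "F k"]] Fs[of k] Fb[of _ k] by auto
  have Vc: "(\<lambda>t. V n (nat \<lfloor>real n * t\<rfloor>) \<omega>) \<in> cadlag01" for n \<omega>
    using step_in_cadlag01[of "\<lambda>i. V n i \<omega>" n] .
  have Fm': "(\<lambda>\<omega>. F k (\<lambda>t. V n (nat \<lfloor>real n * t\<rfloor>) \<omega>)) \<in> borel_measurable M" for n
    by (rule measurable_supnorm_continuous_step[OF skorokhod_continuous_imp_supnorm_continuous[OF Fs] V])
  have Gm': "(\<lambda>\<omega>. G (\<lambda>t. V n (nat \<lfloor>real n * t\<rfloor>) \<omega>)) \<in> borel_measurable M" for n
    by (rule measurable_supnorm_continuous_step[OF G V])
  from order_tendstoD(1)[OF conv_k k] show ?thesis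
  proof eventually_elim
    case (elim n)
    have "(\<integral>\<omega>. F k (\<lambda>t. V n (nat \<lfloor>real n * t\<rfloor>) \<omega>) \<partial>M) \<le> (\<integral>\<omega>. G (\<lambda>t. V n (nat \<lfloor>real n * t\<rfloor>) \<omega>) \<partial>M)"
    proof (rule integral_mono)
      show "integrable M (\<lambda>\<omega>. F k (\<lambda>t. V n (nat \<lfloor>real n * t\<rfloor>) \<omega>))"
        by (rule M.integrable_const_bound[where B=C])
          (simp_all add: Fb Vc Fm')
      show "integrable M (\<lambda>\<omega>. G (\<lambda>t. V n (nat \<lfloor>real n * t\<rfloor>) \<omega>))"
        by (rule M.integrable_const_bound[where B=C])
          (simp_all add: bound Vc Gm')
      show "F k (\<lambda>t. V n (nat \<lfloor>real n * t\<rfloor>) \<omega>) \<le> G (\<lambda>t. V n (nat \<lfloor>real n * t\<rfloor>) \<omega>)" for \<omega>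
        unfolding F_def by (rule inf_conv_le[OF bound]) (simp_all add: Vc)
    qed
    then show ?case using elim by linarith
  qed
qed

text \<open>The lower bound is applied to \<open>G\<close> and to \<open>- G\<close>; uniform
  continuity classes are symmetric under negation although the envelopes are one-sided.\<close>

theorem conv_dist_D01_supnorm_continuous:
  assumes M: "prob_space M" and N: "prob_space N"
    and conv: "conv_dist_D01 M (\<lambda>n \<omega> t. V n (nat \<lfloor>real n * t\<rfloor>) \<omega>) N (\<lambda>\<omega> t. B t \<omega>)"
    and V: "\<And>n i. V n i \<in> borel_measurable M"
    and B: "\<And>t. t \<in> {0..1} \<Longrightarrow> B t \<in> borel_measurable N"
    and c: "\<And>\<omega>. \<omega> \<in> space N \<Longrightarrow> continuous_on {0..1} (\<lambda>t. B t \<omega>)"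
    and G: "supnorm_continuous G" and bound: "\<And>x. x \<in> cadlag01 \<Longrightarrow> \<bar>G x\<bar> \<le> C"
  shows "(\<lambda>n. \<integral>\<omega>. G (\<lambda>t. V n (nat \<lfloor>real n * t\<rfloor>) \<omega>) \<partial>M) \<longlonglongrightarrow> (\<integral>\<omega>. G (\<lambda>t. B t \<omega>) \<partial>N)"
proof (rule tendstoI)
  fix e :: real assume e: "e > 0"
  have G': "supnorm_continuous (\<lambda>x. - G x)"
    using G unfolding supnorm_continuous_def by (simp add: abs_minus_commute)
  have b': "\<bar>- G x\<bar> \<le> C" if "x \<in> cadlag01" for x using bound[OF that] by simp
  have 1: "eventually (\<lambda>n. (\<integral>\<omega>. G (\<lambda>t. B t \<omega>) \<partial>N) - e < (\<integral>\<omega>. G (\<lambda>t. V n (nat \<lfloor>real n * t\<rfloor>) \<omega>) \<partial>M)) sequentially"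
    by (rule conv_dist_D01_liminf[OF M N conv V B c G bound e])
  have 2: "eventually (\<lambda>n. (\<integral>\<omega>. - G (\<lambda>t. B t \<omega>) \<partial>N) - e < (\<integral>\<omega>. - G (\<lambda>t. V n (nat \<lfloor>real n * t\<rfloor>) \<omega>) \<partial>M)) sequentially"
    by (rule conv_dist_D01_liminf[OF M N conv V B c G' b' e])
  show "eventually (\<lambda>n. dist (\<integral>\<omega>. G (\<lambda>t. V n (nat \<lfloor>real n * t\<rfloor>) \<omega>) \<partial>M) (\<integral>\<omega>. G (\<lambda>t. B t \<omega>) \<partial>N) < e) sequentially"
    using 1 2 by eventually_elim (simp add: dist_real_def abs_less_iff)
qed

section \<open>The Cramer--Wold device\<close>

text \<open>Cosines with an arbitrary phase include the sines and the constants, and the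
  product-to-sum formula makes their sums an algebra. Expectations of these functions are determined
  by expectations of cosines of linear forms, which is what Gaussian vectors provide.\<close>

inductive trig_poly :: "'i set \<Rightarrow> (('i \<Rightarrow> real) \<Rightarrow> real) \<Rightarrow> bool" for I where
  cosine: "trig_poly I (\<lambda>x. c * cos ((\<Sum>i\<in>I. a i * x i) + b))"
| add: "trig_poly I f \<Longrightarrow> trig_poly I g \<Longrightarrow> trig_poly I (\<lambda>x. f x + g x)"

lemma trig_poly_const: "trig_poly I (\<lambda>x. c)"
  using trig_poly.cosine[of I c "\<lambda>_. 0" 0] by simp

lemma trig_poly_cos_mult:
  assumes "trig_poly I g"
  shows "trig_poly I (\<lambda>x. (c * cos ((\<Sum>i\<in>I. a i * x i) + b)) * g x)"
  using assms
proof induction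
  case (cosine c' a' b')
  have "trig_poly I (\<lambda>x. (c * c' / 2) * cos ((\<Sum>i\<in>I. (a i - a' i) * x i) + (b - b'))
      + (c * c' / 2) * cos ((\<Sum>i\<in>I. (a i + a' i) * x i) + (b + b')))"
    by (intro trig_poly.intros)
  moreover have "(c * cos ((\<Sum>i\<in>I. a i * x i) + b)) * (c' * cos ((\<Sum>i\<in>I. a' i * x i) + b')) =
      (c * c' / 2) * cos ((\<Sum>i\<in>I. (a i - a' i) * x i) + (b - b'))
      + (c * c' / 2) * cos ((\<Sum>i\<in>I. (a i + a' i) * x i) + (b + b'))" for x
  proof -
    define u v where "u = (\<Sum>i\<in>I. a i * x i) + b" and "v = (\<Sum>i\<in>I. a' i * x i) + b'"
    have "(\<Sum>i\<in>I. (a i - a' i) * x i) + (b - b') = u - v" "(\<Sum>i\<in>I. (a i + a' i) * x i) + (b + b') = u + v"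
      by (simp_all add: u_def v_def algebra_simps sum.distrib sum_subtractf)
    then show ?thesis unfolding u_def[symmetric] v_def[symmetric]
      by (simp only:) (simp add: cos_add cos_diff field_simps)
  qed
  ultimately show ?case by simp
next
  case (add f g)
  from trig_poly.add[OF add.IH] show ?case by (simp add: algebra_simps)
qed

lemma trig_poly_mult:
  assumes "trig_poly I f" "trig_poly I g"
  shows "trig_poly I (\<lambda>x. f x * g x)"
  using assms(1)
proof induction
  case (cosine c a b)
  show ?case by (rule trig_poly_cos_mult[OF assms(2)])
next
  case (add f1 f2)
  from trig_poly.add[OF add.IH] show ?case by (simp add: algebra_simps)
qed

lemma trig_poly_bounded:
  assumes "trig_poly I f"
  shows "\<exists>K. \<forall>x. \<bar>f x\<bar> \<le> K"
  using assms
proof induction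
  case (cosine c a b)
  have "\<bar>c * cos y\<bar> \<le> \<bar>c\<bar>" for y :: real
    using mult_left_le[of "\<bar>cos y\<bar>" "\<bar>c\<bar>"] by (simp add: abs_mult)
  then show ?case by blast
next
  case (add f g)
  then obtain K1 K2 where K: "\<forall>x. \<bar>f x\<bar> \<le> K1" "\<forall>x. \<bar>g x\<bar> \<le> K2" by blast
  have "\<bar>f x + g x\<bar> \<le> K1 + K2" for x
    using K(1)[rule_format, of x] K(2)[rule_format, of x] by linarith
  then show ?case by blast
qed

lemma trig_poly_continuous:
  fixes f :: "('i::countable \<Rightarrow> real) \<Rightarrow> real"
  assumes "trig_poly I f" "finite I"
  shows "continuous_on S f"
  using assms(1)
proof induction
  case (cosine c a b)
  have "continuous_on S (\<lambda>x. x i)" for i :: 'i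
    by (rule continuous_on_subset[OF continuous_on_product_coordinates]) simp
  then show ?case by (intro continuous_intros)
next
  case (add f g)
  then show ?case by (intro continuous_intros)
qed

lemma trig_poly_polynomial_comp:
  assumes "real_polynomial_function Q" and p: "trig_poly I p"
  shows "trig_poly I (\<lambda>x. Q (p x :: real))"
  using assms(1)
proof induction
  case (linear f)
  then have "f y = f 1 * y" for y :: real
    using linear_cmul[OF bounded_linear.linear, of f y 1] by (simp add: mult.commute)
  then have "(\<lambda>x. f (p x)) = (\<lambda>x. f 1 * p x)" by (rule ext)
  then show ?case using trig_poly_mult[OF trig_poly_const[of I "f 1"] p] by simp
next
  case (const c)
  show ?case by (rule trig_poly_const)
next
  case (add f g)
  from trig_poly.add[OF add.IH] show ?case .
next
  case (mult f g)
  from trig_poly_mult[OF mult.IH] show ?case .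
qed

lemma (in prob_space) prob_tail_less:
  assumes [measurable]: "Z \<in> borel_measurable M" and "e > 0"
  obtains L :: nat where "prob {\<omega>\<in>space M. Z \<omega> > real L} < e"
proof -
  define A where "A n = {\<omega>\<in>space M. Z \<omega> > real n}" for n :: nat
  have "(\<lambda>n. prob (A n)) \<longlonglongrightarrow> prob (\<Inter>i. A i)"
  proof (rule finite_Lim_measure_decseq)
    show "range A \<subseteq> sets M" unfolding A_def by auto
    show "decseq A" unfolding A_def decseq_def by (auto intro: order.strict_trans1[OF of_nat_mono])
  qed
  moreover have "(\<Inter>i. A i) = {}"
  proof -
    have "\<exists>n. \<not> Z \<omega> > real n" for \<omega> using real_arch_simple[of "Z \<omega>"] by (auto simp: not_less)
    then show ?thesis by (auto simp: A_def)
  qed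
  ultimately have "(\<lambda>n. prob (A n)) \<longlonglongrightarrow> 0" by simp
  then have "eventually (\<lambda>n. prob (A n) < e) sequentially" using assms(2) by (rule order_tendstoD)
  then obtain L where "prob (A L) < e" using eventually_happens by force
  then show ?thesis using that by (simp add: A_def)
qed

text \<open>Tychonoff's theorem, since the index type may be infinite. Below, coordinates outside a
  finite index set are pinned by the degenerate interval [0, 0].\<close>

lemma compact_box_fun:
  fixes l u :: "'i \<Rightarrow> real"
  shows "compact {x. \<forall>i. x i \<in> {l i..u i}}"
proof -
  have "compactin (product_topology (\<lambda>_. euclidean) UNIV) (PiE UNIV (\<lambda>i. {l i..u i}))"
    by (subst compactin_PiE) auto
  moreover have "PiE UNIV (\<lambda>i. {l i..u i}) = {x. \<forall>i. x i \<in> {l i..u i}}" by (auto simp: PiE_UNIV_domain)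
  ultimately show ?thesis by (simp add: euclidean_product_topology)
qed

text \<open>Stone-Weierstrass on the cube with zero coordinates outside \<open>I\<close>. Two of its
  points differ in a coordinate from \<open>I\<close>, and the sine of that coordinate, suitably
  scaled, separates them.\<close>

lemma trig_poly_approx:
  fixes f :: "('i::countable \<Rightarrow> real) \<Rightarrow> real" and L :: real
  assumes I: "finite I" and f: "continuous_on UNIV f" and e: "e > 0" and L: "L \<ge> 0"
  shows "\<exists>p. trig_poly I p \<and> (\<forall>x. (\<forall>i. i \<notin> I \<longrightarrow> x i = 0) \<longrightarrow> (\<forall>i\<in>I. \<bar>x i\<bar> \<le> L) \<longrightarrow> \<bar>f x - p x\<bar> < e)"
proof -
  define S where "S = {x :: 'i \<Rightarrow> real. \<forall>i. x i \<in> {(if i \<in> I then -L else 0)..(if i \<in> I then L else 0)}}"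
  have "\<exists>p. trig_poly I p \<and> (\<forall>x \<in> S. \<bar>f x - p x\<bar> < e)"
  proof (rule Stone_Weierstrass_HOL)
    show "compact S" unfolding S_def by (rule compact_box_fun)
    show "trig_poly I (\<lambda>x. c)" for c by (rule trig_poly_const)
    show "continuous_on S g" if "trig_poly I g" for g by (rule trig_poly_continuous[OF that I])
    show "trig_poly I (\<lambda>x. g x + h x)" if "trig_poly I g \<and> trig_poly I h" for g h
      using that by (auto intro: trig_poly.add)
    show "trig_poly I (\<lambda>x. g x * h x)" if "trig_poly I g \<and> trig_poly I h" for g h
      using that by (auto intro: trig_poly_mult)
    show "continuous_on S f" by (rule continuous_on_subset[OF f]) simp
    fix x y assume "x \<in> S \<and> y \<in> S \<and> x \<noteq> y"
    then have xy: "x \<in> S" "y \<in> S" "x \<noteq> y" by auto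
    then obtain k where k: "x k \<noteq> y k" by blast
    have kI: "k \<in> I"
    proof (rule ccontr)
      assume "k \<notin> I"
      moreover have "x k \<in> {(if k \<in> I then -L else 0)..(if k \<in> I then L else 0)}"
        "y k \<in> {(if k \<in> I then -L else 0)..(if k \<in> I then L else 0)}"
        using xy unfolding S_def by blast+
      ultimately show False using k by simp
    qed
    have b: "\<bar>z k\<bar> \<le> L" if "z \<in> S" for z
    proof -
      have "z k \<in> {(if k \<in> I then -L else 0)..(if k \<in> I then L else 0)}"
        using that unfolding S_def by blast
      then show ?thesis using kI by auto
    qed
    \<comment> \<open>The phase \<open>pi/2\<close> turns the cosine into minus a sine. Dividing by
      \<open>L + 1\<close> brings the argument into [-1, 1], inside the interval where sine is
      injective.\<close>
    define g where "g z = 1 * cos ((\<Sum>i\<in>I. (if i = k then 1 / (L+1) else 0) * z i) + pi/2)" for z :: "'i \<Rightarrow> real"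
    have g: "g z = - sin (z k / (L+1))" for z
    proof -
      have "(\<Sum>i\<in>I. (if i = k then 1 / (L+1) else 0) * z i) = (\<Sum>i\<in>I. if i = k then z i / (L+1) else 0)"
        by (rule sum.cong) auto
      then show ?thesis using I kI by (simp add: g_def cos_add)
    qed
    have r: "\<bar>z k / (L+1)\<bar> \<le> pi/2" if "z \<in> S" for z
    proof -
      have "\<bar>z k / (L+1)\<bar> \<le> 1" using b[OF that] L by (simp add: field_simps)
      then show ?thesis using pi_ge_two by linarith
    qed
    have "g x \<noteq> g y"
    proof
      assume "g x = g y"
      then have sn: "sin (x k / (L+1)) = sin (y k / (L+1))" by (simp add: g)
      have bd: "- (pi/2) \<le> x k / (L+1)" "x k / (L+1) \<le> pi/2" "- (pi/2) \<le> y k / (L+1)" "y k / (L+1) \<le> pi/2"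
        using r[OF xy(1)] r[OF xy(2)] by linarith+
      have "x k / (L+1) = y k / (L+1)" by (rule sin_inj_pi[OF bd sn])
      then show False using k L by simp
    qed
    moreover have "trig_poly I g" unfolding g_def by (rule trig_poly.cosine)
    ultimately show "\<exists>f. trig_poly I f \<and> f x \<noteq> f y" by blast
  qed (rule e)
  then obtain p where p: "trig_poly I p" "\<And>x. x \<in> S \<Longrightarrow> \<bar>f x - p x\<bar> < e" by blast
  show ?thesis
  proof (intro exI[of _ p] conjI allI impI p(1))
    fix x :: "'i \<Rightarrow> real" assume x: "\<forall>i. i \<notin> I \<longrightarrow> x i = 0" "\<forall>i\<in>I. \<bar>x i\<bar> \<le> L"
    have "x \<in> S" unfolding S_def
    proof (intro CollectI allI)
      fix i show "x i \<in> {(if i \<in> I then -L else 0)..(if i \<in> I then L else 0)}"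
        using x(1)[rule_format, of i] x(2)[rule_format, of i] by (cases "i \<in> I") auto
    qed
    then show "\<bar>f x - p x\<bar> < e" by (rule p(2))
  qed
qed

text \<open>A random vector over \<open>I\<close>, padded by zeros to a function on the whole index
  type, so that Borel sets and continuity are those of one fixed function space.\<close>

definition restr0 :: "'i set \<Rightarrow> ('i \<Rightarrow> 'a \<Rightarrow> real) \<Rightarrow> 'a \<Rightarrow> 'i \<Rightarrow> real" where
  "restr0 I X \<omega> = (\<lambda>i. if i \<in> I then X i \<omega> else 0)"

lemma restr0_sum: "finite I \<Longrightarrow> (\<Sum>i\<in>I. a i * restr0 I X \<omega> i) = (\<Sum>i\<in>I. a i * X i \<omega>)"
  by (rule sum.cong) (auto simp: restr0_def)

lemma measurable_restr0:
  fixes X :: "'i::countable \<Rightarrow> 'a \<Rightarrow> real"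
  assumes X: "\<And>i. i \<in> I \<Longrightarrow> X i \<in> borel_measurable M" and f: "continuous_on UNIV f"
  shows "(\<lambda>\<omega>. f (restr0 I X \<omega>) :: real) \<in> borel_measurable M"
proof (rule measurable_compose[where f="restr0 I X" and g=f])
  show "restr0 I X \<in> M \<rightarrow>\<^sub>M borel"
  proof (rule measurable_coordinatewise_then_product)
    fix i show "(\<lambda>\<omega>. restr0 I X \<omega> i) \<in> borel_measurable M"
      using X[of i] by (cases "i \<in> I") (simp_all add: restr0_def)
  qed
  show "f \<in> borel_measurable borel" by (rule borel_measurable_continuous_onI[OF f])
qed

lemma trig_poly_expectation_eq:
  fixes X :: "'i::countable \<Rightarrow> 'a \<Rightarrow> real" and Y :: "'i \<Rightarrow> 'b \<Rightarrow> real"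
  assumes M: "prob_space M" and N: "prob_space N" and I: "finite I"
    and X: "\<And>i. i \<in> I \<Longrightarrow> X i \<in> borel_measurable M"
    and Y: "\<And>i. i \<in> I \<Longrightarrow> Y i \<in> borel_measurable N"
    and eq: "\<And>a b. (\<integral>\<omega>. cos ((\<Sum>i\<in>I. a i * X i \<omega>) + b) \<partial>M) = (\<integral>\<omega>. cos ((\<Sum>i\<in>I. a i * Y i \<omega>) + b) \<partial>N)"
    and p: "trig_poly I p"
  shows "(\<integral>\<omega>. p (restr0 I X \<omega>) \<partial>M) = (\<integral>\<omega>. p (restr0 I Y \<omega>) \<partial>N)"
proof -
  interpret M: prob_space M by fact
  interpret N: prob_space N by fact
  have iM: "integrable M (\<lambda>\<omega>. g (restr0 I X \<omega>))" and iN: "integrable N (\<lambda>\<omega>. g (restr0 I Y \<omega>))" if tp: "trig_poly I g" for g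
  proof -
    obtain K where K: "\<And>x. \<bar>g x\<bar> \<le> K" using trig_poly_bounded[OF tp] by blast
    note c = trig_poly_continuous[OF tp I, of UNIV]
    have mX: "(\<lambda>\<omega>. g (restr0 I X \<omega>)) \<in> borel_measurable M" by (rule measurable_restr0[OF X c])
    have mY: "(\<lambda>\<omega>. g (restr0 I Y \<omega>)) \<in> borel_measurable N" by (rule measurable_restr0[OF Y c])
    show "integrable M (\<lambda>\<omega>. g (restr0 I X \<omega>))"
      by (rule M.integrable_const_bound[of _ K]) (simp_all add: K mX)
    show "integrable N (\<lambda>\<omega>. g (restr0 I Y \<omega>))"
      by (rule N.integrable_const_bound[of _ K]) (simp_all add: K mY)
  qed
  show ?thesis using p
  proof induction
    case (cosine c a b)
    show ?case by (simp add: restr0_sum[OF I] eq)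
  next
    case (add f g)
    then show ?case by (simp add: iM iN)
  qed
qed

text \<open>Off the tail event, clamping does not increase the distance of \<open>p\<close> from
  \<open>f\<close>, because \<open>f\<close> itself has values in \<open>[-C, C]\<close>; clamping
  and polynomial approximation then cost \<open>e\<close> each. On the tail event, whose probability
  is below \<open>e\<close>, the difference is at most \<open>2 C + e\<close>.\<close>

lemma clamped_trig_poly_expectation:
  fixes Z :: "'i::countable \<Rightarrow> 'a \<Rightarrow> real" and f p q :: "('i \<Rightarrow> real) \<Rightarrow> real"
  assumes P: "prob_space P" and I: "finite I" and Z: "\<And>i. i \<in> I \<Longrightarrow> Z i \<in> borel_measurable P"
    and f: "continuous_on UNIV f" and C: "\<And>x. \<bar>f x\<bar> \<le> C" and e: "e > 0"
    and L: "measure P {\<omega>\<in>space P. (\<Sum>i\<in>I. \<bar>Z i \<omega>\<bar>) > L} < e"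
    and p: "\<And>x. \<forall>i. i \<notin> I \<longrightarrow> x i = 0 \<Longrightarrow> \<forall>i\<in>I. \<bar>x i\<bar> \<le> L \<Longrightarrow> \<bar>f x - p x\<bar> < e"
    and q: "trig_poly I q" and pq: "\<And>x. \<bar>max (-C) (min C (p x)) - q x\<bar> < e"
  shows "\<bar>(\<integral>\<omega>. f (restr0 I Z \<omega>) \<partial>P) - (\<integral>\<omega>. q (restr0 I Z \<omega>) \<partial>P)\<bar> \<le> 2 * e + 2 * C * e"
proof -
  interpret P: prob_space P by fact
  have C0: "C \<ge> 0" using C[of "\<lambda>_. 0"] by linarith
  define A where "A = {\<omega>\<in>space P. (\<Sum>i\<in>I. \<bar>Z i \<omega>\<bar>) > L}"
  have "(\<lambda>\<omega>. \<Sum>i\<in>I. \<bar>Z i \<omega>\<bar>) \<in> borel_measurable P"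
    by (intro borel_measurable_sum borel_measurable_abs Z)
  then have A: "A \<in> sets P" unfolding A_def by measurable
  obtain K' where K': "\<And>x. \<bar>q x\<bar> \<le> K'" using trig_poly_bounded[OF q] by blast
  have mf: "(\<lambda>\<omega>. f (restr0 I Z \<omega>)) \<in> borel_measurable P" by (rule measurable_restr0[OF Z f])
  have mq: "(\<lambda>\<omega>. q (restr0 I Z \<omega>)) \<in> borel_measurable P"
    by (rule measurable_restr0[OF Z trig_poly_continuous[OF q I]])
  have int_f: "integrable P (\<lambda>\<omega>. f (restr0 I Z \<omega>))"
    by (rule P.integrable_const_bound[of _ C]) (simp_all add: C mf)
  have int_q: "integrable P (\<lambda>\<omega>. q (restr0 I Z \<omega>))"
    by (rule P.integrable_const_bound[of _ K'])
      (simp_all add: K' mq)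
  have pw: "\<bar>f (restr0 I Z \<omega>) - q (restr0 I Z \<omega>)\<bar> \<le> 2 * e + 2 * C * indicator A \<omega>" if \<omega>: "\<omega> \<in> space P" for \<omega>
  proof (cases "\<omega> \<in> A")
    case True
    then show ?thesis using C[of "restr0 I Z \<omega>"] pq[of "restr0 I Z \<omega>"] e C0
      by simp
  next
    case False
    have zi: "\<bar>Z i \<omega>\<bar> \<le> L" if i: "i \<in> I" for i
    proof -
      have "\<bar>Z i \<omega>\<bar> \<le> (\<Sum>i\<in>I. \<bar>Z i \<omega>\<bar>)" using member_le_sum[OF i, of "\<lambda>i. \<bar>Z i \<omega>\<bar>"] I by simp
      then show ?thesis using False \<omega> by (simp add: A_def)
    qed
    have "\<bar>f (restr0 I Z \<omega>) - p (restr0 I Z \<omega>)\<bar> < e"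
      by (rule p) (simp_all add: restr0_def zi)
    then show ?thesis using C[of "restr0 I Z \<omega>"] pq[of "restr0 I Z \<omega>"] False by simp
  qed
  have "\<bar>(\<integral>\<omega>. f (restr0 I Z \<omega>) \<partial>P) - (\<integral>\<omega>. q (restr0 I Z \<omega>) \<partial>P)\<bar>
    = \<bar>\<integral>\<omega>. f (restr0 I Z \<omega>) - q (restr0 I Z \<omega>) \<partial>P\<bar>" using int_f int_q by simp
  also have "\<dots> \<le> (\<integral>\<omega>. \<bar>f (restr0 I Z \<omega>) - q (restr0 I Z \<omega>)\<bar> \<partial>P)" by (rule integral_abs_bound)
  also have "\<dots> \<le> (\<integral>\<omega>. 2 * e + 2 * C * indicator A \<omega> \<partial>P)"
  proof (rule integral_mono)
    show "integrable P (\<lambda>\<omega>. \<bar>f (restr0 I Z \<omega>) - q (restr0 I Z \<omega>)\<bar>)" using int_f int_q by simp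
    show "integrable P (\<lambda>\<omega>. 2 * e + 2 * C * indicator A \<omega>)" using A by (simp add: P.emeasure_eq_measure)
  qed (rule pw)
  also have "\<dots> = 2 * e + 2 * C * measure P A" using A by (simp add: P.emeasure_eq_measure P.prob_space)
  also have "\<dots> \<le> 2 * e + 2 * C * e" using L C0 by (simp add: A_def mult_left_mono)
  finally show ?thesis .
qed

text \<open>Cramer--Wold: on a large cube, \<open>f\<close> is approximated by a trigonometric polynomial \<open>p\<close>. Outside of
  the cube \<open>p\<close> is tamed by clamping it to \<open>[-C, C]\<close>; the clamped function is a uniform limit of
  polynomials in \<open>p\<close>, which are trigonometric polynomials again.\<close>

theorem expectation_eq_of_cos_eq:
  fixes X :: "'i::countable \<Rightarrow> 'a \<Rightarrow> real" and Y :: "'i \<Rightarrow> 'b \<Rightarrow> real" and f :: "('i \<Rightarrow> real) \<Rightarrow> real"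
  assumes M: "prob_space M" and N: "prob_space N" and I: "finite I"
    and X: "\<And>i. i \<in> I \<Longrightarrow> X i \<in> borel_measurable M"
    and Y: "\<And>i. i \<in> I \<Longrightarrow> Y i \<in> borel_measurable N"
    and eq: "\<And>a b. (\<integral>\<omega>. cos ((\<Sum>i\<in>I. a i * X i \<omega>) + b) \<partial>M) = (\<integral>\<omega>. cos ((\<Sum>i\<in>I. a i * Y i \<omega>) + b) \<partial>N)"
    and f: "continuous_on UNIV f" and C: "\<And>x. \<bar>f x\<bar> \<le> C"
  shows "(\<integral>\<omega>. f (restr0 I X \<omega>) \<partial>M) = (\<integral>\<omega>. f (restr0 I Y \<omega>) \<partial>N)"
proof -
  interpret M: prob_space M by fact
  interpret N: prob_space N by fact
  have C0: "C \<ge> 0" using C[of "\<lambda>_. 0"] by linarith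
  define h where "h u = max (-C) (min C u)" for u :: real
  have hc: "continuous_on A h" for A unfolding h_def by (intro continuous_intros)
  have mX: "(\<lambda>\<omega>. \<Sum>i\<in>I. \<bar>X i \<omega>\<bar>) \<in> borel_measurable M"
    by (intro borel_measurable_sum borel_measurable_abs X)
  have mY: "(\<lambda>\<omega>. \<Sum>i\<in>I. \<bar>Y i \<omega>\<bar>) \<in> borel_measurable N"
    by (intro borel_measurable_sum borel_measurable_abs Y)
  have close: "\<bar>(\<integral>\<omega>. f (restr0 I X \<omega>) \<partial>M) - (\<integral>\<omega>. f (restr0 I Y \<omega>) \<partial>N)\<bar> \<le> (4 + 4 * C) * e" if e: "e > 0" for e
  proof -
    obtain L1 :: nat where L1: "M.prob {\<omega>\<in>space M. (\<Sum>i\<in>I. \<bar>X i \<omega>\<bar>) > real L1} < e"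
      by (rule M.prob_tail_less[OF mX e])
    obtain L2 :: nat where L2: "N.prob {\<omega>\<in>space N. (\<Sum>i\<in>I. \<bar>Y i \<omega>\<bar>) > real L2} < e"
      by (rule N.prob_tail_less[OF mY e])
    define L where "L = max (real L1) (real L2)"
    have L0: "0 \<le> L" unfolding L_def by simp
    have L1': "M.prob {\<omega>\<in>space M. (\<Sum>i\<in>I. \<bar>X i \<omega>\<bar>) > L} < e"
      by (rule le_less_trans[OF M.finite_measure_mono L1]) (use mX in \<open>auto simp: L_def\<close>)
    have L2': "N.prob {\<omega>\<in>space N. (\<Sum>i\<in>I. \<bar>Y i \<omega>\<bar>) > L} < e"
      by (rule le_less_trans[OF N.finite_measure_mono L2]) (use mY in \<open>auto simp: L_def\<close>)
    obtain p where p: "trig_poly I p"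
      "\<And>x. \<forall>i. i \<notin> I \<longrightarrow> x i = 0 \<Longrightarrow> \<forall>i\<in>I. \<bar>x i\<bar> \<le> L \<Longrightarrow> \<bar>f x - p x\<bar> < e"
      using trig_poly_approx[OF I f e L0] by blast
    obtain K where K: "\<And>x. \<bar>p x\<bar> \<le> K" using trig_poly_bounded[OF p(1)] by blast
    obtain Q where Q: "real_polynomial_function Q" "\<And>u. u \<in> {-K..K} \<Longrightarrow> \<bar>h u - Q u\<bar> < e"
      by (rule Stone_Weierstrass_real_polynomial_function[OF compact_Icc[of "-K" K] hc e]) (rule that)
    have Qp: "trig_poly I (\<lambda>x. Q (p x))" by (rule trig_poly_polynomial_comp[OF Q(1) p(1)])
    have hQ: "\<bar>max (-C) (min C (p x)) - Q (p x)\<bar> < e" for x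
      unfolding h_def[symmetric] by (rule Q(2)) (use K[of x] in \<open>simp add: abs_le_iff\<close>)
    have "\<bar>(\<integral>\<omega>. f (restr0 I X \<omega>) \<partial>M) - (\<integral>\<omega>. Q (p (restr0 I X \<omega>)) \<partial>M)\<bar> \<le> 2 * e + 2 * C * e"
      by (rule clamped_trig_poly_expectation[OF M I X f C e L1' p(2) Qp hQ])
    moreover have "\<bar>(\<integral>\<omega>. f (restr0 I Y \<omega>) \<partial>N) - (\<integral>\<omega>. Q (p (restr0 I Y \<omega>)) \<partial>N)\<bar> \<le> 2 * e + 2 * C * e"
      by (rule clamped_trig_poly_expectation[OF N I Y f C e L2' p(2) Qp hQ])
    moreover have "(\<integral>\<omega>. Q (p (restr0 I X \<omega>)) \<partial>M) = (\<integral>\<omega>. Q (p (restr0 I Y \<omega>)) \<partial>N)"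
      by (rule trig_poly_expectation_eq[OF M N I X Y eq Qp])
    ultimately show ?thesis by (simp add: algebra_simps)
  qed
  have "\<bar>(\<integral>\<omega>. f (restr0 I X \<omega>) \<partial>M) - (\<integral>\<omega>. f (restr0 I Y \<omega>) \<partial>N)\<bar> \<le> 0 + e" if "e > 0" for e
    using close[of "e / (4 + 4 * C)"] that C0 by simp
  then have "\<bar>(\<integral>\<omega>. f (restr0 I X \<omega>) \<partial>M) - (\<integral>\<omega>. f (restr0 I Y \<omega>) \<partial>N)\<bar> \<le> 0"
    by (rule field_le_epsilon)
  then show ?thesis by simp
qed

section \<open>Gaussian vectors\<close>

text \<open>Real and imaginary parts of the characteristic function of the standard normal law,
  carried over to \<open>Z\<close> through its density.\<close>

lemma (in prob_space) std_normal_cos_sin: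
  assumes D: "distributed M lborel Z std_normal_density"
  shows "expectation (\<lambda>\<omega>. cos (t * Z \<omega>)) = exp (- (t\<^sup>2) / 2)"
    and "expectation (\<lambda>\<omega>. sin (t * Z \<omega>)) = 0"
proof -
  let ?S = "density lborel (\<lambda>x. ennreal (std_normal_density x))"
  interpret S: prob_space ?S by (rule prob_space_normal_density) simp
  have eq: "(CLINT x|?S. iexp (t * x)) = complex_of_real (exp (- (t\<^sup>2) / 2))"
    using char_std_normal_distribution unfolding char_def by metis
  have int: "integrable ?S (\<lambda>x. iexp (t * x))"
    by (rule S.integrable_const_bound[of _ 1]) (auto)
  have "(\<integral>x. cos (t * x) \<partial>?S) = Re (CLINT x|?S. iexp (t * x))"
    using integral_Re[OF int] by (simp add: Re_exp)
  then have c: "(\<integral>x. cos (t * x) \<partial>?S) = exp (- (t\<^sup>2) / 2)" by (simp only: eq Re_complex_of_real)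
  have "(\<integral>x. sin (t * x) \<partial>?S) = Im (CLINT x|?S. iexp (t * x))"
    using integral_Im[OF int] by (simp add: Im_exp)
  then have s: "(\<integral>x. sin (t * x) \<partial>?S) = 0" by (simp only: eq Im_complex_of_real)
  have "(\<integral>x. cos (t * x) \<partial>?S) = (\<integral>x. std_normal_density x * cos (t * x) \<partial>lborel)"
    by (rule integral_real_density) auto
  also have "\<dots> = expectation (\<lambda>\<omega>. cos (t * Z \<omega>))"
    by (rule distributed_integral[OF D]) auto
  finally show "expectation (\<lambda>\<omega>. cos (t * Z \<omega>)) = exp (- (t\<^sup>2) / 2)" using c by simp
  have "(\<integral>x. sin (t * x) \<partial>?S) = (\<integral>x. std_normal_density x * sin (t * x) \<partial>lborel)"
    by (rule integral_real_density) auto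
  also have "\<dots> = expectation (\<lambda>\<omega>. sin (t * Z \<omega>))"
    by (rule distributed_integral[OF D]) auto
  finally show "expectation (\<lambda>\<omega>. sin (t * Z \<omega>)) = 0" using s by simp
qed

lemma centered_normal_measurable: "centered_normal N X v \<Longrightarrow> X \<in> borel_measurable N"
  unfolding centered_normal_def by (auto dest: distributed_measurable)

lemma centered_normal_cos_sin0:
  assumes N: "prob_space N" and X: "centered_normal N X v"
  shows "(\<integral>\<omega>. cos (X \<omega>) \<partial>N) = exp (- v / 2)" and "(\<integral>\<omega>. sin (X \<omega>) \<partial>N) = 0"
proof -
  interpret N: prob_space N by fact
  have "(\<integral>\<omega>. cos (X \<omega>) \<partial>N) = exp (- v / 2) \<and> (\<integral>\<omega>. sin (X \<omega>) \<partial>N) = 0"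
    using X unfolding centered_normal_def
  proof (elim disjE conjE)
    assume v: "v = 0" and [measurable]: "X \<in> borel_measurable N" and ae: "AE \<omega> in N. X \<omega> = 0"
    have "(\<integral>\<omega>. cos (X \<omega>) \<partial>N) = (\<integral>\<omega>. 1 \<partial>N)" by (rule integral_cong_AE) (use ae in auto)
    moreover have "(\<integral>\<omega>. sin (X \<omega>) \<partial>N) = (\<integral>\<omega>. 0 \<partial>N)" by (rule integral_cong_AE) (use ae in auto)
    ultimately show ?thesis using v by (simp add: N.prob_space)
  next
    assume v: "v > 0" and D: "distributed N lborel X (\<lambda>x. ennreal (normal_density 0 (sqrt v) x))"
    define Z where "Z = (\<lambda>\<omega>. (X \<omega> - 0) / sqrt v)"
    have sv: "0 < sqrt v" using v by simp
    have Z: "distributed N lborel Z std_normal_density"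
      using D unfolding N.normal_standard_normal_convert[OF sv] Z_def .
    have "X \<omega> = sqrt v * Z \<omega>" for \<omega> using sv by (simp add: Z_def)
    then show ?thesis using N.std_normal_cos_sin[OF Z, of "sqrt v"] v by simp
  qed
  then show "(\<integral>\<omega>. cos (X \<omega>) \<partial>N) = exp (- v / 2)" "(\<integral>\<omega>. sin (X \<omega>) \<partial>N) = 0" by auto
qed

lemma centered_normal_cos:
  assumes N: "prob_space N" and X: "centered_normal N X v"
  shows "(\<integral>\<omega>. cos (X \<omega> + b) \<partial>N) = cos b * exp (- v / 2)"
proof -
  interpret N: prob_space N by fact
  note [measurable] = centered_normal_measurable[OF X]
  have i: "integrable N (\<lambda>\<omega>. cos (X \<omega>))" "integrable N (\<lambda>\<omega>. sin (X \<omega>))"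
    by (rule N.integrable_const_bound[of _ 1]; simp)+
  have "(\<integral>\<omega>. cos (X \<omega> + b) \<partial>N) = (\<integral>\<omega>. cos (X \<omega>) * cos b - sin (X \<omega>) * sin b \<partial>N)" by (simp add: cos_add)
  also have "\<dots> = exp (- v / 2) * cos b" using i centered_normal_cos_sin0[OF N X] by simp
  finally show ?thesis by simp
qed

text \<open>The addition formula splits the cosine into products of a function of \<open>X\<close>
  and a function of \<open>Y\<close>, whose expectations factor. This takes the place of a
  convolution of densities.\<close>

lemma centered_normal_indep_cos:
  assumes N: "prob_space N" and X: "centered_normal N X v" and Y: "centered_normal N Y w"
    and ind: "prob_space.indep_var N borel X borel Y"
  shows "(\<integral>\<omega>. cos (X \<omega> + Y \<omega> + b) \<partial>N) = cos b * exp (- (v + w) / 2)"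
proof -
  interpret N: prob_space N by fact
  note [measurable] = centered_normal_measurable[OF X] centered_normal_measurable[OF Y]
  have b: "integrable N (\<lambda>\<omega>. cos (X \<omega>))" "integrable N (\<lambda>\<omega>. sin (X \<omega>))"
    "integrable N (\<lambda>\<omega>. cos (Y \<omega> + b))" "integrable N (\<lambda>\<omega>. sin (Y \<omega> + b))"
    by (rule N.integrable_const_bound[of _ 1]; simp)+
  have i1: "N.indep_var borel (\<lambda>\<omega>. cos (X \<omega>)) borel (\<lambda>\<omega>. cos (Y \<omega> + b))"
    using N.indep_var_compose[OF ind, of cos borel "\<lambda>y. cos (y + b)" borel] by (simp add: comp_def)
  have i2: "N.indep_var borel (\<lambda>\<omega>. sin (X \<omega>)) borel (\<lambda>\<omega>. sin (Y \<omega> + b))"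
    using N.indep_var_compose[OF ind, of sin borel "\<lambda>y. sin (y + b)" borel] by (simp add: comp_def)
  have p: "integrable N (\<lambda>\<omega>. cos (X \<omega>) * cos (Y \<omega> + b))" "integrable N (\<lambda>\<omega>. sin (X \<omega>) * sin (Y \<omega> + b))"
    using N.indep_var_integrable[OF i1 b(1,3)] N.indep_var_integrable[OF i2 b(2,4)] by auto
  have "(\<integral>\<omega>. cos (X \<omega> + Y \<omega> + b) \<partial>N) = (\<integral>\<omega>. cos (X \<omega>) * cos (Y \<omega> + b) - sin (X \<omega>) * sin (Y \<omega> + b) \<partial>N)"
    by (simp add: cos_add[of "X _" "Y _ + b", symmetric] add.assoc)
  also have "\<dots> = exp (- v / 2) * (cos b * exp (- w / 2))"
    using p N.indep_var_lebesgue_integral[OF i1 b(1,3)] N.indep_var_lebesgue_integral[OF i2 b(2,4)]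
      centered_normal_cos_sin0[OF N X] centered_normal_cos[OF N Y] by simp
  also have "\<dots> = cos b * exp (- (v + w) / 2)"
    by (simp add: mult_exp_exp add_divide_distrib[symmetric])
  finally show ?thesis .
qed

text \<open>A repetition-free enumeration turns finite index sets into the lists of the definition.
  Indices are enumerated, not times, so one time may serve several indices, as the endpoints of the
  bridges do.\<close>

lemma gaussian_process01_finite_sum:
  assumes G: "gaussian_process01 N B c" and I: "finite I" and t: "\<And>i. i \<in> I \<Longrightarrow> t i \<in> {0..1}"
  shows "centered_normal N (\<lambda>\<omega>. \<Sum>i\<in>I. a i * B (t i) \<omega>) (\<Sum>i\<in>I. \<Sum>j\<in>I. a i * a j * c (t i) (t j))"
proof -
  obtain xs where xs: "set xs = I" "distinct xs" using finite_distinct_list[OF I] by blast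
  have conv: "(\<Sum>i<length xs. g (xs ! i)) = (\<Sum>i\<in>I. g i)" for g :: "_ \<Rightarrow> real"
    using sum.reindex_bij_betw[OF bij_betw_nth[OF xs(2) refl xs(1)[symmetric]], of g]
    by simp
  have "length (map t xs) = length (map a xs) \<and> set (map t xs) \<subseteq> {0..1}" using t xs by auto
  then have "centered_normal N (\<lambda>\<omega>. \<Sum>i<length (map t xs). map a xs ! i * B (map t xs ! i) \<omega>)
          (\<Sum>i<length (map t xs). \<Sum>j<length (map t xs). map a xs ! i * map a xs ! j * c (map t xs ! i) (map t xs ! j))"
    using G unfolding gaussian_process01_def by blast
  moreover have "(\<Sum>i<length (map t xs). map a xs ! i * B (map t xs ! i) \<omega>) = (\<Sum>i\<in>I. a i * B (t i) \<omega>)" for \<omega>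
    using conv[of "\<lambda>i. a i * B (t i) \<omega>"] by simp
  moreover have "(\<Sum>i<length (map t xs). \<Sum>j<length (map t xs). map a xs ! i * map a xs ! j * c (map t xs ! i) (map t xs ! j))
      = (\<Sum>i\<in>I. \<Sum>j\<in>I. a i * a j * c (t i) (t j))"
  proof -
    have "(\<Sum>i<length (map t xs). \<Sum>j<length (map t xs). map a xs ! i * map a xs ! j * c (map t xs ! i) (map t xs ! j))
      = (\<Sum>i<length xs. \<Sum>j<length xs. a (xs ! i) * a (xs ! j) * c (t (xs ! i)) (t (xs ! j)))" by simp
    also have "\<dots> = (\<Sum>i<length xs. \<Sum>j\<in>I. a (xs ! i) * a j * c (t (xs ! i)) (t j))"
      by (intro sum.cong refl conv)
    also have "\<dots> = (\<Sum>i\<in>I. \<Sum>j\<in>I. a i * a j * c (t i) (t j))" by (rule conv)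
    finally show ?thesis .
  qed
  ultimately show ?thesis by simp
qed

section \<open>The law of the limit\<close>

text \<open>The path on the interval, tied down at both ends and brought to unit length by Brownian
  scaling. For a Wiener path this is a standard Brownian bridge in \<open>u\<close>.\<close>

definition bridge_of :: "(real \<Rightarrow> real) \<Rightarrow> real \<Rightarrow> real \<Rightarrow> real \<Rightarrow> real" where
  "bridge_of z \<alpha> \<beta> u = (z (\<alpha> + (\<beta> - \<alpha>) * u) - z \<alpha> - u * (z \<beta> - z \<alpha>)) / sqrt (\<beta> - \<alpha>)"

text \<open>Together with \<open>bridge_time\<close> this displays the bridge at \<open>u\<close> as
  a linear form in three values of the path. The three coefficients add up to 0.\<close>

definition bridge_coef :: "real \<Rightarrow> real \<Rightarrow> real \<Rightarrow> nat \<Rightarrow> real" where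
  "bridge_coef \<alpha> \<beta> u j = (if j = 0 then 1 else if j = 1 then - (1 - u) else - u) / sqrt (\<beta> - \<alpha>)"

definition bridge_time :: "real \<Rightarrow> real \<Rightarrow> real \<Rightarrow> nat \<Rightarrow> real" where
  "bridge_time \<alpha> \<beta> u j = (if j = 0 then \<alpha> + (\<beta> - \<alpha>) * u else if j = 1 then \<alpha> else \<beta>)"

lemma sum_lessThan_3: "(\<Sum>j<3. f j) = f 0 + f 1 + f (2::nat)" for f :: "nat \<Rightarrow> real"
  by (simp add: eval_nat_numeral)

lemma bridge_of_sum: "bridge_of z \<alpha> \<beta> u = (\<Sum>j<3. bridge_coef \<alpha> \<beta> u j * z (bridge_time \<alpha> \<beta> u j))"
  unfolding sum_lessThan_3 by (simp add: bridge_of_def bridge_coef_def bridge_time_def diff_divide_distrib algebra_simps add_divide_distrib)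

lemma affine_in_interval:
  fixes \<alpha> \<beta> u :: real
  assumes "\<alpha> \<le> \<beta>" "u \<in> {0..1}"
  shows "\<alpha> \<le> \<alpha> + (\<beta> - \<alpha>) * u" "\<alpha> + (\<beta> - \<alpha>) * u \<le> \<beta>"
proof -
  have "0 \<le> (\<beta> - \<alpha>) * u" "(\<beta> - \<alpha>) * u \<le> \<beta> - \<alpha>" using assms mult_left_le[of u "\<beta> - \<alpha>"] by auto
  then show "\<alpha> \<le> \<alpha> + (\<beta> - \<alpha>) * u" "\<alpha> + (\<beta> - \<alpha>) * u \<le> \<beta>" by auto
qed

lemma bridge_time_in:
  assumes "0 \<le> \<alpha>" "\<alpha> \<le> \<beta>" "\<beta> \<le> 1" "u \<in> {0..1}"
  shows "bridge_time \<alpha> \<beta> u j \<in> {0..1}"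
  using affine_in_interval[OF assms(2,4)] assms(1-3) by (auto simp: bridge_time_def)

text \<open>Since the coefficients sum to 0, the common offset \<open>\<alpha>\<close> cancels, as
  if the interval started at 0; the factor \<open>1 / sqrt (\<beta> - \<alpha>)\<close> in both
  arguments then removes its length.\<close>

lemma bridge_cov_same:
  assumes ab: "\<alpha> < \<beta>" and u: "u \<in> {0..1}" and v: "v \<in> {0..1}"
  shows "(\<Sum>i<3. \<Sum>j<3. bridge_coef \<alpha> \<beta> u i * bridge_coef \<alpha> \<beta> v j
     * min (bridge_time \<alpha> \<beta> u i) (bridge_time \<alpha> \<beta> v j)) = min u v - u * v"
proof -
  define l where "l = \<beta> - \<alpha>"
  have l: "l > 0" using ab by (simp add: l_def)
  have be: "\<beta> = \<alpha> + l" by (simp add: l_def)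
  define s t where "s = \<alpha> + l * u" and "t = \<alpha> + l * v"
  have st: "\<alpha> \<le> s" "s \<le> \<beta>" "\<alpha> \<le> t" "t \<le> \<beta>"
    using affine_in_interval[OF less_imp_le[OF ab]] u v by (auto simp: s_def t_def l_def)
  have m: "min s \<alpha> = \<alpha>" "min s \<beta> = s" "min \<alpha> t = \<alpha>" "min \<beta> t = t" "min \<alpha> \<beta> = \<alpha>" "min \<beta> \<alpha> = \<alpha>"
    using st ab by auto
  have mst: "min s t = \<alpha> + l * min u v"
    using l by (simp add: s_def t_def min_def)
  have sq: "x / sqrt l * (y / sqrt l) * z = x * y * z / l" for x y z :: real
    using l by simp
  have "(\<Sum>i<3. \<Sum>j<3. bridge_coef \<alpha> \<beta> u i * bridge_coef \<alpha> \<beta> v j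
     * min (bridge_time \<alpha> \<beta> u i) (bridge_time \<alpha> \<beta> v j)) =
     (min s t - (1 - v) * min s \<alpha> - v * min s \<beta>
      - (1 - u) * (min \<alpha> t - (1 - v) * min \<alpha> \<alpha> - v * min \<alpha> \<beta>)
      - u * (min \<beta> t - (1 - v) * min \<beta> \<alpha> - v * min \<beta> \<beta>)) / l"
    unfolding sum_lessThan_3 bridge_coef_def bridge_time_def l_def[symmetric]
    by (simp add: abs_of_pos[OF l] sq s_def[symmetric] t_def[symmetric] diff_divide_distrib add_divide_distrib algebra_simps)
  also have "\<dots> = (l * min u v - l * (u * v)) / l"
    unfolding m mst by (simp add: be s_def t_def algebra_simps)
  also have "\<dots> = min u v - u * v" using l by (simp add: diff_divide_distrib)
  finally show ?thesis .
qed

text \<open>Every time of the first block precedes every time of the second, so the minimum does not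
  depend on \<open>j\<close>, and the coefficients of the second block sum to 0. This is the source
  of the independence of the two limits.\<close>

lemma bridge_cov_disjoint:
  assumes o: "0 \<le> \<alpha>" "\<alpha> < \<beta>" "\<beta> \<le> \<gamma>" "\<gamma> < \<delta>" and u: "u \<in> {0..1}" and v: "v \<in> {0..1}"
  shows "(\<Sum>i<3. \<Sum>j<3. bridge_coef \<alpha> \<beta> u i * bridge_coef \<gamma> \<delta> v j
     * min (bridge_time \<alpha> \<beta> u i) (bridge_time \<gamma> \<delta> v j)) = 0"
proof (rule sum.neutral, rule ballI)
  fix i :: nat assume "i \<in> {..<3}"
  have "bridge_time \<alpha> \<beta> u i \<le> \<gamma>"
    using affine_in_interval[OF less_imp_le[OF o(2)] u] o by (auto simp: bridge_time_def)
  moreover have "\<gamma> \<le> bridge_time \<gamma> \<delta> v j" for j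
    using affine_in_interval[OF less_imp_le[OF o(4)] v] o by (auto simp: bridge_time_def)
  ultimately have m: "min (bridge_time \<alpha> \<beta> u i) (bridge_time \<gamma> \<delta> v j) = bridge_time \<alpha> \<beta> u i" for j
    using order_trans by (intro min_absorb1) blast
  have "(\<Sum>j<3. bridge_coef \<alpha> \<beta> u i * bridge_coef \<gamma> \<delta> v j * min (bridge_time \<alpha> \<beta> u i) (bridge_time \<gamma> \<delta> v j))
    = bridge_coef \<alpha> \<beta> u i * bridge_time \<alpha> \<beta> u i * (\<Sum>j<3. bridge_coef \<gamma> \<delta> v j)"
    unfolding m by (simp add: sum_distrib_left mult_ac)
  also have "(\<Sum>j<3. bridge_coef \<gamma> \<delta> v j) = 0"
    unfolding sum_lessThan_3 by (simp add: bridge_coef_def add_divide_distrib[symmetric] flip: minus_divide_left)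
  finally show "(\<Sum>j<3. bridge_coef \<alpha> \<beta> u i * bridge_coef \<gamma> \<delta> v j * min (bridge_time \<alpha> \<beta> u i) (bridge_time \<gamma> \<delta> v j)) = 0"
    by simp
qed

lemma bridge_cov_comm:
  "(\<Sum>i<3. \<Sum>j<3. bridge_coef \<alpha> \<beta> u i * bridge_coef \<gamma> \<delta> v j * min (bridge_time \<alpha> \<beta> u i) (bridge_time \<gamma> \<delta> v j)) =
   (\<Sum>i<3. \<Sum>j<3. bridge_coef \<gamma> \<delta> v i * bridge_coef \<alpha> \<beta> u j * min (bridge_time \<gamma> \<delta> v i) (bridge_time \<alpha> \<beta> u j))"
  by (subst sum.swap) (simp add: mult_ac min.commute)

definition left_end :: "real \<Rightarrow> bool \<Rightarrow> real" where "left_end \<theta> b = (if b then 0 else \<theta>)"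
definition right_end :: "real \<Rightarrow> bool \<Rightarrow> real" where "right_end \<theta> b = (if b then \<theta> else 1)"

text \<open>The target covariance: two independent bridges on the grid \<open>i / m\<close>, where
  \<open>True\<close> will stand for the first block. A single index set for both blocks lets
  Cramer-Wold treat them jointly.\<close>

definition pair_cov :: "nat \<Rightarrow> bool \<times> nat \<Rightarrow> bool \<times> nat \<Rightarrow> real" where
  "pair_cov m k k' = (if fst k = fst k' then
     min (real (snd k) / real m) (real (snd k') / real m) - real (snd k) / real m * (real (snd k') / real m) else 0)"

text \<open>Both bridges come from one Wiener path. A linear form in their grid values is a linear
  form in values of \<open>W\<close>, with three terms per index, hence Gaussian, and it remains to
  compute its variance.\<close>

lemma wiener_bridges_cos:
  assumes N: "prob_space N" and W: "wiener_process01 N W" and \<theta>: "0 < \<theta>" "\<theta> < 1" and m: "m > 0"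
  defines "I \<equiv> (UNIV :: bool set) \<times> {..m}"
  defines "U \<equiv> \<lambda>(b, i) \<omega>. bridge_of (\<lambda>t. W t \<omega>) (left_end \<theta> b) (right_end \<theta> b) (real i / real m)"
  shows "(\<integral>\<omega>. cos ((\<Sum>k\<in>I. a k * U k \<omega>) + b) \<partial>N) = cos b * exp (- (\<Sum>k\<in>I. \<Sum>k'\<in>I. a k * a k' * pair_cov m k k') / 2)"
proof -
  define \<alpha> \<beta> u where "\<alpha> k = left_end \<theta> (fst k)" and "\<beta> k = right_end \<theta> (fst k)" and "u k = real (snd k) / real m" for k :: "bool \<times> nat"
  have I: "finite I" by (simp add: I_def)
  have uI: "u k \<in> {0..1}" if "k \<in> I" for k using that m by (auto simp: u_def I_def)
  have ab: "0 \<le> \<alpha> k" "\<alpha> k < \<beta> k" "\<beta> k \<le> 1" for k using \<theta> by (auto simp: \<alpha>_def \<beta>_def left_end_def right_end_def)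
  have G: "gaussian_process01 N W (\<lambda>s t. min s t)" using W by (simp add: wiener_process01_def)
  have "centered_normal N (\<lambda>\<omega>. \<Sum>p\<in>I \<times> {..<3}. (a (fst p) * bridge_coef (\<alpha> (fst p)) (\<beta> (fst p)) (u (fst p)) (snd p))
        * W (bridge_time (\<alpha> (fst p)) (\<beta> (fst p)) (u (fst p)) (snd p)) \<omega>)
      (\<Sum>p\<in>I \<times> {..<3}. \<Sum>p'\<in>I \<times> {..<3}. (a (fst p) * bridge_coef (\<alpha> (fst p)) (\<beta> (fst p)) (u (fst p)) (snd p))
        * (a (fst p') * bridge_coef (\<alpha> (fst p')) (\<beta> (fst p')) (u (fst p')) (snd p'))
        * min (bridge_time (\<alpha> (fst p)) (\<beta> (fst p)) (u (fst p)) (snd p)) (bridge_time (\<alpha> (fst p')) (\<beta> (fst p')) (u (fst p')) (snd p')))"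
  proof (rule gaussian_process01_finite_sum[OF G])
    show "finite (I \<times> {..<3::nat})" using I by simp
    fix p assume "p \<in> I \<times> {..<3::nat}"
    then have "fst p \<in> I" by auto
    then show "bridge_time (\<alpha> (fst p)) (\<beta> (fst p)) (u (fst p)) (snd p) \<in> {0..1}"
      by (intro bridge_time_in uI ab(1,3) less_imp_le[OF ab(2)])
  qed
  moreover have "(\<Sum>p\<in>I \<times> {..<3}. (a (fst p) * bridge_coef (\<alpha> (fst p)) (\<beta> (fst p)) (u (fst p)) (snd p))
        * W (bridge_time (\<alpha> (fst p)) (\<beta> (fst p)) (u (fst p)) (snd p)) \<omega>) = (\<Sum>k\<in>I. a k * U k \<omega>)" for \<omega>
  proof -
    have "(\<Sum>p\<in>I \<times> {..<3}. (a (fst p) * bridge_coef (\<alpha> (fst p)) (\<beta> (fst p)) (u (fst p)) (snd p))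
        * W (bridge_time (\<alpha> (fst p)) (\<beta> (fst p)) (u (fst p)) (snd p)) \<omega>) =
       (\<Sum>k\<in>I. \<Sum>j<3. (a k * bridge_coef (\<alpha> k) (\<beta> k) (u k) j) * W (bridge_time (\<alpha> k) (\<beta> k) (u k) j) \<omega>)"
      by (simp add: sum.cartesian_product case_prod_beta)
    also have "\<dots> = (\<Sum>k\<in>I. a k * U k \<omega>)"
      by (intro sum.cong refl)
        (simp add: U_def bridge_of_sum sum_distrib_left mult.assoc case_prod_beta \<alpha>_def \<beta>_def u_def)
    finally show ?thesis .
  qed
  moreover have "(\<Sum>p\<in>I \<times> {..<3}. \<Sum>p'\<in>I \<times> {..<3}. (a (fst p) * bridge_coef (\<alpha> (fst p)) (\<beta> (fst p)) (u (fst p)) (snd p))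
        * (a (fst p') * bridge_coef (\<alpha> (fst p')) (\<beta> (fst p')) (u (fst p')) (snd p'))
        * min (bridge_time (\<alpha> (fst p)) (\<beta> (fst p)) (u (fst p)) (snd p)) (bridge_time (\<alpha> (fst p')) (\<beta> (fst p')) (u (fst p')) (snd p')))
      = (\<Sum>k\<in>I. \<Sum>k'\<in>I. a k * a k' * pair_cov m k k')"
  proof -
    have cov: "(\<Sum>i<3. \<Sum>j<3. bridge_coef (\<alpha> k) (\<beta> k) (u k) i * bridge_coef (\<alpha> k') (\<beta> k') (u k') j
       * min (bridge_time (\<alpha> k) (\<beta> k) (u k) i) (bridge_time (\<alpha> k') (\<beta> k') (u k') j)) = pair_cov m k k'"
      if "k \<in> I" "k' \<in> I" for k k'
    proof (cases "fst k = fst k'")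
      case True
      then have "\<alpha> k' = \<alpha> k" "\<beta> k' = \<beta> k" by (simp_all add: \<alpha>_def \<beta>_def)
      then show ?thesis using bridge_cov_same[OF ab(2) uI[OF that(1)] uI[OF that(2)], of k] True
        by (simp add: pair_cov_def u_def)
    next
      case False
      have "\<beta> k \<le> \<alpha> k' \<or> \<beta> k' \<le> \<alpha> k" using False \<theta> by (auto simp: \<alpha>_def \<beta>_def left_end_def right_end_def)
      then show ?thesis
      proof
        assume "\<beta> k \<le> \<alpha> k'"
        from bridge_cov_disjoint[OF ab(1,2) this ab(2) uI[OF that(1)] uI[OF that(2)]]
        show ?thesis using False by (simp add: pair_cov_def)
      next
        assume "\<beta> k' \<le> \<alpha> k"
        from bridge_cov_disjoint[OF ab(1,2) this ab(2) uI[OF that(2)] uI[OF that(1)]]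
        show ?thesis using False by (subst bridge_cov_comm) (simp add: pair_cov_def)
      qed
    qed
    have "(\<Sum>p\<in>I \<times> {..<3}. \<Sum>p'\<in>I \<times> {..<3}. (a (fst p) * bridge_coef (\<alpha> (fst p)) (\<beta> (fst p)) (u (fst p)) (snd p))
        * (a (fst p') * bridge_coef (\<alpha> (fst p')) (\<beta> (fst p')) (u (fst p')) (snd p'))
        * min (bridge_time (\<alpha> (fst p)) (\<beta> (fst p)) (u (fst p)) (snd p)) (bridge_time (\<alpha> (fst p')) (\<beta> (fst p')) (u (fst p')) (snd p')))
      = (\<Sum>k\<in>I. \<Sum>i<3. \<Sum>k'\<in>I. \<Sum>j<3. (a k * bridge_coef (\<alpha> k) (\<beta> k) (u k) i)
        * (a k' * bridge_coef (\<alpha> k') (\<beta> k') (u k') j)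
        * min (bridge_time (\<alpha> k) (\<beta> k) (u k) i) (bridge_time (\<alpha> k') (\<beta> k') (u k') j))"
      by (simp add: sum.cartesian_product')
    also have "\<dots> = (\<Sum>k\<in>I. \<Sum>k'\<in>I. \<Sum>i<3. \<Sum>j<3. (a k * bridge_coef (\<alpha> k) (\<beta> k) (u k) i)
        * (a k' * bridge_coef (\<alpha> k') (\<beta> k') (u k') j)
        * min (bridge_time (\<alpha> k) (\<beta> k) (u k) i) (bridge_time (\<alpha> k') (\<beta> k') (u k') j))"
      by (intro sum.cong refl sum.swap)
    also have "\<dots> = (\<Sum>k\<in>I. \<Sum>k'\<in>I. a k * a k' * (\<Sum>i<3. \<Sum>j<3. bridge_coef (\<alpha> k) (\<beta> k) (u k) i
        * bridge_coef (\<alpha> k') (\<beta> k') (u k') j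
        * min (bridge_time (\<alpha> k) (\<beta> k) (u k) i) (bridge_time (\<alpha> k') (\<beta> k') (u k') j)))"
      unfolding sum_distrib_left by (intro sum.cong refl) (simp add: mult_ac)
    also have "\<dots> = (\<Sum>k\<in>I. \<Sum>k'\<in>I. a k * a k' * pair_cov m k k')"
      by (intro sum.cong refl) (simp add: cov)
    finally show ?thesis .
  qed
  ultimately have "centered_normal N (\<lambda>\<omega>. \<Sum>k\<in>I. a k * U k \<omega>) (\<Sum>k\<in>I. \<Sum>k'\<in>I. a k * a k' * pair_cov m k k')"
    by simp
  from centered_normal_cos[OF N this] show ?thesis .
qed

lemma sum_bool_times:
  fixes g :: "bool \<times> nat \<Rightarrow> real"
  shows "(\<Sum>k\<in>UNIV \<times> {..m}. g k) = (\<Sum>i\<le>m. g (True, i)) + (\<Sum>i\<le>m. g (False, i))"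
  by (simp add: sum.cartesian_product' UNIV_bool add.commute)

text \<open>Gaussianity is given for each bridge separately; the joint law comes from the
  independence of the paths, through the linear forms \<open>P\<close> and \<open>Q\<close>, each a
  measurable function of one path.\<close>

lemma independent_bridges_cos:
  assumes N: "prob_space N" and B: "brownian_bridge N B1" "brownian_bridge N B2" and m: "m > 0"
    and ind: "prob_space.indep_var N (PiM {0..1} (\<lambda>_. borel)) (path01 B1) (PiM {0..1} (\<lambda>_. borel)) (path01 B2)"
  defines "I \<equiv> (UNIV :: bool set) \<times> {..m}"
  defines "U \<equiv> \<lambda>(b, i) \<omega>. (if b then B1 else B2) (real i / real m) \<omega>"
  shows "(\<integral>\<omega>. cos ((\<Sum>k\<in>I. a k * U k \<omega>) + b) \<partial>N) = cos b * exp (- (\<Sum>k\<in>I. \<Sum>k'\<in>I. a k * a k' * pair_cov m k k') / 2)"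
proof -
  interpret N: prob_space N by fact
  define P where "P \<omega> = (\<Sum>i\<le>m. a (True, i) * B1 (real i / real m) \<omega>)" for \<omega>
  define Q where "Q \<omega> = (\<Sum>i\<le>m. a (False, i) * B2 (real i / real m) \<omega>)" for \<omega>
  define vP where "vP = (\<Sum>i\<le>m. \<Sum>j\<le>m. a (True, i) * a (True, j) * pair_cov m (True, i) (True, j))"
  define vQ where "vQ = (\<Sum>i\<le>m. \<Sum>j\<le>m. a (False, i) * a (False, j) * pair_cov m (False, i) (False, j))"
  have t: "real i / real m \<in> {0..1}" if "i \<in> {..m}" for i using that m by auto
  have nP: "centered_normal N P vP"
    using gaussian_process01_finite_sum[OF B(1)[unfolded brownian_bridge_def] finite_atMost t, of m "\<lambda>i. i" "\<lambda>i. a (True, i)"]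
    unfolding P_def vP_def pair_cov_def by simp
  have nQ: "centered_normal N Q vQ"
    using gaussian_process01_finite_sum[OF B(2)[unfolded brownian_bridge_def] finite_atMost t, of m "\<lambda>i. i" "\<lambda>i. a (False, i)"]
    unfolding Q_def vQ_def pair_cov_def by simp
  have PQ: "(\<Sum>k\<in>I. a k * U k \<omega>) = P \<omega> + Q \<omega>" for \<omega>
    unfolding I_def sum_bool_times by (simp add: U_def P_def Q_def)
  have v: "(\<Sum>k\<in>I. \<Sum>k'\<in>I. a k * a k' * pair_cov m k k') = vP + vQ"
    unfolding I_def sum_bool_times by (simp add: vP_def vQ_def sum.distrib pair_cov_def)
  have "N.indep_var borel ((\<lambda>p. \<Sum>i\<le>m. a (True, i) * p (real i / real m)) \<circ> path01 B1)
      borel ((\<lambda>p. \<Sum>i\<le>m. a (False, i) * p (real i / real m)) \<circ> path01 B2)"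
  proof (rule N.indep_var_compose[OF ind])
    have "(\<lambda>p. p (real i / real m)) \<in> borel_measurable (PiM {0..1} (\<lambda>_. borel :: real measure))" if "i \<in> {..m}" for i
      by (rule measurable_component_singleton) (rule t[OF that])
    then show "(\<lambda>p. \<Sum>i\<le>m. a (True, i) * p (real i / real m)) \<in> borel_measurable (PiM {0..1} (\<lambda>_. borel :: real measure))"
      "(\<lambda>p. \<Sum>i\<le>m. a (False, i) * p (real i / real m)) \<in> borel_measurable (PiM {0..1} (\<lambda>_. borel :: real measure))"
      by (auto intro!: borel_measurable_sum borel_measurable_times)
  qed
  moreover have "(\<lambda>p. \<Sum>i\<le>m. a (True, i) * p (real i / real m)) \<circ> path01 B1 = P"
    "(\<lambda>p. \<Sum>i\<le>m. a (False, i) * p (real i / real m)) \<circ> path01 B2 = Q"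
    using t by (auto simp: fun_eq_iff P_def Q_def path01_def intro!: sum.cong)
  ultimately have "N.indep_var borel P borel Q" by simp
  from centered_normal_indep_cos[OF N nP nQ this] show ?thesis by (simp add: PQ v)
qed

lemma continuous_on_Max_finite:
  fixes h :: "'i \<Rightarrow> 'a::topological_space \<Rightarrow> real"
  assumes "finite A" "A \<noteq> {}" "\<And>i. i \<in> A \<Longrightarrow> continuous_on S (h i)"
  shows "continuous_on S (\<lambda>x. Max ((\<lambda>i. h i x) ` A))"
  using assms
proof (induction A rule: finite_ne_induct)
  case (insert i A)
  have "continuous_on S (\<lambda>x. max (h i x) (Max ((\<lambda>i. h i x) ` A)))"
    by (intro continuous_on_max insert.IH insert.prems) auto
  then show ?case using insert.hyps by simp
qed simp

definition grid_max :: "(real \<Rightarrow> real) \<Rightarrow> nat \<Rightarrow> real" where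
  "grid_max g m = Max ((\<lambda>i. \<bar>g (real i / real m)\<bar>) ` {..m})"

text \<open>The supremum is attained at some \<open>t0\<close>. The grid points just below
  \<open>t0\<close> converge to it, and no grid value exceeds the supremum.\<close>

lemma grid_max_tendsto:
  assumes g: "continuous_on {0..1} g"
  shows "grid_max g \<longlonglongrightarrow> (SUP t\<in>{0..1}. \<bar>g t\<bar>)"
proof -
  have cg: "continuous_on {0..1} (\<lambda>t. \<bar>g t\<bar>)" by (intro continuous_intros g)
  obtain t0 where t0: "t0 \<in> {0..1}" "\<And>t. t \<in> {0..1} \<Longrightarrow> \<bar>g t\<bar> \<le> \<bar>g t0\<bar>"
    using continuous_attains_sup[OF compact_Icc _ cg] by auto
  have S: "(SUP t\<in>{0..1}. \<bar>g t\<bar>) = \<bar>g t0\<bar>"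
    by (rule cSup_eq_maximum) (use t0 in auto)
  define s where "s m = real (nat \<lfloor>real m * t0\<rfloor>) / real m" for m
  have sm: "s m \<in> {0..1}" if "m > 0" for m
    using nat_floor_le[of t0 m] t0(1) that by (auto simp: s_def)
  have ev: "eventually (\<lambda>m::nat. m > 0) sequentially" by (rule eventually_gt_at_top)
  have "s \<longlonglongrightarrow> t0"
  proof (rule tendsto_sandwich)
    show "(\<lambda>m. t0 - 1 / real m) \<longlonglongrightarrow> t0"
      using tendsto_diff[OF tendsto_const[of t0] lim_1_over_n] by simp
    show "(\<lambda>m. t0) \<longlonglongrightarrow> t0" by simp
    show "eventually (\<lambda>m. t0 - 1 / real m \<le> s m) sequentially" using ev
    proof eventually_elim
      case (elim m)
      have "real m * t0 - 1 \<le> real (nat \<lfloor>real m * t0\<rfloor>)" by linarith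
      then have "(real m * t0 - 1) / real m \<le> s m" unfolding s_def by (rule divide_right_mono) simp
      then show ?case using elim by (simp add: diff_divide_distrib)
    qed
    show "eventually (\<lambda>m. s m \<le> t0) sequentially" using ev
    proof eventually_elim
      case (elim m)
      have "0 \<le> real m * t0" using t0(1) by simp
      then have "real (nat \<lfloor>real m * t0\<rfloor>) \<le> real m * t0" by linarith
      then show ?case using elim by (simp add: s_def field_simps)
    qed
  qed
  moreover have "eventually (\<lambda>m. s m \<in> {0..1}) sequentially"
    using ev by eventually_elim (rule sm)
  ultimately have lim: "(\<lambda>m. \<bar>g (s m)\<bar>) \<longlonglongrightarrow> \<bar>g t0\<bar>"
    using continuous_on_tendsto_compose[OF cg _ t0(1)] by blast
  show ?thesis unfolding S
  proof (rule tendsto_sandwich[OF _ _ lim tendsto_const])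
    show "eventually (\<lambda>m. \<bar>g (s m)\<bar> \<le> grid_max g m) sequentially"
      unfolding grid_max_def s_def
      by (intro always_eventually allI Max_ge imageI) (use t0(1) nat_floor_le[of t0] in simp_all)
    show "eventually (\<lambda>m. grid_max g m \<le> \<bar>g t0\<bar>) sequentially" using ev
    proof eventually_elim
      case (elim m)
      have "\<bar>g (real i / real m)\<bar> \<le> \<bar>g t0\<bar>" if "i \<le> m" for i
        by (rule t0(2)) (use that elim in auto)
      then show ?case unfolding grid_max_def by (intro Max.boundedI) auto
    qed
  qed
qed

lemma measurable_grid_max:
  assumes "\<And>t. t \<in> {0..1} \<Longrightarrow> B t \<in> borel_measurable N" "m > 0"
  shows "(\<lambda>\<omega>. grid_max (\<lambda>t. B t \<omega>) m) \<in> borel_measurable N"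
  unfolding grid_max_def
  by (intro borel_measurable_Max borel_measurable_abs assms(1)) (use assms(2) in auto)

text \<open>\<open>Suc m\<close> rules out the degenerate grid. The suprema become measurable as
  limits of grid maxima.\<close>

lemma expectation_grid_max_tendsto:
  fixes f :: "real \<times> real \<Rightarrow> real"
  assumes N: "prob_space N"
    and m: "\<And>t. t \<in> {0..1} \<Longrightarrow> B1 t \<in> borel_measurable N" "\<And>t. t \<in> {0..1} \<Longrightarrow> B2 t \<in> borel_measurable N"
    and c: "\<And>\<omega>. \<omega> \<in> space N \<Longrightarrow> continuous_on {0..1} (\<lambda>t. B1 t \<omega>)" "\<And>\<omega>. \<omega> \<in> space N \<Longrightarrow> continuous_on {0..1} (\<lambda>t. B2 t \<omega>)"
    and f: "continuous_on UNIV f" and C: "\<And>x. \<bar>f x\<bar> \<le> C"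
  shows "(\<lambda>m. \<integral>\<omega>. f (grid_max (\<lambda>t. B1 t \<omega>) (Suc m), grid_max (\<lambda>t. B2 t \<omega>) (Suc m)) \<partial>N)
    \<longlonglongrightarrow> (\<integral>\<omega>. f (SUP t\<in>{0..1}. \<bar>B1 t \<omega>\<bar>, SUP t\<in>{0..1}. \<bar>B2 t \<omega>\<bar>) \<partial>N)"
proof -
  interpret N: prob_space N by fact
  have lim: "(\<lambda>m. f (grid_max (\<lambda>t. B1 t \<omega>) (Suc m), grid_max (\<lambda>t. B2 t \<omega>) (Suc m)))
      \<longlonglongrightarrow> f (SUP t\<in>{0..1}. \<bar>B1 t \<omega>\<bar>, SUP t\<in>{0..1}. \<bar>B2 t \<omega>\<bar>)" if "\<omega> \<in> space N" for \<omega>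
    by (rule continuous_on_tendsto_compose[OF f])
      (auto intro!: tendsto_Pair LIMSEQ_Suc grid_max_tendsto c that)
  have meas: "(\<lambda>\<omega>. f (grid_max (\<lambda>t. B1 t \<omega>) (Suc m), grid_max (\<lambda>t. B2 t \<omega>) (Suc m))) \<in> borel_measurable N" for m
  proof (rule measurable_compose[where g=f and N=borel])
    show "(\<lambda>\<omega>. (grid_max (\<lambda>t. B1 t \<omega>) (Suc m), grid_max (\<lambda>t. B2 t \<omega>) (Suc m))) \<in> N \<rightarrow>\<^sub>M borel"
      by (intro borel_measurable_Pair measurable_grid_max m) auto
    show "f \<in> borel_measurable borel" by (rule borel_measurable_continuous_onI[OF f])
  qed
  show ?thesis
  proof (rule integral_dominated_convergence[where w="\<lambda>_. C"])
    show "(\<lambda>\<omega>. f (SUP t\<in>{0..1}. \<bar>B1 t \<omega>\<bar>, SUP t\<in>{0..1}. \<bar>B2 t \<omega>\<bar>)) \<in> borel_measurable N"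
      by (rule borel_measurable_LIMSEQ_real[OF lim meas])
  qed (simp_all add: meas lim C)
qed

text \<open>On each grid the two random vectors have the same expectations of cosines, hence the
  same expectations of bounded continuous functions. Refining the grid gives two limits of one
  sequence.\<close>

theorem bridge_suprema_law:
  fixes f :: "real \<times> real \<Rightarrow> real" and N :: "'a measure" and N' :: "'b measure"
  assumes N: "prob_space N" and W: "wiener_process01 N W" and \<theta>: "0 < \<theta>" "\<theta> < 1"
    and N': "prob_space N'" and B: "brownian_bridge N' B1" "brownian_bridge N' B2"
    and ind: "prob_space.indep_var N' (PiM {0..1} (\<lambda>_. borel)) (path01 B1) (PiM {0..1} (\<lambda>_. borel)) (path01 B2)"
    and f: "continuous_on UNIV f" and C: "\<And>x. \<bar>f x\<bar> \<le> C"
  shows "(\<integral>\<omega>. f (SUP t\<in>{0..1}. \<bar>bridge_of (\<lambda>t. W t \<omega>) 0 \<theta> t\<bar>, SUP t\<in>{0..1}. \<bar>bridge_of (\<lambda>t. W t \<omega>) \<theta> 1 t\<bar>) \<partial>N)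
    = (\<integral>\<omega>. f (SUP t\<in>{0..1}. \<bar>B1 t \<omega>\<bar>, SUP t\<in>{0..1}. \<bar>B2 t \<omega>\<bar>) \<partial>N')"
proof (rule LIMSEQ_unique)
  let ?Br = "\<lambda>b t \<omega>. bridge_of (\<lambda>t. W t \<omega>) (left_end \<theta> b) (right_end \<theta> b) t"
  have Wm: "\<And>t. t \<in> {0..1} \<Longrightarrow> W t \<in> borel_measurable N"
    and Wc: "\<And>\<omega>. \<omega> \<in> space N \<Longrightarrow> continuous_on {0..1} (\<lambda>t. W t \<omega>)"
    using W by (auto simp: wiener_process01_def gaussian_process01_def)
  have ends: "0 \<le> left_end \<theta> b" "left_end \<theta> b \<le> right_end \<theta> b" "right_end \<theta> b \<le> 1" for b
    using \<theta> by (auto simp: left_end_def right_end_def)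
  have in01: "left_end \<theta> b + (right_end \<theta> b - left_end \<theta> b) * t \<in> {0..1}" "left_end \<theta> b \<in> {0..1}" "right_end \<theta> b \<in> {0..1}"
    if "t \<in> {0..1}" for b t
    using affine_in_interval[OF ends(2) that, of b] ends[of b] by auto
  have Brm: "?Br b t \<in> borel_measurable N" if "t \<in> {0..1}" for b t
    unfolding bridge_of_def
    by (intro borel_measurable_divide borel_measurable_diff borel_measurable_times borel_measurable_const Wm in01[OF that])
  have Brc: "continuous_on {0..1} (\<lambda>t. ?Br b t \<omega>)" if "\<omega> \<in> space N" for b \<omega>
  proof -
    have "continuous_on {0..1} (\<lambda>t. W (left_end \<theta> b + (right_end \<theta> b - left_end \<theta> b) * t) \<omega>)"
      by (rule continuous_on_compose2[OF Wc[OF that]]) (use in01(1) in \<open>auto intro!: continuous_intros\<close>)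
    then show ?thesis unfolding bridge_of_def using \<theta>
      by (intro continuous_intros) (auto simp: left_end_def right_end_def)
  qed
  have Bm: "\<And>t. t \<in> {0..1} \<Longrightarrow> B1 t \<in> borel_measurable N'" "\<And>t. t \<in> {0..1} \<Longrightarrow> B2 t \<in> borel_measurable N'"
    and Bc: "\<And>\<omega>. \<omega> \<in> space N' \<Longrightarrow> continuous_on {0..1} (\<lambda>t. B1 t \<omega>)" "\<And>\<omega>. \<omega> \<in> space N' \<Longrightarrow> continuous_on {0..1} (\<lambda>t. B2 t \<omega>)"
    using B by (auto simp: brownian_bridge_def gaussian_process01_def)
  show "(\<lambda>m. \<integral>\<omega>. f (grid_max (\<lambda>t. ?Br True t \<omega>) (Suc m), grid_max (\<lambda>t. ?Br False t \<omega>) (Suc m)) \<partial>N)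
    \<longlonglongrightarrow> (\<integral>\<omega>. f (SUP t\<in>{0..1}. \<bar>bridge_of (\<lambda>t. W t \<omega>) 0 \<theta> t\<bar>, SUP t\<in>{0..1}. \<bar>bridge_of (\<lambda>t. W t \<omega>) \<theta> 1 t\<bar>) \<partial>N)"
    using expectation_grid_max_tendsto[OF N Brm[of _ True] Brm[of _ False] Brc[of _ True] Brc[of _ False] f C]
    by (simp add: left_end_def right_end_def)
  have lim': "(\<lambda>m. \<integral>\<omega>. f (grid_max (\<lambda>t. B1 t \<omega>) (Suc m), grid_max (\<lambda>t. B2 t \<omega>) (Suc m)) \<partial>N')
    \<longlonglongrightarrow> (\<integral>\<omega>. f (SUP t\<in>{0..1}. \<bar>B1 t \<omega>\<bar>, SUP t\<in>{0..1}. \<bar>B2 t \<omega>\<bar>) \<partial>N')"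
    by (rule expectation_grid_max_tendsto[OF N' Bm Bc f C])
  have "(\<integral>\<omega>. f (grid_max (\<lambda>t. ?Br True t \<omega>) (Suc m), grid_max (\<lambda>t. ?Br False t \<omega>) (Suc m)) \<partial>N)
      = (\<integral>\<omega>. f (grid_max (\<lambda>t. B1 t \<omega>) (Suc m), grid_max (\<lambda>t. B2 t \<omega>) (Suc m)) \<partial>N')" for m
  proof -
    define I where "I = (UNIV :: bool set) \<times> {..Suc m}"
    define U where "U = (\<lambda>(b, i) \<omega>. ?Br b (real i / real (Suc m)) \<omega>)"
    define V where "V = (\<lambda>(b, i) \<omega>. (if b then B1 else B2) (real i / real (Suc m)) \<omega>)"
    define F where "F x = f (Max ((\<lambda>i. \<bar>x (True, i)\<bar>) ` {..Suc m}), Max ((\<lambda>i. \<bar>x (False, i)\<bar>) ` {..Suc m}))"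
      for x :: "bool \<times> nat \<Rightarrow> real"
    have t: "real i / real (Suc m) \<in> {0..1}" if "i \<in> {..Suc m}" for i using that by auto
    have I: "finite I" by (simp add: I_def)
    have Um: "U k \<in> borel_measurable N" if "k \<in> I" for k
      using Brm[OF t, of "snd k" "fst k"] that by (auto simp: U_def I_def split_beta)
    have Vm: "V k \<in> borel_measurable N'" if "k \<in> I" for k
      using Bm[OF t, of "snd k"] that by (auto simp: V_def I_def split_beta)
    have Fc: "continuous_on UNIV F"
      unfolding F_def
      by (intro continuous_on_compose2[OF f] continuous_on_Pair continuous_on_Max_finite continuous_on_rabs continuous_on_product_coordinates) auto
    have "(\<integral>\<omega>. F (restr0 I U \<omega>) \<partial>N) = (\<integral>\<omega>. F (restr0 I V \<omega>) \<partial>N')"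
    proof (rule expectation_eq_of_cos_eq[OF N N' I Um Vm _ Fc])
      fix a :: "bool \<times> nat \<Rightarrow> real" and b
      show "(\<integral>\<omega>. cos ((\<Sum>i\<in>I. a i * U i \<omega>) + b) \<partial>N) = (\<integral>\<omega>. cos ((\<Sum>i\<in>I. a i * V i \<omega>) + b) \<partial>N')"
        unfolding I_def U_def V_def
        using wiener_bridges_cos[OF N W \<theta>, of "Suc m" a b] independent_bridges_cos[OF N' B _ ind, of "Suc m" a b]
        by simp
      show "\<bar>F x\<bar> \<le> C" for x unfolding F_def by (rule C)
    qed
    moreover have "F (restr0 I U \<omega>) = f (grid_max (\<lambda>t. ?Br True t \<omega>) (Suc m), grid_max (\<lambda>t. ?Br False t \<omega>) (Suc m))" for \<omega>
      unfolding F_def grid_max_def restr0_def I_def U_def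
      by (auto intro!: arg_cong[where f=f] arg_cong[where f=Max] image_cong)
    moreover have "F (restr0 I V \<omega>) = f (grid_max (\<lambda>t. B1 t \<omega>) (Suc m), grid_max (\<lambda>t. B2 t \<omega>) (Suc m))" for \<omega>
      unfolding F_def grid_max_def restr0_def I_def V_def
      by (auto intro!: arg_cong[where f=f] arg_cong[where f=Max] image_cong)
    ultimately show ?thesis by simp
  qed
  then show "(\<lambda>m. \<integral>\<omega>. f (grid_max (\<lambda>t. ?Br True t \<omega>) (Suc m), grid_max (\<lambda>t. ?Br False t \<omega>) (Suc m)) \<partial>N)
    \<longlonglongrightarrow> (\<integral>\<omega>. f (SUP t\<in>{0..1}. \<bar>B1 t \<omega>\<bar>, SUP t\<in>{0..1}. \<bar>B2 t \<omega>\<bar>) \<partial>N')"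
    using lim' by simp
qed

section \<open>A maximal inequality and moments of weakly dependent sequences\<close>

text \<open>Dyadic induction with an arbitrary starting index \<open>a\<close>: an increment ending
  in the right half is the increment over the whole left half plus one inside the right half, and
  the larger of two maxima is bounded by their sum. Each level adds one to the factor that is
  finally squared.\<close>

lemma (in prob_space) rademacher_menshov:
  fixes S :: "nat \<Rightarrow> 'a \<Rightarrow> real"
  assumes [measurable]: "\<And>k. S k \<in> borel_measurable M"
    and int: "\<And>a b. integrable M (\<lambda>\<omega>. (S b \<omega> - S a \<omega>)\<^sup>2)"
    and inc: "\<And>a b. a \<le> b \<Longrightarrow> expectation (\<lambda>\<omega>. (S b \<omega> - S a \<omega>)\<^sup>2) \<le> K * real (b - a)"
  shows "integrable M (\<lambda>\<omega>. Max ((\<lambda>k. (S (a + k) \<omega> - S a \<omega>)\<^sup>2) ` {..2^m}))"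
    and "expectation (\<lambda>\<omega>. Max ((\<lambda>k. (S (a + k) \<omega> - S a \<omega>)\<^sup>2) ` {..2^m})) \<le> (real m + 1)\<^sup>2 * K * 2^m"
proof -
  define R where "R m a \<omega> = Max ((\<lambda>k. (S (a + k) \<omega> - S a \<omega>)\<^sup>2) ` {..2^m})" for m a \<omega>
  have R_ge: "(S (a + k) \<omega> - S a \<omega>)\<^sup>2 \<le> R m a \<omega>" if "k \<le> 2^m" for k m a \<omega>
    unfolding R_def using that by (intro Max_ge) auto
  have R_le: "R m a \<omega> \<le> b" if "\<And>k. k \<le> 2^m \<Longrightarrow> (S (a + k) \<omega> - S a \<omega>)\<^sup>2 \<le> b" for m a \<omega> b
    unfolding R_def using that by (intro Max.boundedI) auto
  have R_nonneg: "0 \<le> R m a \<omega>" for m a \<omega> using R_ge[of 0 m a \<omega>] by simp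
  have R_int: "integrable M (R m a)" for m a
  proof (rule Bochner_Integration.integrable_bound)
    show "integrable M (\<lambda>\<omega>. \<Sum>k\<le>2^m. (S (a + k) \<omega> - S a \<omega>)\<^sup>2)" by (intro Bochner_Integration.integrable_sum int)
    show "R m a \<in> borel_measurable M" unfolding R_def by measurable
    have "R m a \<omega> \<le> (\<Sum>k\<le>2^m. (S (a + k) \<omega> - S a \<omega>)\<^sup>2)" for \<omega>
      by (rule R_le) (auto intro!: member_le_sum[where f="\<lambda>k. (S (a + k) \<omega> - S a \<omega>)\<^sup>2"])
    then show "AE \<omega> in M. norm (R m a \<omega>) \<le> norm (\<Sum>k\<le>2^m. (S (a + k) \<omega> - S a \<omega>)\<^sup>2)"
      using R_nonneg by (auto simp: sum_nonneg)
  qed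
  have "expectation (R m a) \<le> (real m + 1)\<^sup>2 * K * 2^m"
  proof (induction m arbitrary: a)
    case 0
    have "expectation (R 0 a) \<le> expectation (\<lambda>\<omega>. (S (a + 1) \<omega> - S a \<omega>)\<^sup>2)"
    proof (rule integral_mono[OF R_int int])
      fix \<omega> show "R 0 a \<omega> \<le> (S (a + 1) \<omega> - S a \<omega>)\<^sup>2"
      proof (rule R_le)
        fix k :: nat assume "k \<le> 2^0"
        then have "k = 0 \<or> k = 1" by auto
        then show "(S (a + k) \<omega> - S a \<omega>)\<^sup>2 \<le> (S (a + 1) \<omega> - S a \<omega>)\<^sup>2" by auto
      qed
    qed
    also have "\<dots> \<le> K * real (a + 1 - a)" by (rule inc) simp
    finally show ?case by simp
  next
    case (Suc m)
    \<comment> \<open>With this weight in \<open>(x + y)^2 \<le> (1 + 1/c) x^2 + (1 + c) y^2\<close>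
      the recursion closes: \<open>(1 + 1/c) 2 c^2 + (1 + c) = (1 + c) (2 c + 1) \<le> 2 (c +
      1)^2\<close>.\<close>
    define c where "c = real m + 1"
    have c: "c > 0" by (simp add: c_def)
    let ?D = "\<lambda>\<omega>. (S (a + 2^m) \<omega> - S a \<omega>)\<^sup>2"
    have pw: "R (Suc m) a \<omega> \<le> (1 + 1/c) * (R m a \<omega> + R m (a + 2^m) \<omega>) + (1 + c) * ?D \<omega>" for \<omega>
    proof (rule R_le)
      fix k :: nat assume k: "k \<le> 2 ^ Suc m"
      show "(S (a + k) \<omega> - S a \<omega>)\<^sup>2 \<le> (1 + 1/c) * (R m a \<omega> + R m (a + 2^m) \<omega>) + (1 + c) * ?D \<omega>"
      proof (cases "k \<le> 2^m")
        case True
        have "(S (a + k) \<omega> - S a \<omega>)\<^sup>2 \<le> 1 * R m a \<omega>" using R_ge[OF True] by simp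
        also have "\<dots> \<le> (1 + 1/c) * (R m a \<omega> + R m (a + 2^m) \<omega>)"
          using c R_nonneg by (intro mult_mono) auto
        also have "\<dots> \<le> (1 + 1/c) * (R m a \<omega> + R m (a + 2^m) \<omega>) + (1 + c) * ?D \<omega>"
          using c by simp
        finally show ?thesis .
      next
        case False
        define x y where "x = S (a + k) \<omega> - S (a + 2^m) \<omega>" and "y = S (a + 2^m) \<omega> - S a \<omega>"
        have "k - 2^m \<le> 2^m" using k by simp
        from R_ge[OF this, of "a + 2^m" \<omega>] have x: "x\<^sup>2 \<le> R m (a + 2^m) \<omega>"
          using False by (simp add: x_def add.assoc)
        have "(x + y)\<^sup>2 \<le> (1 + 1/c) * x\<^sup>2 + (1 + c) * y\<^sup>2"
        proof -
          have "0 \<le> (x / sqrt c - sqrt c * y)\<^sup>2" by simp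
          also have "\<dots> = x\<^sup>2 / c - 2 * x * y + c * y\<^sup>2"
            using c by (simp add: power2_diff power_divide power_mult_distrib)
          finally show ?thesis by (simp add: power2_sum algebra_simps)
        qed
        also have "\<dots> \<le> (1 + 1/c) * (R m a \<omega> + R m (a + 2^m) \<omega>) + (1 + c) * y\<^sup>2"
          using c x R_nonneg[of m a \<omega>] by (intro add_right_mono mult_left_mono) auto
        finally show ?thesis by (simp add: x_def y_def)
      qed
    qed
    have "expectation (R (Suc m) a) \<le> expectation (\<lambda>\<omega>. (1 + 1/c) * (R m a \<omega> + R m (a + 2^m) \<omega>) + (1 + c) * ?D \<omega>)"
      by (rule integral_mono) (use R_int int pw in auto)
    also have "\<dots> = (1 + 1/c) * (expectation (R m a) + expectation (R m (a + 2^m))) + (1 + c) * expectation ?D"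
      using R_int int by simp
    also have "\<dots> \<le> (1 + 1/c) * (c\<^sup>2 * K * 2^m + c\<^sup>2 * K * 2^m) + (1 + c) * (K * real (a + 2^m - a))"
      using c Suc.IH[folded c_def] inc[of a "a + 2^m"] by (intro add_mono mult_left_mono) auto
    also have "\<dots> = (K * 2^m) * ((1 + 1/c) * (2 * c\<^sup>2) + (1 + c))" by (simp add: algebra_simps)
    also have "(1 + 1/c) * (2 * c\<^sup>2) + (1 + c) = (1 + c) * (2 * c + 1)"
      using c by (simp add: field_simps power2_eq_square)
    also have "(K * 2^m) * ((1 + c) * (2 * c + 1)) \<le> (K * 2^m) * (2 * (c + 1)\<^sup>2)"
    proof (rule mult_left_mono)
      show "(1 + c) * (2 * c + 1) \<le> 2 * (c + 1)\<^sup>2" using c by (simp add: power2_eq_square algebra_simps)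
      \<comment> \<open>The sign of \<open>K\<close> is read off from the increment bound for a
        single step.\<close>
      have "0 \<le> expectation (\<lambda>\<omega>. (S 1 \<omega> - S 0 \<omega>)\<^sup>2)" by simp
      also have "\<dots> \<le> K" using inc[of 0 1] by simp
      finally show "0 \<le> K * 2^m" by simp
    qed
    also have "\<dots> = (real (Suc m) + 1)\<^sup>2 * K * 2 ^ Suc m" by (simp add: c_def add_ac)
    finally show ?case .
  qed
  then show "expectation (\<lambda>\<omega>. Max ((\<lambda>k. (S (a + k) \<omega> - S a \<omega>)\<^sup>2) ` {..2^m})) \<le> (real m + 1)\<^sup>2 * K * 2^m"
    by (simp add: R_def[abs_def])
  show "integrable M (\<lambda>\<omega>. Max ((\<lambda>k. (S (a + k) \<omega> - S a \<omega>)\<^sup>2) ` {..2^m}))"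
    using R_int[of m a] by (simp add: R_def[abs_def])
qed

section \<open>Second and fourth moments under summable covariances and cumulants\<close>

text \<open>The Gaussian part of the fourth moments is written out and \<open>\<kappa>\<close> is
  the remainder. Bounds on finite partial sums avoid infinite sums altogether. With
  \<open>\<gamma>\<close> and \<open>\<kappa>\<close> as parameters the axioms can be transferred to
  the reversed sequence, see \<open>reflect\<close>.\<close>

locale weak_dep = prob_space M for M :: "'a measure" +
  fixes Y :: "int \<Rightarrow> 'a \<Rightarrow> real" and \<gamma> :: "int \<Rightarrow> real" and \<kappa> :: "int \<Rightarrow> int \<Rightarrow> int \<Rightarrow> real" and G K :: real
  assumes Y_meas[measurable]: "\<And>k. Y k \<in> borel_measurable M"
    and Y_int4: "\<And>k. integrable M (\<lambda>\<omega>. (Y k \<omega>) ^ 4)"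
    and Y_cov: "\<And>i j. expectation (\<lambda>\<omega>. Y i \<omega> * Y j \<omega>) = \<gamma> (j - i)"
    and Y_cum: "\<And>a b c d. expectation (\<lambda>\<omega>. Y a \<omega> * Y b \<omega> * (Y c \<omega> * Y d \<omega>)) =
        \<gamma> (b - a) * \<gamma> (d - c) + \<gamma> (c - a) * \<gamma> (d - b) + \<gamma> (d - a) * \<gamma> (c - b) + \<kappa> (b - a) (c - a) (d - a)"
    and gamma_bound: "\<And>F. finite F \<Longrightarrow> (\<Sum>j\<in>F. \<bar>\<gamma> j\<bar>) \<le> G"
    and kappa_bound: "\<And>h F. finite F \<Longrightarrow> (\<Sum>(r, s)\<in>F. \<bar>\<kappa> h r s\<bar>) \<le> K"
begin

lemma gamma_minus: "\<gamma> (- j) = \<gamma> j"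
proof -
  have "\<gamma> (0 - j) = expectation (\<lambda>\<omega>. Y j \<omega> * Y 0 \<omega>)" by (rule Y_cov[symmetric])
  also have "\<dots> = expectation (\<lambda>\<omega>. Y 0 \<omega> * Y j \<omega>)" by (simp add: mult.commute)
  also have "\<dots> = \<gamma> (j - 0)" by (rule Y_cov)
  finally show ?thesis by simp
qed

lemma G_nonneg: "0 \<le> G" using gamma_bound[of "{}"] by simp
lemma K_nonneg: "0 \<le> K" using kappa_bound[of "{}"] by simp

text \<open>\<open>\<gamma>\<close> is even, so only the arguments of \<open>\<kappa>\<close> change
  sign, and both bounds persist. The reversed sequence therefore has the same long-run variance and
  obeys the same error bounds.\<close>

lemma reflect: "weak_dep M (\<lambda>k. Y (c - k)) \<gamma> (\<lambda>h r s. \<kappa> (- h) (- r) (- s)) G K"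
proof unfold_locales
  fix i j
  show "expectation (\<lambda>\<omega>. Y (c - i) \<omega> * Y (c - j) \<omega>) = \<gamma> (j - i)"
    using gamma_minus[of "j - i"] by (simp add: Y_cov)
next
  fix a b c' d
  show "expectation (\<lambda>\<omega>. Y (c - a) \<omega> * Y (c - b) \<omega> * (Y (c - c') \<omega> * Y (c - d) \<omega>)) =
       \<gamma> (b - a) * \<gamma> (d - c') + \<gamma> (c' - a) * \<gamma> (d - b) + \<gamma> (d - a) * \<gamma> (c' - b) +
       \<kappa> (- (b - a)) (- (c' - a)) (- (d - a))"
    using gamma_minus[of "b - a"] gamma_minus[of "d - c'"] gamma_minus[of "c' - a"] gamma_minus[of "d - b"]
      gamma_minus[of "d - a"] gamma_minus[of "c' - b"] by (simp add: Y_cum)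
next
  fix h and F :: "(int \<times> int) set" assume F: "finite F"
  let ?f = "\<lambda>(r, s). (- r, - s) :: int \<times> int"
  have "(\<Sum>(r, s)\<in>F. \<bar>\<kappa> (- h) (- r) (- s)\<bar>) = (\<Sum>(r, s)\<in>?f ` F. \<bar>\<kappa> (- h) r s\<bar>)"
    by (subst sum.reindex) (auto simp: inj_on_def case_prod_beta)
  also have "\<dots> \<le> K" by (rule kappa_bound) (use F in simp)
  finally show "(\<Sum>(r, s)\<in>F. \<bar>\<kappa> (- h) (- r) (- s)\<bar>) \<le> K" .
qed (auto intro: Y_int4 gamma_bound)

text \<open>Two applications of \<open>2 |x y| \<le> x^2 + y^2\<close> reduce the product to fourth
  powers.\<close>

lemma int_prod4: "integrable M (\<lambda>\<omega>. Y a \<omega> * Y b \<omega> * (Y c \<omega> * Y d \<omega>))"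
proof (rule Bochner_Integration.integrable_bound)
  show "integrable M (\<lambda>\<omega>. Y a \<omega> ^ 4 + Y b \<omega> ^ 4 + Y c \<omega> ^ 4 + Y d \<omega> ^ 4)"
    by (intro Bochner_Integration.integrable_add Y_int4)
  have sq: "\<bar>x * y\<bar> \<le> (x\<^sup>2 + y\<^sup>2) / 2" for x y :: real
  proof -
    have "0 \<le> (\<bar>x\<bar> - \<bar>y\<bar>)\<^sup>2" by simp
    also have "\<dots> = x\<^sup>2 + y\<^sup>2 - 2 * \<bar>x * y\<bar>" by (simp add: power2_diff abs_mult)
    finally show ?thesis by simp
  qed
  have "\<bar>p * q * (r * s)\<bar> \<le> p ^ 4 + q ^ 4 + r ^ 4 + s ^ 4" for p q r s :: real
  proof -
    have av: "((a + b) / 2 + (c + d) / 2) / 2 \<le> a + b + c + d"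
      if "0 \<le> a" "0 \<le> b" "0 \<le> c" "0 \<le> d" for a b c d :: real
      using that by (simp add: field_simps)
    have p4: "((x::real)\<^sup>2)\<^sup>2 = x ^ 4" for x by simp
    have "\<bar>p * q * (r * s)\<bar> \<le> ((p * q)\<^sup>2 + (r * s)\<^sup>2) / 2" by (rule sq)
    also have "\<dots> = (p\<^sup>2 * q\<^sup>2 + r\<^sup>2 * s\<^sup>2) / 2" by (simp add: power_mult_distrib)
    also have "\<dots> \<le> ((p ^ 4 + q ^ 4) / 2 + (r ^ 4 + s ^ 4) / 2) / 2"
      using sq[of "p\<^sup>2" "q\<^sup>2"] sq[of "r\<^sup>2" "s\<^sup>2"] unfolding p4 abs_mult by (simp add: add_divide_distrib)
    also have "\<dots> \<le> p ^ 4 + q ^ 4 + r ^ 4 + s ^ 4"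
      by (rule av) simp_all
    finally show ?thesis .
  qed
  then show "AE \<omega> in M. norm (Y a \<omega> * Y b \<omega> * (Y c \<omega> * Y d \<omega>)) \<le> norm (Y a \<omega> ^ 4 + Y b \<omega> ^ 4 + Y c \<omega> ^ 4 + Y d \<omega> ^ 4)"
    by (intro AE_I2) (auto intro: order_trans[OF _ abs_ge_self])
qed measurable

lemma int_prod2: "integrable M (\<lambda>\<omega>. Y a \<omega> * Y b \<omega>)"
proof (rule Bochner_Integration.integrable_bound)
  show "integrable M (\<lambda>\<omega>. 1 + Y a \<omega> * Y b \<omega> * (Y a \<omega> * Y b \<omega>))"
    by (intro Bochner_Integration.integrable_add int_prod4) simp
  have "\<bar>x\<bar> \<le> \<bar>1 + x * x\<bar>" for x :: real
  proof -
    have "0 \<le> (\<bar>x\<bar> - 1)\<^sup>2" by simp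
    also have "(\<bar>x\<bar> - 1)\<^sup>2 = 1 + x * x - 2 * \<bar>x\<bar>"
      by (simp add: power2_diff) (simp add: power2_eq_square)
    finally have "2 * \<bar>x\<bar> \<le> 1 + x * x" by simp
    then show ?thesis by linarith
  qed
  then show "AE \<omega> in M. norm (Y a \<omega> * Y b \<omega>) \<le> norm (1 + Y a \<omega> * Y b \<omega> * (Y a \<omega> * Y b \<omega>))"
    by (intro AE_I2) simp
qed measurable

text \<open>The pair is (time, lag): an observation times the one \<open>snd p\<close> steps
  earlier, centered at its mean.\<close>

definition \<xi> :: "nat \<times> nat \<Rightarrow> 'a \<Rightarrow> real" where
  "\<xi> p \<omega> = Y (int (fst p)) \<omega> * Y (int (fst p) - int (snd p)) \<omega> - \<gamma> (int (snd p))"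

lemma xi_meas[measurable]: "\<xi> p \<in> borel_measurable M"
  unfolding \<xi>_def[abs_def] by measurable

lemma xi_prod: "\<xi> p \<omega> * \<xi> p' \<omega> = Y (int (fst p)) \<omega> * Y (int (fst p) - int (snd p)) \<omega> * (Y (int (fst p')) \<omega> * Y (int (fst p') - int (snd p')) \<omega>)
   - \<gamma> (int (snd p)) * (Y (int (fst p')) \<omega> * Y (int (fst p') - int (snd p')) \<omega>)
   - \<gamma> (int (snd p')) * (Y (int (fst p)) \<omega> * Y (int (fst p) - int (snd p)) \<omega>) + \<gamma> (int (snd p)) * \<gamma> (int (snd p'))"
  by (simp add: \<xi>_def algebra_simps)

lemma xi_prod_int: "integrable M (\<lambda>\<omega>. \<xi> p \<omega> * \<xi> p' \<omega>)"
  unfolding xi_prod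
  by (intro Bochner_Integration.integrable_add Bochner_Integration.integrable_diff integrable_mult_right int_prod4 int_prod2) simp

text \<open>Of the three pairings in the fourth moment, one is the product of the two means and is
  removed by centering. The other two pairings and the cumulant remain.\<close>

lemma xi_cov: "expectation (\<lambda>\<omega>. \<xi> p \<omega> * \<xi> p' \<omega>) =
   \<gamma> (int (fst p') - int (fst p)) * \<gamma> (int (fst p') - int (snd p') - int (fst p) + int (snd p))
   + \<gamma> (int (fst p') - int (snd p') - int (fst p)) * \<gamma> (int (fst p') - int (fst p) + int (snd p))
   + \<kappa> (- int (snd p)) (int (fst p') - int (fst p)) (int (fst p') - int (snd p') - int (fst p))"
proof -
  have "expectation (\<lambda>\<omega>. \<xi> p \<omega> * \<xi> p' \<omega>) =
    expectation (\<lambda>\<omega>. Y (int (fst p)) \<omega> * Y (int (fst p) - int (snd p)) \<omega> * (Y (int (fst p')) \<omega> * Y (int (fst p') - int (snd p')) \<omega>))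
    - \<gamma> (int (snd p)) * expectation (\<lambda>\<omega>. Y (int (fst p')) \<omega> * Y (int (fst p') - int (snd p')) \<omega>)
    - \<gamma> (int (snd p')) * expectation (\<lambda>\<omega>. Y (int (fst p)) \<omega> * Y (int (fst p) - int (snd p)) \<omega>)
    + \<gamma> (int (snd p)) * \<gamma> (int (snd p'))"
    unfolding xi_prod by (simp add: int_prod4 int_prod2 prob_space)
  then show ?thesis unfolding Y_cum Y_cov by (simp add: gamma_minus algebra_simps)
qed

lemma gamma_pair_bound:
  assumes T: "finite T" and inj: "inj_on f T"
  shows "(\<Sum>p\<in>T. \<bar>\<gamma> (fst (f p)) * \<gamma> (snd (f p))\<bar>) \<le> G\<^sup>2"
proof -
  let ?A = "fst ` f ` T" and ?B = "snd ` f ` T"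
  have "(\<Sum>p\<in>T. \<bar>\<gamma> (fst (f p)) * \<gamma> (snd (f p))\<bar>) = (\<Sum>z\<in>f ` T. \<bar>\<gamma> (fst z) * \<gamma> (snd z)\<bar>)"
    by (simp add: sum.reindex[OF inj])
  also have "\<dots> \<le> (\<Sum>z\<in>?A \<times> ?B. \<bar>\<gamma> (fst z) * \<gamma> (snd z)\<bar>)"
  proof (rule sum_mono2)
    show "finite (?A \<times> ?B)" using T by simp
    show "f ` T \<subseteq> ?A \<times> ?B" by (intro subsetI) (simp add: mem_Times_iff)
  qed simp
  also have "\<dots> = (\<Sum>a\<in>?A. \<bar>\<gamma> a\<bar>) * (\<Sum>b\<in>?B. \<bar>\<gamma> b\<bar>)"
    by (simp add: sum.cartesian_product' sum_product abs_mult)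
  also have "\<dots> \<le> G * G"
    by (intro mult_mono gamma_bound sum_nonneg G_nonneg) (use T in auto)
  finally show ?thesis by (simp add: power2_eq_square)
qed

text \<open>For fixed \<open>p\<close>, the argument pairs of the two \<open>\<gamma>\<close>
  products and the last two arguments of \<open>\<kappa>\<close> are injective functions of
  \<open>p'\<close>, so no term is counted twice. The first argument of \<open>\<kappa>\<close> is
  minus the lag of \<open>p\<close>; the bound on cumulants is uniform in it.\<close>

lemma xi_cov_sum_bound:
  assumes T: "finite T"
  shows "(\<Sum>p'\<in>T. \<bar>expectation (\<lambda>\<omega>. \<xi> p \<omega> * \<xi> p' \<omega>)\<bar>) \<le> 2 * G\<^sup>2 + K"
proof -
  let ?f1 = "\<lambda>p'. (int (fst p') - int (fst p), int (fst p') - int (snd p') - int (fst p) + int (snd p))"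
  let ?f2 = "\<lambda>p'. (int (fst p') - int (snd p') - int (fst p), int (fst p') - int (fst p) + int (snd p))"
  let ?f3 = "\<lambda>p'. (int (fst p') - int (fst p), int (fst p') - int (snd p') - int (fst p))"
  have inj: "inj_on ?f1 T" "inj_on ?f2 T" "inj_on ?f3 T" by (auto simp: inj_on_def prod_eq_iff)
  have "(\<Sum>p'\<in>T. \<bar>expectation (\<lambda>\<omega>. \<xi> p \<omega> * \<xi> p' \<omega>)\<bar>) \<le>
    (\<Sum>p'\<in>T. \<bar>\<gamma> (fst (?f1 p')) * \<gamma> (snd (?f1 p'))\<bar> + \<bar>\<gamma> (fst (?f2 p')) * \<gamma> (snd (?f2 p'))\<bar>
      + \<bar>\<kappa> (- int (snd p)) (fst (?f3 p')) (snd (?f3 p'))\<bar>)"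
    unfolding xi_cov by (rule sum_mono) simp
  also have "\<dots> = (\<Sum>p'\<in>T. \<bar>\<gamma> (fst (?f1 p')) * \<gamma> (snd (?f1 p'))\<bar>) + (\<Sum>p'\<in>T. \<bar>\<gamma> (fst (?f2 p')) * \<gamma> (snd (?f2 p'))\<bar>)
      + (\<Sum>p'\<in>T. \<bar>\<kappa> (- int (snd p)) (fst (?f3 p')) (snd (?f3 p'))\<bar>)"
    by (simp add: sum.distrib)
  also have "(\<Sum>p'\<in>T. \<bar>\<kappa> (- int (snd p)) (fst (?f3 p')) (snd (?f3 p'))\<bar>) = (\<Sum>(r, s)\<in>?f3 ` T. \<bar>\<kappa> (- int (snd p)) r s\<bar>)"
    by (simp add: sum.reindex[OF inj(3)] case_prod_beta)
  also have "(\<Sum>p'\<in>T. \<bar>\<gamma> (fst (?f1 p')) * \<gamma> (snd (?f1 p'))\<bar>) + (\<Sum>p'\<in>T. \<bar>\<gamma> (fst (?f2 p')) * \<gamma> (snd (?f2 p'))\<bar>)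
      + (\<Sum>(r, s)\<in>?f3 ` T. \<bar>\<kappa> (- int (snd p)) r s\<bar>) \<le> G\<^sup>2 + G\<^sup>2 + K"
    by (intro add_mono gamma_pair_bound kappa_bound T inj finite_imageI)
  finally show ?thesis by simp
qed

lemma xi_square_int:
  "integrable M (\<lambda>\<omega>. (\<Sum>p\<in>T. w p * \<xi> p \<omega>)\<^sup>2)"
  unfolding power2_eq_square sum_product
proof (intro Bochner_Integration.integrable_sum)
  fix p p'
  have "integrable M (\<lambda>\<omega>. (w p * w p') * (\<xi> p \<omega> * \<xi> p' \<omega>))" by (intro integrable_mult_right xi_prod_int)
  then show "integrable M (\<lambda>\<omega>. w p * \<xi> p \<omega> * (w p' * \<xi> p' \<omega>))" by (simp add: mult_ac)
qed

text \<open>Row sums of the covariance matrix are bounded, so the second moment grows at most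
  linearly in the number of terms, for any weights in [-1, 1]. This supplies the increment bound of
  the maximal inequality.\<close>

lemma xi_square_bound:
  assumes T: "finite T" and w: "\<And>p. \<bar>w p\<bar> \<le> 1"
  shows "expectation (\<lambda>\<omega>. (\<Sum>p\<in>T. w p * \<xi> p \<omega>)\<^sup>2) \<le> (2 * G\<^sup>2 + K) * real (card T)"
proof -
  have "expectation (\<lambda>\<omega>. (\<Sum>p\<in>T. w p * \<xi> p \<omega>)\<^sup>2) = expectation (\<lambda>\<omega>. \<Sum>p\<in>T. \<Sum>p'\<in>T. (w p * w p') * (\<xi> p \<omega> * \<xi> p' \<omega>))"
    by (simp add: power2_eq_square sum_product mult_ac)
  also have "\<dots> = (\<Sum>p\<in>T. \<Sum>p'\<in>T. (w p * w p') * expectation (\<lambda>\<omega>. \<xi> p \<omega> * \<xi> p' \<omega>))"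
    by (simp add: xi_prod_int)
  also have "\<dots> \<le> (\<Sum>p\<in>T. \<Sum>p'\<in>T. \<bar>expectation (\<lambda>\<omega>. \<xi> p \<omega> * \<xi> p' \<omega>)\<bar>)"
  proof (intro sum_mono)
    fix p p'
    have "\<bar>w p * w p'\<bar> \<le> 1" using mult_mono[OF w[of p] w[of p']] by (simp add: abs_mult)
    then have "\<bar>w p * w p'\<bar> * \<bar>expectation (\<lambda>\<omega>. \<xi> p \<omega> * \<xi> p' \<omega>)\<bar> \<le> 1 * \<bar>expectation (\<lambda>\<omega>. \<xi> p \<omega> * \<xi> p' \<omega>)\<bar>"
      by (rule mult_right_mono) simp
    then show "(w p * w p') * expectation (\<lambda>\<omega>. \<xi> p \<omega> * \<xi> p' \<omega>) \<le> \<bar>expectation (\<lambda>\<omega>. \<xi> p \<omega> * \<xi> p' \<omega>)\<bar>"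
      by (simp add: abs_mult[symmetric])
  qed
  also have "\<dots> \<le> (\<Sum>p\<in>T. 2 * G\<^sup>2 + K)" by (intro sum_mono xi_cov_sum_bound T)
  finally show ?thesis by (simp add: mult.commute)
qed

end

section \<open>The Bartlett estimator\<close>

text \<open>Half weight on the diagonal: after doubling, squares count once and cross products
  twice.\<close>

definition lag_weight :: "nat \<Rightarrow> real" where "lag_weight j = (if j = 0 then 1/2 else 1)"

text \<open>Pairs (time, lag) with time in \<open>(a, b]\<close>; \<open>j < i\<close> keeps the
  earlier time at least 1. Enlarging \<open>b\<close> only adds rows, so sums over
  \<open>lag_pairs 0 b l\<close> are partial sums in the block length \<open>b\<close>.\<close>

definition lag_pairs :: "nat \<Rightarrow> nat \<Rightarrow> nat \<Rightarrow> (nat \<times> nat) set" where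
  "lag_pairs a b l = (SIGMA i:{a<..b}. {j. j \<le> l \<and> j < i})"

lemma lag_weight_bound: "\<bar>lag_weight j\<bar> \<le> 1" by (simp add: lag_weight_def)

lemma lag_pairs_subset: "lag_pairs a b l \<subseteq> {a<..b} \<times> {..l}" by (auto simp: lag_pairs_def)

lemma finite_lag_pairs[simp]: "finite (lag_pairs a b l)"
  by (rule finite_subset[OF lag_pairs_subset]) simp

lemma card_lag_pairs: "card (lag_pairs a b l) \<le> (b - a) * (l + 1)"
  using card_mono[OF _ lag_pairs_subset[of a b l]] by simp

lemma lag_pairs_split:
  assumes "a \<le> b"
  shows "sum f (lag_pairs 0 b l) = sum f (lag_pairs 0 a l) + sum f (lag_pairs a b l)"
proof -
  have "lag_pairs 0 b l = lag_pairs 0 a l \<union> lag_pairs a b l" using assms by (auto simp: lag_pairs_def)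
  moreover have "lag_pairs 0 a l \<inter> lag_pairs a b l = {}" by (auto simp: lag_pairs_def)
  ultimately show ?thesis by (simp add: sum.union_disjoint)
qed

lemma lag_pairs_sum_rows:
  fixes f :: "nat \<Rightarrow> nat \<Rightarrow> real"
  shows "(\<Sum>p\<in>lag_pairs 0 m l. f (fst p) (snd p)) = (\<Sum>i=1..m. \<Sum>j\<le>min l (i - 1). f i j)"
proof -
  have "(\<Sum>p\<in>lag_pairs 0 m l. f (fst p) (snd p)) = (\<Sum>i\<in>{0<..m}. \<Sum>j\<in>{j. j \<le> l \<and> j < i}. f i j)"
    unfolding lag_pairs_def by (subst sum.Sigma) (auto simp: case_prod_beta)
  also have "\<dots> = (\<Sum>i=1..m. \<Sum>j\<le>min l (i - 1). f i j)"
    by (intro sum.cong) auto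
  finally show ?thesis .
qed

lemma lag_pairs_sum_columns:
  fixes f :: "nat \<Rightarrow> nat \<Rightarrow> real"
  shows "(\<Sum>p\<in>lag_pairs 0 m l. f (fst p) (snd p)) = (\<Sum>j\<le>l. \<Sum>i=1..m - j. f (i + j) j)"
proof -
  have "(\<Sum>j\<le>l. \<Sum>i=1..m - j. f (i + j) j) = (\<Sum>p\<in>(SIGMA j:{..l}. {1..m - j}). f (snd p + fst p) (fst p))"
    by (subst sum.Sigma) (auto simp: case_prod_beta)
  also have "\<dots> = (\<Sum>p\<in>lag_pairs 0 m l. f (fst p) (snd p))"
    by (rule sum.reindex_bij_witness[where i="\<lambda>p. (snd p, fst p - snd p)" and j="\<lambda>p. (snd p + fst p, fst p)"])
      (auto simp: lag_pairs_def)
  finally show ?thesis by simp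
qed

text \<open>Lag \<open>j\<close> occurs in the \<open>q + 1 - j\<close> inner sums with
  \<open>l \<ge> j\<close>.\<close>

lemma sum_triangle_average:
  fixes A :: "nat \<Rightarrow> real"
  shows "(\<Sum>l\<le>q. \<Sum>j\<le>l. A j) = (\<Sum>j\<le>q. (real q + 1 - real j) * A j)"
proof (induction q)
  case (Suc q)
  have "(\<Sum>j\<le>q. (real (Suc q) + 1 - real j) * A j) = (\<Sum>j\<le>q. (real q + 1 - real j) * A j) + (\<Sum>j\<le>q. A j)"
    by (simp add: sum.distrib[symmetric] algebra_simps)
  then show ?case using Suc by simp
qed simp

definition bartlett_form :: "(nat \<Rightarrow> real) \<Rightarrow> nat \<Rightarrow> nat \<Rightarrow> real" where
  "bartlett_form y m q = (1 / real m) * (\<Sum>i=1..m. (y i)\<^sup>2)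
     + 2 * (\<Sum>j=1..q. bartlett q j * ((1 / real m) * (\<Sum>i=1..m - j. y i * y (i + j))))"

text \<open>The Bartlett weights average the truncated sums over the truncation point \<open>l\<close>. This turns a
  maximum over all bandwidths into a sum of maxima for fixed \<open>l\<close>.\<close>

lemma bartlett_form_average:
  "bartlett_form y m q = 2 / (real m * (real q + 1)) *
     (\<Sum>l\<le>q. \<Sum>p\<in>lag_pairs 0 m l. lag_weight (snd p) * (y (fst p) * y (fst p - snd p)))"
proof -
  define A where "A j = (\<Sum>i=1..m - j. y i * y (i + j))" for j
  have "(\<Sum>p\<in>lag_pairs 0 m l. lag_weight (snd p) * (y (fst p) * y (fst p - snd p))) = (\<Sum>j\<le>l. lag_weight j * A j)" for l
    using lag_pairs_sum_columns[of "\<lambda>i j. lag_weight j * (y i * y (i - j))" m l]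
    by (simp add: A_def sum_distrib_left mult_ac)
  then have "(\<Sum>l\<le>q. \<Sum>p\<in>lag_pairs 0 m l. lag_weight (snd p) * (y (fst p) * y (fst p - snd p)))
      = (\<Sum>j\<le>q. (real q + 1 - real j) * (lag_weight j * A j))"
    by (simp add: sum_triangle_average)
  also have "\<dots> = (real q + 1) / 2 * A 0 + (\<Sum>j=1..q. (real q + 1 - real j) * A j)"
    by (simp add: sum.atMost_shift lag_weight_def sum.atLeast1_atMost_eq)
  also have "(\<Sum>j=1..q. (real q + 1 - real j) * A j) = (real q + 1) * (\<Sum>j=1..q. bartlett q j * A j)"
    unfolding sum_distrib_left by (intro sum.cong refl) (simp add: bartlett_def field_simps)
  finally have *: "(\<Sum>l\<le>q. \<Sum>p\<in>lag_pairs 0 m l. lag_weight (snd p) * (y (fst p) * y (fst p - snd p)))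
      = (real q + 1) * (A 0 / 2 + (\<Sum>j=1..q. bartlett q j * A j))" by (simp add: algebra_simps)
  have "bartlett_form y m q = (1 / real m) * (A 0 + 2 * (\<Sum>j=1..q. bartlett q j * A j))"
    unfolding bartlett_form_def A_def by (simp add: power2_eq_square sum_distrib_left algebra_simps)
  also have "\<dots> = 2 / (real m * (real q + 1)) * ((real q + 1) * (A 0 / 2 + (\<Sum>j=1..q. bartlett q j * A j)))"
  proof -
    have "2 / (real m * Q) * (Q * z) = (1 / real m) * (2 * z)" if "Q \<noteq> 0" for Q z :: real using that by simp
    then have "2 / (real m * (real q + 1)) * ((real q + 1) * (A 0 / 2 + (\<Sum>j=1..q. bartlett q j * A j)))
        = (1 / real m) * (2 * (A 0 / 2 + (\<Sum>j=1..q. bartlett q j * A j)))" by (smt (verit) of_nat_0_le_iff)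
    then show ?thesis by (simp only: distrib_left)
  qed
  finally show ?thesis unfolding * .
qed

text \<open>At truncation \<open>n\<close> all lags are present. The identity serves twice: for the
  moments of partial sums and, applied to window sums, for the positivity of the Bartlett
  form.\<close>

lemma square_sum_lag_pairs:
  "(\<Sum>i=1..n. y i)\<^sup>2 = 2 * (\<Sum>p\<in>lag_pairs 0 n n. lag_weight (snd p) * (y (fst p) * y (fst p - snd p)))"
proof -
  have "(\<Sum>p\<in>lag_pairs 0 n n. lag_weight (snd p) * (y (fst p) * y (fst p - snd p)))
    = (\<Sum>i=1..n. \<Sum>j\<le>min n (i - 1). lag_weight j * (y i * y (i - j)))"
    by (rule lag_pairs_sum_rows)
  also have "\<dots> = (\<Sum>i=1..n. \<Sum>j\<le>i - 1. lag_weight j * (y i * y (i - j)))"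
    by (intro sum.cong) auto
  also have "2 * \<dots> = (\<Sum>i=1..n. y i)\<^sup>2"
  proof (induction n)
    case (Suc n)
    have "(\<Sum>j\<le>n. lag_weight j * (y (Suc n) * y (Suc n - j))) = (y (Suc n))\<^sup>2 / 2 + (\<Sum>j=1..n. y (Suc n) * y (Suc n - j))"
      by (simp add: sum.atMost_shift lag_weight_def sum.atLeast1_atMost_eq power2_eq_square)
    also have "(\<Sum>j=1..n. y (Suc n) * y (Suc n - j)) = y (Suc n) * (\<Sum>i=1..n. y i)"
      unfolding sum_distrib_left
      by (rule sum.reindex_bij_witness[where i="\<lambda>i. Suc n - i" and j="\<lambda>i. Suc n - i"]) auto
    finally show ?case using Suc by (simp add: power2_sum algebra_simps)
  qed simp
  finally show ?thesis by simp
qed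

section \<open>Deterministic centering and the long-run variance\<close>

text \<open>The Bartlett form with every lagged product replaced by its expectation.\<close>

definition lag_center :: "(int \<Rightarrow> real) \<Rightarrow> nat \<Rightarrow> nat \<Rightarrow> real" where
  "lag_center \<gamma> k q = 2 / (real k * (real q + 1)) * (\<Sum>l\<le>q. \<Sum>p\<in>lag_pairs 0 k l. lag_weight (snd p) * \<gamma> (int (snd p)))"

text \<open>The one-sided series with half weight at 0, doubled: for even \<open>\<gamma>\<close>
  this is the sum over all integer lags.\<close>

definition lrv :: "(int \<Rightarrow> real) \<Rightarrow> real" where
  "lrv \<gamma> = 2 * (\<Sum>j. lag_weight j * \<gamma> (int j))"

text \<open>The finitely many early partial sums get a crude bound \<open>D\<close>, kept as an
  indicator term instead of a case distinction because these bounds are averaged next.\<close>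

lemma lag_partial_sums:
  assumes "summable (\<lambda>j. \<bar>\<gamma> (int j)\<bar>)" and e: "e > 0"
  obtains m0 D where "D \<ge> 0" "\<And>n. \<bar>(\<Sum>j\<le>n. lag_weight j * \<gamma> (int j)) - lrv \<gamma> / 2\<bar> \<le> e + D * (if n < m0 then 1 else 0)"
proof -
  let ?g = "\<lambda>n. \<Sum>j\<le>n. lag_weight j * \<gamma> (int j)"
  have "summable (\<lambda>j. lag_weight j * \<gamma> (int j))"
    by (rule summable_comparison_test'[OF assms(1), of 0]) (auto simp: lag_weight_def abs_mult)
  then have lim: "?g \<longlonglongrightarrow> lrv \<gamma> / 2" unfolding lrv_def by (simp add: summable_LIMSEQ')
  then obtain m0 where m0: "\<And>n. n \<ge> m0 \<Longrightarrow> \<bar>?g n - lrv \<gamma> / 2\<bar> < e"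
    using LIMSEQ_D[OF lim e] by auto
  define D where "D = (\<Sum>n<m0. \<bar>?g n - lrv \<gamma> / 2\<bar>)"
  show ?thesis
  proof (rule that[of D])
    show "D \<ge> 0" by (simp add: D_def sum_nonneg)
    fix n show "\<bar>?g n - lrv \<gamma> / 2\<bar> \<le> e + D * (if n < m0 then 1 else 0)"
    proof (cases "n < m0")
      case True
      have "\<bar>?g n - lrv \<gamma> / 2\<bar> \<le> D" unfolding D_def
        by (rule member_le_sum[where f="\<lambda>n. \<bar>?g n - lrv \<gamma> / 2\<bar>"]) (use True in auto)
      then show ?thesis using True e by simp
    qed (use m0[of n] in auto)
  qed
qed

lemma lag_center_rows:
  "lag_center \<gamma> k q = 2 / (real k * (real q + 1)) * (\<Sum>l\<le>q. \<Sum>i=1..k. \<Sum>j\<le>min l (i - 1). lag_weight j * \<gamma> (int j))"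
  unfolding lag_center_def lag_pairs_sum_rows[of "\<lambda>i j. lag_weight j * \<gamma> (int j)"] ..

text \<open>The center is a double Cesaro mean of partial sums, over \<open>l \<le> q\<close> and
  \<open>i \<le> k\<close>. At most \<open>m0\<close> values of \<open>l\<close> and
  \<open>m0\<close> values of \<open>i\<close> cut the partial sum too early; averaging dilutes them
  by \<open>1 / q\<close> and \<open>1 / k\<close>.\<close>

lemma lag_center_limit:
  assumes sm: "summable (\<lambda>j. \<bar>\<gamma> (int j)\<bar>)" and e: "e > 0"
  obtains n0 where "\<And>k q. k \<ge> n0 \<Longrightarrow> q \<ge> n0 \<Longrightarrow> \<bar>lag_center \<gamma> k q - lrv \<gamma>\<bar> \<le> e"
proof -
  let ?g = "\<lambda>n. \<Sum>j\<le>n. lag_weight j * \<gamma> (int j)"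
  have e4: "e/4 > 0" using e by simp
  obtain m0 D where D: "D \<ge> 0" and g: "\<And>n. \<bar>?g n - lrv \<gamma> / 2\<bar> \<le> e/4 + D * (if n < m0 then 1 else 0)"
    using lag_partial_sums[OF sm e4] by metis
  \<comment> \<open>Beyond this threshold each of the two families of early terms costs at most
    \<open>e/8\<close> on average. Together with the \<open>e/4\<close> of the other terms, and with
    the factor 2 in \<open>lag_center\<close>, this makes \<open>e\<close>.\<close>
  define n0 where "n0 = nat \<lceil>8 * D * real m0 / e\<rceil> + 1"
  have n0: "8 * D * real m0 \<le> e * real n" if "n \<ge> n0" for n
  proof -
    have "8 * D * real m0 / e \<le> real n" using that unfolding n0_def by linarith
    then show ?thesis using e by (simp add: pos_divide_le_eq mult.commute)
  qed
  show ?thesis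
  proof (rule that[of n0])
    fix k q assume k: "k \<ge> n0" and q: "q \<ge> n0"
    have kp: "real k > 0" using k by (simp add: n0_def)
    define Q where "Q = real q + 1"
    have Qp: "Q > 0" by (simp add: Q_def)
    have c: "(\<Sum>l\<le>q. \<Sum>i=1..k. lrv \<gamma> / 2) = (real k * Q) * (lrv \<gamma> / 2)" by (simp add: Q_def algebra_simps)
    have "\<bar>(\<Sum>l\<le>q. \<Sum>i=1..k. ?g (min l (i - 1))) - (\<Sum>l\<le>q. \<Sum>i=1..k. lrv \<gamma> / 2)\<bar>
       \<le> (\<Sum>l\<le>q. \<Sum>i=1..k. \<bar>?g (min l (i - 1)) - lrv \<gamma> / 2\<bar>)"
      unfolding sum_subtractf[symmetric] by (intro order_trans[OF sum_abs] sum_mono sum_abs)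
    also have "\<dots> \<le> (\<Sum>l\<le>q. \<Sum>i=1..k. e/4 + D * (if l < m0 then 1 else 0) + D * (if i \<le> m0 then 1 else 0))"
    proof (intro sum_mono)
      fix l i assume "i \<in> {1..k}"
      then show "\<bar>?g (min l (i - 1)) - lrv \<gamma> / 2\<bar> \<le> e/4 + D * (if l < m0 then 1 else 0) + D * (if i \<le> m0 then 1 else 0)"
        using g[of "min l (i - 1)"] D by (auto split: if_splits simp: min_def)
    qed
    also have "\<dots> = (real k * Q) * (e/4) + D * real k * (\<Sum>l\<le>q. if l < m0 then 1 else 0) + D * Q * (\<Sum>i=1..k. if i \<le> m0 then 1 else 0)"
      by (simp add: sum.distrib sum_distrib_left[symmetric] Q_def algebra_simps)
    also have "\<dots> \<le> (real k * Q) * (e/4) + D * real k * real m0 + D * Q * real m0"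
    proof -
      have "(\<Sum>l\<le>q. if l < m0 then 1 else 0 :: real) = real (card {l. l \<le> q \<and> l < m0})"
        by (simp add: sum.If_cases Int_def)
      moreover have "card {l. l \<le> q \<and> l < m0} \<le> card {..<m0}" by (rule card_mono) auto
      moreover have "(\<Sum>i=1..k. if i \<le> m0 then 1 else 0 :: real) = real (card {i. (Suc 0 \<le> i \<and> i \<le> k) \<and> i \<le> m0})"
        by (simp add: sum.If_cases Int_def)
      moreover have "card {i. (Suc 0 \<le> i \<and> i \<le> k) \<and> i \<le> m0} \<le> card {1..m0}" by (rule card_mono) auto
      ultimately show ?thesis using D kp Qp by (intro add_mono order.refl mult_left_mono) auto
    qed
    also have "\<dots> \<le> (real k * Q) * (e/4) + (real k * Q) * (e/8) + (real k * Q) * (e/8)"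
    proof -
      have "8 * D * real m0 \<le> e * Q" using n0[OF q] e by (simp add: Q_def algebra_simps)
      then have "real k * (D * real m0) \<le> real k * (Q * (e/8))" using kp by (intro mult_left_mono) (auto simp: algebra_simps)
      moreover have "Q * (D * real m0) \<le> Q * (real k * (e/8))" using n0[OF k] Qp by (intro mult_left_mono) (auto simp: algebra_simps)
      ultimately show ?thesis by (simp add: algebra_simps)
    qed
    finally have "\<bar>(\<Sum>l\<le>q. \<Sum>i=1..k. ?g (min l (i - 1))) - (real k * Q) * (lrv \<gamma> / 2)\<bar> \<le> (real k * Q) * (e/2)"
      unfolding c by (simp add: algebra_simps)
    then have "2 / (real k * Q) * \<bar>(\<Sum>l\<le>q. \<Sum>i=1..k. ?g (min l (i - 1))) - (real k * Q) * (lrv \<gamma> / 2)\<bar> \<le> 2 / (real k * Q) * ((real k * Q) * (e/2))"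
      using kp Qp by (intro mult_left_mono) auto
    also have "\<dots> = e" using kp Qp by simp
    also have "2 / (real k * Q) * \<bar>(\<Sum>l\<le>q. \<Sum>i=1..k. ?g (min l (i - 1))) - (real k * Q) * (lrv \<gamma> / 2)\<bar>
      = \<bar>2 / (real k * Q) * ((\<Sum>l\<le>q. \<Sum>i=1..k. ?g (min l (i - 1))) - (real k * Q) * (lrv \<gamma> / 2))\<bar>"
      unfolding abs_mult using kp Qp by simp
    also have "2 / (real k * Q) * ((\<Sum>l\<le>q. \<Sum>i=1..k. ?g (min l (i - 1))) - (real k * Q) * (lrv \<gamma> / 2)) = lag_center \<gamma> k q - lrv \<gamma>"
      unfolding lag_center_rows Q_def[symmetric] using kp Qp by (simp add: field_simps)
    finally show "\<bar>lag_center \<gamma> k q - lrv \<gamma>\<bar> \<le> e" .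
  qed
qed

text \<open>The same Cesaro argument without a bandwidth. By \<open>square_sum_lag_pairs\<close> the
  sequence is the variance of a partial sum of length \<open>n\<close>, divided by
  \<open>n\<close>.\<close>

lemma lag_pairs_mean_limit:
  assumes sm: "summable (\<lambda>j. \<bar>\<gamma> (int j)\<bar>)"
  shows "(\<lambda>n. 2 / real n * (\<Sum>p\<in>lag_pairs 0 n n. lag_weight (snd p) * \<gamma> (int (snd p)))) \<longlonglongrightarrow> lrv \<gamma>"
proof (rule LIMSEQ_I)
  fix e :: real assume e: "e > 0"
  let ?g = "\<lambda>n. \<Sum>j\<le>n. lag_weight j * \<gamma> (int j)"
  have e4: "e/8 > 0" using e by simp
  obtain m0 D where D: "D \<ge> 0" and g: "\<And>n. \<bar>?g n - lrv \<gamma> / 2\<bar> \<le> e/8 + D * (if n < m0 then 1 else 0)"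
    using lag_partial_sums[OF sm e4] by metis
  define n0 where "n0 = nat \<lceil>8 * D * real m0 / e\<rceil> + 1"
  show "\<exists>n0. \<forall>n\<ge>n0. norm (2 / real n * (\<Sum>p\<in>lag_pairs 0 n n. lag_weight (snd p) * \<gamma> (int (snd p))) - lrv \<gamma>) < e"
  proof (intro exI allI impI)
    fix n assume n: "n \<ge> n0"
    have "8 * D * real m0 / e \<le> real n" using n unfolding n0_def by linarith
    then have n': "8 * D * real m0 \<le> e * real n" using e by (simp add: pos_divide_le_eq mult.commute)
    have np: "real n > 0" using n by (simp add: n0_def)
    have r: "(\<Sum>p\<in>lag_pairs 0 n n. lag_weight (snd p) * \<gamma> (int (snd p))) = (\<Sum>i=1..n. ?g (i - 1))"
      unfolding lag_pairs_sum_rows[of "\<lambda>i j. lag_weight j * \<gamma> (int j)"] by (intro sum.cong) auto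
    have c: "(\<Sum>i=1..n. lrv \<gamma> / 2) = real n * (lrv \<gamma> / 2)" by simp
    have "\<bar>(\<Sum>i=1..n. ?g (i - 1)) - (\<Sum>i=1..n. lrv \<gamma> / 2)\<bar> \<le> (\<Sum>i=1..n. \<bar>?g (i - 1) - lrv \<gamma> / 2\<bar>)"
      unfolding sum_subtractf[symmetric] by (rule sum_abs)
    also have "\<dots> \<le> (\<Sum>i=1..n. e/8 + D * (if i \<le> m0 then 1 else 0))"
    proof (intro sum_mono)
      fix i assume "i \<in> {1..n}"
      then show "\<bar>?g (i - 1) - lrv \<gamma> / 2\<bar> \<le> e/8 + D * (if i \<le> m0 then 1 else 0)"
        using g[of "i - 1"] D by (auto split: if_splits)
    qed
    also have "\<dots> = real n * (e/8) + D * (\<Sum>i=1..n. if i \<le> m0 then 1 else 0)"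
      by (simp add: sum.distrib sum_distrib_left[symmetric])
    also have "\<dots> \<le> real n * (e/8) + D * real m0"
    proof -
      have "(\<Sum>i=1..n. if i \<le> m0 then 1 else 0 :: real) = real (card {i. (Suc 0 \<le> i \<and> i \<le> n) \<and> i \<le> m0})"
        by (simp add: sum.If_cases Int_def)
      moreover have "card {i. (Suc 0 \<le> i \<and> i \<le> n) \<and> i \<le> m0} \<le> card {1..m0}" by (rule card_mono) auto
      ultimately show ?thesis using D by (intro add_mono order.refl mult_left_mono) auto
    qed
    also have "\<dots> \<le> real n * (e/4)" using n' by (simp add: algebra_simps)
    finally have "\<bar>(\<Sum>i=1..n. ?g (i - 1)) - real n * (lrv \<gamma> / 2)\<bar> \<le> real n * (e/4)" unfolding c .
    then have "2 / real n * \<bar>(\<Sum>i=1..n. ?g (i - 1)) - real n * (lrv \<gamma> / 2)\<bar> \<le> 2 / real n * (real n * (e/4))"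
      using np by (intro mult_left_mono) auto
    also have "\<dots> = e/2" using np by simp
    also have "2 / real n * \<bar>(\<Sum>i=1..n. ?g (i - 1)) - real n * (lrv \<gamma> / 2)\<bar> = \<bar>2 / real n * ((\<Sum>i=1..n. ?g (i - 1)) - real n * (lrv \<gamma> / 2))\<bar>"
      unfolding abs_mult using np by simp
    also have "2 / real n * ((\<Sum>i=1..n. ?g (i - 1)) - real n * (lrv \<gamma> / 2)) = 2 / real n * (\<Sum>i=1..n. ?g (i - 1)) - lrv \<gamma>"
      using np by (simp add: field_simps)
    finally show "norm (2 / real n * (\<Sum>p\<in>lag_pairs 0 n n. lag_weight (snd p) * \<gamma> (int (snd p))) - lrv \<gamma>) < e"
      unfolding r using e by simp
  qed
qed

section \<open>Uniform deviation bounds and moments of partial sums\<close>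

context weak_dep
begin

text \<open>For fixed truncation \<open>l\<close> this is a process in the block length
  \<open>k\<close> alone: the dependence of the bandwidth on \<open>k\<close> has moved into the
  range over which \<open>l\<close> is summed.\<close>

definition U :: "nat \<Rightarrow> nat \<Rightarrow> 'a \<Rightarrow> real" where
  "U l k \<omega> = (\<Sum>p\<in>lag_pairs 0 k l. lag_weight (snd p) * \<xi> p \<omega>)"

lemma U_meas[measurable]: "U l k \<in> borel_measurable M"
  unfolding U_def[abs_def] by measurable

lemma U_0: "U l 0 \<omega> = 0" by (simp add: U_def lag_pairs_def)

lemma U_diff: "a \<le> b \<Longrightarrow> U l b \<omega> - U l a \<omega> = (\<Sum>p\<in>lag_pairs a b l. lag_weight (snd p) * \<xi> p \<omega>)"
  unfolding U_def by (simp add: lag_pairs_split[of a b])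

lemma U_diff_int: "integrable M (\<lambda>\<omega>. (U l b \<omega> - U l a \<omega>)\<^sup>2)"
proof (cases "a \<le> b")
  case True
  then show ?thesis by (simp add: U_diff xi_square_int[where w="\<lambda>p. lag_weight (snd p)"])
next
  case False
  then show ?thesis
    by (simp add: power2_commute[of "U l b _"] U_diff xi_square_int[where w="\<lambda>p. lag_weight (snd p)"])
qed

lemma U_diff_bound:
  assumes "a \<le> b"
  shows "expectation (\<lambda>\<omega>. (U l b \<omega> - U l a \<omega>)\<^sup>2) \<le> ((2 * G\<^sup>2 + K) * (real l + 1)) * real (b - a)"
proof -
  have "expectation (\<lambda>\<omega>. (U l b \<omega> - U l a \<omega>)\<^sup>2) \<le> (2 * G\<^sup>2 + K) * real (card (lag_pairs a b l))"
    unfolding U_diff[OF assms] by (rule xi_square_bound) (auto intro: lag_weight_bound)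
  also have "\<dots> \<le> (2 * G\<^sup>2 + K) * (real (b - a) * (real l + 1))"
  proof (rule mult_left_mono)
    have "real (card (lag_pairs a b l)) \<le> real ((b - a) * (l + 1))" using card_lag_pairs by (rule of_nat_mono)
    then show "real (card (lag_pairs a b l)) \<le> real (b - a) * (real l + 1)" by (simp only: of_nat_mult of_nat_add of_nat_1)
    show "0 \<le> 2 * G\<^sup>2 + K" using K_nonneg by simp
  qed
  finally show ?thesis by (simp add: mult_ac)
qed

definition Umax :: "nat \<Rightarrow> nat \<Rightarrow> 'a \<Rightarrow> real" where
  "Umax m l \<omega> = Max ((\<lambda>k. (U l k \<omega>)\<^sup>2) ` {..2^m})"

lemma Umax_int: "integrable M (Umax m l)"
  using rademacher_menshov(1)[where S="U l" and K="(2 * G\<^sup>2 + K) * (real l + 1)" and a=0 and m=m, OF U_meas U_diff_int U_diff_bound]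
  by (simp add: U_0 Umax_def[abs_def])

lemma Umax_bound: "expectation (Umax m l) \<le> (real m + 1)\<^sup>2 * ((2 * G\<^sup>2 + K) * (real l + 1)) * 2^m"
  using rademacher_menshov(2)[where S="U l" and K="(2 * G\<^sup>2 + K) * (real l + 1)" and a=0 and m=m, OF U_meas U_diff_int U_diff_bound]
  by (simp add: U_0 Umax_def[abs_def])

lemma Umax_ge: "k \<le> 2^m \<Longrightarrow> (U l k \<omega>)\<^sup>2 \<le> Umax m l \<omega>"
  unfolding Umax_def by (intro Max_ge) auto

lemma Umax_nonneg: "0 \<le> Umax m l \<omega>"
  using Umax_ge[of 0 m l \<omega>] by (simp add: U_0)

lemma lag_pairs_sum_Y:
  "(\<Sum>p\<in>lag_pairs 0 k l. lag_weight (snd p) * (Y (int (fst p)) \<omega> * Y (int (fst p - snd p)) \<omega>))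
    = U l k \<omega> + (\<Sum>p\<in>lag_pairs 0 k l. lag_weight (snd p) * \<gamma> (int (snd p)))"
proof -
  have "(\<Sum>p\<in>lag_pairs 0 k l. lag_weight (snd p) * (Y (int (fst p)) \<omega> * Y (int (fst p - snd p)) \<omega>))
    = (\<Sum>p\<in>lag_pairs 0 k l. lag_weight (snd p) * \<xi> p \<omega> + lag_weight (snd p) * \<gamma> (int (snd p)))"
  proof (rule sum.cong[OF refl])
    fix p assume "p \<in> lag_pairs 0 k l"
    then have "int (fst p - snd p) = int (fst p) - int (snd p)" by (auto simp: lag_pairs_def of_nat_diff)
    then show "lag_weight (snd p) * (Y (int (fst p)) \<omega> * Y (int (fst p - snd p)) \<omega>)
      = lag_weight (snd p) * \<xi> p \<omega> + lag_weight (snd p) * \<gamma> (int (snd p))"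
      by (simp add: \<xi>_def algebra_simps)
  qed
  then show ?thesis by (simp add: sum.distrib U_def)
qed

lemma bartlett_form_centered:
  "bartlett_form (\<lambda>i. Y (int i) \<omega>) k q - lag_center \<gamma> k q = 2 / (real k * (real q + 1)) * (\<Sum>l\<le>q. U l k \<omega>)"
  unfolding bartlett_form_average lag_center_def lag_pairs_sum_Y
  by (simp only: sum.distrib right_diff_distrib[symmetric]) simp

text \<open>The variable \<open>H\<close> dominates the squared deviation for all \<open>k\<close>
  in the range at once, and the maximal inequality bounds its expectation; Markov then yields one
  exceptional event. \<open>q0\<close> is a lower bound for the bandwidths in the range and
  \<open>2^m\<close> a dyadic length covering \<open>n\<close>.\<close>

lemma bartlett_form_uniform:
  fixes q :: "nat \<Rightarrow> nat" and c \<delta> :: real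
  assumes c: "c > 0" and n: "n \<ge> 1" "n \<le> 2^m" and q: "mono q"
    and q0: "\<And>k. c * real n \<le> real k \<Longrightarrow> q0 \<le> q k" and \<delta>: "\<delta> > 0"
  obtains E where "E \<in> events"
    "prob E \<le> (2 * G\<^sup>2 + K) * (4 * (real (q n) + 1)^3 * (real m + 1)\<^sup>2 * 2^m / (c * real n * (real q0 + 1))\<^sup>2) / \<delta>\<^sup>2"
    "\<And>\<omega> k. \<omega> \<in> space M - E \<Longrightarrow> c * real n \<le> real k \<Longrightarrow> k \<le> n \<Longrightarrow>
       \<bar>bartlett_form (\<lambda>i. Y (int i) \<omega>) k (q k) - lag_center \<gamma> k (q k)\<bar> \<le> \<delta>"
proof -
  define Q where "Q = real (q n) + 1"
  have Q: "Q > 0" by (simp add: Q_def)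
  \<comment> \<open>A lower bound for the normalization \<open>k (q k + 1)\<close> over the whole
    range of \<open>k\<close>.\<close>
  define d where "d = c * real n * (real q0 + 1)"
  have d: "d > 0" using c n by (simp add: d_def)
  define H where "H \<omega> = 4 / d\<^sup>2 * Q * (\<Sum>l\<le>q n. Umax m l \<omega>)" for \<omega>
  have Hint: "integrable M H" unfolding H_def[abs_def]
    by (intro integrable_mult_right Bochner_Integration.integrable_sum Umax_int)
  have Hnn: "0 \<le> H \<omega>" for \<omega> unfolding H_def using Q by (intro mult_nonneg_nonneg sum_nonneg Umax_nonneg) auto
  define E where "E = {\<omega>\<in>space M. \<delta>\<^sup>2 \<le> H \<omega>}"
  have GK: "0 \<le> 2 * G\<^sup>2 + K" using K_nonneg by simp
  have EH: "expectation H \<le> (2 * G\<^sup>2 + K) * (4 * Q^3 * (real m + 1)\<^sup>2 * 2^m / d\<^sup>2)"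
  proof -
    have "expectation H = 4 / d\<^sup>2 * Q * (\<Sum>l\<le>q n. expectation (Umax m l))"
      unfolding H_def[abs_def] by (simp add: Umax_int)
    also have "\<dots> \<le> 4 / d\<^sup>2 * Q * (\<Sum>l\<le>q n. (real m + 1)\<^sup>2 * ((2 * G\<^sup>2 + K) * Q) * 2^m)"
    proof (intro mult_left_mono sum_mono)
      fix l assume "l \<in> {..q n}"
      then have "(real m + 1)\<^sup>2 * ((2 * G\<^sup>2 + K) * (real l + 1)) * 2^m \<le> (real m + 1)\<^sup>2 * ((2 * G\<^sup>2 + K) * Q) * 2^m"
        using GK by (intro mult_right_mono mult_left_mono) (auto simp: Q_def)
      then show "expectation (Umax m l) \<le> (real m + 1)\<^sup>2 * ((2 * G\<^sup>2 + K) * Q) * 2^m"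
        using Umax_bound[of m l] by linarith
    qed (use Q in auto)
    also have "\<dots> = (2 * G\<^sup>2 + K) * (4 * Q^3 * (real m + 1)\<^sup>2 * 2^m / d\<^sup>2)"
      by (simp add: Q_def[symmetric] power3_eq_cube add.commute[of 1] mult_ac)
    finally show ?thesis .
  qed
  show ?thesis
  proof (rule that[of E])
    show "E \<in> events" unfolding E_def using Hint by measurable
    have "prob E \<le> expectation H / \<delta>\<^sup>2"
      unfolding E_def using integral_Markov_inequality_measure[OF Hint, of "{}" "\<delta>\<^sup>2"] Hnn \<delta> by simp
    also have "\<dots> \<le> (2 * G\<^sup>2 + K) * (4 * Q^3 * (real m + 1)\<^sup>2 * 2^m / d\<^sup>2) / \<delta>\<^sup>2"
      by (rule divide_right_mono[OF EH]) simp
    finally show "prob E \<le> (2 * G\<^sup>2 + K) * (4 * (real (q n) + 1)^3 * (real m + 1)\<^sup>2 * 2^m / (c * real n * (real q0 + 1))\<^sup>2) / \<delta>\<^sup>2"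
      by (simp add: Q_def d_def)
    fix \<omega> k assume \<omega>: "\<omega> \<in> space M - E" and k: "c * real n \<le> real k" "k \<le> n"
    have H: "H \<omega> \<le> \<delta>\<^sup>2" using \<omega> by (auto simp: E_def)
    have qk: "q k \<le> q n" using q k(2) by (rule monoD)
    have kd: "d \<le> real k * (real (q k) + 1)" unfolding d_def
      using q0[OF k(1)] k(1) c by (intro mult_mono) auto
    \<comment> \<open>Cauchy-Schwarz over \<open>l\<close>; afterwards monotonicity of the bandwidth
      replaces \<open>q k\<close> by \<open>q n\<close>, which removes \<open>k\<close> from the
      bound.\<close>
    have "(\<Sum>l\<le>q k. U l k \<omega>)\<^sup>2 \<le> (\<Sum>l\<le>q k. 1\<^sup>2) * (\<Sum>l\<le>q k. (U l k \<omega>)\<^sup>2)"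
      using Cauchy_Schwarz_ineq_sum[of "\<lambda>_. 1" "\<lambda>l. U l k \<omega>" "{..q k}"] by simp
    also have "\<dots> \<le> Q * (\<Sum>l\<le>q n. (U l k \<omega>)\<^sup>2)"
    proof (rule mult_mono)
      show "(\<Sum>l\<le>q k. 1\<^sup>2) \<le> Q" using qk by (simp add: Q_def)
      show "(\<Sum>l\<le>q k. (U l k \<omega>)\<^sup>2) \<le> (\<Sum>l\<le>q n. (U l k \<omega>)\<^sup>2)" using qk by (intro sum_mono2) auto
    qed (use Q in \<open>auto intro: sum_nonneg\<close>)
    also have "\<dots> \<le> Q * (\<Sum>l\<le>q n. Umax m l \<omega>)"
      using Q k(2) n(2) by (intro mult_left_mono sum_mono Umax_ge) auto
    finally have sq: "(\<Sum>l\<le>q k. U l k \<omega>)\<^sup>2 \<le> Q * (\<Sum>l\<le>q n. Umax m l \<omega>)" .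
    have "(2 / (real k * (real (q k) + 1)) * (\<Sum>l\<le>q k. U l k \<omega>))\<^sup>2 = (2 / (real k * (real (q k) + 1)))\<^sup>2 * (\<Sum>l\<le>q k. U l k \<omega>)\<^sup>2"
      by (rule power_mult_distrib)
    also have "\<dots> \<le> (2 / d)\<^sup>2 * (Q * (\<Sum>l\<le>q n. Umax m l \<omega>))"
    proof (rule mult_mono[OF _ sq])
      have "2 / (real k * (real (q k) + 1)) \<le> 2 / d" using kd d by (intro divide_left_mono) auto
      then show "(2 / (real k * (real (q k) + 1)))\<^sup>2 \<le> (2 / d)\<^sup>2" by (intro power_mono) auto
    qed auto
    also have "\<dots> = H \<omega>" by (simp add: H_def power_divide)
    finally have "(bartlett_form (\<lambda>i. Y (int i) \<omega>) k (q k) - lag_center \<gamma> k (q k))\<^sup>2 \<le> \<delta>\<^sup>2"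
      unfolding bartlett_form_centered using H by linarith
    then show "\<bar>bartlett_form (\<lambda>i. Y (int i) \<omega>) k (q k) - lag_center \<gamma> k (q k)\<bar> \<le> \<delta>"
      using \<delta> abs_le_square_iff[of "bartlett_form (\<lambda>i. Y (int i) \<omega>) k (q k) - lag_center \<gamma> k (q k)" \<delta>] by simp
  qed
qed

text \<open>The squared sum is \<open>2 U n n\<close> plus its mean \<open>e\<close>, so the fourth
  moment equals \<open>4 E U^2 + e^2\<close> and reduces to the second moment of \<open>U\<close>.
  The constants 8 and 2 leave room to spare.\<close>

lemma partial_sum_moments:
  defines "S \<equiv> \<lambda>n \<omega>. \<Sum>i=1..n. Y (int i) \<omega>"
  shows "integrable M (\<lambda>\<omega>. (S n \<omega>)\<^sup>2)" "integrable M (\<lambda>\<omega>. ((S n \<omega>)\<^sup>2)\<^sup>2)"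
    and "expectation (\<lambda>\<omega>. (S n \<omega>)\<^sup>2) = 2 * (\<Sum>p\<in>lag_pairs 0 n n. lag_weight (snd p) * \<gamma> (int (snd p)))"
    and "expectation (\<lambda>\<omega>. ((S n \<omega>)\<^sup>2)\<^sup>2) \<le> 8 * (2 * G\<^sup>2 + K) * (real n + 1) * real n + 2 * (expectation (\<lambda>\<omega>. (S n \<omega>)\<^sup>2))\<^sup>2"
proof -
  define e where "e = 2 * (\<Sum>p\<in>lag_pairs 0 n n. lag_weight (snd p) * \<gamma> (int (snd p)))"
  have S2: "(S n \<omega>)\<^sup>2 = 2 * U n n \<omega> + e" for \<omega>
    unfolding S_def square_sum_lag_pairs e_def lag_pairs_sum_Y by simp
  have xi_int: "integrable M (\<xi> p)" for p
    unfolding \<xi>_def[abs_def] by (intro Bochner_Integration.integrable_diff int_prod2) simp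
  have xi0: "expectation (\<xi> p) = 0" for p
    unfolding \<xi>_def[abs_def] by (simp add: int_prod2 Y_cov gamma_minus prob_space)
  have U_int: "integrable M (U n n)"
    unfolding U_def[abs_def] by (intro Bochner_Integration.integrable_sum integrable_mult_right xi_int)
  have U0: "expectation (U n n) = 0" unfolding U_def[abs_def] by (simp add: xi_int xi0)
  have U2_int: "integrable M (\<lambda>\<omega>. (U n n \<omega>)\<^sup>2)" using U_diff_int[of n n 0] by (simp add: U_0)
  have U2: "expectation (\<lambda>\<omega>. (U n n \<omega>)\<^sup>2) \<le> (2 * G\<^sup>2 + K) * (real n + 1) * real n"
    using U_diff_bound[of 0 n n] by (simp add: U_0)
  show "integrable M (\<lambda>\<omega>. (S n \<omega>)\<^sup>2)" unfolding S2 using U_int by simp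
  have ex: "expectation (\<lambda>\<omega>. (S n \<omega>)\<^sup>2) = e" unfolding S2 using U_int U0 by (simp add: prob_space)
  then show "expectation (\<lambda>\<omega>. (S n \<omega>)\<^sup>2) = 2 * (\<Sum>p\<in>lag_pairs 0 n n. lag_weight (snd p) * \<gamma> (int (snd p)))"
    by (simp add: e_def)
  have S4: "((S n \<omega>)\<^sup>2)\<^sup>2 = 4 * (U n n \<omega>)\<^sup>2 + 4 * e * U n n \<omega> + e\<^sup>2" for \<omega>
    unfolding S2 by (simp add: power2_sum power_mult_distrib)
  show "integrable M (\<lambda>\<omega>. ((S n \<omega>)\<^sup>2)\<^sup>2)" unfolding S4 using U_int U2_int by simp
  have "expectation (\<lambda>\<omega>. ((S n \<omega>)\<^sup>2)\<^sup>2) = 4 * expectation (\<lambda>\<omega>. (U n n \<omega>)\<^sup>2) + e\<^sup>2"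
    unfolding S4 using U_int U2_int U0 by (simp add: prob_space)
  also have "\<dots> \<le> 8 * ((2 * G\<^sup>2 + K) * (real n + 1) * real n) + 2 * e\<^sup>2"
  proof -
    have "0 \<le> (2 * G\<^sup>2 + K) * (real n + 1) * real n" using K_nonneg by simp
    then show ?thesis using U2 zero_le_power2[of e] by linarith
  qed
  finally show "expectation (\<lambda>\<omega>. ((S n \<omega>)\<^sup>2)\<^sup>2) \<le> 8 * (2 * G\<^sup>2 + K) * (real n + 1) * real n + 2 * (expectation (\<lambda>\<omega>. (S n \<omega>)\<^sup>2))\<^sup>2"
    unfolding ex by (simp only: mult.assoc)
qed

end

section \<open>Composed test functionals and the moment structure of stationary sequences\<close>

lemma supnorm_continuous_pair:
  fixes f :: "real \<times> real \<Rightarrow> real"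
  assumes f: "continuous_on UNIV f" and F: "supnorm_continuous F1" "supnorm_continuous F2"
  shows "supnorm_continuous (\<lambda>x. f (F1 x, F2 x))"
  unfolding supnorm_continuous_def
proof (intro ballI allI impI)
  fix x and e :: real assume x: "x \<in> cadlag01" and e: "e > 0"
  have "\<exists>d>0. \<forall>z. dist z (F1 x, F2 x) < d \<longrightarrow> dist (f z) (f (F1 x, F2 x)) < e"
    using f e unfolding continuous_on_iff by blast
  then obtain d where d: "d > 0" "\<And>z. dist z (F1 x, F2 x) < d \<Longrightarrow> dist (f z) (f (F1 x, F2 x)) < e" by blast
  have d2: "d/2 > 0" using d(1) by simp
  obtain d1 where d1: "d1 > 0" "\<And>y. y \<in> cadlag01 \<Longrightarrow> (\<And>t. t \<in> {0..1} \<Longrightarrow> \<bar>x t - y t\<bar> < d1) \<Longrightarrow> \<bar>F1 x - F1 y\<bar> < d/2"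
    using supnorm_continuousD[OF F(1) x d2] by metis
  obtain d2 where d2: "d2 > 0" "\<And>y. y \<in> cadlag01 \<Longrightarrow> (\<And>t. t \<in> {0..1} \<Longrightarrow> \<bar>x t - y t\<bar> < d2) \<Longrightarrow> \<bar>F2 x - F2 y\<bar> < d/2"
    using supnorm_continuousD[OF F(2) x d2] by metis
  show "\<exists>d>0. \<forall>y\<in>cadlag01. (\<forall>t\<in>{0..1}. \<bar>x t - y t\<bar> < d) \<longrightarrow> \<bar>f (F1 x, F2 x) - f (F1 y, F2 y)\<bar> < e"
  proof (rule exI[of _ "min d1 d2"], intro conjI ballI impI)
    fix y assume y: "y \<in> cadlag01" "\<forall>t\<in>{0..1}. \<bar>x t - y t\<bar> < min d1 d2"
    have 1: "\<bar>F1 x - F1 y\<bar> < d/2" by (rule d1(2)) (use y in auto)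
    have 2: "\<bar>F2 x - F2 y\<bar> < d/2" by (rule d2(2)) (use y in auto)
    have "dist (F1 y, F2 y) (F1 x, F2 x) \<le> dist (F1 y) (F1 x) + dist (F2 y) (F2 x)"
      unfolding dist_prod_def by (simp add: sqrt_sum_squares_le_sum)
    also have "\<dots> < d" using 1 2 unfolding dist_real_def by linarith
    finally have "dist (f (F1 y, F2 y)) (f (F1 x, F2 x)) < e" by (rule d(2))
    then show "\<bar>f (F1 x, F2 x) - f (F1 y, F2 y)\<bar> < e" by (simp add: dist_real_def abs_minus_commute)
  qed (use d1 d2 in auto)
qed

lemma supnorm_continuous_compose:
  fixes h :: "real \<Rightarrow> real"
  assumes h: "continuous_on UNIV h" and F: "supnorm_continuous F"
  shows "supnorm_continuous (\<lambda>x. h (F x))"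
proof -
  have "continuous_on UNIV (\<lambda>z :: real \<times> real. h (fst z))"
    by (rule continuous_on_compose2[OF h]) (auto intro: continuous_intros)
  from supnorm_continuous_pair[OF this F F] show ?thesis by simp
qed

lemma supnorm_continuous_eval:
  assumes "t \<in> {0..1}"
  shows "supnorm_continuous (\<lambda>x. x t)"
  unfolding supnorm_continuous_def
proof (intro ballI allI impI)
  fix x and e :: real assume e: "e > 0"
  show "\<exists>d>0. \<forall>y\<in>cadlag01. (\<forall>t\<in>{0..1}. \<bar>x t - y t\<bar> < d) \<longrightarrow> \<bar>x t - y t\<bar> < e"
    by (rule exI[of _ e]) (use e assms in auto)
qed

text \<open>A shift by \<open>a\<close> brings every product to the form occurring in
  \<open>autocov\<close> and \<open>cumulant4\<close>. The summability assumptions enter through the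
  bounds they give for finite partial sums.\<close>

lemma weak_dep_of_stationary:
  assumes M: "prob_space M" and stat: "fourth_order_stationary M Y"
    and gamma_sum: "(\<lambda>j. \<bar>autocov M Y j\<bar>) summable_on UNIV"
    and kappa_sum: "\<And>h. (\<lambda>(r, s). \<bar>cumulant4 M Y h r s\<bar>) summable_on UNIV"
      "\<And>h. (\<Sum>\<^sub>\<infinity>(r, s). \<bar>cumulant4 M Y h r s\<bar>) \<le> C"
  shows "weak_dep M Y (autocov M Y) (cumulant4 M Y) (\<Sum>\<^sub>\<infinity>j. \<bar>autocov M Y j\<bar>) C"
proof -
  interpret prob_space M by fact
  have st: "(\<integral>\<omega>. prod_list (map (\<lambda>k. Y (k + h) \<omega>) ks) \<partial>M) = (\<integral>\<omega>. prod_list (map (\<lambda>k. Y k \<omega>) ks) \<partial>M)"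
    if "length ks \<le> 4" for ks h
    using stat that unfolding fourth_order_stationary_def by blast
  have cov: "expectation (\<lambda>\<omega>. Y i \<omega> * Y j \<omega>) = autocov M Y (j - i)" for i j
    using st[of "[0, j - i]" i] by (simp add: autocov_def)
  have sym: "autocov M Y (- j) = autocov M Y j" for j
    using cov[of j 0] by (simp add: autocov_def mult.commute)
  show ?thesis
  proof unfold_locales
    fix a b c d
    have "expectation (\<lambda>\<omega>. Y a \<omega> * Y b \<omega> * (Y c \<omega> * Y d \<omega>)) =
      expectation (\<lambda>\<omega>. Y 0 \<omega> * Y (b - a) \<omega> * Y (c - a) \<omega> * Y (d - a) \<omega>)"
      using st[of "[0, b - a, c - a, d - a]" a] by (simp add: mult.assoc)
    then show "expectation (\<lambda>\<omega>. Y a \<omega> * Y b \<omega> * (Y c \<omega> * Y d \<omega>)) =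
        autocov M Y (b - a) * autocov M Y (d - c) + autocov M Y (c - a) * autocov M Y (d - b) +
        autocov M Y (d - a) * autocov M Y (c - b) + cumulant4 M Y (b - a) (c - a) (d - a)"
      using sym[of "d - c"] sym[of "d - b"] sym[of "c - b"] by (simp add: cumulant4_def)
  next
    fix h and F :: "(int \<times> int) set" assume "finite F"
    then have "(\<Sum>(r, s)\<in>F. \<bar>cumulant4 M Y h r s\<bar>) \<le> (\<Sum>\<^sub>\<infinity>(r, s). \<bar>cumulant4 M Y h r s\<bar>)"
      by (intro finite_sum_le_infsum kappa_sum(1)) auto
    then show "(\<Sum>(r, s)\<in>F. \<bar>cumulant4 M Y h r s\<bar>) \<le> C" using kappa_sum(2)[of h] by linarith
  next
    fix F :: "int set" assume "finite F"
    then show "(\<Sum>j\<in>F. \<bar>autocov M Y j\<bar>) \<le> (\<Sum>\<^sub>\<infinity>j. \<bar>autocov M Y j\<bar>)"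
      by (intro finite_sum_le_infsum gamma_sum) auto
  qed (use stat cov in \<open>auto simp: fourth_order_stationary_def\<close>)
qed

lemma (in weak_dep) gamma_summable: "summable (\<lambda>j. \<bar>\<gamma> (int j)\<bar>)"
proof (rule bounded_imp_summable[where B=G])
  fix n
  have "(\<Sum>j\<le>n. \<bar>\<gamma> (int j)\<bar>) = (\<Sum>j\<in>int ` {..n}. \<bar>\<gamma> j\<bar>)" by (simp add: sum.reindex)
  also have "\<dots> \<le> G" by (rule gamma_bound) simp
  finally show "(\<Sum>j\<le>n. \<bar>\<gamma> (int j)\<bar>) \<le> G" .
qed simp

section \<open>Identification of the long-run variance\<close>

text \<open>\<open>X - min X L\<close> vanishes while \<open>X \<le> L\<close> and is at most
  \<open>X^2 / L\<close> above that level.\<close>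

lemma (in prob_space) min_expectation_tail:
  fixes X :: "'a \<Rightarrow> real"
  assumes [measurable]: "X \<in> borel_measurable M" and nn: "\<And>\<omega>. 0 \<le> X \<omega>"
    and int: "integrable M X" "integrable M (\<lambda>\<omega>. (X \<omega>)\<^sup>2)" and L: "L > 0"
  shows "\<bar>expectation X - expectation (\<lambda>\<omega>. min (X \<omega>) L)\<bar> \<le> expectation (\<lambda>\<omega>. (X \<omega>)\<^sup>2) / L"
proof -
  have im: "integrable M (\<lambda>\<omega>. min (X \<omega>) L)"
    by (rule Bochner_Integration.integrable_bound[OF int(1)]) (use nn L in \<open>auto simp: min_def\<close>)
  have b: "0 \<le> X \<omega> - min (X \<omega>) L" "X \<omega> - min (X \<omega>) L \<le> (X \<omega>)\<^sup>2 / L" for \<omega>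
  proof -
    show "0 \<le> X \<omega> - min (X \<omega>) L" by simp
    show "X \<omega> - min (X \<omega>) L \<le> (X \<omega>)\<^sup>2 / L"
    proof (cases "X \<omega> \<le> L")
      case True then show ?thesis using L by simp
    next
      case False
      then have "X \<omega> * L \<le> X \<omega> * X \<omega>" using nn[of \<omega>] by (intro mult_left_mono) auto
      then have "X \<omega> \<le> (X \<omega>)\<^sup>2 / L" using L by (simp add: pos_le_divide_eq power2_eq_square)
      then show ?thesis using False L by simp
    qed
  qed
  have "expectation X - expectation (\<lambda>\<omega>. min (X \<omega>) L) = expectation (\<lambda>\<omega>. X \<omega> - min (X \<omega>) L)"
    using int im by simp
  moreover have "0 \<le> expectation (\<lambda>\<omega>. X \<omega> - min (X \<omega>) L)" by (rule Bochner_Integration.integral_nonneg) (rule b)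
  moreover have "expectation (\<lambda>\<omega>. X \<omega> - min (X \<omega>) L) \<le> expectation (\<lambda>\<omega>. (X \<omega>)\<^sup>2 / L)"
    by (rule integral_mono) (use int im b in auto)
  ultimately show ?thesis by simp
qed

lemma wiener_square_moment:
  assumes N: "prob_space N" and W: "wiener_process01 N W"
  shows "integrable N (\<lambda>\<omega>. (W 1 \<omega>)\<^sup>2)" "(\<integral>\<omega>. (W 1 \<omega>)\<^sup>2 \<partial>N) = 1"
proof -
  interpret N: prob_space N by fact
  have "centered_normal N (\<lambda>\<omega>. \<Sum>i\<in>{0::nat}. 1 * W 1 \<omega>) (\<Sum>i\<in>{0::nat}. \<Sum>j\<in>{0::nat}. 1 * 1 * min 1 1)"
    by (rule gaussian_process01_finite_sum[OF W[unfolded wiener_process01_def], of "{0::nat}" "\<lambda>_. 1" "\<lambda>_. 1"]) auto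
  then have D: "distributed N lborel (W 1) std_normal_density" by (simp add: centered_normal_def)
  have m: "integrable lborel (\<lambda>x. std_normal_density x * x\<^sup>2)" by (rule integrable_std_normal_moment)
  show "integrable N (\<lambda>\<omega>. (W 1 \<omega>)\<^sup>2)"
    using distributed_integrable[OF D, of "\<lambda>x. x\<^sup>2"] m by simp
  have "N.variance (W 1) = 1\<^sup>2" by (rule N.normal_distributed_variance[OF _ D]) simp
  moreover have "N.expectation (W 1) = 0" by (rule N.standard_normal_distributed_expectation[OF D])
  ultimately show "(\<integral>\<omega>. (W 1 \<omega>)\<^sup>2 \<partial>N) = 1" by simp
qed

text \<open>Convergence in distribution controls truncated second moments of the normalized sum, and
  the bounded fourth moments make the truncation error at most \<open>A / L\<close> uniformly in
  \<open>n \<ge> 1\<close>. Hence \<open>lrv \<gamma>\<close> and the truncated second moment of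
  \<open>\<sigma> W 1\<close> differ by at most \<open>A / L\<close>, and \<open>L\<close> tends to
  infinity.\<close>

lemma (in weak_dep) lrv_eq_variance:
  assumes N: "prob_space N" and W: "wiener_process01 N W"
    and fclt: "conv_dist_D01 M
                 (\<lambda>n \<omega> t. (1 / sqrt (real n)) * (\<Sum>j\<in>{1..nat \<lfloor>real n * t\<rfloor>}. Y (int j) \<omega>))
                 N (\<lambda>\<omega> t. \<sigma> * W t \<omega>)"
  shows "lrv \<gamma> = \<sigma>\<^sup>2"
proof -
  interpret N: prob_space N by fact
  define V where "V n i \<omega> = (1 / sqrt (real n)) * (\<Sum>j\<in>{1..i}. Y (int j) \<omega>)" for n i \<omega>
  have Vm: "V n i \<in> borel_measurable M" for n i unfolding V_def[abs_def] by measurable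
  have Wm: "\<And>t. t \<in> {0..1} \<Longrightarrow> W t \<in> borel_measurable N"
    and Wc: "\<And>\<omega>. \<omega> \<in> space N \<Longrightarrow> continuous_on {0..1} (\<lambda>t. W t \<omega>)"
    using W by (auto simp: wiener_process01_def gaussian_process01_def)
  define X where "X n \<omega> = (V n n \<omega>)\<^sup>2" for n \<omega>
  have X_eq: "X n \<omega> = (\<Sum>j=1..n. Y (int j) \<omega>)\<^sup>2 / real n" for n \<omega>
    by (simp add: X_def V_def power_mult_distrib power_divide)
  have X_int: "integrable M (X n)" "integrable M (\<lambda>\<omega>. (X n \<omega>)\<^sup>2)" for n
    unfolding X_eq power_divide using partial_sum_moments(1,2)[of n] by (simp_all only: integrable_divide)
  have EX: "expectation (X n) = 2 / real n * (\<Sum>p\<in>lag_pairs 0 n n. lag_weight (snd p) * \<gamma> (int (snd p)))" for n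
    unfolding X_eq using partial_sum_moments(3)[of n] by simp
  have limX: "(\<lambda>n. expectation (X n)) \<longlonglongrightarrow> lrv \<gamma>"
    unfolding EX by (rule lag_pairs_mean_limit[OF gamma_summable])
  then obtain A1 where A1: "\<And>n. \<bar>expectation (X n)\<bar> \<le> A1"
    using convergent_imp_Bseq[OF convergentI[OF limX]] unfolding Bseq_def by auto
  \<comment> \<open>Bounds the second moment of \<open>X n\<close>: the estimate
    \<open>(n + 1) / n \<le> 2\<close> turns the 8 of \<open>partial_sum_moments\<close> into
    16.\<close>
  define A where "A = 16 * (2 * G\<^sup>2 + K) + 2 * A1\<^sup>2"
  have X2: "expectation (\<lambda>\<omega>. (X n \<omega>)\<^sup>2) \<le> A" if "n \<ge> 1" for n
  proof -
    let ?e = "expectation (\<lambda>\<omega>. (\<Sum>j=1..n. Y (int j) \<omega>)\<^sup>2)"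
    have np: "real n > 0" using that by simp
    have "expectation (\<lambda>\<omega>. (X n \<omega>)\<^sup>2) = expectation (\<lambda>\<omega>. ((\<Sum>j=1..n. Y (int j) \<omega>)\<^sup>2)\<^sup>2) / (real n)\<^sup>2"
      unfolding X_eq power_divide by (rule integral_divide_zero)
    also have "\<dots> \<le> (8 * (2 * G\<^sup>2 + K) * (real n + 1) * real n + 2 * ?e\<^sup>2) / (real n)\<^sup>2"
      by (intro divide_right_mono partial_sum_moments(4)) simp
    also have "\<dots> = 8 * (2 * G\<^sup>2 + K) * ((real n + 1) / real n) + 2 * (?e / real n)\<^sup>2"
    proof -
      have "(k * (x + 1) * x + 2 * e\<^sup>2) / x\<^sup>2 = k * ((x + 1) / x) + 2 * (e / x)\<^sup>2" if "x > 0" for k x e :: real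
        using that by (simp add: field_simps power2_eq_square)
      then show ?thesis using np by blast
    qed
    also have "?e / real n = expectation (X n)" unfolding X_eq by simp
    also have "8 * (2 * G\<^sup>2 + K) * ((real n + 1) / real n) + 2 * (expectation (X n))\<^sup>2 \<le> 8 * (2 * G\<^sup>2 + K) * 2 + 2 * A1\<^sup>2"
    proof (intro add_mono mult_left_mono)
      show "(real n + 1) / real n \<le> 2" using that by (simp add: field_simps)
      show "(expectation (X n))\<^sup>2 \<le> A1\<^sup>2" using A1[of n] by (metis abs_ge_zero power2_abs power_mono)
    qed (use K_nonneg in auto)
    finally show ?thesis by (simp add: A_def)
  qed
  have key: "\<bar>lrv \<gamma> - (\<integral>\<omega>. min ((\<sigma> * W 1 \<omega>)\<^sup>2) L \<partial>N)\<bar> \<le> A / L" if L: "L > 0" for L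
  proof -
    have hc: "continuous_on UNIV (\<lambda>u::real. min (u\<^sup>2) L)" by (intro continuous_intros)
    have sc: "supnorm_continuous (\<lambda>x. min ((x 1)\<^sup>2) L)"
      by (rule supnorm_continuous_compose[OF hc supnorm_continuous_eval]) simp
    have "(\<lambda>n. \<integral>\<omega>. min ((V n (nat \<lfloor>real n * 1\<rfloor>) \<omega>)\<^sup>2) L \<partial>M) \<longlonglongrightarrow> (\<integral>\<omega>. min ((\<sigma> * W 1 \<omega>)\<^sup>2) L \<partial>N)"
    proof (rule conv_dist_D01_supnorm_continuous[OF prob_space_axioms N _ Vm _ _ sc, where C=L])
      show "conv_dist_D01 M (\<lambda>n \<omega> t. V n (nat \<lfloor>real n * t\<rfloor>) \<omega>) N (\<lambda>\<omega> t. \<sigma> * W t \<omega>)"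
        using fclt unfolding V_def .
      show "(\<lambda>\<omega>. \<sigma> * W t \<omega>) \<in> borel_measurable N" if "t \<in> {0..1}" for t
        using Wm[OF that] by measurable
      show "continuous_on {0..1} (\<lambda>t. \<sigma> * W t \<omega>)" if "\<omega> \<in> space N" for \<omega>
        by (intro continuous_intros Wc that)
      show "\<bar>min ((x 1)\<^sup>2) L\<bar> \<le> L" for x :: "real \<Rightarrow> real" using L by (auto simp: min_def)
    qed
    then have l1: "(\<lambda>n. expectation (\<lambda>\<omega>. min (X n \<omega>) L)) \<longlonglongrightarrow> (\<integral>\<omega>. min ((\<sigma> * W 1 \<omega>)\<^sup>2) L \<partial>N)"
      by (simp add: X_def)
    have "(\<lambda>n. \<bar>expectation (X n) - expectation (\<lambda>\<omega>. min (X n \<omega>) L)\<bar>) \<longlonglongrightarrow> \<bar>lrv \<gamma> - (\<integral>\<omega>. min ((\<sigma> * W 1 \<omega>)\<^sup>2) L \<partial>N)\<bar>"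
      by (intro tendsto_intros limX l1)
    moreover have "eventually (\<lambda>n. \<bar>expectation (X n) - expectation (\<lambda>\<omega>. min (X n \<omega>) L)\<bar> \<le> A / L) sequentially"
      using eventually_ge_at_top[of 1]
    proof eventually_elim
      case (elim n)
      have "\<bar>expectation (X n) - expectation (\<lambda>\<omega>. min (X n \<omega>) L)\<bar> \<le> expectation (\<lambda>\<omega>. (X n \<omega>)\<^sup>2) / L"
        by (rule min_expectation_tail) (use X_int L in \<open>auto simp: X_def\<close>)
      also have "\<dots> \<le> A / L" using X2[OF elim] L by (simp add: divide_right_mono)
      finally show ?case .
    qed
    ultimately show ?thesis by (rule tendsto_upperbound) simp
  qed
  have "(\<lambda>L. \<integral>\<omega>. min ((\<sigma> * W 1 \<omega>)\<^sup>2) (real (Suc L)) \<partial>N) \<longlonglongrightarrow> (\<integral>\<omega>. (\<sigma> * W 1 \<omega>)\<^sup>2 \<partial>N)"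
  proof (rule integral_dominated_convergence[where w="\<lambda>\<omega>. (\<sigma> * W 1 \<omega>)\<^sup>2"])
    have [measurable]: "W 1 \<in> borel_measurable N" by (rule Wm) simp
    show "(\<lambda>\<omega>. (\<sigma> * W 1 \<omega>)\<^sup>2) \<in> borel_measurable N" by measurable
    show "(\<lambda>\<omega>. min ((\<sigma> * W 1 \<omega>)\<^sup>2) (real (Suc L))) \<in> borel_measurable N" for L by measurable
    show "integrable N (\<lambda>\<omega>. (\<sigma> * W 1 \<omega>)\<^sup>2)"
      unfolding power_mult_distrib using wiener_square_moment(1)[OF N W] by simp
    show "AE \<omega> in N. (\<lambda>L. min ((\<sigma> * W 1 \<omega>)\<^sup>2) (real (Suc L))) \<longlonglongrightarrow> (\<sigma> * W 1 \<omega>)\<^sup>2"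
    proof (rule AE_I2, rule tendsto_eventually)
      fix \<omega>
      have "eventually (\<lambda>L. L \<ge> nat \<lceil>(\<sigma> * W 1 \<omega>)\<^sup>2\<rceil>) sequentially" by (rule eventually_ge_at_top)
      then show "eventually (\<lambda>L. min ((\<sigma> * W 1 \<omega>)\<^sup>2) (real (Suc L)) = (\<sigma> * W 1 \<omega>)\<^sup>2) sequentially"
      proof eventually_elim
        case (elim L)
        then have "(\<sigma> * W 1 \<omega>)\<^sup>2 \<le> real (Suc L)" by linarith
        then show ?case by simp
      qed
    qed
  qed (auto simp: min_def)
  moreover have "(\<integral>\<omega>. (\<sigma> * W 1 \<omega>)\<^sup>2 \<partial>N) = \<sigma>\<^sup>2"
    unfolding power_mult_distrib using wiener_square_moment[OF N W] by simp
  ultimately have lim: "(\<lambda>L. \<bar>lrv \<gamma> - (\<integral>\<omega>. min ((\<sigma> * W 1 \<omega>)\<^sup>2) (real (Suc L)) \<partial>N)\<bar>) \<longlonglongrightarrow> \<bar>lrv \<gamma> - \<sigma>\<^sup>2\<bar>"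
    by (intro tendsto_intros) simp
  have "(\<lambda>L. A * (1 / real (Suc L))) \<longlonglongrightarrow> A * 0"
    by (intro tendsto_intros LIMSEQ_Suc lim_1_over_n)
  then have "\<bar>lrv \<gamma> - \<sigma>\<^sup>2\<bar> \<le> 0"
    using tendsto_le[OF _ _ lim, of "\<lambda>L. A * (1 / real (Suc L))" 0] key[of "real (Suc _)"] by simp
  then show ?thesis by simp
qed

section \<open>Growth of the bandwidth\<close>

lemma doubling_power:
  fixes q :: "nat \<Rightarrow> nat" and C :: real
  assumes "\<And>k. real (q (2 ^ (k + 1))) \<le> C * real (q (2 ^ k))" "C \<ge> 0"
  shows "real (q (2 ^ (k + j))) \<le> C ^ j * real (q (2 ^ k))"
proof (induction j)
  case (Suc j)
  have "real (q (2 ^ (k + Suc j))) \<le> C * real (q (2 ^ (k + j)))" using assms(1)[of "k + j"] by simp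
  also have "\<dots> \<le> C * (C ^ j * real (q (2 ^ k)))" by (rule mult_left_mono[OF Suc assms(2)])
  finally show ?case by (simp add: mult_ac)
qed simp

text \<open>If the ceiling of \<open>c n\<close> lies between \<open>2^k\<close> and
  \<open>2^(k+1)\<close>, then \<open>n \<le> 2^(k+J)\<close> as soon as \<open>2^J > 2 / c\<close>.
  A fixed number of doublings thus leads from \<open>c n\<close> to \<open>n\<close>.\<close>

lemma doubling_ratio:
  fixes q :: "nat \<Rightarrow> nat" and c :: real
  assumes mono: "mono q" and doubling: "\<exists>C. \<forall>k. real (q (2 ^ (k + 1))) \<le> C * real (q (2 ^ k))" and c: "c > 0"
  obtains D where "D \<ge> 1" "\<And>n. c * real n \<ge> 1 \<Longrightarrow> real (q n) + 1 \<le> D * (real (q (nat \<lceil>c * real n\<rceil>)) + 1)"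
proof -
  obtain C0 where C0: "\<And>k. real (q (2 ^ (k + 1))) \<le> C0 * real (q (2 ^ k))" using doubling by blast
  define C where "C = max C0 1"
  have C1: "C \<ge> 1" by (simp add: C_def)
  have C: "real (q (2 ^ (k + 1))) \<le> C * real (q (2 ^ k))" for k
  proof -
    have "C0 * real (q (2 ^ k)) \<le> C * real (q (2 ^ k))" by (rule mult_right_mono) (simp_all add: C_def)
    then show ?thesis using C0[of k] by linarith
  qed
  obtain J where J: "2 / c < 2 ^ J" using real_arch_pow[of 2 "2 / c"] by auto
  show ?thesis
  proof (rule that[of "C ^ J"])
    show "C ^ J \<ge> 1" using C1 by (rule one_le_power)
    fix n assume n: "c * real n \<ge> 1"
    define a where "a = nat \<lceil>c * real n\<rceil>"
    have a1: "a \<ge> 1" using n unfolding a_def by linarith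
    obtain k where k: "2 ^ k \<le> a" "a < 2 ^ (k + 1)" using ex_power_ivl1[of 2 a] a1 by auto
    have "c * real n \<le> real a" unfolding a_def by linarith
    also have "real a < 2 ^ (k + 1)" using k(2) by (metis of_nat_less_iff of_nat_numeral of_nat_power)
    finally have "c * real n < 2 * 2 ^ k" by simp
    then have "real n < (2 / c) * 2 ^ k" using c by (simp add: field_simps)
    also have "\<dots> \<le> 2 ^ J * 2 ^ k" using J by (intro mult_right_mono) auto
    also have "\<dots> = real (2 ^ (k + J))" by (simp add: power_add)
    finally have "n \<le> 2 ^ (k + J)" by linarith
    then have "real (q n) \<le> real (q (2 ^ (k + J)))" using monoD[OF mono] by simp
    also have "\<dots> \<le> C ^ J * real (q (2 ^ k))" by (rule doubling_power[OF C]) (use C1 in simp)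
    also have "\<dots> \<le> C ^ J * real (q a)" using monoD[OF mono k(1)] C1 by (intro mult_left_mono) auto
    finally have "real (q n) \<le> C ^ J * real (q a)" .
    moreover have "1 \<le> C ^ J" using C1 by (rule one_le_power)
    ultimately show "real (q n) + 1 \<le> C ^ J * (real (q (nat \<lceil>c * real n\<rceil>)) + 1)"
      unfolding a_def by (simp add: distrib_left)
  qed
qed

definition log_ceil :: "nat \<Rightarrow> nat" where "log_ceil n = nat \<lceil>log 2 (real n)\<rceil>"

lemma log_ceil_bounds:
  assumes "n \<ge> 1"
  shows "n \<le> 2 ^ log_ceil n" "(2::real) ^ log_ceil n \<le> 2 * real n" "real (log_ceil n) \<le> ln (real n) / ln 2 + 1"
proof -
  have nn: "0 \<le> log 2 (real n)" using assms by simp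
  have l: "log 2 (real n) \<le> real (log_ceil n)" "real (log_ceil n) \<le> log 2 (real n) + 1"
    using nn unfolding log_ceil_def by linarith+
  have n: "2 powr log 2 (real n) = real n" using assms by simp
  have "real n \<le> 2 powr real (log_ceil n)" using l(1) n by (metis powr_mono one_le_numeral)
  then have "real n \<le> real (2 ^ log_ceil n)" by (simp add: powr_realpow)
  then show "n \<le> 2 ^ log_ceil n" by linarith
  have "2 powr real (log_ceil n) \<le> 2 powr (log 2 (real n) + 1)" using l(2) by (intro powr_mono) auto
  then show "(2::real) ^ log_ceil n \<le> 2 * real n" by (simp add: powr_realpow powr_add n)
  show "real (log_ceil n) \<le> ln (real n) / ln 2 + 1" using l(2) by (simp add: log_def)
qed

text \<open>With \<open>L = ln n\<close> the assumption gives
  \<open>q L^2 / n \<le> C / L^2\<close>, and the 1 added to the bandwidth costs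
  \<open>L^2 / n\<close>; both vanish.\<close>

lemma bandwidth_log_limit:
  fixes q :: "nat \<Rightarrow> nat"
  assumes q_log: "\<exists>C. \<forall>n. real (q n) * (ln (real n)) ^ 4 \<le> C * real n"
  shows "(\<lambda>n. (real (q n) + 1) * (real (log_ceil n) + 1)\<^sup>2 / real n) \<longlonglongrightarrow> 0"
proof -
  obtain C where C: "\<And>n. real (q n) * (ln (real n)) ^ 4 \<le> C * real n" using q_log by blast
  have lnlim: "filterlim (\<lambda>n::nat. ln (real n)) at_top sequentially"
    by (rule filterlim_compose[OF ln_at_top filterlim_real_sequentially])
  have sq: "(\<lambda>n. (ln (real n) / real n powr (1/2))\<^sup>2) \<longlonglongrightarrow> 0\<^sup>2"
    by (intro tendsto_power lim_ln_over_power) simp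
  have inv: "(\<lambda>n. inverse (ln (real n))) \<longlonglongrightarrow> 0" by (rule tendsto_inverse_0_at_top[OF lnlim])
  have lim: "(\<lambda>n. 16 * C * (inverse (ln (real n)))\<^sup>2 + 16 * (ln (real n) / real n powr (1/2))\<^sup>2) \<longlonglongrightarrow> 16 * C * 0\<^sup>2 + 16 * 0\<^sup>2"
    by (intro tendsto_intros inv sq tendsto_power[OF inv])
  show ?thesis
  proof (rule tendsto_sandwich[OF _ _ tendsto_const])
    show "(\<lambda>n. 16 * C * (inverse (ln (real n)))\<^sup>2 + 16 * (ln (real n) / real n powr (1/2))\<^sup>2) \<longlonglongrightarrow> 0"
      using lim by simp
    show "eventually (\<lambda>n. 0 \<le> (real (q n) + 1) * (real (log_ceil n) + 1)\<^sup>2 / real n) sequentially" by simp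
    have "eventually (\<lambda>n. ln (real n) \<ge> 2) sequentially" using lnlim by (simp add: filterlim_at_top)
    then show "eventually (\<lambda>n. (real (q n) + 1) * (real (log_ceil n) + 1)\<^sup>2 / real n
        \<le> 16 * C * (inverse (ln (real n)))\<^sup>2 + 16 * (ln (real n) / real n powr (1/2))\<^sup>2) sequentially"
      using eventually_ge_at_top[of 1]
    proof eventually_elim
      case (elim n)
      define L where "L = ln (real n)"
      have L: "L \<ge> 2" using elim by (simp add: L_def)
      have np: "real n > 0" using elim by simp
      \<comment> \<open>Passing from the binary to the natural logarithm costs a factor of at most
        2; the rounding and the added 1 are absorbed into \<open>4 L\<close>.\<close>
      have "1 / 2 \<le> ln (2::real)" using ln_2_less_1 ln_add_one_self_le_self2[of "-1/2"] ln_div[of 1 2] by simp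
      then have "L / ln 2 \<le> 2 * L" using L by (simp add: field_simps)
      then have m: "real (log_ceil n) + 1 \<le> 4 * L"
        using log_ceil_bounds(3)[of n] elim L by (simp add: L_def)
      have "(real (log_ceil n) + 1)\<^sup>2 \<le> (4 * L)\<^sup>2" by (rule power_mono[OF m]) simp
      then have m2: "(real (log_ceil n) + 1)\<^sup>2 \<le> 16 * L\<^sup>2" by (simp add: power_mult_distrib)
      have "(real (q n) + 1) * (real (log_ceil n) + 1)\<^sup>2 / real n \<le> (real (q n) + 1) * (16 * L\<^sup>2) / real n"
        by (intro divide_right_mono mult_left_mono m2) auto
      also have "\<dots> = 16 * (real (q n) * L\<^sup>2 / real n) + 16 * (L\<^sup>2 / real n)"
        by (simp add: distrib_right add_divide_distrib)
      also have "real (q n) * L\<^sup>2 / real n \<le> C * (inverse L)\<^sup>2"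
      proof -
        have L2: "L\<^sup>2 > 0" using L by simp
        have "real (q n) * (L\<^sup>2 * L\<^sup>2) \<le> C * real n" using C[of n] by (simp add: L_def flip: power_add)
        then have "(real (q n) * L\<^sup>2) * L\<^sup>2 \<le> C * real n" by (simp only: mult.assoc)
        then have "real (q n) * L\<^sup>2 \<le> C * real n / L\<^sup>2" by (simp only: pos_le_divide_eq[OF L2])
        also have "\<dots> = (C * (inverse L)\<^sup>2) * real n" by (simp add: power_inverse divide_inverse)
        finally show ?thesis by (simp only: pos_divide_le_eq[OF np])
      qed
      also have "L\<^sup>2 / real n = (L / real n powr (1/2))\<^sup>2"
        using np by (simp add: power_divide powr_half_sqrt)
      finally show ?case by (simp add: L_def mult.assoc)
    qed
  qed
qed

text \<open>This is the probability bound of \<open>bartlett_form_uniform\<close> up to constants.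
  Doubling cancels two of the three powers of \<open>q n + 1\<close> against the bandwidth at
  \<open>c n\<close>, and \<open>2 ^ log_ceil n \<le> 2 n\<close> cancels one of the two powers of
  \<open>n\<close>.\<close>

lemma bandwidth_rate:
  fixes q :: "nat \<Rightarrow> nat" and c :: real
  assumes mono: "mono q" and doubling: "\<exists>C. \<forall>k. real (q (2 ^ (k + 1))) \<le> C * real (q (2 ^ k))"
    and q_log: "\<exists>C. \<forall>n. real (q n) * (ln (real n)) ^ 4 \<le> C * real n" and c: "c > 0"
  shows "(\<lambda>n. 4 * (real (q n) + 1)^3 * (real (log_ceil n) + 1)\<^sup>2 * 2 ^ log_ceil n
      / (c * real n * (real (q (nat \<lceil>c * real n\<rceil>)) + 1))\<^sup>2) \<longlonglongrightarrow> 0"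
proof -
  obtain D where D: "D \<ge> 1" "\<And>n. c * real n \<ge> 1 \<Longrightarrow> real (q n) + 1 \<le> D * (real (q (nat \<lceil>c * real n\<rceil>)) + 1)"
    by (rule doubling_ratio[OF mono doubling c]) (rule that)
  let ?b = "\<lambda>n. (8 * D\<^sup>2 / c\<^sup>2) * ((real (q n) + 1) * (real (log_ceil n) + 1)\<^sup>2 / real n)"
  have lim: "?b \<longlonglongrightarrow> (8 * D\<^sup>2 / c\<^sup>2) * 0"
    by (intro tendsto_intros bandwidth_log_limit q_log)
  show ?thesis
  proof (rule tendsto_sandwich[OF _ _ tendsto_const])
    show "?b \<longlonglongrightarrow> 0" using lim by simp
    show "eventually (\<lambda>n. 0 \<le> 4 * (real (q n) + 1)^3 * (real (log_ceil n) + 1)\<^sup>2 * 2 ^ log_ceil n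
      / (c * real n * (real (q (nat \<lceil>c * real n\<rceil>)) + 1))\<^sup>2) sequentially" by simp
    show "eventually (\<lambda>n. 4 * (real (q n) + 1)^3 * (real (log_ceil n) + 1)\<^sup>2 * 2 ^ log_ceil n
      / (c * real n * (real (q (nat \<lceil>c * real n\<rceil>)) + 1))\<^sup>2 \<le> ?b n) sequentially"
      using eventually_ge_at_top[of "nat \<lceil>1 / c\<rceil> + 1"]
    proof eventually_elim
      case (elim n)
      then have "1 / c \<le> real n" by linarith
      then have cn: "c * real n \<ge> 1" using c by (simp add: field_simps)
      have n1: "n \<ge> 1" using elim by simp
      define Q q0 m where "Q = real (q n) + 1" and "q0 = real (q (nat \<lceil>c * real n\<rceil>)) + 1" and "m = real (log_ceil n) + 1"
      have pos: "Q > 0" "q0 > 0" "real n > 0" using n1 by (auto simp: Q_def q0_def)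
      have Qq: "Q \<le> D * q0" using D(2)[OF cn] by (simp add: Q_def q0_def)
      have "4 * Q^3 * m\<^sup>2 * 2 ^ log_ceil n / (c * real n * q0)\<^sup>2 \<le> 4 * ((D * q0)\<^sup>2 * Q) * m\<^sup>2 * (2 * real n) / (c * real n * q0)\<^sup>2"
      proof (intro divide_right_mono mult_mono)
        have "Q\<^sup>2 \<le> (D * q0)\<^sup>2" using Qq pos by (intro power_mono) auto
        then show "Q^3 \<le> (D * q0)\<^sup>2 * Q" using pos by (simp add: power3_eq_cube power2_eq_square)
        show "2 ^ log_ceil n \<le> 2 * real n" by (rule log_ceil_bounds(2)[OF n1])
      qed (use pos in auto)
      also have "\<dots> = (8 * D\<^sup>2 / c\<^sup>2) * (Q * m\<^sup>2 / real n)"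
        using pos c by (simp add: field_simps power2_eq_square)
      finally show ?case by (simp add: Q_def q0_def m_def)
    qed
  qed
qed

lemma bandwidth_over_n:
  fixes q :: "nat \<Rightarrow> nat"
  assumes q_log: "\<exists>C. \<forall>n. real (q n) * (ln (real n)) ^ 4 \<le> C * real n"
  shows "(\<lambda>n. (real (q n) + 1) / real n) \<longlonglongrightarrow> 0"
proof (rule tendsto_sandwich[OF _ _ tendsto_const bandwidth_log_limit[OF q_log]])
  show "eventually (\<lambda>n. (real (q n) + 1) / real n \<le> (real (q n) + 1) * (real (log_ceil n) + 1)\<^sup>2 / real n) sequentially"
  proof (intro always_eventually allI divide_right_mono)
    fix n
    have "1\<^sup>2 \<le> (real (log_ceil n) + 1)\<^sup>2" by (rule power_mono) auto
    then show "real (q n) + 1 \<le> (real (q n) + 1) * (real (log_ceil n) + 1)\<^sup>2"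
      using mult_left_mono[of 1 "(real (log_ceil n) + 1)\<^sup>2" "real (q n) + 1"] by simp
  qed simp
qed simp

section \<open>Uniform consistency of the Bartlett form\<close>

text \<open>The sequence \<open>Y\<close> is quantified inside \<open>eventually\<close>, so the
  threshold in \<open>n\<close> does not depend on it. The second block calls for this: its reversed
  sequence is reflected at \<open>n + 1\<close> and changes with \<open>n\<close>.\<close>

lemma bartlett_consistency:
  fixes q :: "nat \<Rightarrow> nat" and c \<delta> \<eta> :: real and M :: "'a measure"
  assumes mono: "mono q" and doubling: "\<exists>C. \<forall>k. real (q (2 ^ (k + 1))) \<le> C * real (q (2 ^ k))"
    and q_log: "\<exists>C. \<forall>n. real (q n) * (ln (real n)) ^ 4 \<le> C * real n"
    and q_inf: "filterlim q at_top sequentially" and c: "c > 0" and \<delta>: "\<delta> > 0" and \<eta>: "\<eta> > 0"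
    and gs: "summable (\<lambda>j. \<bar>\<gamma> (int j)\<bar>)"
  shows "eventually (\<lambda>n. \<forall>Y \<kappa>. weak_dep M Y \<gamma> \<kappa> G K \<longrightarrow> (\<exists>E\<in>sets M. measure M E < \<eta> \<and>
     (\<forall>\<omega>\<in>space M - E. \<forall>k. c * real n \<le> real k \<longrightarrow> k \<le> n \<longrightarrow>
        \<bar>bartlett_form (\<lambda>i. Y (int i) \<omega>) k (q k) - lrv \<gamma>\<bar> \<le> \<delta>))) sequentially"
proof -
  have d2: "\<delta>/2 > 0" using \<delta> by simp
  obtain n0 where n0: "\<And>k q. k \<ge> n0 \<Longrightarrow> q \<ge> n0 \<Longrightarrow> \<bar>lag_center \<gamma> k q - lrv \<gamma>\<bar> \<le> \<delta>/2"
    by (rule lag_center_limit[OF gs d2]) (rule that)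
  let ?r = "\<lambda>n. 4 * (real (q n) + 1)^3 * (real (log_ceil n) + 1)\<^sup>2 * 2 ^ log_ceil n
      / (c * real n * (real (q (nat \<lceil>c * real n\<rceil>)) + 1))\<^sup>2"
  have "(\<lambda>n. (2 * G\<^sup>2 + K) * ?r n / (\<delta>/2)\<^sup>2) \<longlonglongrightarrow> (2 * G\<^sup>2 + K) * 0 / (\<delta>/2)\<^sup>2"
    by (intro tendsto_intros bandwidth_rate mono doubling q_log c) (use \<delta> in simp)
  then have e1: "eventually (\<lambda>n. (2 * G\<^sup>2 + K) * ?r n / (\<delta>/2)\<^sup>2 < \<eta>) sequentially"
    using \<eta> by (intro order_tendstoD(2)) simp_all
  have "eventually (\<lambda>k. k \<ge> n0 \<and> q k \<ge> n0) sequentially"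
    using q_inf by (auto simp: filterlim_at_top intro: eventually_conj eventually_ge_at_top)
  then obtain n1 where n1: "\<And>k. k \<ge> n1 \<Longrightarrow> k \<ge> n0 \<and> q k \<ge> n0" by (auto simp: eventually_sequentially)
  show ?thesis using e1 eventually_ge_at_top[of "nat \<lceil>real n1 / c\<rceil> + 1"]
  proof eventually_elim
    case (elim n)
    have nge: "n \<ge> 1" using elim by simp
    have "real n1 / c \<le> real n" using elim(2) by linarith
    then have n1c: "real n1 \<le> c * real n" using c by (simp add: pos_divide_le_eq mult.commute)
    show ?case
    proof (intro allI impI)
      fix Y \<kappa> assume "weak_dep M Y \<gamma> \<kappa> G K"
      then interpret weak_dep M Y \<gamma> \<kappa> G K .
      have q0: "q (nat \<lceil>c * real n\<rceil>) \<le> q k" if "c * real n \<le> real k" for k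
        using monoD[OF mono] that by (simp add: nat_le_iff ceiling_le_iff)
      obtain E where E: "E \<in> events" "prob E \<le> (2 * G\<^sup>2 + K) * ?r n / (\<delta>/2)\<^sup>2"
        "\<And>\<omega> k. \<omega> \<in> space M - E \<Longrightarrow> c * real n \<le> real k \<Longrightarrow> k \<le> n \<Longrightarrow>
          \<bar>bartlett_form (\<lambda>i. Y (int i) \<omega>) k (q k) - lag_center \<gamma> k (q k)\<bar> \<le> \<delta>/2"
        by (rule bartlett_form_uniform[OF c nge log_ceil_bounds(1)[OF nge] mono q0 d2]) (assumption, rule that)
      show "\<exists>E\<in>sets M. measure M E < \<eta> \<and>
         (\<forall>\<omega>\<in>space M - E. \<forall>k. c * real n \<le> real k \<longrightarrow> k \<le> n \<longrightarrow>
          \<bar>bartlett_form (\<lambda>i. Y (int i) \<omega>) k (q k) - lrv \<gamma>\<bar> \<le> \<delta>)"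
      proof (intro bexI[of _ E] conjI ballI allI impI)
        show "prob E < \<eta>" using E(2) elim(1) by linarith
        fix \<omega> k assume w: "\<omega> \<in> space M - E" and k: "c * real n \<le> real k" "k \<le> n"
        have "n1 \<le> k" using n1c k(1) by linarith
        then have "\<bar>lag_center \<gamma> k (q k) - lrv \<gamma>\<bar> \<le> \<delta>/2" using n1 n0 by blast
        then show "\<bar>bartlett_form (\<lambda>i. Y (int i) \<omega>) k (q k) - lrv \<gamma>\<bar> \<le> \<delta>" using E(3)[OF w k] by linarith
      qed (rule E(1))
    qed
  qed
qed

section \<open>Stability of the Bartlett estimator\<close>

definition in_window :: "nat \<Rightarrow> nat \<Rightarrow> nat \<Rightarrow> real" where
  "in_window q t i = of_bool (i \<le> t \<and> t \<le> i + q)"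

text \<open>The sum of \<open>q + 1\<close> consecutive values ending at index \<open>t\<close>,
  clipped to \<open>1..m\<close>. Letting \<open>t\<close> run up to \<open>m + q\<close> puts each
  value into exactly \<open>q + 1\<close> windows.\<close>

definition window_sum :: "(nat \<Rightarrow> real) \<Rightarrow> nat \<Rightarrow> nat \<Rightarrow> nat \<Rightarrow> real" where
  "window_sum y m q t = (\<Sum>i=1..m. y i * in_window q t i)"

text \<open>Bartlett weights make the estimator a mean of squared window sums; hence it is a positive
  semidefinite quadratic form, and its square root satisfies the triangle inequality.\<close>

lemma bartlett_form_windows:
  "bartlett_form y m q = (\<Sum>t=1..m + q. (window_sum y m q t)\<^sup>2) / (real m * (real q + 1))"
proof -
  define F where "F p = lag_weight (snd p) * (y (fst p) * y (fst p - snd p))" for p :: "nat \<times> nat"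
  have sq: "(window_sum y m q t)\<^sup>2 = 2 * (\<Sum>p\<in>lag_pairs 0 m m. F p * (in_window q t (fst p) * in_window q t (fst p - snd p)))" for t
    unfolding window_sum_def square_sum_lag_pairs F_def by (simp add: mult_ac)
  \<comment> \<open>Times \<open>i\<close> and \<open>i - j\<close> share \<open>q + 1 - j\<close>
    windows (none for \<open>j > q\<close>), which is also the number of truncation points from
    \<open>j\<close> to \<open>q\<close>; this leads back to
    \<open>bartlett_form_average\<close>.\<close>
  have count: "(\<Sum>t=1..m + q. in_window q t (fst p) * in_window q t (fst p - snd p)) = real (card {l. l \<le> q \<and> snd p \<le> l})"
    if "p \<in> lag_pairs 0 m m" for p
  proof -
    have p: "snd p < fst p" "fst p \<le> m" using that by (auto simp: lag_pairs_def)
    have "(\<Sum>t=1..m + q. in_window q t (fst p) * in_window q t (fst p - snd p)) = (\<Sum>t=1..m + q. of_bool (t \<in> {fst p..fst p - snd p + q}))"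
      by (rule sum.cong) (use p in \<open>auto simp: in_window_def\<close>)
    also have "\<dots> = (\<Sum>t\<in>{1..m + q} \<inter> {fst p..fst p - snd p + q}. 1)"
      by (subst sum.inter_restrict) (auto simp: of_bool_def intro!: sum.cong)
    also have "{1..m + q} \<inter> {fst p..fst p - snd p + q} = {fst p..fst p - snd p + q}" using p by auto
    also have "(\<Sum>t\<in>{fst p..fst p - snd p + q}. 1) = real (q + 1 - snd p)" using p by simp
    also have "{l. l \<le> q \<and> snd p \<le> l} = {snd p..q}" by auto
    then have "real (q + 1 - snd p) = real (card {l. l \<le> q \<and> snd p \<le> l})" by simp
    finally show ?thesis .
  qed
  have "(\<Sum>t=1..m + q. (window_sum y m q t)\<^sup>2) = 2 * (\<Sum>t=1..m + q. \<Sum>p\<in>lag_pairs 0 m m. F p * (in_window q t (fst p) * in_window q t (fst p - snd p)))"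
    unfolding sq by (simp only: sum_distrib_left)
  also have "(\<Sum>t=1..m + q. \<Sum>p\<in>lag_pairs 0 m m. F p * (in_window q t (fst p) * in_window q t (fst p - snd p)))
    = (\<Sum>p\<in>lag_pairs 0 m m. F p * (\<Sum>t=1..m + q. in_window q t (fst p) * in_window q t (fst p - snd p)))"
    by (subst sum.swap) (simp only: sum_distrib_left)
  also have "\<dots> = (\<Sum>p\<in>lag_pairs 0 m m. F p * real (card {l. l \<le> q \<and> snd p \<le> l}))"
    by (intro sum.cong refl) (simp only: count)
  also have "\<dots> = (\<Sum>p\<in>lag_pairs 0 m m. \<Sum>l\<le>q. if snd p \<le> l then F p else 0)"
  proof (rule sum.cong[OF refl])
    fix p
    have "(\<Sum>l\<le>q. if snd p \<le> l then F p else 0) = (\<Sum>l\<in>{l. l \<le> q \<and> snd p \<le> l}. F p)"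
      by (rule sum.mono_neutral_cong_right) auto
    then show "F p * real (card {l. l \<le> q \<and> snd p \<le> l}) = (\<Sum>l\<le>q. if snd p \<le> l then F p else 0)" by simp
  qed
  also have "\<dots> = (\<Sum>l\<le>q. \<Sum>p\<in>lag_pairs 0 m m. if snd p \<le> l then F p else 0)" by (rule sum.swap)
  also have "\<dots> = (\<Sum>l\<le>q. \<Sum>p\<in>lag_pairs 0 m l. F p)"
    by (intro sum.cong refl sum.mono_neutral_cong_right) (auto simp: lag_pairs_def)
  finally show ?thesis unfolding bartlett_form_average F_def by simp
qed

lemma bartlett_form_sqrt:
  "sqrt (bartlett_form y m q) = L2_set (window_sum y m q) {1..m + q} / sqrt (real m * (real q + 1))"
  unfolding bartlett_form_windows L2_set_def by (simp add: real_sqrt_divide)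

lemma bartlett_form_triangle:
  "sqrt (bartlett_form (\<lambda>i. y i + v i) m q) \<le> sqrt (bartlett_form y m q) + sqrt (bartlett_form v m q)"
proof -
  have "window_sum (\<lambda>i. y i + v i) m q = (\<lambda>t. window_sum y m q t + window_sum v m q t)"
    by (simp add: fun_eq_iff window_sum_def distrib_right sum.distrib)
  then have "L2_set (window_sum (\<lambda>i. y i + v i) m q) {1..m + q} \<le> L2_set (window_sum y m q) {1..m + q} + L2_set (window_sum v m q) {1..m + q}"
    using L2_set_triangle_ineq by simp
  then show ?thesis unfolding bartlett_form_sqrt add_divide_distrib[symmetric] by (rule divide_right_mono) simp
qed

lemma bartlett_form_minus: "bartlett_form (\<lambda>i. - v i) m q = bartlett_form v m q"
  unfolding bartlett_form_def by simp

lemma bartlett_form_cong: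
  assumes "\<And>i. 1 \<le> i \<Longrightarrow> i \<le> m \<Longrightarrow> y i = y' i"
  shows "bartlett_form y m q = bartlett_form y' m q"
  unfolding bartlett_form_windows window_sum_def using assms by simp

text \<open>A Schur-type bound: each window has at most \<open>q + 1\<close> points and each point
  lies in at most \<open>q + 1\<close> windows, so the squared window sums total at most
  \<open>(q + 1)^2\<close> times the sum of squares.\<close>

lemma bartlett_form_le:
  "bartlett_form v m q \<le> (real q + 1) / real m * (\<Sum>i=1..m. (v i)\<^sup>2)"
proof -
  define B where "B = (\<Sum>i=1..m. (v i)\<^sup>2)"
  have w2: "(in_window q t i)\<^sup>2 = in_window q t i" for t i by (simp add: in_window_def)
  have row: "(\<Sum>i=1..m. in_window q t i) \<le> real q + 1" for t
  proof -
    have "(\<Sum>i=1..m. in_window q t i) = real (card ({1..m} \<inter> {i. i \<le> t \<and> t \<le> i + q}))"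
      unfolding in_window_def by (simp add: of_bool_def sum.If_cases)
    also have "card ({1..m} \<inter> {i. i \<le> t \<and> t \<le> i + q}) \<le> card {t - q..t}" by (rule card_mono) auto
    also have "\<dots> \<le> q + 1" by simp
    finally show ?thesis by simp
  qed
  have col: "(\<Sum>t=1..m + q. in_window q t i) \<le> real q + 1" for i
  proof -
    have "(\<Sum>t=1..m + q. in_window q t i) = real (card ({1..m + q} \<inter> {t. i \<le> t \<and> t \<le> i + q}))"
      unfolding in_window_def by (simp add: of_bool_def sum.If_cases)
    also have "card ({1..m + q} \<inter> {t. i \<le> t \<and> t \<le> i + q}) \<le> card {i..i + q}" by (rule card_mono) auto
    also have "\<dots> = q + 1" by simp
    finally show ?thesis by simp
  qed
  have "(\<Sum>t=1..m + q. (window_sum v m q t)\<^sup>2) \<le> (\<Sum>t=1..m + q. (real q + 1) * (\<Sum>i=1..m. (v i)\<^sup>2 * in_window q t i))"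
  proof (rule sum_mono)
    fix t
    have "(window_sum v m q t)\<^sup>2 = (\<Sum>i=1..m. in_window q t i * (v i * in_window q t i))\<^sup>2"
      unfolding window_sum_def by (intro arg_cong[where f="\<lambda>s. s\<^sup>2"] sum.cong refl) (simp add: in_window_def)
    also have "\<dots> \<le> (\<Sum>i=1..m. (in_window q t i)\<^sup>2) * (\<Sum>i=1..m. (v i * in_window q t i)\<^sup>2)"
      by (rule Cauchy_Schwarz_ineq_sum)
    also have "\<dots> \<le> (real q + 1) * (\<Sum>i=1..m. (v i)\<^sup>2 * in_window q t i)"
      unfolding power_mult_distrib w2 by (intro mult_right_mono row sum_nonneg) (simp add: in_window_def)
    finally show "(window_sum v m q t)\<^sup>2 \<le> (real q + 1) * (\<Sum>i=1..m. (v i)\<^sup>2 * in_window q t i)" .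
  qed
  also have "\<dots> = (real q + 1) * (\<Sum>i=1..m. (v i)\<^sup>2 * (\<Sum>t=1..m + q. in_window q t i))"
    by (subst sum_distrib_left[symmetric], subst sum.swap) (simp only: sum_distrib_left)
  also have "\<dots> \<le> (real q + 1) * (\<Sum>i=1..m. (v i)\<^sup>2 * (real q + 1))"
    by (intro mult_left_mono sum_mono col) auto
  also have "\<dots> = (real q + 1) * (real q + 1) * B" unfolding B_def by (simp add: sum_distrib_left mult_ac)
  finally have "(\<Sum>t=1..m + q. (window_sum v m q t)\<^sup>2) \<le> (real q + 1) * (real q + 1) * B" .
  then have "bartlett_form v m q \<le> ((real q + 1) * (real q + 1) * B) / (real m * (real q + 1))"
    unfolding bartlett_form_windows by (rule divide_right_mono) simp
  also have "\<dots> = (real q + 1) / real m * B"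
  proof -
    have "Q * Q * B / (r * Q) = Q / r * B" if "Q \<noteq> 0" for Q r :: real using that by simp
    moreover have "real q + 1 \<noteq> 0" by linarith
    ultimately show ?thesis by blast
  qed
  finally show ?thesis unfolding B_def .
qed

lemma sum_deviation_le:
  fixes e :: "nat \<Rightarrow> real"
  shows "(\<Sum>i=1..m. (e i - (\<Sum>i=1..m. e i) / real m)\<^sup>2) \<le> (\<Sum>i=1..m. (e i)\<^sup>2)"
proof -
  define s where "s = (\<Sum>i=1..m. e i)"
  have "(\<Sum>i=1..m. (e i - s / real m)\<^sup>2) = (\<Sum>i=1..m. (e i)\<^sup>2) - 2 * (s / real m) * s + real m * (s / real m)\<^sup>2"
  proof -
    have "(\<Sum>i=1..m. (e i - u)\<^sup>2) = (\<Sum>i=1..m. (e i)\<^sup>2) - 2 * u * s + real m * u\<^sup>2" for u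
      unfolding power2_diff s_def by (simp add: sum.distrib sum_subtractf sum_distrib_left mult_ac)
    then show ?thesis by blast
  qed
  also have "\<dots> = (\<Sum>i=1..m. (e i)\<^sup>2) - s\<^sup>2 / real m"
    by (cases "m = 0") (simp_all add: power2_eq_square)
  finally show ?thesis unfolding s_def by simp
qed

text \<open>Centering removes the level \<open>c0\<close>, and the centered \<open>y\<close> differs
  from \<open>Z\<close> by \<open>(e i - mean of e) - mean of Z\<close>. The seminorm property, used
  in both directions, reduces the claim to the size of this difference; the factors 2 come from
  \<open>(a - b)^2 \<le> 2 a^2 + 2 b^2\<close>.\<close>

lemma bartlett_form_perturb:
  fixes y e Z :: "nat \<Rightarrow> real"
  assumes m: "m > 0" and y: "\<And>i. 1 \<le> i \<Longrightarrow> i \<le> m \<Longrightarrow> y i = c0 + e i + Z i"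
    and R: "(\<Sum>i=1..m. (e i)\<^sup>2) \<le> R"
  shows "\<bar>sqrt (bartlett_form (\<lambda>i. y i - (\<Sum>i=1..m. y i) / real m) m q) - sqrt (bartlett_form Z m q)\<bar>
    \<le> sqrt ((real q + 1) / real m * (2 * R + 2 * (\<Sum>i=1..m. Z i)\<^sup>2 / real m))"
proof -
  define se sz where "se = (\<Sum>i=1..m. e i) / real m" and "sz = (\<Sum>i=1..m. Z i) / real m"
  define v where "v i = (e i - se) - sz" for i
  have "(\<Sum>i=1..m. y i) = (\<Sum>i=1..m. c0 + e i + Z i)" by (rule sum.cong) (auto simp: y)
  also have "\<dots> / real m = c0 + se + sz" using m by (simp add: sum.distrib se_def sz_def add_divide_distrib)
  finally have ybar: "(\<Sum>i=1..m. y i) / real m = c0 + se + sz" .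
  have b1: "bartlett_form (\<lambda>i. y i - (\<Sum>i=1..m. y i) / real m) m q = bartlett_form (\<lambda>i. Z i + v i) m q"
    unfolding ybar by (rule bartlett_form_cong) (simp add: y v_def)
  have b2: "bartlett_form Z m q = bartlett_form (\<lambda>i. (Z i + v i) + - v i) m q" by simp
  have bv: "bartlett_form v m q \<le> (real q + 1) / real m * (2 * R + 2 * (\<Sum>i=1..m. Z i)\<^sup>2 / real m)"
  proof -
    have "(\<Sum>i=1..m. (v i)\<^sup>2) \<le> (\<Sum>i=1..m. 2 * (e i - se)\<^sup>2 + 2 * sz\<^sup>2)"
    proof (rule sum_mono)
      fix i
      have "0 \<le> ((e i - se) + sz)\<^sup>2" by simp
      then show "(v i)\<^sup>2 \<le> 2 * (e i - se)\<^sup>2 + 2 * sz\<^sup>2" unfolding v_def power2_sum power2_diff[of "e i - se" sz] by linarith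
    qed
    also have "\<dots> = 2 * (\<Sum>i=1..m. (e i - se)\<^sup>2) + 2 * (real m * sz\<^sup>2)"
      by (simp add: sum.distrib sum_distrib_left)
    also have "(\<Sum>i=1..m. (e i - se)\<^sup>2) \<le> R" unfolding se_def using sum_deviation_le[of e m] R by linarith
    also have "real m * sz\<^sup>2 = (\<Sum>i=1..m. Z i)\<^sup>2 / real m"
      using m by (simp add: sz_def power2_eq_square)
    finally have "(\<Sum>i=1..m. (v i)\<^sup>2) \<le> 2 * R + 2 * (\<Sum>i=1..m. Z i)\<^sup>2 / real m" by simp
    then have "(real q + 1) / real m * (\<Sum>i=1..m. (v i)\<^sup>2) \<le> (real q + 1) / real m * (2 * R + 2 * (\<Sum>i=1..m. Z i)\<^sup>2 / real m)"
      by (rule mult_left_mono) simp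
    then show ?thesis using bartlett_form_le[of v m q] by linarith
  qed
  have "sqrt (bartlett_form (\<lambda>i. Z i + v i) m q) \<le> sqrt (bartlett_form Z m q) + sqrt (bartlett_form v m q)"
    by (rule bartlett_form_triangle)
  moreover have "sqrt (bartlett_form Z m q) \<le> sqrt (bartlett_form (\<lambda>i. Z i + v i) m q) + sqrt (bartlett_form v m q)"
    using bartlett_form_triangle[of "\<lambda>i. Z i + v i" "\<lambda>i. - v i" m q] unfolding bartlett_form_minus by simp
  moreover have "sqrt (bartlett_form v m q) \<le> sqrt ((real q + 1) / real m * (2 * R + 2 * (\<Sum>i=1..m. Z i)\<^sup>2 / real m))"
    using bv by simp
  ultimately show ?thesis unfolding b1 by linarith
qed

lemma sum_reflect:
  fixes f :: "nat \<Rightarrow> real"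
  shows "(\<Sum>i\<in>{a<..b}. f i) = (\<Sum>i=1..b - a. f (b + 1 - i))"
  by (rule sum.reindex_bij_witness[where i="\<lambda>i. b + 1 - i" and j="\<lambda>i. b + 1 - i"]) auto

lemma lrv_block_first:
  "lrv_block x 0 m q = bartlett_form (\<lambda>i. x i - (\<Sum>i=1..m. x i) / real m) m q"
proof -
  have "{0<..n} = {1..n}" for n :: nat by auto
  then show ?thesis unfolding lrv_block_def bartlett_form_def psum_def Let_def by simp
qed

text \<open>Sample autocovariances are unchanged when a block is read backwards. The second block
  starts at a random index but ends at \<open>n\<close>, so after reversal it is an initial segment
  of random length, the situation covered by \<open>bartlett_consistency\<close>.\<close>

lemma lrv_block_reflect:
  "lrv_block x a b q = bartlett_form (\<lambda>i. x (b + 1 - i) - (\<Sum>i=1..b - a. x (b + 1 - i)) / real (b - a)) (b - a) q"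
proof -
  define xb where "xb = psum x a b / real (b - a)"
  have xb: "xb = (\<Sum>i=1..b - a. x (b + 1 - i)) / real (b - a)" unfolding xb_def psum_def sum_reflect ..
  have cross: "(\<Sum>i\<in>{a<..b - j}. (x i - xb) * (x (i + j) - xb)) = (\<Sum>i=1..b - a - j. (x (b + 1 - i) - xb) * (x (b + 1 - (i + j)) - xb))" for j
  proof -
    have "(\<Sum>i\<in>{a<..b - j}. (x i - xb) * (x (i + j) - xb)) = (\<Sum>i=1..b - j - a. (x (b - j + 1 - i) - xb) * (x (b - j + 1 - i + j) - xb))"
      by (rule sum_reflect)
    also have "\<dots> = (\<Sum>i=1..b - a - j. (x (b + 1 - i) - xb) * (x (b + 1 - (i + j)) - xb))"
    proof (rule sum.cong)
      fix i assume "i \<in> {1..b - a - j}"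
      then have "b - j + 1 - i = b + 1 - (i + j)" "b - j + 1 - i + j = b + 1 - i" by auto
      then show "(x (b - j + 1 - i) - xb) * (x (b - j + 1 - i + j) - xb) = (x (b + 1 - i) - xb) * (x (b + 1 - (i + j)) - xb)"
        by (simp only: mult.commute)
    qed auto
    finally show ?thesis .
  qed
  have sq: "(\<Sum>i\<in>{a<..b}. (x i - xb)\<^sup>2) = (\<Sum>i=1..b - a. (x (b + 1 - i) - xb)\<^sup>2)" by (rule sum_reflect)
  show ?thesis unfolding lrv_block_def Let_def xb_def[symmetric] cross sq bartlett_form_def xb[symmetric] ..
qed

section \<open>Bridge functionals of paths\<close>

definition bridge_sup :: "real \<Rightarrow> real \<Rightarrow> (real \<Rightarrow> real) \<Rightarrow> real" where
  "bridge_sup \<alpha> \<beta> z = (SUP u\<in>{0..1}. \<bar>bridge_of z \<alpha> \<beta> u\<bar>)"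

lemma bridge_of_alt:
  "bridge_of z \<alpha> \<beta> u = (z (\<alpha> + (\<beta> - \<alpha>) * u) - (1 - u) * z \<alpha> - u * z \<beta>) / sqrt (\<beta> - \<alpha>)"
  by (simp add: bridge_of_def algebra_simps)

text \<open>Three values of the path enter, with weights of modulus \<open>1\<close>,
  \<open>1 - u\<close> and \<open>u\<close>, of total mass 2.\<close>

lemma bridge_of_diff_le:
  assumes ab: "0 \<le> \<alpha>" "\<alpha> < \<beta>" "\<beta> \<le> 1" and u: "u \<in> {0..1}" and d: "\<And>t. t \<in> {0..1} \<Longrightarrow> \<bar>x t - y t\<bar> \<le> d"
  shows "\<bar>bridge_of x \<alpha> \<beta> u - bridge_of y \<alpha> \<beta> u\<bar> \<le> 2 * d / sqrt (\<beta> - \<alpha>)"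
proof -
  have i: "\<alpha> + (\<beta> - \<alpha>) * u \<in> {0..1}" "\<alpha> \<in> {0..1}" "\<beta> \<in> {0..1}"
    using affine_in_interval[OF less_imp_le[OF ab(2)] u] ab by auto
  have "\<bar>(1 - u) * (x \<alpha> - y \<alpha>)\<bar> \<le> (1 - u) * d" "\<bar>u * (x \<beta> - y \<beta>)\<bar> \<le> u * d"
    using u d[OF i(2)] d[OF i(3)] by (simp_all add: abs_mult mult_left_mono)
  then have "\<bar>(x (\<alpha> + (\<beta> - \<alpha>) * u) - y (\<alpha> + (\<beta> - \<alpha>) * u)) - (1 - u) * (x \<alpha> - y \<alpha>) - u * (x \<beta> - y \<beta>)\<bar> \<le> d + (1 - u) * d + u * d"
    using d[OF i(1)] by linarith
  also have "\<dots> = 2 * d" by (simp add: algebra_simps)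
  finally have "\<bar>(x (\<alpha> + (\<beta> - \<alpha>) * u) - y (\<alpha> + (\<beta> - \<alpha>) * u)) - (1 - u) * (x \<alpha> - y \<alpha>) - u * (x \<beta> - y \<beta>)\<bar> / sqrt (\<beta> - \<alpha>) \<le> 2 * d / sqrt (\<beta> - \<alpha>)"
    using ab by (intro divide_right_mono) auto
  also have "\<bar>(x (\<alpha> + (\<beta> - \<alpha>) * u) - y (\<alpha> + (\<beta> - \<alpha>) * u)) - (1 - u) * (x \<alpha> - y \<alpha>) - u * (x \<beta> - y \<beta>)\<bar> / sqrt (\<beta> - \<alpha>)
    = \<bar>bridge_of x \<alpha> \<beta> u - bridge_of y \<alpha> \<beta> u\<bar>"
    unfolding bridge_of_alt diff_divide_distrib[symmetric] using ab by (simp add: abs_divide algebra_simps)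
  finally show ?thesis .
qed

lemma bridge_of_bound:
  assumes ab: "0 \<le> \<alpha>" "\<alpha> < \<beta>" "\<beta> \<le> 1" and u: "u \<in> {0..1}" and R: "\<And>t. t \<in> {0..1} \<Longrightarrow> \<bar>z t\<bar> \<le> R"
  shows "\<bar>bridge_of z \<alpha> \<beta> u\<bar> \<le> 2 * R / sqrt (\<beta> - \<alpha>)"
  using bridge_of_diff_le[OF ab u, of z "\<lambda>_. 0" R] R by (simp add: bridge_of_def)

lemma bridge_sup_bdd:
  assumes ab: "0 \<le> \<alpha>" "\<alpha> < \<beta>" "\<beta> \<le> 1" and z: "z \<in> cadlag01"
  shows "bdd_above ((\<lambda>u. \<bar>bridge_of z \<alpha> \<beta> u\<bar>) ` {0..1})"
proof -
  obtain R where R: "\<And>t. t \<in> {0..1} \<Longrightarrow> \<bar>z t\<bar> \<le> R" using cadlag01_bounded[OF z] by blast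
  show ?thesis by (rule bdd_aboveI2[where M="2 * R / sqrt (\<beta> - \<alpha>)"]) (rule bridge_of_bound[OF ab _ R])
qed

lemma bridge_sup_le:
  assumes "\<And>u. u \<in> {0..1} \<Longrightarrow> \<bar>bridge_of z \<alpha> \<beta> u\<bar> \<le> b"
  shows "bridge_sup \<alpha> \<beta> z \<le> b"
  unfolding bridge_sup_def by (rule cSUP_least) (use assms in auto)

lemma bridge_sup_ge:
  assumes ab: "0 \<le> \<alpha>" "\<alpha> < \<beta>" "\<beta> \<le> 1" and z: "z \<in> cadlag01" and u: "u \<in> {0..1}"
  shows "\<bar>bridge_of z \<alpha> \<beta> u\<bar> \<le> bridge_sup \<alpha> \<beta> z"
  unfolding bridge_sup_def by (rule cSUP_upper[OF u bridge_sup_bdd[OF ab z]])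

lemma bridge_sup_lipschitz:
  assumes ab: "0 \<le> \<alpha>" "\<alpha> < \<beta>" "\<beta> \<le> 1" and xy: "x \<in> cadlag01" "y \<in> cadlag01"
    and d: "\<And>t. t \<in> {0..1} \<Longrightarrow> \<bar>x t - y t\<bar> \<le> d"
  shows "\<bar>bridge_sup \<alpha> \<beta> x - bridge_sup \<alpha> \<beta> y\<bar> \<le> 2 * d / sqrt (\<beta> - \<alpha>)"
proof -
  have bd: "\<bar>bridge_of x \<alpha> \<beta> u - bridge_of y \<alpha> \<beta> u\<bar> \<le> 2 * d / sqrt (\<beta> - \<alpha>)" if "u \<in> {0..1}" for u
    by (rule bridge_of_diff_le[OF ab that d])
  have "bridge_sup \<alpha> \<beta> x \<le> bridge_sup \<alpha> \<beta> y + 2 * d / sqrt (\<beta> - \<alpha>)"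
  proof (rule bridge_sup_le)
    fix u :: real assume u: "u \<in> {0..1}"
    show "\<bar>bridge_of x \<alpha> \<beta> u\<bar> \<le> bridge_sup \<alpha> \<beta> y + 2 * d / sqrt (\<beta> - \<alpha>)"
      using bd[OF u] bridge_sup_ge[OF ab xy(2) u] by linarith
  qed
  moreover have "bridge_sup \<alpha> \<beta> y \<le> bridge_sup \<alpha> \<beta> x + 2 * d / sqrt (\<beta> - \<alpha>)"
  proof (rule bridge_sup_le)
    fix u :: real assume u: "u \<in> {0..1}"
    show "\<bar>bridge_of y \<alpha> \<beta> u\<bar> \<le> bridge_sup \<alpha> \<beta> x + 2 * d / sqrt (\<beta> - \<alpha>)"
      using bd[OF u] bridge_sup_ge[OF ab xy(1) u] by linarith
  qed
  ultimately show ?thesis by linarith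
qed

lemma supnorm_continuous_lipschitz:
  assumes L: "L > 0" and F: "\<And>x y d. x \<in> cadlag01 \<Longrightarrow> y \<in> cadlag01 \<Longrightarrow> d > 0 \<Longrightarrow> (\<And>t. t \<in> {0..1} \<Longrightarrow> \<bar>x t - y t\<bar> \<le> d) \<Longrightarrow> \<bar>F x - F y\<bar> \<le> L * d"
  shows "supnorm_continuous F"
  unfolding supnorm_continuous_def
proof (intro ballI allI impI)
  fix x and e :: real assume x: "x \<in> cadlag01" and e: "e > 0"
  show "\<exists>d>0. \<forall>y\<in>cadlag01. (\<forall>t\<in>{0..1}. \<bar>x t - y t\<bar> < d) \<longrightarrow> \<bar>F x - F y\<bar> < e"
  proof (rule exI[of _ "e / (2 * L)"], intro conjI ballI impI)
    show "e / (2 * L) > 0" using e L by simp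
    fix y assume y: "y \<in> cadlag01" "\<forall>t\<in>{0..1}. \<bar>x t - y t\<bar> < e / (2 * L)"
    have "\<bar>F x - F y\<bar> \<le> L * (e / (2 * L))"
    proof (rule F[OF x y(1)])
      show "e / (2 * L) > 0" using e L by simp
      show "\<bar>x t - y t\<bar> \<le> e / (2 * L)" if "t \<in> {0..1}" for t using y(2) that by (auto intro: less_imp_le)
    qed
    also have "\<dots> < e" using e L by simp
    finally show "\<bar>F x - F y\<bar> < e" .
  qed
qed

lemma bridge_sup_supnorm_continuous:
  assumes ab: "0 \<le> \<alpha>" "\<alpha> < \<beta>" "\<beta> \<le> 1"
  shows "supnorm_continuous (bridge_sup \<alpha> \<beta>)"
proof (rule supnorm_continuous_lipschitz[where L="2 / sqrt (\<beta> - \<alpha>)"])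
  show "2 / sqrt (\<beta> - \<alpha>) > 0" using ab by simp
  fix x y d assume "x \<in> cadlag01" "y \<in> cadlag01" "\<And>t. t \<in> {0..1} \<Longrightarrow> \<bar>x t - y t\<bar> \<le> d"
  from bridge_sup_lipschitz[OF ab this] show "\<bar>bridge_sup \<alpha> \<beta> x - bridge_sup \<alpha> \<beta> y\<bar> \<le> 2 / sqrt (\<beta> - \<alpha>) * d" by simp
qed

section \<open>Supremum and modulus of continuity as functionals\<close>

definition sup_abs :: "(real \<Rightarrow> real) \<Rightarrow> real" where
  "sup_abs z = (SUP t\<in>{0..1}. \<bar>z t\<bar>)"

definition modulus :: "real \<Rightarrow> (real \<Rightarrow> real) \<Rightarrow> real" where
  "modulus h z = (SUP p\<in>{p\<in>{0..1} \<times> {0..1}. \<bar>fst p - snd p\<bar> \<le> h}. \<bar>z (fst p) - z (snd p)\<bar>)"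

lemma sup_abs_ge:
  assumes z: "z \<in> cadlag01" and t: "t \<in> {0..1}" shows "\<bar>z t\<bar> \<le> sup_abs z"
proof -
  obtain R where R: "\<And>t. t \<in> {0..1} \<Longrightarrow> \<bar>z t\<bar> \<le> R" using cadlag01_bounded[OF z] by blast
  show ?thesis unfolding sup_abs_def by (rule cSUP_upper[OF t bdd_aboveI2[OF R]])
qed

lemma sup_abs_le: "(\<And>t. t \<in> {0..1} \<Longrightarrow> \<bar>z t\<bar> \<le> b) \<Longrightarrow> sup_abs z \<le> b"
  unfolding sup_abs_def by (rule cSUP_least) auto

lemma modulus_ge:
  assumes z: "z \<in> cadlag01" and t: "s \<in> {0..1}" "t \<in> {0..1}" "\<bar>s - t\<bar> \<le> h" shows "\<bar>z s - z t\<bar> \<le> modulus h z"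
proof -
  obtain R where R: "\<And>t. t \<in> {0..1} \<Longrightarrow> \<bar>z t\<bar> \<le> R" using cadlag01_bounded[OF z] by blast
  have "bdd_above ((\<lambda>p. \<bar>z (fst p) - z (snd p)\<bar>) ` {p\<in>{0..1} \<times> {0..1}. \<bar>fst p - snd p\<bar> \<le> h})"
  proof (rule bdd_aboveI2[where M="2 * R"])
    fix p :: "real \<times> real" assume "p \<in> {p\<in>{0..1} \<times> {0..1}. \<bar>fst p - snd p\<bar> \<le> h}"
    then have "fst p \<in> {0..1}" "snd p \<in> {0..1}" by auto
    from R[OF this(1)] R[OF this(2)] show "\<bar>z (fst p) - z (snd p)\<bar> \<le> 2 * R" by linarith
  qed
  from cSUP_upper[OF _ this, of "(s, t)"] show ?thesis using t by (simp add: modulus_def)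
qed

lemma modulus_le:
  assumes "h \<ge> 0" "\<And>s t. s \<in> {0..1} \<Longrightarrow> t \<in> {0..1} \<Longrightarrow> \<bar>s - t\<bar> \<le> h \<Longrightarrow> \<bar>z s - z t\<bar> \<le> b"
  shows "modulus h z \<le> b"
  unfolding modulus_def
proof (rule cSUP_least)
  have "(0, 0) \<in> {p\<in>{0..1} \<times> {0..1}. \<bar>fst p - snd p\<bar> \<le> h}" using assms(1) by simp
  then show "{p\<in>{0..1} \<times> {0..1}. \<bar>fst p - snd p\<bar> \<le> h} \<noteq> {}" by blast
qed (use assms(2) in auto)

lemma sup_abs_supnorm_continuous: "supnorm_continuous sup_abs"
proof (rule supnorm_continuous_lipschitz[where L=1])
  fix x y d assume xy: "x \<in> cadlag01" "y \<in> cadlag01" and d: "\<And>t. t \<in> {0..1} \<Longrightarrow> \<bar>x t - y t\<bar> \<le> d"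
  have "sup_abs x \<le> sup_abs y + d"
  proof (rule sup_abs_le)
    fix t :: real assume t: "t \<in> {0..1}"
    show "\<bar>x t\<bar> \<le> sup_abs y + d" using d[OF t] sup_abs_ge[OF xy(2) t] by linarith
  qed
  moreover have "sup_abs y \<le> sup_abs x + d"
  proof (rule sup_abs_le)
    fix t :: real assume t: "t \<in> {0..1}"
    show "\<bar>y t\<bar> \<le> sup_abs x + d" using d[OF t] sup_abs_ge[OF xy(1) t] by linarith
  qed
  ultimately show "\<bar>sup_abs x - sup_abs y\<bar> \<le> 1 * d" by linarith
qed simp

lemma modulus_supnorm_continuous:
  assumes h: "h \<ge> 0"
  shows "supnorm_continuous (modulus h)"
proof (rule supnorm_continuous_lipschitz[where L=2])
  fix x y d assume xy: "x \<in> cadlag01" "y \<in> cadlag01" and d: "\<And>t. t \<in> {0..1} \<Longrightarrow> \<bar>x t - y t\<bar> \<le> d"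
  have "modulus h x \<le> modulus h y + 2 * d"
  proof (rule modulus_le[OF h])
    fix s t :: real assume st: "s \<in> {0..1}" "t \<in> {0..1}" "\<bar>s - t\<bar> \<le> h"
    show "\<bar>x s - x t\<bar> \<le> modulus h y + 2 * d" using d[OF st(1)] d[OF st(2)] modulus_ge[OF xy(2) st] by linarith
  qed
  moreover have "modulus h y \<le> modulus h x + 2 * d"
  proof (rule modulus_le[OF h])
    fix s t :: real assume st: "s \<in> {0..1}" "t \<in> {0..1}" "\<bar>s - t\<bar> \<le> h"
    show "\<bar>y s - y t\<bar> \<le> modulus h x + 2 * d" using d[OF st(1)] d[OF st(2)] modulus_ge[OF xy(1) st] by linarith
  qed
  ultimately show "\<bar>modulus h x - modulus h y\<bar> \<le> 2 * d" by linarith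
qed simp

lemma modulus_tendsto:
  assumes z: "continuous_on {0..1} z"
  shows "(\<lambda>k. modulus (1 / real (Suc k)) z) \<longlonglongrightarrow> 0"
proof (rule LIMSEQ_I)
  fix e :: real assume e: "e > 0"
  have zc: "z \<in> cadlag01" by (rule continuous_in_cadlag01[OF z])
  have "uniformly_continuous_on {0..1} z" by (rule compact_uniformly_continuous[OF z]) simp
  then obtain r where r: "r > 0" "\<And>s t. s \<in> {0..1} \<Longrightarrow> t \<in> {0..1} \<Longrightarrow> dist s t < r \<Longrightarrow> dist (z s) (z t) < e/2"
    using e unfolding uniformly_continuous_on_def by (metis half_gt_zero)
  show "\<exists>k0. \<forall>k\<ge>k0. norm (modulus (1 / real (Suc k)) z - 0) < e"
  proof (intro exI allI impI)
    fix k assume k: "k \<ge> nat \<lceil>1 / r\<rceil>"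
    have "1 / r < real (Suc k)" using k by linarith
    then have kr: "1 / real (Suc k) < r" using r(1) by (simp add: field_simps)
    have "modulus (1 / real (Suc k)) z \<le> e/2"
    proof (rule modulus_le)
      fix s t :: real assume st: "s \<in> {0..1}" "t \<in> {0..1}" "\<bar>s - t\<bar> \<le> 1 / real (Suc k)"
      have "dist (z s) (z t) < e/2" by (rule r(2)[OF st(1,2)]) (use st(3) kr in \<open>simp add: dist_real_def\<close>)
      then show "\<bar>z s - z t\<bar> \<le> e/2" by (simp add: dist_real_def)
    qed simp
    moreover have "0 \<le> modulus (1 / real (Suc k)) z" using modulus_ge[OF zc, of 0 0 "1 / real (Suc k)"] by simp
    ultimately show "norm (modulus (1 / real (Suc k)) z - 0) < e" using e by simp
  qed
qed

section \<open>CUSUM statistics of blocks\<close>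

definition block_max :: "(nat \<Rightarrow> real) \<Rightarrow> nat \<Rightarrow> nat \<Rightarrow> real" where
  "block_max x a b = Max ((\<lambda>k. \<bar>psum x a k - real (k - a) / real (b - a) * psum x a b\<bar>) ` {a<..b})"

lemma Max_diff_le:
  fixes f g :: "'i \<Rightarrow> real"
  assumes "finite A" "A \<noteq> {}" "\<And>i. i \<in> A \<Longrightarrow> \<bar>f i - g i\<bar> \<le> d"
  shows "\<bar>Max (f ` A) - Max (g ` A)\<bar> \<le> d"
proof -
  have "Max (f ` A) \<le> Max (g ` A) + d"
  proof (rule Max.boundedI)
    fix y assume "y \<in> f ` A"
    then obtain i where i: "i \<in> A" "y = f i" by auto
    have "g i \<le> Max (g ` A)" using assms(1) i by (intro Max_ge) auto
    then show "y \<le> Max (g ` A) + d" using assms(3)[OF i(1)] i(2) by linarith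
  qed (use assms in auto)
  moreover have "Max (g ` A) \<le> Max (f ` A) + d"
  proof (rule Max.boundedI)
    fix y assume "y \<in> g ` A"
    then obtain i where i: "i \<in> A" "y = g i" by auto
    have "f i \<le> Max (f ` A)" using assms(1) i by (intro Max_ge) auto
    then show "y \<le> Max (f ` A) + d" using assms(3)[OF i(1)] i(2) by linarith
  qed (use assms in auto)
  ultimately show ?thesis by linarith
qed

text \<open>A constant level makes the partial sums linear and is removed by the CUSUM correction.
  The perturbation \<open>e\<close> enters through its partial sums up to \<open>k\<close> and up to
  \<open>b\<close>, each at most \<open>r\<close>.\<close>

lemma block_max_perturb:
  assumes ab: "a < b" and x: "\<And>i. a < i \<Longrightarrow> i \<le> b \<Longrightarrow> x i = c0 + e i + Y i"
    and r: "(\<Sum>i\<in>{a<..b}. \<bar>e i\<bar>) \<le> r"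
  shows "\<bar>block_max x a b - block_max Y a b\<bar> \<le> 2 * r"
  unfolding block_max_def
proof (rule Max_diff_le)
  fix k assume k: "k \<in> {a<..b}"
  define u where "u = real (k - a) / real (b - a)"
  have u: "0 \<le> u" "u \<le> 1" using k ab by (auto simp: u_def)
  have ps: "psum x a j = c0 * real (j - a) + psum e a j + psum Y a j" if "j \<le> b" for j
  proof -
    have "psum x a j = (\<Sum>i\<in>{a<..j}. c0 + e i + Y i)"
      unfolding psum_def by (rule sum.cong) (use that in \<open>auto simp: x\<close>)
    then show ?thesis by (simp add: sum.distrib psum_def mult.commute)
  qed
  have pe: "\<bar>psum e a j\<bar> \<le> r" if "j \<le> b" for j
  proof -
    have "\<bar>psum e a j\<bar> \<le> (\<Sum>i\<in>{a<..j}. \<bar>e i\<bar>)" unfolding psum_def by (rule sum_abs)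
    also have "\<dots> \<le> (\<Sum>i\<in>{a<..b}. \<bar>e i\<bar>)" using that by (intro sum_mono2) auto
    finally show ?thesis using r by linarith
  qed
  have c: "u * (c0 * real (b - a)) = c0 * real (k - a)" using ab by (simp add: u_def)
  have "psum x a k - u * psum x a b = (psum Y a k - u * psum Y a b) + (psum e a k - u * psum e a b)"
    using k c by (simp add: ps algebra_simps)
  moreover have "\<bar>u * psum e a b\<bar> \<le> 1 * r" unfolding abs_mult using u pe[of b] by (intro mult_mono) auto
  moreover have "\<bar>psum e a k\<bar> \<le> r" using k by (intro pe) auto
  ultimately show "\<bar>\<bar>psum x a k - real (k - a) / real (b - a) * psum x a b\<bar> -
        \<bar>psum Y a k - real (k - a) / real (b - a) * psum Y a b\<bar>\<bar> \<le> 2 * r"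
    unfolding u_def[symmetric] by linarith
qed (use ab in auto)

text \<open>The left side compares the maximum of \<open>|\<psi> k|\<close> over the block with the
  supremum of \<open>|\<phi> u|\<close>. From a grid index to \<open>u = fr k\<close> no time is
  lost; from \<open>u\<close> to an index the fraction moves by at most \<open>1 / (b - a)\<close>,
  which also changes the linear interpolation and causes the extra
  \<open>2 R / (b - a)\<close>.\<close>

lemma block_max_bridge:
  fixes \<alpha> \<beta> \<epsilon> h \<eta> R :: real
  assumes al: "0 \<le> \<alpha>" "\<alpha> < \<beta>" "\<beta> \<le> 1" and n: "n > 0" and ab: "a < b" "b \<le> n"
    and z: "z \<in> cadlag01" "\<And>k. k \<le> n \<Longrightarrow> z (real k / real n) = (\<Sum>i=1..k. Y i) / sqrt (real n)"
    and \<epsilon>: "\<bar>\<alpha> - real a / real n\<bar> \<le> \<epsilon>" "\<bar>\<beta> - real b / real n\<bar> \<le> \<epsilon>" "\<epsilon> + 1 / real (b - a) \<le> h"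
    and \<eta>: "modulus h z \<le> \<eta>" and R: "sup_abs z \<le> R"
  shows "\<bar>block_max Y a b / sqrt (real n) - sqrt (\<beta> - \<alpha>) * bridge_sup \<alpha> \<beta> z\<bar> \<le> 2 * \<eta> + 2 * R / real (b - a)"
proof -
  define l where "l = sqrt (\<beta> - \<alpha>)"
  have l: "l > 0" using al by (simp add: l_def)
  define \<phi> where "\<phi> u = z (\<alpha> + (\<beta> - \<alpha>) * u) - (1 - u) * z \<alpha> - u * z \<beta>" for u
  define fr where "fr k = real (k - a) / real (b - a)" for k
  define \<psi> where "\<psi> k = z (real k / real n) - (1 - fr k) * z (real a / real n) - fr k * z (real b / real n)" for k
  have np: "real n > 0" using n by simp
  have bap: "real (b - a) > 0" using ab by simp
  have fr: "0 \<le> fr k" "fr k \<le> 1" if "k \<in> {a<..b}" for k using that ab by (auto simp: fr_def)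
  have mod: "\<bar>z s - z t\<bar> \<le> \<eta>" if "s \<in> {0..1}" "t \<in> {0..1}" "\<bar>s - t\<bar> \<le> h" for s t
    using modulus_ge[OF z(1) that] \<eta> by linarith
  have zR: "\<bar>z t\<bar> \<le> R" if "t \<in> {0..1}" for t using sup_abs_ge[OF z(1) that] R by linarith
  have eh: "\<epsilon> \<le> h" using \<epsilon>(3) bap by (smt (verit) divide_pos_pos)
  have in01: "\<alpha> \<in> {0..1}" "\<beta> \<in> {0..1}" "real a / real n \<in> {0..1}" "real b / real n \<in> {0..1}"
    using al ab np by auto
  have mab: "\<bar>z \<alpha> - z (real a / real n)\<bar> \<le> \<eta>" "\<bar>z \<beta> - z (real b / real n)\<bar> \<le> \<eta>"
    using mod in01 \<epsilon>(1,2) eh by (meson order_trans)+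
  have R0: "0 \<le> R" using zR[OF in01(1)] by linarith
  have close: "\<bar>\<phi> u - \<psi> k\<bar> \<le> 2 * \<eta> + 2 * R * d" if u: "u \<in> {0..1}" and k: "k \<in> {a<..b}" and d: "\<bar>u - fr k\<bar> \<le> d" "\<epsilon> + d \<le> h" for u k d
  proof -
    have kn: "real k / real n = real a / real n + (real b / real n - real a / real n) * fr k"
    proof -
      have "(real b / real n - real a / real n) = real (b - a) / real n" using ab by (simp add: of_nat_diff diff_divide_distrib)
      then have "(real b / real n - real a / real n) * fr k = real (k - a) / real n" using bap by (simp add: fr_def)
      then show ?thesis using k by (simp add: of_nat_diff diff_divide_distrib)
    qed
    have k01: "real k / real n \<in> {0..1}" using k ab np by auto
    have u01: "\<alpha> + (\<beta> - \<alpha>) * u \<in> {0..1}" using affine_in_interval[OF less_imp_le[OF al(2)] u] al by auto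
    \<comment> \<open>The discrepancy of the two times splits into that of the fractions and a
      convex combination of the discrepancies at the endpoints, so it is at most
      \<open>d + \<epsilon>\<close>.\<close>
    have "\<alpha> + (\<beta> - \<alpha>) * u - real k / real n = (\<beta> - \<alpha>) * (u - fr k) + ((1 - fr k) * (\<alpha> - real a / real n) + fr k * (\<beta> - real b / real n))"
      unfolding kn by (simp add: algebra_simps diff_divide_distrib)
    moreover have "\<bar>(\<beta> - \<alpha>) * (u - fr k)\<bar> \<le> 1 * d" unfolding abs_mult using al d by (intro mult_mono) auto
    moreover have "\<bar>(1 - fr k) * (\<alpha> - real a / real n)\<bar> \<le> (1 - fr k) * \<epsilon>" unfolding abs_mult using fr[OF k] \<epsilon> by (simp add: mult_left_mono)
    moreover have "\<bar>fr k * (\<beta> - real b / real n)\<bar> \<le> fr k * \<epsilon>" unfolding abs_mult using fr[OF k] \<epsilon> by (simp add: mult_left_mono)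
    moreover have "(1 - fr k) * \<epsilon> + fr k * \<epsilon> = \<epsilon>" by (simp add: algebra_simps)
    ultimately have "\<bar>(\<alpha> + (\<beta> - \<alpha>) * u) - real k / real n\<bar> \<le> h" using d(2) by linarith
    then have 1: "\<bar>z (\<alpha> + (\<beta> - \<alpha>) * u) - z (real k / real n)\<bar> \<le> \<eta>" by (rule mod[OF u01 k01])
    have 2: "\<bar>(1 - fr k) * (z \<alpha> - z (real a / real n))\<bar> \<le> (1 - fr k) * \<eta>" "\<bar>fr k * (z \<beta> - z (real b / real n))\<bar> \<le> fr k * \<eta>"
      unfolding abs_mult using fr[OF k] mab by (simp_all add: mult_left_mono)
    have 3: "\<bar>(fr k - u) * (z \<alpha> - z \<beta>)\<bar> \<le> d * (2 * R)"
      unfolding abs_mult using d(1) zR[OF in01(1)] zR[OF in01(2)] by (intro mult_mono) auto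
    have "\<phi> u - \<psi> k = (z (\<alpha> + (\<beta> - \<alpha>) * u) - z (real k / real n)) - (1 - fr k) * (z \<alpha> - z (real a / real n)) - fr k * (z \<beta> - z (real b / real n)) - (fr k - u) * (z \<alpha> - z \<beta>)"
      unfolding \<phi>_def \<psi>_def by (simp add: algebra_simps)
    then have "\<bar>\<phi> u - \<psi> k\<bar> \<le> \<eta> + (1 - fr k) * \<eta> + fr k * \<eta> + d * (2 * R)" using 1 2 3 by linarith
    also have "\<dots> = 2 * \<eta> + 2 * R * d" by (simp add: algebra_simps)
    finally show ?thesis .
  qed
  have bridge: "l * \<bar>bridge_of z \<alpha> \<beta> u\<bar> = \<bar>\<phi> u\<bar>" for u
    unfolding bridge_of_alt \<phi>_def[symmetric] l_def[symmetric] using l by (simp add: abs_divide)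
  have blk: "block_max Y a b / sqrt (real n) = Max ((\<lambda>k. \<bar>\<psi> k\<bar>) ` {a<..b})"
  proof -
    have S: "psum Y a k = sqrt (real n) * (z (real k / real n) - z (real a / real n))" if "a \<le> k" "k \<le> n" for k
    proof -
      have "{1..k} = {1..a} \<union> {a<..k}" using that by auto
      then have "(\<Sum>i=1..k. Y i) = (\<Sum>i=1..a. Y i) + psum Y a k" unfolding psum_def
        by (simp add: sum.union_disjoint[symmetric] ivl_disj_int)
      then show ?thesis using that np z(2)[of k] z(2)[of a] by (simp add: field_simps)
    qed
    have e: "\<bar>psum Y a k - real (k - a) / real (b - a) * psum Y a b\<bar> = sqrt (real n) * \<bar>\<psi> k\<bar>" if "k \<in> {a<..b}" for k
    proof -
      have "psum Y a k - real (k - a) / real (b - a) * psum Y a b = sqrt (real n) * \<psi> k"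
        unfolding fr_def[symmetric] using that ab by (simp add: S \<psi>_def algebra_simps)
      then show ?thesis by (simp add: abs_mult)
    qed
    have "block_max Y a b = Max ((\<lambda>k. sqrt (real n) * \<bar>\<psi> k\<bar>) ` {a<..b})"
      unfolding block_max_def by (intro arg_cong[where f=Max] image_cong refl e)
    also have "\<dots> = Max ((*) (sqrt (real n)) ` (\<lambda>k. \<bar>\<psi> k\<bar>) ` {a<..b})" by (simp add: image_image)
    also have "\<dots> = sqrt (real n) * Max ((\<lambda>k. \<bar>\<psi> k\<bar>) ` {a<..b})"
      by (rule mono_Max_commute[symmetric]) (use ab in \<open>auto intro!: monoI mult_left_mono\<close>)
    finally show ?thesis using np by simp
  qed
  have abs_le: "\<bar>x\<bar> \<le> \<bar>y\<bar> + c" if "\<bar>x - y\<bar> \<le> c" for x y c :: real using that by linarith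
  have upper: "Max ((\<lambda>k. \<bar>\<psi> k\<bar>) ` {a<..b}) \<le> l * bridge_sup \<alpha> \<beta> z + 2 * \<eta>"
  proof (rule Max.boundedI)
    fix y assume "y \<in> (\<lambda>k. \<bar>\<psi> k\<bar>) ` {a<..b}"
    then obtain k where k: "k \<in> {a<..b}" "y = \<bar>\<psi> k\<bar>" by auto
    have f01: "fr k \<in> {0..1}" using fr[OF k(1)] by simp
    have "\<bar>\<phi> (fr k) - \<psi> k\<bar> \<le> 2 * \<eta> + 2 * R * 0" by (rule close[OF f01 k(1)]) (use eh in auto)
    moreover have "\<bar>\<phi> (fr k)\<bar> \<le> l * bridge_sup \<alpha> \<beta> z"
      unfolding bridge[symmetric] using l bridge_sup_ge[OF al z(1) f01] by (intro mult_left_mono) auto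
    ultimately show "y \<le> l * bridge_sup \<alpha> \<beta> z + 2 * \<eta>" using k(2) by linarith
  qed (use ab in auto)
  have lower: "l * bridge_sup \<alpha> \<beta> z \<le> Max ((\<lambda>k. \<bar>\<psi> k\<bar>) ` {a<..b}) + (2 * \<eta> + 2 * R / real (b - a))"
  proof -
    have "bridge_sup \<alpha> \<beta> z \<le> (Max ((\<lambda>k. \<bar>\<psi> k\<bar>) ` {a<..b}) + (2 * \<eta> + 2 * R / real (b - a))) / l"
    proof (rule bridge_sup_le)
      fix u :: real assume u: "u \<in> {0..1}"
      \<comment> \<open>The indices of the block start at \<open>a + 1\<close>, hence the
        \<open>max 1\<close>; at \<open>u = 0\<close> it moves the point by one grid step.\<close>
      define j where "j = max 1 (nat \<lceil>u * real (b - a)\<rceil>)"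
      define k where "k = a + j"
      have up: "u * real (b - a) \<le> real (b - a)" "0 \<le> u * real (b - a)" using u bap by (auto simp: mult_left_le_one_le)
      have "nat \<lceil>u * real (b - a)\<rceil> \<le> b - a" using up(1) by linarith
      then have j: "1 \<le> j" "j \<le> b - a" using ab unfolding j_def by linarith+
      then have k: "k \<in> {a<..b}" using ab by (auto simp: k_def)
      have "real (k - a) = max 1 (real (nat \<lceil>u * real (b - a)\<rceil>))" by (simp only: k_def j_def diff_add_inverse of_nat_max of_nat_1)
      then have "\<bar>u * real (b - a) - real (k - a)\<bar> \<le> 1" using up(2) by linarith
      then have "\<bar>u * real (b - a) - real (k - a)\<bar> / real (b - a) \<le> 1 / real (b - a)" using bap by (intro divide_right_mono) auto
      moreover have "u - fr k = (u * real (b - a) - real (k - a)) / real (b - a)" using bap by (simp add: fr_def diff_divide_distrib)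
      ultimately have "\<bar>u - fr k\<bar> \<le> 1 / real (b - a)" using bap by (simp add: abs_divide)
      from close[OF u k this \<epsilon>(3)] have "\<bar>\<phi> u - \<psi> k\<bar> \<le> 2 * \<eta> + 2 * R / real (b - a)" by simp
      then have "\<bar>\<phi> u\<bar> \<le> \<bar>\<psi> k\<bar> + (2 * \<eta> + 2 * R / real (b - a))" by (rule abs_le)
      moreover have "\<bar>\<psi> k\<bar> \<le> Max ((\<lambda>k. \<bar>\<psi> k\<bar>) ` {a<..b})" using k by (intro Max_ge) auto
      ultimately have "\<bar>\<phi> u\<bar> \<le> Max ((\<lambda>k. \<bar>\<psi> k\<bar>) ` {a<..b}) + (2 * \<eta> + 2 * R / real (b - a))"
        by (meson add_right_mono order_trans)
      then have "\<bar>bridge_of z \<alpha> \<beta> u\<bar> * l \<le> Max ((\<lambda>k. \<bar>\<psi> k\<bar>) ` {a<..b}) + (2 * \<eta> + 2 * R / real (b - a))"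
        using bridge[of u] by (simp only: mult.commute[of _ l])
      then show "\<bar>bridge_of z \<alpha> \<beta> u\<bar> \<le> (Max ((\<lambda>k. \<bar>\<psi> k\<bar>) ` {a<..b}) + (2 * \<eta> + 2 * R / real (b - a))) / l"
        by (simp only: pos_le_divide_eq[OF l])
    qed
    then show ?thesis by (simp only: pos_le_divide_eq[OF l] mult.commute[of _ l])
  qed
  have nn: "0 \<le> 2 * R / real (b - a)" using R0 by simp
  have "\<bar>x - y\<bar> \<le> 2 * \<eta> + d" if "x \<le> y + 2 * \<eta>" "y \<le> x + (2 * \<eta> + d)" "0 \<le> d" for x y d :: real
    using that by linarith
  from this[OF upper lower nn] show ?thesis unfolding blk l_def[symmetric] .
qed

lemma inverse_sqrt_diff:
  fixes p l :: real
  assumes p: "p > 0" and l: "l > 0"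
  shows "\<bar>1 / sqrt p - 1 / sqrt l\<bar> \<le> (1 / sqrt p) * \<bar>l - p\<bar> / l"
proof -
  have sp: "sqrt p > 0" "sqrt l > 0" using p l by auto
  have "1 / sqrt p - 1 / sqrt l = (1 / sqrt p) * ((sqrt l - sqrt p) / sqrt l)" using sp by (simp add: field_simps)
  moreover have "\<bar>(sqrt l - sqrt p) / sqrt l\<bar> \<le> \<bar>l - p\<bar> / l"
  proof -
    have "l - p = (sqrt l - sqrt p) * (sqrt l + sqrt p)" using p l by (simp add: algebra_simps)
    then have "\<bar>l - p\<bar> = \<bar>sqrt l - sqrt p\<bar> * (sqrt l + sqrt p)" using sp by (simp add: abs_mult)
    moreover have "\<bar>sqrt l - sqrt p\<bar> * sqrt l \<le> \<bar>sqrt l - sqrt p\<bar> * (sqrt l + sqrt p)" using sp by (intro mult_left_mono) auto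
    ultimately have "\<bar>sqrt l - sqrt p\<bar> * sqrt l \<le> \<bar>l - p\<bar>" by linarith
    then have "\<bar>sqrt l - sqrt p\<bar> \<le> \<bar>l - p\<bar> / sqrt l" using sp by (simp add: pos_le_divide_eq)
    then have "\<bar>sqrt l - sqrt p\<bar> / sqrt l \<le> \<bar>l - p\<bar> / sqrt l / sqrt l" using sp by (intro divide_right_mono) auto
    then show ?thesis using l by (simp add: abs_divide)
  qed
  ultimately show ?thesis using sp mult_left_mono[of "\<bar>(sqrt l - sqrt p) / sqrt l\<bar>" "\<bar>l - p\<bar> / l" "1 / sqrt p"]
    by (simp add: abs_mult abs_divide)
qed

text \<open>The terms of the bound are, in order: misclassified observations, modulus of the path,
  discretization, deviation of the block length from \<open>(\<beta> - \<alpha>) n\<close>, and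
  error of the scale \<open>s\<close>. The size of the bridge functional itself is controlled by
  \<open>R\<close>.\<close>

lemma block_stat_close:
  fixes \<alpha> \<beta> \<epsilon> h \<eta> R \<sigma> s sd :: real
  assumes al: "0 \<le> \<alpha>" "\<alpha> < \<beta>" "\<beta> \<le> 1" and n: "n > 0" and ab: "a < b" "b \<le> n"
    and z: "z \<in> cadlag01" "\<And>k. k \<le> n \<Longrightarrow> z (real k / real n) = (\<Sum>i=1..k. Y i) / sqrt (real n)"
    and \<epsilon>: "\<bar>\<alpha> - real a / real n\<bar> \<le> \<epsilon>" "\<bar>\<beta> - real b / real n\<bar> \<le> \<epsilon>" "\<epsilon> + 1 / real (b - a) \<le> h" "\<epsilon> \<le> (\<beta> - \<alpha>) / 4"
    and \<eta>: "modulus h z \<le> \<eta>" and R: "sup_abs z \<le> R"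
    and x: "\<And>i. a < i \<Longrightarrow> i \<le> b \<Longrightarrow> x i = c0 + e i + Y i" and r: "(\<Sum>i\<in>{a<..b}. \<bar>e i\<bar>) \<le> r"
    and \<sigma>: "\<sigma> > 0" and sd: "\<bar>s - \<sigma>\<bar> \<le> sd" "sd \<le> \<sigma> / 2"
  shows "\<bar>(1 / s) * (1 / sqrt (real (b - a))) * block_max x a b - bridge_sup \<alpha> \<beta> z / \<sigma>\<bar>
    \<le> (2 / \<sigma>) * sqrt (2 / (\<beta> - \<alpha>)) * (2 * r / sqrt (real n) + 2 * \<eta> + 4 * R / ((\<beta> - \<alpha>) * real n) + 4 * \<epsilon> * R / (\<beta> - \<alpha>))
      + 4 * R * sd / (sqrt (\<beta> - \<alpha>) * \<sigma>\<^sup>2)"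
proof -
  define l where "l = \<beta> - \<alpha>"
  have l: "l > 0" using al by (simp add: l_def)
  have np: "real n > 0" using n by simp
  \<comment> \<open>The relative block length. The condition
    \<open>\<epsilon> \<le> (\<beta> - \<alpha>) / 4\<close> keeps it at least half of its limit
    \<open>l\<close>, so \<open>1 / sqrt p\<close> stays bounded and close to
    \<open>1 / sqrt l\<close>.\<close>
  define p where "p = real (b - a) / real n"
  have pe: "p = real b / real n - real a / real n" using ab by (simp add: p_def of_nat_diff diff_divide_distrib)
  have pl: "\<bar>l - p\<bar> \<le> 2 * \<epsilon>" using \<epsilon>(1,2) unfolding pe l_def by linarith
  have "4 * \<epsilon> \<le> l" using \<epsilon>(4) by (simp add: l_def)
  then have p2: "p \<ge> l / 2" using pl by linarith
  have pp: "p > 0" using p2 l by linarith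
  have ban: "real (b - a) = p * real n" using np by (simp add: p_def)
  have zR: "\<bar>z t\<bar> \<le> R" if "t \<in> {0..1}" for t using sup_abs_ge[OF z(1) that] R by linarith
  have R0: "0 \<le> R" using zR[of 0] by simp
  define B where "B = bridge_sup \<alpha> \<beta> z"
  have B0: "0 \<le> B" using bridge_sup_ge[OF al z(1), of 0] unfolding B_def by simp
  have BR: "B \<le> 2 * R / sqrt l" unfolding B_def l_def by (rule bridge_sup_le) (rule bridge_of_bound[OF al _ zR])
  define P where "P = sqrt l * B"
  have PR: "0 \<le> P" "P \<le> 2 * R" using B0 BR l by (auto simp: P_def pos_le_divide_eq mult.commute)
  define N where "N = block_max x a b / sqrt (real n)"
  define r' where "r' = 1 / sqrt p"
  have r': "0 < r'" "r' \<le> sqrt (2 / l)"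
  proof -
    show "0 < r'" using pp by (simp add: r'_def)
    have "1 / p \<le> 2 / l" using p2 l pp by (simp add: field_simps)
    then have "sqrt (1 / p) \<le> sqrt (2 / l)" by (rule real_sqrt_le_mono)
    moreover have "sqrt (1 / p) = r'" by (simp add: r'_def real_sqrt_divide)
    ultimately show "r' \<le> sqrt (2 / l)" by simp
  qed
  define D where "D = 2 * r / sqrt (real n) + 2 * \<eta> + 4 * R / (l * real n)"
  have NP: "\<bar>N - P\<bar> \<le> D"
  proof -
    have "\<bar>block_max x a b - block_max Y a b\<bar> \<le> 2 * r" by (rule block_max_perturb[OF ab(1) x r])
    then have "\<bar>block_max x a b - block_max Y a b\<bar> / sqrt (real n) \<le> 2 * r / sqrt (real n)" by (rule divide_right_mono) simp
    then have "\<bar>N - block_max Y a b / sqrt (real n)\<bar> \<le> 2 * r / sqrt (real n)"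
      unfolding N_def diff_divide_distrib[symmetric] by (simp add: abs_divide)
    moreover have "\<bar>block_max Y a b / sqrt (real n) - P\<bar> \<le> 2 * \<eta> + 2 * R / real (b - a)"
      unfolding P_def B_def l_def by (rule block_max_bridge[OF al n ab z \<epsilon>(1-3) \<eta> R])
    moreover have "2 * R / real (b - a) \<le> 4 * R / (l * real n)"
    proof -
      have "l / 2 * real n \<le> real (b - a)" unfolding ban using p2 np by (intro mult_right_mono) auto
      then have "2 * R / real (b - a) \<le> 2 * R / (l / 2 * real n)" using R0 l np ab(1) by (intro divide_left_mono mult_pos_pos) auto
      then show ?thesis by simp
    qed
    moreover have "\<bar>x - y\<bar> \<le> c1 + c2 + c4" if "\<bar>x - w\<bar> \<le> c1" "\<bar>w - y\<bar> \<le> c2 + c3" "c3 \<le> c4" for x y w c1 c2 c3 c4 :: real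
      using that by linarith
    ultimately show ?thesis unfolding D_def by blast
  qed
  have D0: "0 \<le> D" using NP by linarith
  define A where "A = (1 / sqrt (real (b - a))) * block_max x a b"
  have A: "A = r' * N" unfolding A_def r'_def N_def ban using np pp by (simp add: real_sqrt_mult)
  have B: "B = (1 / sqrt l) * P" using l by (simp add: P_def)
  have AB: "\<bar>A - B\<bar> \<le> sqrt (2 / l) * (D + 4 * \<epsilon> * R / l)"
  proof -
    have "A - B = r' * (N - P) + (r' - 1 / sqrt l) * P" unfolding A B by (simp add: algebra_simps)
    moreover have "\<bar>r' * (N - P)\<bar> \<le> sqrt (2 / l) * D" unfolding abs_mult using r' NP l by (intro mult_mono) auto
    moreover have "\<bar>(r' - 1 / sqrt l) * P\<bar> \<le> (sqrt (2 / l) * (2 * \<epsilon>) / l) * (2 * R)"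
    proof -
      have "\<bar>r' - 1 / sqrt l\<bar> \<le> r' * \<bar>l - p\<bar> / l" unfolding r'_def by (rule inverse_sqrt_diff[OF pp l])
      also have "\<dots> \<le> sqrt (2 / l) * (2 * \<epsilon>) / l" using r' pl l by (intro divide_right_mono mult_mono) auto
      finally have 1: "\<bar>r' - 1 / sqrt l\<bar> \<le> sqrt (2 / l) * (2 * \<epsilon>) / l" .
      show ?thesis unfolding abs_mult using 1 PR by (intro mult_mono) auto
    qed
    moreover have "(sqrt (2 / l) * (2 * \<epsilon>) / l) * (2 * R) = sqrt (2 / l) * (4 * \<epsilon> * R / l)" by simp
    ultimately show ?thesis unfolding distrib_left by linarith
  qed
  have s: "s \<ge> \<sigma> / 2" using sd by linarith
  have sp: "s > 0" using s \<sigma> by linarith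
  have inv_s: "1 / s \<le> 2 / \<sigma>" using s \<sigma> sp by (simp add: field_simps)
  have "(1 / s) * A - B / \<sigma> = (1 / s) * (A - B) + B * ((\<sigma> - s) / (s * \<sigma>))" using sp \<sigma> by (simp add: field_simps)
  moreover have "\<bar>(1 / s) * (A - B)\<bar> \<le> (2 / \<sigma>) * (sqrt (2 / l) * (D + 4 * \<epsilon> * R / l))"
    unfolding abs_mult using inv_s sp AB \<sigma> by (intro mult_mono) auto
  moreover have "\<bar>B * ((\<sigma> - s) / (s * \<sigma>))\<bar> \<le> (2 * R / sqrt l) * (sd * (2 / \<sigma> / \<sigma>))"
  proof -
    have "\<bar>(\<sigma> - s) / (s * \<sigma>)\<bar> = \<bar>s - \<sigma>\<bar> * ((1 / s) / \<sigma>)" using sp \<sigma> by (simp add: abs_divide abs_mult abs_minus_commute)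
    also have "\<dots> \<le> sd * (2 / \<sigma> / \<sigma>)" using sd(1) inv_s sp \<sigma> by (intro mult_mono divide_right_mono) auto
    finally have "\<bar>(\<sigma> - s) / (s * \<sigma>)\<bar> \<le> sd * (2 / \<sigma> / \<sigma>)" .
    then show ?thesis unfolding abs_mult using B0 BR by (intro mult_mono) auto
  qed
  moreover have "(2 * R / sqrt l) * (sd * (2 / \<sigma> / \<sigma>)) = 4 * R * sd / (sqrt l * \<sigma>\<^sup>2)"
    by (simp add: power2_eq_square)
  moreover have "\<bar>x\<bar> \<le> c1 + c3" if "x = u + v" "\<bar>u\<bar> \<le> c1" "\<bar>v\<bar> \<le> c2" "c2 = c3" for x u v c1 c2 c3 :: real
    using that by linarith
  ultimately have "\<bar>(1 / s) * A - B / \<sigma>\<bar> \<le> (2 / \<sigma>) * (sqrt (2 / l) * (D + 4 * \<epsilon> * R / l)) + 4 * R * sd / (sqrt l * \<sigma>\<^sup>2)"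
    by blast
  then show ?thesis unfolding A_def B_def D_def l_def by (simp only: mult.assoc)
qed

lemma bartlett_form_nonneg: "0 \<le> bartlett_form y m q"
  unfolding bartlett_form_windows by (intro divide_nonneg_nonneg sum_nonneg) auto

text \<open>The perturbation bound for the seminorm is combined with
  \<open>|sqrt v - \<sigma>| \<le> |v - \<sigma>^2| / \<sigma>\<close>.\<close>

lemma sqrt_bartlett_close:
  fixes y e Z :: "nat \<Rightarrow> real"
  assumes m: "m > 0" and y: "\<And>i. 1 \<le> i \<Longrightarrow> i \<le> m \<Longrightarrow> y i = c0 + e i + Z i"
    and C: "(\<Sum>i=1..m. (e i)\<^sup>2) \<le> C" and Z: "(\<Sum>i=1..m. Z i)\<^sup>2 / real m \<le> D"
    and \<sigma>: "\<sigma> > 0" and b: "\<bar>bartlett_form Z m q - \<sigma>\<^sup>2\<bar> \<le> \<delta>"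
  shows "\<bar>sqrt (bartlett_form (\<lambda>i. y i - (\<Sum>i=1..m. y i) / real m) m q) - \<sigma>\<bar>
    \<le> sqrt ((real q + 1) / real m * (2 * C + 2 * D)) + \<delta> / \<sigma>"
proof -
  define v where "v = bartlett_form Z m q"
  have v: "v \<ge> 0" unfolding v_def by (rule bartlett_form_nonneg)
  have "\<bar>sqrt v - \<sigma>\<bar> \<le> \<delta> / \<sigma>"
  proof -
    have "v - \<sigma>\<^sup>2 = (sqrt v - \<sigma>) * (sqrt v + \<sigma>)" using v by (simp add: algebra_simps power2_eq_square)
    then have "\<bar>v - \<sigma>\<^sup>2\<bar> = \<bar>sqrt v - \<sigma>\<bar> * (sqrt v + \<sigma>)" using v \<sigma> by (simp add: abs_mult)
    moreover have "\<bar>sqrt v - \<sigma>\<bar> * \<sigma> \<le> \<bar>sqrt v - \<sigma>\<bar> * (sqrt v + \<sigma>)" using v by (intro mult_left_mono) auto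
    ultimately have "\<bar>sqrt v - \<sigma>\<bar> * \<sigma> \<le> \<delta>" using b unfolding v_def by linarith
    then show ?thesis using \<sigma> by (simp add: pos_le_divide_eq)
  qed
  moreover have "\<bar>sqrt (bartlett_form (\<lambda>i. y i - (\<Sum>i=1..m. y i) / real m) m q) - sqrt v\<bar>
    \<le> sqrt ((real q + 1) / real m * (2 * C + 2 * (\<Sum>i=1..m. Z i)\<^sup>2 / real m))"
    unfolding v_def by (rule bartlett_form_perturb[OF m y C])
  moreover have "sqrt ((real q + 1) / real m * (2 * C + 2 * (\<Sum>i=1..m. Z i)\<^sup>2 / real m)) \<le> sqrt ((real q + 1) / real m * (2 * C + 2 * D))"
    using Z by (intro real_sqrt_le_mono mult_left_mono) auto
  ultimately show ?thesis by linarith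
qed

section \<open>Convergence in distribution and in probability\<close>

text \<open>A bounded continuous \<open>f\<close> need not be uniformly continuous. Tightness of
  \<open>X\<close> confines both sequences to a ball, on which \<open>f\<close> is uniformly
  continuous; outside, boundedness of \<open>f\<close> is paid for by a small probability.\<close>

lemma slutsky_R2:
  fixes T X :: "nat \<Rightarrow> 'a \<Rightarrow> real \<times> real"
  assumes M: "prob_space M" and T: "\<And>n. T n \<in> borel_measurable M" and X: "\<And>n. X n \<in> borel_measurable M"
    and conv: "\<And>g :: real \<times> real \<Rightarrow> real. continuous_on UNIV g \<Longrightarrow> bounded (range g) \<Longrightarrow> (\<lambda>n. \<integral>\<omega>. g (X n \<omega>) \<partial>M) \<longlonglongrightarrow> (\<integral>\<omega>. g (L \<omega>) \<partial>N)"
    and tight: "\<And>\<eta>. \<eta> > 0 \<Longrightarrow> \<exists>R. eventually (\<lambda>n. \<exists>E\<in>sets M. measure M E < \<eta> \<and> (\<forall>\<omega>\<in>space M - E. norm (X n \<omega>) \<le> R)) sequentially"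
    and close: "\<And>\<tau> \<eta>. \<tau> > 0 \<Longrightarrow> \<eta> > 0 \<Longrightarrow> eventually (\<lambda>n. \<exists>E\<in>sets M. measure M E < \<eta> \<and> (\<forall>\<omega>\<in>space M - E. dist (T n \<omega>) (X n \<omega>) \<le> \<tau>)) sequentially"
  shows "conv_dist_R2 M T N L"
  unfolding conv_dist_R2_def
proof (intro allI impI)
  interpret prob_space M by fact
  fix f :: "real \<times> real \<Rightarrow> real" assume "continuous_on UNIV f \<and> bounded (range f)"
  then have f: "continuous_on UNIV f" and bf: "bounded (range f)" by auto
  obtain C where C: "\<And>x. \<bar>f x\<bar> \<le> C" using bf by (auto simp: bounded_iff)
  have fb: "f \<in> borel_measurable borel" by (rule borel_measurable_continuous_onI[OF f])
  have mT: "(\<lambda>\<omega>. f (T n \<omega>)) \<in> borel_measurable M" and mX: "(\<lambda>\<omega>. f (X n \<omega>)) \<in> borel_measurable M" for n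
    using measurable_compose[OF T fb] measurable_compose[OF X fb] by auto
  have iT: "integrable M (\<lambda>\<omega>. f (T n \<omega>))" and iX: "integrable M (\<lambda>\<omega>. f (X n \<omega>))" for n
    by (rule integrable_const_bound[of _ C]; simp add: C mT mX)+
  have C0: "C \<ge> 0" using C[of 0] by linarith
  have "(\<lambda>n. (\<integral>\<omega>. f (T n \<omega>) \<partial>M) - (\<integral>\<omega>. f (X n \<omega>) \<partial>M)) \<longlonglongrightarrow> 0"
  proof (rule LIMSEQ_I)
    fix e :: real assume e: "e > 0"
    \<comment> \<open>Two exceptional events and the bound \<open>2 C\<close> on the difference of
      values of \<open>f\<close> contribute at most \<open>4 C \<eta> \<le> e/2\<close>.\<close>
    define \<eta> where "\<eta> = e / (8 * (C + 1))"
    have \<eta>: "\<eta> > 0" using e C0 by (simp add: \<eta>_def)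
    obtain R where R: "eventually (\<lambda>n. \<exists>E\<in>sets M. measure M E < \<eta> \<and> (\<forall>\<omega>\<in>space M - E. norm (X n \<omega>) \<le> R)) sequentially"
      using tight[OF \<eta>] by blast
    have "uniformly_continuous_on (cball 0 (R + 1)) f"
      by (rule compact_uniformly_continuous[OF continuous_on_subset[OF f]]) auto
    then obtain d where d: "d > 0" "\<And>x y. x \<in> cball 0 (R + 1) \<Longrightarrow> y \<in> cball 0 (R + 1) \<Longrightarrow> dist x y < d \<Longrightarrow> dist (f x) (f y) < e/4"
      using e unfolding uniformly_continuous_on_def by (metis zero_less_divide_iff zero_less_numeral)
    \<comment> \<open>The cap at 1 keeps \<open>T n\<close> inside the ball of radius
      \<open>R + 1\<close>.\<close>
    define \<tau> where "\<tau> = min (d/2) 1"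
    have \<tau>: "\<tau> > 0" using d(1) by (simp add: \<tau>_def)
    have "eventually (\<lambda>n. norm ((\<integral>\<omega>. f (T n \<omega>) \<partial>M) - (\<integral>\<omega>. f (X n \<omega>) \<partial>M) - 0) < e) sequentially"
      using R close[OF \<tau> \<eta>]
    proof eventually_elim
      case (elim n)
      then obtain E1 E2 where E1: "E1 \<in> sets M" "measure M E1 < \<eta>" "\<And>\<omega>. \<omega> \<in> space M - E1 \<Longrightarrow> norm (X n \<omega>) \<le> R"
        and E2: "E2 \<in> sets M" "measure M E2 < \<eta>" "\<And>\<omega>. \<omega> \<in> space M - E2 \<Longrightarrow> dist (T n \<omega>) (X n \<omega>) \<le> \<tau>" by blast
      define E where "E = E1 \<union> E2"
      have E: "E \<in> sets M" using E1 E2 by (simp add: E_def)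
      have pE: "measure M E \<le> 2 * \<eta>" using measure_Un_le[OF E1(1) E2(1)] E1(2) E2(2) by (simp add: E_def)
      have pw: "\<bar>f (T n \<omega>) - f (X n \<omega>)\<bar> \<le> e/4 + 2 * C * indicator E \<omega>" if w: "\<omega> \<in> space M" for \<omega>
      proof (cases "\<omega> \<in> E")
        case True
        then show ?thesis using C[of "T n \<omega>"] C[of "X n \<omega>"] e by simp
      next
        case False
        then have 1: "norm (X n \<omega>) \<le> R" and 2: "dist (T n \<omega>) (X n \<omega>) \<le> \<tau>" using w E1(3) E2(3) by (auto simp: E_def)
        have x: "X n \<omega> \<in> cball 0 (R + 1)" using 1 by simp
        have "norm (T n \<omega>) \<le> norm (X n \<omega>) + dist (T n \<omega>) (X n \<omega>)"
          using norm_triangle_sub[of "T n \<omega>" "X n \<omega>"] by (simp add: dist_norm)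
        also have "\<dots> \<le> R + 1" using 1 2 by (simp add: \<tau>_def)
        finally have t: "T n \<omega> \<in> cball 0 (R + 1)" by simp
        have "dist (T n \<omega>) (X n \<omega>) < d" using 2 d(1) by (simp add: \<tau>_def)
        from d(2)[OF t x this] have "\<bar>f (T n \<omega>) - f (X n \<omega>)\<bar> \<le> e/4" by (simp add: dist_real_def)
        then show ?thesis using False by simp
      qed
      have "\<bar>(\<integral>\<omega>. f (T n \<omega>) \<partial>M) - (\<integral>\<omega>. f (X n \<omega>) \<partial>M)\<bar> = \<bar>\<integral>\<omega>. f (T n \<omega>) - f (X n \<omega>) \<partial>M\<bar>" using iT iX by simp
      also have "\<dots> \<le> (\<integral>\<omega>. \<bar>f (T n \<omega>) - f (X n \<omega>)\<bar> \<partial>M)" by (rule integral_abs_bound)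
      also have "\<dots> \<le> (\<integral>\<omega>. e/4 + 2 * C * indicator E \<omega> \<partial>M)"
      proof (rule integral_mono)
        show "integrable M (\<lambda>\<omega>. \<bar>f (T n \<omega>) - f (X n \<omega>)\<bar>)" using iT iX by simp
        show "integrable M (\<lambda>\<omega>. e/4 + 2 * C * indicator E \<omega>)" using E by (simp add: emeasure_eq_measure)
      qed (rule pw)
      also have "\<dots> = e/4 + 2 * C * measure M E" using E by (simp add: emeasure_eq_measure prob_space)
      also have "\<dots> \<le> e/4 + 2 * C * (2 * \<eta>)" by (intro add_left_mono mult_left_mono pE) (use C0 in simp)
      also have "\<dots> \<le> e/4 + 4 * (C + 1) * \<eta>" using \<eta> by (simp add: algebra_simps)
      also have "4 * (C + 1) * \<eta> = e/2"
      proof -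
        have "4 * u * (e / (8 * u)) = e/2" if "u > 0" for u :: real using that by simp
        then show ?thesis using C0 unfolding \<eta>_def by (metis add_nonneg_pos zero_less_one)
      qed
      also have "e/4 + e/2 < e" using e by simp
      finally show ?case by simp
    qed
    then show "\<exists>n0. \<forall>n\<ge>n0. norm ((\<integral>\<omega>. f (T n \<omega>) \<partial>M) - (\<integral>\<omega>. f (X n \<omega>) \<partial>M) - 0) < e"
      by (simp add: eventually_sequentially)
  qed
  from tendsto_add[OF this conv[OF f bf]] show "(\<lambda>n. \<integral>\<omega>. f (T n \<omega>) \<partial>M) \<longlonglongrightarrow> (\<integral>\<omega>. f (L \<omega>) \<partial>N)" by simp
qed

text \<open>Truncation at \<open>\<tau>\<close> makes \<open>F k\<close> a bounded test functional.
  Its expectation under the limit tends to 0 in \<open>k\<close>; fixing a \<open>k\<close> with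
  value below \<open>\<eta> \<tau>\<close>, convergence in \<open>n\<close> and Markov finish. The
  index \<open>k\<close> is chosen before \<open>n\<close>, so the result yields both tightness and
  asymptotic equicontinuity.\<close>

lemma functional_negligible:
  assumes M: "prob_space M" and N: "prob_space N"
    and conv: "conv_dist_D01 M (\<lambda>n \<omega> t. V n (nat \<lfloor>real n * t\<rfloor>) \<omega>) N (\<lambda>\<omega> t. B t \<omega>)"
    and V: "\<And>n i. V n i \<in> borel_measurable M"
    and B: "\<And>t. t \<in> {0..1} \<Longrightarrow> B t \<in> borel_measurable N"
    and c: "\<And>\<omega>. \<omega> \<in> space N \<Longrightarrow> continuous_on {0..1} (\<lambda>t. B t \<omega>)"
    and F: "\<And>k. supnorm_continuous (F k)" and nn: "\<And>k x. x \<in> cadlag01 \<Longrightarrow> 0 \<le> F k x"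
    and lim: "\<And>\<omega>. \<omega> \<in> space N \<Longrightarrow> (\<lambda>k. F k (\<lambda>t. B t \<omega>)) \<longlonglongrightarrow> 0"
    and \<tau>: "\<tau> > 0" and \<eta>: "\<eta> > 0"
  shows "\<exists>k::nat. eventually (\<lambda>n. \<exists>E\<in>sets M. measure M E < \<eta> \<and> (\<forall>\<omega>\<in>space M - E. F k (\<lambda>t. V n (nat \<lfloor>real n * t\<rfloor>) \<omega>) < \<tau>)) sequentially"
proof -
  interpret M: prob_space M by fact
  interpret N: prob_space N by fact
  define H where "H k x = min \<tau> (F k x)" for k x
  have Hs: "supnorm_continuous (H k)" for k
  proof -
    have "continuous_on UNIV (\<lambda>u::real. min \<tau> u)" by (intro continuous_intros)
    from supnorm_continuous_compose[OF this F] show ?thesis unfolding H_def[abs_def] .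
  qed
  have Hb: "\<bar>H k x\<bar> \<le> \<tau>" if "x \<in> cadlag01" for k x using nn[OF that] \<tau> by (auto simp: H_def min_def)
  have Hm: "(\<lambda>\<omega>. H k (\<lambda>t. B t \<omega>)) \<in> borel_measurable N" for k
    by (rule measurable_supnorm_continuous_continuous[OF Hs B c])
  have Bc: "(\<lambda>t. B t \<omega>) \<in> cadlag01" if "\<omega> \<in> space N" for \<omega> by (rule continuous_in_cadlag01[OF c[OF that]])
  have "(\<lambda>k. \<integral>\<omega>. H k (\<lambda>t. B t \<omega>) \<partial>N) \<longlonglongrightarrow> (\<integral>\<omega>. 0 \<partial>N)"
  proof (rule integral_dominated_convergence[where w="\<lambda>_. \<tau>"])
    show "AE \<omega> in N. (\<lambda>k. H k (\<lambda>t. B t \<omega>)) \<longlonglongrightarrow> 0"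
    proof (rule AE_I2)
      fix \<omega> assume "\<omega> \<in> space N"
      from tendsto_min[OF tendsto_const[of \<tau>] lim[OF this]] show "(\<lambda>k. H k (\<lambda>t. B t \<omega>)) \<longlonglongrightarrow> 0"
        using \<tau> by (simp add: H_def)
    qed
  qed (use Hm Hb Bc in auto)
  then have "eventually (\<lambda>k. (\<integral>\<omega>. H k (\<lambda>t. B t \<omega>) \<partial>N) < \<eta> * \<tau>) sequentially"
    using \<tau> \<eta> by (intro order_tendstoD(2)) auto
  then obtain k where k: "(\<integral>\<omega>. H k (\<lambda>t. B t \<omega>) \<partial>N) < \<eta> * \<tau>" using eventually_happens by force
  have "(\<lambda>n. \<integral>\<omega>. H k (\<lambda>t. V n (nat \<lfloor>real n * t\<rfloor>) \<omega>) \<partial>M) \<longlonglongrightarrow> (\<integral>\<omega>. H k (\<lambda>t. B t \<omega>) \<partial>N)"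
    by (rule conv_dist_D01_supnorm_continuous[OF M N conv V B c Hs Hb])
  from order_tendstoD(2)[OF this k]
  have "eventually (\<lambda>n. \<exists>E\<in>sets M. measure M E < \<eta> \<and> (\<forall>\<omega>\<in>space M - E. F k (\<lambda>t. V n (nat \<lfloor>real n * t\<rfloor>) \<omega>) < \<tau>)) sequentially"
  proof eventually_elim
    case (elim n)
    let ?Z = "\<lambda>\<omega> t. V n (nat \<lfloor>real n * t\<rfloor>) \<omega>"
    have Zc: "?Z \<omega> \<in> cadlag01" for \<omega> using step_in_cadlag01[of "\<lambda>i. V n i \<omega>" n] .
    have m: "(\<lambda>\<omega>. H k (?Z \<omega>)) \<in> borel_measurable M" by (rule measurable_supnorm_continuous_step[OF Hs V])
    have i: "integrable M (\<lambda>\<omega>. H k (?Z \<omega>))" by (rule M.integrable_const_bound[of _ \<tau>]) (simp_all add: m Hb Zc)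
    define E where "E = {\<omega>\<in>space M. H k (?Z \<omega>) \<ge> \<tau>}"
    have "measure M E \<le> (\<integral>\<omega>. H k (?Z \<omega>) \<partial>M) / \<tau>" unfolding E_def
      by (rule integral_Markov_inequality_measure[OF i, of "{}"]) (use nn[OF Zc] \<tau> in \<open>auto simp: H_def\<close>)
    also have "\<dots> < \<eta>" using elim \<tau> by (simp add: pos_divide_less_eq)
    finally have "measure M E < \<eta>" .
    moreover have "E \<in> sets M" unfolding E_def using m by measurable
    moreover have "F k (?Z \<omega>) < \<tau>" if "\<omega> \<in> space M - E" for \<omega> using that by (auto simp: E_def H_def)
    ultimately show ?case by blast
  qed
  then show ?thesis by blast
qed

section \<open>Measurability of the statistics\<close>

lemma measurable_psum:
  assumes x: "\<And>i. (\<lambda>\<omega>. x \<omega> i) \<in> borel_measurable M"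
  shows "(\<lambda>\<omega>. psum (x \<omega>) a b) \<in> borel_measurable M"
  unfolding psum_def by (intro borel_measurable_sum x)

lemma measurable_khat:
  assumes x: "\<And>i. (\<lambda>\<omega>. x \<omega> i) \<in> borel_measurable M"
  shows "(\<lambda>\<omega>. khat (x \<omega>) n) \<in> M \<rightarrow>\<^sub>M count_space UNIV"
proof -
  have [measurable]: "(\<lambda>\<omega>. cusum_dev (x \<omega>) n k) \<in> borel_measurable M" for k
    unfolding cusum_dev_def using measurable_psum[OF x] by measurable
  have [measurable]: "(\<lambda>\<omega>. Max (cusum_dev (x \<omega>) n ` {1..n})) \<in> borel_measurable M"
    by (rule borel_measurable_Max) auto
  show ?thesis unfolding khat_def by measurable
qed

lemma measurable_block_max:
  assumes x: "\<And>i. (\<lambda>\<omega>. x \<omega> i) \<in> borel_measurable M"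
  shows "(\<lambda>\<omega>. block_max (x \<omega>) a b) \<in> borel_measurable M"
proof -
  note [measurable] = measurable_psum[OF x]
  show ?thesis unfolding block_max_def by measurable
qed

lemma measurable_lrv_block:
  assumes [measurable]: "\<And>i. (\<lambda>\<omega>. x \<omega> i) \<in> borel_measurable M"
  shows "(\<lambda>\<omega>. lrv_block (x \<omega>) a b q) \<in> borel_measurable M"
proof -
  note [measurable] = measurable_psum[OF assms]
  show ?thesis unfolding lrv_block_def Let_def by measurable
qed

lemma T_n1_block:
  "T_n1 q x n = (let k = khat x n in (1 / sqrt (lrv_block x 0 k (q k))) * (1 / sqrt (real (k - 0))) * block_max x 0 k)"
proof -
  have "{0<..k} = {1..k}" for k :: nat by auto
  then show ?thesis unfolding T_n1_def block_max_def by simp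
qed

lemma T_n2_block:
  "T_n2 q x n = (let k = khat x n in (1 / sqrt (lrv_block x k n (q (n - k)))) * (1 / sqrt (real (n - k))) * block_max x k n)"
  unfolding T_n2_def block_max_def ..

text \<open>The random split point takes countably many values, and for each fixed value the
  statistic is measurable.\<close>

lemma measurable_T:
  assumes x: "\<And>i. (\<lambda>\<omega>. x \<omega> i) \<in> borel_measurable M"
  shows "(\<lambda>\<omega>. (T_n1 q (x \<omega>) n, T_n2 q (x \<omega>) n)) \<in> borel_measurable M"
proof -
  note [measurable] = measurable_block_max[OF x] measurable_lrv_block[OF x]
  have "(\<lambda>\<omega>. T_n1 q (x \<omega>) n) \<in> borel_measurable M"
    unfolding T_n1_block Let_def
    by (rule measurable_compose_countable[OF _ measurable_khat[OF x]]) measurable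
  moreover have "(\<lambda>\<omega>. T_n2 q (x \<omega>) n) \<in> borel_measurable M"
    unfolding T_n2_block Let_def
    by (rule measurable_compose_countable[OF _ measurable_khat[OF x]]) measurable
  ultimately show ?thesis by (rule borel_measurable_Pair)
qed

text \<open>\<open>block_approx \<alpha> \<beta> \<sigma> R \<zeta> \<tau>\<close>: if all error terms of a block \<open>(a, b]\<close> are at most \<open>\<zeta>\<close>, where
  \<open>a / n \<approx> \<alpha>\<close> and \<open>b / n \<approx> \<beta>\<close>, then its studentized CUSUM statistic is \<open>\<tau>\<close>-close to the bridge functional.\<close>

definition block_approx :: "real \<Rightarrow> real \<Rightarrow> real \<Rightarrow> real \<Rightarrow> real \<Rightarrow> real \<Rightarrow> bool" where
  "block_approx \<alpha> \<beta> \<sigma> R \<zeta> \<tau> \<longleftrightarrow> (\<forall>n a b z Y x c0 e s r \<epsilon> h.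
     n > 0 \<and> a < b \<and> b \<le> n \<and> z \<in> cadlag01 \<and> (\<forall>k\<le>n. z (real k / real n) = (\<Sum>i=1..k. Y i) / sqrt (real n)) \<and>
     \<bar>\<alpha> - real a / real n\<bar> \<le> \<epsilon> \<and> \<bar>\<beta> - real b / real n\<bar> \<le> \<epsilon> \<and> \<epsilon> + 1 / real (b - a) \<le> h \<and> \<epsilon> \<le> \<zeta> \<and>
     modulus h z \<le> \<zeta> \<and> sup_abs z \<le> R \<and> (\<forall>i. a < i \<longrightarrow> i \<le> b \<longrightarrow> x i = c0 + e i + Y i) \<and>
     (\<Sum>i\<in>{a<..b}. \<bar>e i\<bar>) \<le> r \<and> r / sqrt (real n) \<le> \<zeta> \<and> 1 / real n \<le> \<zeta> \<and> \<bar>s - \<sigma>\<bar> \<le> \<zeta> \<longrightarrow>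
     \<bar>(1 / s) * (1 / sqrt (real (b - a))) * block_max x a b - bridge_sup \<alpha> \<beta> z / \<sigma>\<bar> \<le> \<tau>)"

lemma block_approxD:
  assumes "block_approx \<alpha> \<beta> \<sigma> R \<zeta> \<tau>" "n > 0" "a < b" "b \<le> n" "z \<in> cadlag01"
    "\<And>k. k \<le> n \<Longrightarrow> z (real k / real n) = (\<Sum>i=1..k. Y i) / sqrt (real n)"
    "\<bar>\<alpha> - real a / real n\<bar> \<le> \<epsilon>" "\<bar>\<beta> - real b / real n\<bar> \<le> \<epsilon>" "\<epsilon> + 1 / real (b - a) \<le> h" "\<epsilon> \<le> \<zeta>"
    "modulus h z \<le> \<zeta>" "sup_abs z \<le> R" "\<And>i. a < i \<Longrightarrow> i \<le> b \<Longrightarrow> x i = c0 + e i + Y i"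
    "(\<Sum>i\<in>{a<..b}. \<bar>e i\<bar>) \<le> r" "r / sqrt (real n) \<le> \<zeta>" "1 / real n \<le> \<zeta>" "\<bar>s - \<sigma>\<bar> \<le> \<zeta>"
  shows "\<bar>(1 / s) * (1 / sqrt (real (b - a))) * block_max x a b - bridge_sup \<alpha> \<beta> z / \<sigma>\<bar> \<le> \<tau>"
proof -
  have k: "\<forall>k\<le>n. z (real k / real n) = (\<Sum>i=1..k. Y i) / sqrt (real n)"
    and i: "\<forall>i. a < i \<longrightarrow> i \<le> b \<longrightarrow> x i = c0 + e i + Y i" using assms(6,13) by auto
  show ?thesis
    by (rule assms(1)[unfolded block_approx_def, THEN spec[of _ n], THEN spec[of _ a], THEN spec[of _ b],
        THEN spec[of _ z], THEN spec[of _ Y], THEN spec[of _ x], THEN spec[of _ c0], THEN spec[of _ e],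
        THEN spec[of _ s], THEN spec[of _ r], THEN spec[of _ \<epsilon>], THEN spec[of _ h], THEN mp])
      (intro conjI assms(2-5,7-12,14-17) k i)
qed

section \<open>Deterministic comparison outside the exceptional events\<close>

text \<open>All error terms are at most linear in the tolerance, with total constant
  \<open>Kc\<close>. The claim covers every smaller tolerance so that the two blocks can share
  one.\<close>

lemma block_stat_small:
  fixes \<alpha> \<beta> \<sigma> \<tau> R :: real
  assumes al: "0 \<le> \<alpha>" "\<alpha> < \<beta>" "\<beta> \<le> 1" and \<sigma>: "\<sigma> > 0" and \<tau>: "\<tau> > 0" and R0: "R \<ge> 0"
  shows "\<exists>\<zeta>>0. \<forall>\<zeta>'. 0 < \<zeta>' \<and> \<zeta>' \<le> \<zeta> \<longrightarrow> block_approx \<alpha> \<beta> \<sigma> R \<zeta>' \<tau>"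
proof -
  define l where "l = \<beta> - \<alpha>"
  have l: "l > 0" using al by (simp add: l_def)
  define c where "c = (2 / \<sigma>) * sqrt (2 / l)"
  have c: "c > 0" using \<sigma> l by (simp add: c_def)
  define Kc where "Kc = c * (4 + 8 * R / l) + 4 * R / (sqrt l * \<sigma>\<^sup>2)"
  have Kc: "Kc \<ge> 0" unfolding Kc_def using c R0 l \<sigma> by (intro add_nonneg_nonneg mult_nonneg_nonneg) auto
  \<comment> \<open>\<open>l / 4\<close> and \<open>\<sigma> / 2\<close> meet the side conditions of
    \<open>block_stat_close\<close>; the first entry makes
    \<open>Kc \<zeta> \<le> \<tau>\<close>.\<close>
  define \<zeta> where "\<zeta> = min (\<tau> / (Kc + 1)) (min (l / 4) (\<sigma> / 2))"
  have \<zeta>0: "\<zeta> > 0" using \<tau> Kc l \<sigma> by (simp add: \<zeta>_def)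
  show ?thesis
  proof (rule exI[of _ \<zeta>], unfold block_approx_def, intro conjI allI impI \<zeta>0, elim conjE)
    fix \<zeta>' n a b z Y x c0 e s r \<epsilon> h
    assume z': "0 < \<zeta>'" "\<zeta>' \<le> \<zeta>" and n: "(n::nat) > 0" and ab: "a < b" "b \<le> n" and z: "z \<in> cadlag01"
      and zk: "\<forall>k\<le>n. z (real k / real n) = (\<Sum>i=1..k. Y i) / sqrt (real n)"
      and e1: "\<bar>\<alpha> - real a / real n\<bar> \<le> \<epsilon>" and e2: "\<bar>\<beta> - real b / real n\<bar> \<le> \<epsilon>" and e3: "\<epsilon> + 1 / real (b - a) \<le> h" and e4: "\<epsilon> \<le> \<zeta>'"
      and m: "modulus h z \<le> \<zeta>'" and R: "sup_abs z \<le> R" and x: "\<forall>i. a < i \<longrightarrow> i \<le> b \<longrightarrow> x i = c0 + e i + Y i"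
      and r: "(\<Sum>i\<in>{a<..b}. \<bar>e i\<bar>) \<le> r" and rn: "r / sqrt (real n) \<le> \<zeta>'" and n1: "1 / real n \<le> \<zeta>'" and s: "\<bar>s - \<sigma>\<bar> \<le> \<zeta>'"
    have z4: "\<zeta>' \<le> l / 4" "\<zeta>' \<le> \<sigma> / 2" "\<zeta>' \<le> \<tau> / (Kc + 1)" using z'(2) by (auto simp: \<zeta>_def)
    have "\<bar>(1 / s) * (1 / sqrt (real (b - a))) * block_max x a b - bridge_sup \<alpha> \<beta> z / \<sigma>\<bar>
      \<le> (2 / \<sigma>) * sqrt (2 / (\<beta> - \<alpha>)) * (2 * r / sqrt (real n) + 2 * \<zeta>' + 4 * R / ((\<beta> - \<alpha>) * real n) + 4 * \<epsilon> * R / (\<beta> - \<alpha>))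
        + 4 * R * \<zeta>' / (sqrt (\<beta> - \<alpha>) * \<sigma>\<^sup>2)"
    proof (rule block_stat_close[OF al n ab z _ e1 e2 e3 _ m R _ r \<sigma> s z4(2)])
      show "z (real k / real n) = (\<Sum>i=1..k. Y i) / sqrt (real n)" if "k \<le> n" for k using zk that by blast
      show "\<epsilon> \<le> (\<beta> - \<alpha>) / 4" using e4 z4(1) unfolding l_def by linarith
      show "x i = c0 + e i + Y i" if "a < i" "i \<le> b" for i using x that by blast
    qed
    also have "\<dots> = c * (2 * (r / sqrt (real n)) + 2 * \<zeta>' + 4 * R / l * (1 / real n) + 4 * R / l * \<epsilon>) + 4 * R / (sqrt l * \<sigma>\<^sup>2) * \<zeta>'"
      unfolding c_def l_def by (simp add: mult_ac)
    also have "\<dots> \<le> c * (2 * \<zeta>' + 2 * \<zeta>' + 4 * R / l * \<zeta>' + 4 * R / l * \<zeta>') + 4 * R / (sqrt l * \<sigma>\<^sup>2) * \<zeta>'"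
      using c R0 l rn n1 e4 by (intro add_mono mult_left_mono order.refl) auto
    also have "\<dots> = Kc * \<zeta>'" unfolding Kc_def by (simp add: algebra_simps)
    also have "\<dots> \<le> (Kc + 1) * (\<tau> / (Kc + 1))" using Kc z4(3) z'(1) by (intro mult_mono) auto
    also have "\<dots> = \<tau>" using Kc by simp
    finally show "\<bar>(1 / s) * (1 / sqrt (real (b - a))) * block_max x a b - bridge_sup \<alpha> \<beta> z / \<sigma>\<bar> \<le> \<tau>" .
  qed
qed

lemma sum_const_subset:
  fixes d :: real
  assumes "finite A" and f0: "f 0 = (0::real)"
  shows "(\<Sum>i\<in>A. f (if P i then d else 0)) = real (card {i\<in>A. P i}) * f d"
proof -
  have "(\<Sum>i\<in>A. f (if P i then d else 0)) = (\<Sum>i\<in>A. if P i then f d else 0)" by (rule sum.cong) (auto simp: f0)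
  also have "\<dots> = (\<Sum>i\<in>{i\<in>A. P i}. f d)" by (rule sum.mono_neutral_cong_right) (use assms in auto)
  finally show ?thesis by simp
qed

text \<open>A statement about one outcome: randomness enters through the listed bounds on the path,
  on \<open>khat\<close> and on the Bartlett forms of all admissible lengths. With \<open>c\<close>
  half the smaller relative block length and \<open>\<epsilon> \<le> c / 2\<close>, both estimated
  blocks have length at least \<open>c n\<close>.\<close>

lemma statistics_close_pointwise:
  fixes y :: "nat \<Rightarrow> real" and \<theta> \<sigma> R C \<epsilon> h \<zeta> \<tau> \<delta> c \<Delta> \<mu> :: real and q :: "nat \<Rightarrow> nat"
  assumes \<theta>: "0 < \<theta>" "\<theta> < 1" and \<sigma>: "\<sigma> > 0" and c: "c = min \<theta> (1 - \<theta>) / 2" and R0: "R \<ge> 0" and C0: "C \<ge> 0"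
    and z1: "block_approx 0 \<theta> \<sigma> R \<zeta> \<tau>" and z2: "block_approx \<theta> 1 \<sigma> R \<zeta> \<tau>"
    and \<epsilon>: "0 < \<epsilon>" "\<epsilon> \<le> \<zeta>" "\<epsilon> \<le> h / 2" "\<epsilon> \<le> c / 2"
    and n: "n > 0" "1 / real n \<le> \<epsilon> / 2" "1 / (c * real n) \<le> h / 2"
    and \<Delta>: "real n * \<Delta>\<^sup>2 > 0" "C / (real n * \<Delta>\<^sup>2) \<le> \<epsilon> / 2" "C / sqrt (real n * \<Delta>\<^sup>2) \<le> \<zeta>"
    and qn: "mono q" "sqrt ((real (q n) + 1) / (c * real n) * (2 * C + 8 * R\<^sup>2 / c)) \<le> \<zeta> / 2" and \<delta>: "\<delta> \<le> \<sigma> * \<zeta> / 2"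
    and z: "z \<in> cadlag01" "\<And>k. k \<le> n \<Longrightarrow> z (real k / real n) = (\<Sum>i=1..k. y i) / sqrt (real n)"
    and zm: "modulus h z \<le> \<zeta>" "sup_abs z \<le> R"
    and x: "x = (\<lambda>i. \<mu> + (if i > nat \<lfloor>real n * \<theta>\<rfloor> then \<Delta> else 0) + y i)"
    and kh: "\<Delta>\<^sup>2 * \<bar>real (khat x n) - real (nat \<lfloor>real n * \<theta>\<rfloor>)\<bar> \<le> C"
    and b1: "\<And>k. c * real n \<le> real k \<Longrightarrow> k \<le> n \<Longrightarrow> \<bar>bartlett_form y k (q k) - \<sigma>\<^sup>2\<bar> \<le> \<delta>"
    and b2: "\<And>k. c * real n \<le> real k \<Longrightarrow> k \<le> n \<Longrightarrow> \<bar>bartlett_form (\<lambda>i. y (n + 1 - i)) k (q k) - \<sigma>\<^sup>2\<bar> \<le> \<delta>"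
  shows "\<bar>T_n1 q x n - bridge_sup 0 \<theta> z / \<sigma>\<bar> \<le> \<tau> \<and> \<bar>T_n2 q x n - bridge_sup \<theta> 1 z / \<sigma>\<bar> \<le> \<tau>"
proof -
  define k where "k = khat x n"
  define ks where "ks = nat \<lfloor>real n * \<theta>\<rfloor>"
  define d where "d = \<bar>real k - real ks\<bar>"
  have np: "real n > 0" using n by simp
  have cp: "c > 0" using \<theta> by (simp add: c)
  have D2: "\<Delta>\<^sup>2 > 0" using \<Delta>(1) np by (simp add: zero_less_mult_iff)
  have dC: "\<Delta>\<^sup>2 * d \<le> C" using kh by (simp add: d_def k_def ks_def)
  have d0: "0 \<le> d" by (simp add: d_def)
  have "real n * \<theta> > 0" using np \<theta> by simp
  then have ksb: "real ks \<le> real n * \<theta>" "real n * \<theta> < real ks + 1" unfolding ks_def by linarith+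
  have ksn: "\<bar>\<theta> - real ks / real n\<bar> \<le> 1 / real n"
  proof -
    have "\<theta> - real ks / real n = (real n * \<theta> - real ks) / real n" using np by (simp add: diff_divide_distrib)
    moreover have "\<bar>(real n * \<theta> - real ks) / real n\<bar> \<le> 1 / real n" unfolding abs_divide using np ksb by (simp add: divide_right_mono)
    ultimately show ?thesis by simp
  qed
  have dn: "d / real n \<le> \<epsilon> / 2"
  proof -
    have "d \<le> C / \<Delta>\<^sup>2" using dC D2 by (simp add: pos_le_divide_eq mult.commute)
    then have "d / real n \<le> C / \<Delta>\<^sup>2 / real n" using np by (intro divide_right_mono) auto
    also have "\<dots> = C / (real n * \<Delta>\<^sup>2)" by (simp add: mult.commute)
    finally show ?thesis using \<Delta>(2) by linarith
  qed
  have kn: "\<bar>\<theta> - real k / real n\<bar> \<le> \<epsilon>"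
  proof -
    have "\<bar>real ks / real n - real k / real n\<bar> = d / real n" unfolding d_def diff_divide_distrib[symmetric] abs_divide by (simp add: abs_minus_commute)
    then show ?thesis using ksn dn n(2) by linarith
  qed
  have c2: "2 * c \<le> \<theta>" "2 * c \<le> 1 - \<theta>" unfolding c by auto
  have kc: "c \<le> real k / real n" "c \<le> 1 - real k / real n" using kn \<epsilon>(4) c2 by linarith+
  have kc1: "c * real n \<le> real k" using kc(1) np by (simp add: pos_le_divide_eq)
  have kn1: "real k < real n"
  proof -
    have "real k / real n < 1" using kc(2) cp by linarith
    then show ?thesis using np by simp
  qed
  then have kltn: "k < n" by simp
  have kc2: "c * real n \<le> real (n - k)"
  proof -
    have "c * real n \<le> (1 - real k / real n) * real n" using kc(2) np by (intro mult_right_mono) auto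
    also have "\<dots> = real n - real k" using np by (simp add: left_diff_distrib)
    also have "\<dots> = real (n - k)" using kltn by (simp add: of_nat_diff)
    finally show ?thesis .
  qed
  have cn: "c * real n > 0" using cp np by simp
  have k0: "k > 0" using kc1 cn by (metis less_le_trans of_nat_0_less_iff)
  have hh: "\<epsilon> + 1 / real m \<le> h" if "c * real n \<le> real m" for m
  proof -
    have "1 / real m \<le> 1 / (c * real n)" using that cn by (intro divide_left_mono) auto
    then show ?thesis using n(3) \<epsilon>(3) by linarith
  qed
  have n\<zeta>: "1 / real n \<le> \<zeta>" using n(2) \<epsilon>(1,2) by linarith
  \<comment> \<open>Total absolute shift on the misclassified stretch. Relative to
    \<open>sqrt n\<close> it equals \<open>\<Delta>^2 d / (sqrt n |\<Delta>|)\<close>, at most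
    \<open>C\<close> divided by the diverging \<open>sqrt (n \<Delta>^2)\<close>.\<close>
  define r where "r = d * \<bar>\<Delta>\<bar>"
  have rn: "r / sqrt (real n) \<le> \<zeta>"
  proof -
    have a: "\<bar>\<Delta>\<bar> > 0" using D2 by auto
    have "r / sqrt (real n) = (\<Delta>\<^sup>2 * d) / (sqrt (real n) * \<bar>\<Delta>\<bar>)" 
    proof -
      have f: "d * u / w = (u * u * d) / (w * u)" if "u \<noteq> 0" for u w :: real using that by simp
      have sq: "\<Delta>\<^sup>2 = \<bar>\<Delta>\<bar> * \<bar>\<Delta>\<bar>" by (simp add: power2_eq_square)
      show ?thesis unfolding r_def sq by (rule f) (use a in simp)
    qed
    also have "\<dots> \<le> C / (sqrt (real n) * \<bar>\<Delta>\<bar>)" using dC by (intro divide_right_mono) auto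
    also have "sqrt (real n) * \<bar>\<Delta>\<bar> = sqrt (real n * \<Delta>\<^sup>2)" by (simp add: real_sqrt_mult)
    finally show ?thesis using \<Delta>(3) by linarith
  qed
  have sd: "sqrt ((real (q m) + 1) / real m * (2 * C + 2 * (4 * R\<^sup>2 / c))) + \<delta> / \<sigma> \<le> \<zeta>" if m: "c * real n \<le> real m" "m \<le> n" for m
  proof -
    have "(real (q m) + 1) / real m \<le> (real (q n) + 1) / (c * real n)"
      using monoD[OF qn(1) m(2)] m(1) cn by (intro frac_le) auto
    then have "(real (q m) + 1) / real m * (2 * C + 2 * (4 * R\<^sup>2 / c)) \<le> (real (q n) + 1) / (c * real n) * (2 * C + 8 * R\<^sup>2 / c)"
      using C0 cp by (intro mult_mono) auto
    then have "sqrt ((real (q m) + 1) / real m * (2 * C + 2 * (4 * R\<^sup>2 / c))) \<le> \<zeta> / 2"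
      using qn(2) real_sqrt_le_mono order_trans by blast
    moreover have "\<delta> / \<sigma> \<le> \<zeta> / 2" using \<delta> \<sigma> by (simp add: pos_divide_le_eq mult.commute)
    ultimately show ?thesis by linarith
  qed
  have zR: "\<bar>z t\<bar> \<le> R" if "t \<in> {0..1}" for t using sup_abs_ge[OF z(1) that] zm(2) by linarith
  \<comment> \<open>A block sum of \<open>y\<close> is an increment of the path, at most
    \<open>2 R sqrt n\<close>; this controls the effect of centering at the sample mean.\<close>
  have sq_bound: "v\<^sup>2 / real m \<le> 4 * R\<^sup>2 / c" if v: "\<bar>v\<bar> \<le> sqrt (real n) * (2 * R)" and m: "c * real n \<le> real m" for v m
  proof -
    have "\<bar>v\<bar>\<^sup>2 \<le> (sqrt (real n) * (2 * R))\<^sup>2" by (rule power_mono[OF v]) simp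
    then have "v\<^sup>2 \<le> 4 * R\<^sup>2 * real n" by (simp add: power_mult_distrib mult_ac)
    then have "v\<^sup>2 / real m \<le> (4 * R\<^sup>2 * real n) / (c * real n)" using m cn R0 by (intro frac_le) auto
    then show ?thesis using np by simp
  qed
  have S: "(\<Sum>i=1..j. y i) = sqrt (real n) * z (real j / real n)" if "j \<le> n" for j using z(2)[OF that] np by simp
  have card1: "real (card {i\<in>{0<..k}. i > ks}) \<le> d"
  proof -
    have "{i\<in>{0<..k}. i > ks} = {ks<..k}" by auto
    then show ?thesis unfolding d_def by simp
  qed
  have card2: "real (card {i\<in>{k<..n}. \<not> i > ks}) \<le> d"
  proof -
    have "card {i\<in>{k<..n}. \<not> i > ks} \<le> card {k<..ks}" by (rule card_mono) auto
    then show ?thesis unfolding d_def by simp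
  qed
  \<comment> \<open>Each block is referred to its own level, \<open>\<mu>\<close> or
    \<open>\<mu> + \<Delta>\<close>, so that the shift appears only at observations on the wrong
    side of \<open>ks\<close>.\<close>
  define e1 where "e1 i = (if i > ks then \<Delta> else 0)" for i
  define e2 where "e2 i = (if \<not> i > ks then - \<Delta> else 0)" for i
  have x1: "x i = \<mu> + e1 i + y i" for i by (simp add: x e1_def ks_def)
  have x2: "x i = (\<mu> + \<Delta>) + e2 i + y i" for i by (simp add: x e2_def ks_def)
  have e1s: "(\<Sum>i\<in>{0<..k}. \<bar>e1 i\<bar>) \<le> r" "(\<Sum>i\<in>{0<..k}. (e1 i)\<^sup>2) \<le> C"
  proof -
    have "(\<Sum>i\<in>{0<..k}. \<bar>e1 i\<bar>) = real (card {i\<in>{0<..k}. i > ks}) * \<bar>\<Delta>\<bar>"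
      unfolding e1_def by (rule sum_const_subset[where f=abs]) auto
    then show "(\<Sum>i\<in>{0<..k}. \<bar>e1 i\<bar>) \<le> r" unfolding r_def using card1 by (simp add: mult_right_mono)
    have "(\<Sum>i\<in>{0<..k}. (e1 i)\<^sup>2) = real (card {i\<in>{0<..k}. i > ks}) * \<Delta>\<^sup>2"
      unfolding e1_def by (rule sum_const_subset[where f="\<lambda>v. v\<^sup>2"]) auto
    also have "\<dots> \<le> d * \<Delta>\<^sup>2" using card1 by (intro mult_right_mono) auto
    finally show "(\<Sum>i\<in>{0<..k}. (e1 i)\<^sup>2) \<le> C" using dC by (simp add: mult.commute)
  qed
  have e2s: "(\<Sum>i\<in>{k<..n}. \<bar>e2 i\<bar>) \<le> r" "(\<Sum>i\<in>{k<..n}. (e2 i)\<^sup>2) \<le> C"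
  proof -
    have "(\<Sum>i\<in>{k<..n}. \<bar>e2 i\<bar>) = real (card {i\<in>{k<..n}. \<not> i > ks}) * \<bar>- \<Delta>\<bar>"
      unfolding e2_def by (rule sum_const_subset[where f=abs]) auto
    then show "(\<Sum>i\<in>{k<..n}. \<bar>e2 i\<bar>) \<le> r" unfolding r_def using card2 by (simp add: mult_right_mono)
    have "(\<Sum>i\<in>{k<..n}. (e2 i)\<^sup>2) = real (card {i\<in>{k<..n}. \<not> i > ks}) * (- \<Delta>)\<^sup>2"
      unfolding e2_def by (rule sum_const_subset[where f="\<lambda>v. v\<^sup>2"]) auto
    also have "\<dots> \<le> d * \<Delta>\<^sup>2" using card2 by (simp add: mult_right_mono)
    finally show "(\<Sum>i\<in>{k<..n}. (e2 i)\<^sup>2) \<le> C" using dC by (simp add: mult.commute)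
  qed
  have s1: "\<bar>sqrt (lrv_block x 0 k (q k)) - \<sigma>\<bar> \<le> \<zeta>"
  proof -
    have "(\<Sum>i=1..k. (e1 i)\<^sup>2) \<le> C"
    proof -
      have "{1..k} = {0<..k}" by auto
      then show ?thesis using e1s(2) by simp
    qed
    moreover have "(\<Sum>i=1..k. y i)\<^sup>2 / real k \<le> 4 * R\<^sup>2 / c"
    proof (rule sq_bound[OF _ kc1])
      have "\<bar>z (real k / real n)\<bar> \<le> R" by (rule zR) (use kltn np in auto)
      then show "\<bar>\<Sum>i=1..k. y i\<bar> \<le> sqrt (real n) * (2 * R)"
        unfolding S[OF less_imp_le[OF kltn]] abs_mult using R0 np by (intro mult_mono) auto
    qed
    ultimately have "\<bar>sqrt (bartlett_form (\<lambda>i. x i - (\<Sum>i=1..k. x i) / real k) k (q k)) - \<sigma>\<bar>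
      \<le> sqrt ((real (q k) + 1) / real k * (2 * C + 2 * (4 * R\<^sup>2 / c))) + \<delta> / \<sigma>"
      by (rule sqrt_bartlett_close[OF k0 x1 _ _ \<sigma> b1[OF kc1 less_imp_le[OF kltn]]])
    also have "\<dots> \<le> \<zeta>" by (rule sd[OF kc1 less_imp_le[OF kltn]])
    finally show ?thesis unfolding lrv_block_first .
  qed
  have s2: "\<bar>sqrt (lrv_block x k n (q (n - k))) - \<sigma>\<bar> \<le> \<zeta>"
  proof -
    have nk: "n - k > 0" using kltn by simp
    have "(\<Sum>i=1..n - k. (e2 (n + 1 - i))\<^sup>2) \<le> C" using e2s(2) unfolding sum_reflect .
    moreover have "(\<Sum>i=1..n - k. y (n + 1 - i))\<^sup>2 / real (n - k) \<le> 4 * R\<^sup>2 / c"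
    proof (rule sq_bound[OF _ kc2])
      have "{1..n} = {1..k} \<union> {k<..n}" using kltn by auto
      then have "(\<Sum>i=1..n. y i) = (\<Sum>i=1..k. y i) + (\<Sum>i\<in>{k<..n}. y i)"
        by (simp add: sum.union_disjoint[symmetric] ivl_disj_int)
      then have "(\<Sum>i\<in>{k<..n}. y i) = sqrt (real n) * (z (real n / real n) - z (real k / real n))"
        using S[of n] S[of k] kltn by (simp add: right_diff_distrib)
      moreover have "\<bar>z (real n / real n) - z (real k / real n)\<bar> \<le> 2 * R"
        using zR[of "real n / real n"] zR[of "real k / real n"] kltn np by (simp add: abs_le_iff)
      ultimately show "\<bar>\<Sum>i=1..n - k. y (n + 1 - i)\<bar> \<le> sqrt (real n) * (2 * R)"
        unfolding sum_reflect[symmetric] by (simp add: abs_mult mult_left_mono)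
    qed
    ultimately have "\<bar>sqrt (bartlett_form (\<lambda>i. x (n + 1 - i) - (\<Sum>i=1..n - k. x (n + 1 - i)) / real (n - k)) (n - k) (q (n - k))) - \<sigma>\<bar>
      \<le> sqrt ((real (q (n - k)) + 1) / real (n - k) * (2 * C + 2 * (4 * R\<^sup>2 / c))) + \<delta> / \<sigma>"
      by (rule sqrt_bartlett_close[OF nk x2 _ _ \<sigma> b2[OF kc2 diff_le_self]])
    also have "\<dots> \<le> \<zeta>" by (rule sd[OF kc2 diff_le_self])
    finally show ?thesis unfolding lrv_block_reflect .
  qed
  have "\<bar>(1 / sqrt (lrv_block x 0 k (q k))) * (1 / sqrt (real (k - 0))) * block_max x 0 k - bridge_sup 0 \<theta> z / \<sigma>\<bar> \<le> \<tau>"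
  proof (rule block_approxD[OF z1 n(1) k0 less_imp_le[OF kltn] z _ kn _ \<epsilon>(2) zm x1 e1s(1) rn n\<zeta> s1])
    show "\<epsilon> + 1 / real (k - 0) \<le> h" using hh[OF kc1] by simp
  qed (use \<epsilon>(1) in auto)
  moreover have "\<bar>(1 / sqrt (lrv_block x k n (q (n - k)))) * (1 / sqrt (real (n - k))) * block_max x k n - bridge_sup \<theta> 1 z / \<sigma>\<bar> \<le> \<tau>"
  proof (rule block_approxD[OF z2 n(1) kltn order.refl z kn _ hh[OF kc2] \<epsilon>(2) zm x2 e2s(1) rn n\<zeta> s2])
    show "\<bar>1 - real n / real n\<bar> \<le> \<epsilon>" using \<epsilon>(1) np by simp
  qed
  ultimately show ?thesis unfolding T_n1_block T_n2_block Let_def k_def[symmetric] by blast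
qed

section \<open>The studentized statistics\<close>

context weak_dep
begin

context
  fixes N :: "'b measure" and W :: "real \<Rightarrow> 'b \<Rightarrow> real" and \<sigma> :: real
  assumes N: "prob_space N" and W: "wiener_process01 N W" and \<sigma>: "\<sigma> > 0"
    and fclt: "conv_dist_D01 M
                 (\<lambda>n \<omega> t. (1 / sqrt (real n)) * (\<Sum>j\<in>{1..nat \<lfloor>real n * t\<rfloor>}. Y (int j) \<omega>))
                 N (\<lambda>\<omega> t. \<sigma> * W t \<omega>)"
begin

definition S_path :: "nat \<Rightarrow> nat \<Rightarrow> 'a \<Rightarrow> real" where
  "S_path n i \<omega> = (1 / sqrt (real n)) * (\<Sum>j\<in>{1..i}. Y (int j) \<omega>)"

lemma S_path_meas[measurable]: "S_path n i \<in> borel_measurable M"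
  unfolding S_path_def[abs_def] by measurable

lemma S_path_conv: "conv_dist_D01 M (\<lambda>n \<omega> t. S_path n (nat \<lfloor>real n * t\<rfloor>) \<omega>) N (\<lambda>\<omega> t. \<sigma> * W t \<omega>)"
  using fclt unfolding S_path_def .

lemma W_meas: "t \<in> {0..1} \<Longrightarrow> W t \<in> borel_measurable N"
  and W_cont: "\<omega> \<in> space N \<Longrightarrow> continuous_on {0..1} (\<lambda>t. W t \<omega>)"
  using W by (auto simp: wiener_process01_def gaussian_process01_def)

lemma sW_meas: "t \<in> {0..1} \<Longrightarrow> (\<lambda>\<omega>. \<sigma> * W t \<omega>) \<in> borel_measurable N"
  by (intro borel_measurable_times borel_measurable_const W_meas)

lemma sW_cont: "\<omega> \<in> space N \<Longrightarrow> continuous_on {0..1} (\<lambda>t. \<sigma> * W t \<omega>)"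
  by (intro continuous_intros W_cont)

lemma S_path_cadlag: "(\<lambda>t. S_path n (nat \<lfloor>real n * t\<rfloor>) \<omega>) \<in> cadlag01"
  using step_in_cadlag01[of "\<lambda>i. S_path n i \<omega>" n] .

text \<open>The excess of the supremum over \<open>k\<close> vanishes eventually along each limit
  path, so it is negligible in the sense of \<open>functional_negligible\<close>.\<close>

lemma sup_abs_tight:
  assumes \<eta>: "\<eta> > 0"
  shows "\<exists>R\<ge>0. eventually (\<lambda>n. \<exists>E\<in>sets M. measure M E < \<eta> \<and>
    (\<forall>\<omega>\<in>space M - E. sup_abs (\<lambda>t. S_path n (nat \<lfloor>real n * t\<rfloor>) \<omega>) \<le> R)) sequentially"
proof -
  define F where "F k x = max 0 (sup_abs x - real k)" for k :: nat and x
  have "supnorm_continuous (F k)" for k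
  proof -
    have "continuous_on UNIV (\<lambda>u::real. max 0 (u - real k))" by (intro continuous_intros)
    from supnorm_continuous_compose[OF this sup_abs_supnorm_continuous] show ?thesis unfolding F_def[abs_def] .
  qed
  moreover have "0 \<le> F k x" for k x by (simp add: F_def)
  moreover have "(\<lambda>k. F k (\<lambda>t. \<sigma> * W t \<omega>)) \<longlonglongrightarrow> 0" for \<omega>
  proof (rule tendsto_eventually)
    have "eventually (\<lambda>k. k \<ge> nat \<lceil>sup_abs (\<lambda>t. \<sigma> * W t \<omega>)\<rceil>) sequentially" by (rule eventually_ge_at_top)
    then show "eventually (\<lambda>k. F k (\<lambda>t. \<sigma> * W t \<omega>) = 0) sequentially"
    proof eventually_elim
      case (elim k)
      then have "sup_abs (\<lambda>t. \<sigma> * W t \<omega>) \<le> real k" by linarith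
      then show ?case by (simp add: F_def)
    qed
  qed
  ultimately obtain k where k: "eventually (\<lambda>n. \<exists>E\<in>sets M. measure M E < \<eta> \<and>
      (\<forall>\<omega>\<in>space M - E. F k (\<lambda>t. S_path n (nat \<lfloor>real n * t\<rfloor>) \<omega>) < 1)) sequentially"
    using functional_negligible[OF prob_space_axioms N S_path_conv S_path_meas sW_meas sW_cont, of F 1 \<eta>] \<eta> by auto
  have "eventually (\<lambda>n. \<exists>E\<in>sets M. measure M E < \<eta> \<and>
    (\<forall>\<omega>\<in>space M - E. sup_abs (\<lambda>t. S_path n (nat \<lfloor>real n * t\<rfloor>) \<omega>) \<le> real k + 1)) sequentially"
    using k
  proof eventually_elim
    case (elim n)
    then obtain E where E: "E \<in> sets M" "measure M E < \<eta>"
      "\<And>\<omega>. \<omega> \<in> space M - E \<Longrightarrow> F k (\<lambda>t. S_path n (nat \<lfloor>real n * t\<rfloor>) \<omega>) < 1" by blast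
    have "sup_abs (\<lambda>t. S_path n (nat \<lfloor>real n * t\<rfloor>) \<omega>) \<le> real k + 1" if "\<omega> \<in> space M - E" for \<omega>
      using E(3)[OF that] unfolding F_def by linarith
    then show ?case using E(1,2) by blast
  qed
  then show ?thesis by (intro exI[of _ "real k + 1"]) auto
qed

lemma modulus_small:
  assumes \<tau>: "\<tau> > 0" and \<eta>: "\<eta> > 0"
  shows "\<exists>h>0. eventually (\<lambda>n. \<exists>E\<in>sets M. measure M E < \<eta> \<and>
    (\<forall>\<omega>\<in>space M - E. modulus h (\<lambda>t. S_path n (nat \<lfloor>real n * t\<rfloor>) \<omega>) < \<tau>)) sequentially"
proof -
  have sc: "supnorm_continuous (modulus (1 / real (Suc k)))" for k by (rule modulus_supnorm_continuous) simp
  have nn: "0 \<le> modulus (1 / real (Suc k)) x" if "x \<in> cadlag01" for k x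
    using modulus_ge[OF that, of 0 0 "1 / real (Suc k)"] by simp
  have lim: "(\<lambda>k. modulus (1 / real (Suc k)) (\<lambda>t. \<sigma> * W t \<omega>)) \<longlonglongrightarrow> 0" if "\<omega> \<in> space N" for \<omega>
    by (rule modulus_tendsto[OF sW_cont[OF that]])
  obtain k :: nat where "eventually (\<lambda>n. \<exists>E\<in>sets M. measure M E < \<eta> \<and>
    (\<forall>\<omega>\<in>space M - E. modulus (1 / real (Suc k)) (\<lambda>t. S_path n (nat \<lfloor>real n * t\<rfloor>) \<omega>) < \<tau>)) sequentially"
    using functional_negligible[where F="\<lambda>k. modulus (1 / real (Suc k))", OF prob_space_axioms N S_path_conv S_path_meas sW_meas sW_cont sc nn lim \<tau> \<eta>] by blast
  then show ?thesis by (intro exI[of _ "1 / real (Suc k)"]) simp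
qed

text \<open>The order of choices matters: the bound \<open>R\<close> on the path, then the tolerance
  \<open>\<zeta>\<close> depending on \<open>R\<close>, then the lag \<open>h\<close> at which the
  modulus is below \<open>\<zeta>\<close>, then \<open>\<epsilon>\<close> depending on
  \<open>h\<close>, and finally \<open>n\<close>.\<close>

lemma statistics_close:
  fixes \<theta> \<mu> \<tau> \<eta> :: real and \<Delta> :: "nat \<Rightarrow> real" and q :: "nat \<Rightarrow> nat"
  defines "x \<equiv> \<lambda>n \<omega> i. \<mu> + (if i > nat \<lfloor>real n * \<theta>\<rfloor> then \<Delta> n else 0) + Y (int i) \<omega>"
  assumes \<theta>: "0 < \<theta>" "\<theta> < 1"
    and Delta_div: "filterlim (\<lambda>n. real n * (\<Delta> n)\<^sup>2) at_top sequentially"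
    and khat_OP: "\<forall>\<epsilon>>0. \<exists>C. \<exists>n0. \<forall>n\<ge>n0. measure M {\<omega>\<in>space M. (\<Delta> n)\<^sup>2 *
            \<bar>real (khat (x n \<omega>) n) - real (nat \<lfloor>real n * \<theta>\<rfloor>)\<bar> > C} < \<epsilon>"
    and q_mono: "mono q"
    and q_doubling: "\<exists>C. \<forall>k. real (q (2 ^ (k + 1))) \<le> C * real (q (2 ^ k))"
    and q_inf: "filterlim q at_top sequentially"
    and q_log: "\<exists>C. \<forall>n. real (q n) * (ln (real n)) ^ 4 \<le> C * real n"
    and \<tau>: "\<tau> > 0" and \<eta>: "\<eta> > 0"
  shows "eventually (\<lambda>n. \<exists>E\<in>sets M. measure M E < \<eta> \<and> (\<forall>\<omega>\<in>space M - E.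
     \<bar>T_n1 q (x n \<omega>) n - bridge_sup 0 \<theta> (\<lambda>t. S_path n (nat \<lfloor>real n * t\<rfloor>) \<omega>) / \<sigma>\<bar> \<le> \<tau> \<and>
     \<bar>T_n2 q (x n \<omega>) n - bridge_sup \<theta> 1 (\<lambda>t. S_path n (nat \<lfloor>real n * t\<rfloor>) \<omega>) / \<sigma>\<bar> \<le> \<tau>)) sequentially"
proof -
  have lrv: "lrv \<gamma> = \<sigma>\<^sup>2" by (rule lrv_eq_variance[OF N W fclt])
  \<comment> \<open>Five exceptional events: for \<open>khat\<close>, the supremum, the modulus, and
    the Bartlett forms of the forward and the reversed sequence.\<close>
  define \<eta>5 where "\<eta>5 = \<eta> / 5"
  have \<eta>5: "\<eta>5 > 0" using \<eta> by (simp add: \<eta>5_def)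
  obtain R where R0: "R \<ge> 0" and ev2: "eventually (\<lambda>n. \<exists>E\<in>sets M. measure M E < \<eta>5 \<and>
    (\<forall>\<omega>\<in>space M - E. sup_abs (\<lambda>t. S_path n (nat \<lfloor>real n * t\<rfloor>) \<omega>) \<le> R)) sequentially"
    using sup_abs_tight[OF \<eta>5] by blast
  have th: "(0::real) \<le> 0" "0 \<le> \<theta>" "\<theta> \<le> 1" "(1::real) \<le> 1" using \<theta> by auto
  obtain \<zeta>1 where \<zeta>1: "\<zeta>1 > 0" "\<forall>\<zeta>'. 0 < \<zeta>' \<and> \<zeta>' \<le> \<zeta>1 \<longrightarrow> block_approx 0 \<theta> \<sigma> R \<zeta>' \<tau>"
    using block_stat_small[OF th(1) \<theta>(1) th(3) \<sigma> \<tau> R0] by blast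
  obtain \<zeta>2 where \<zeta>2: "\<zeta>2 > 0" "\<forall>\<zeta>'. 0 < \<zeta>' \<and> \<zeta>' \<le> \<zeta>2 \<longrightarrow> block_approx \<theta> 1 \<sigma> R \<zeta>' \<tau>"
    using block_stat_small[OF th(2) \<theta>(2) th(4) \<sigma> \<tau> R0] by blast
  define \<zeta> where "\<zeta> = min \<zeta>1 \<zeta>2"
  have \<zeta>: "\<zeta> > 0" using \<zeta>1(1) \<zeta>2(1) by (simp add: \<zeta>_def)
  have ba: "block_approx 0 \<theta> \<sigma> R \<zeta> \<tau>" "block_approx \<theta> 1 \<sigma> R \<zeta> \<tau>"
    using \<zeta>1(2) \<zeta>2(2) \<zeta> by (auto simp: \<zeta>_def)
  obtain h where h: "h > 0" and ev3: "eventually (\<lambda>n. \<exists>E\<in>sets M. measure M E < \<eta>5 \<and>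
    (\<forall>\<omega>\<in>space M - E. modulus h (\<lambda>t. S_path n (nat \<lfloor>real n * t\<rfloor>) \<omega>) < \<zeta>)) sequentially"
    using modulus_small[OF \<zeta> \<eta>5] by blast
  obtain C1 n1 where C1: "\<And>n. n \<ge> n1 \<Longrightarrow> measure M {\<omega>\<in>space M. (\<Delta> n)\<^sup>2 *
            \<bar>real (khat (x n \<omega>) n) - real (nat \<lfloor>real n * \<theta>\<rfloor>)\<bar> > C1} < \<eta>5"
    using khat_OP \<eta>5 by blast
  define C where "C = max C1 1"
  have C0: "C > 0" by (simp add: C_def)
  have xm: "(\<lambda>\<omega>. x n \<omega> i) \<in> borel_measurable M" for n i unfolding x_def by measurable
  define c where "c = min \<theta> (1 - \<theta>) / 2"
  have c: "c > 0" using \<theta> by (simp add: c_def)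
  define \<delta> where "\<delta> = \<sigma> * \<zeta> / 2"
  have \<delta>: "\<delta> > 0" using \<sigma> \<zeta> by (simp add: \<delta>_def)
  have ev4: "eventually (\<lambda>n. \<forall>Y \<kappa>. weak_dep M Y \<gamma> \<kappa> G K \<longrightarrow> (\<exists>E\<in>sets M. measure M E < \<eta>5 \<and>
     (\<forall>\<omega>\<in>space M - E. \<forall>k. c * real n \<le> real k \<longrightarrow> k \<le> n \<longrightarrow>
        \<bar>bartlett_form (\<lambda>i. Y (int i) \<omega>) k (q k) - lrv \<gamma>\<bar> \<le> \<delta>))) sequentially"
    by (rule bartlett_consistency[OF q_mono q_doubling q_log q_inf c \<delta> \<eta>5 gamma_summable])
  define \<epsilon> where "\<epsilon> = min \<zeta> (min (h / 2) (c / 2))"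
  have \<epsilon>: "0 < \<epsilon>" "\<epsilon> \<le> \<zeta>" "\<epsilon> \<le> h / 2" "\<epsilon> \<le> c / 2" using \<zeta> h c by (auto simp: \<epsilon>_def)
  have inv0: "(\<lambda>n. 1 / real n) \<longlonglongrightarrow> 0" by (rule lim_1_over_n)
  have evn1: "eventually (\<lambda>n. 1 / real n < \<epsilon> / 2) sequentially"
    using order_tendstoD(2)[OF inv0, of "\<epsilon> / 2"] \<epsilon>(1) by simp
  have evn2: "eventually (\<lambda>n. (1 / c) * (1 / real n) < h / 2) sequentially"
    using order_tendstoD(2)[OF tendsto_mult[OF tendsto_const[of "1 / c"] inv0], of "h / 2"] h by simp
  have "(\<lambda>n. sqrt ((1 / c) * ((real (q n) + 1) / real n) * (2 * C + 8 * R\<^sup>2 / c))) \<longlonglongrightarrow> sqrt ((1 / c) * 0 * (2 * C + 8 * R\<^sup>2 / c))"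
    by (intro tendsto_intros bandwidth_over_n q_log)
  then have evq: "eventually (\<lambda>n. sqrt ((1 / c) * ((real (q n) + 1) / real n) * (2 * C + 8 * R\<^sup>2 / c)) < \<zeta> / 2) sequentially"
    using \<zeta> by (intro order_tendstoD(2)) auto
  \<comment> \<open>The three entries ensure, in order, that the misclassified fraction is at most
    \<open>\<epsilon> / 2\<close>, that the misclassified shift is at most \<open>\<zeta>\<close> on
    the scale \<open>sqrt n\<close>, and that \<open>n \<Delta>^2\<close> is positive.\<close>
  define B where "B = max (2 * C / \<epsilon>) (max ((C / \<zeta>)\<^sup>2) 1)"
  have evD: "eventually (\<lambda>n. real n * (\<Delta> n)\<^sup>2 \<ge> B) sequentially"
    using Delta_div by (simp add: filterlim_at_top)
  show ?thesis
    using ev2 ev3 ev4 evn1 evn2 evq evD eventually_ge_at_top[of "max n1 1"]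
  proof eventually_elim
    case (elim n)
    have n: "n > 0" "n \<ge> n1" using elim(8) by auto
    let ?Z = "\<lambda>\<omega> t. S_path n (nat \<lfloor>real n * t\<rfloor>) \<omega>"
    obtain E2 where E2: "E2 \<in> sets M" "measure M E2 < \<eta>5" "\<And>\<omega>. \<omega> \<in> space M - E2 \<Longrightarrow> sup_abs (?Z \<omega>) \<le> R"
      using elim(1) by blast
    obtain E3 where E3: "E3 \<in> sets M" "measure M E3 < \<eta>5" "\<And>\<omega>. \<omega> \<in> space M - E3 \<Longrightarrow> modulus h (?Z \<omega>) < \<zeta>"
      using elim(2) by blast
    have "\<exists>E\<in>sets M. measure M E < \<eta>5 \<and> (\<forall>\<omega>\<in>space M - E. \<forall>k. c * real n \<le> real k \<longrightarrow> k \<le> n \<longrightarrow>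
        \<bar>bartlett_form (\<lambda>i. Y (int i) \<omega>) k (q k) - lrv \<gamma>\<bar> \<le> \<delta>)"
      using elim(3) weak_dep_axioms by blast
    then obtain E4 where E4: "E4 \<in> sets M" "measure M E4 < \<eta>5" "\<And>\<omega> k. \<omega> \<in> space M - E4 \<Longrightarrow> c * real n \<le> real k \<Longrightarrow> k \<le> n \<Longrightarrow>
        \<bar>bartlett_form (\<lambda>i. Y (int i) \<omega>) k (q k) - \<sigma>\<^sup>2\<bar> \<le> \<delta>" unfolding lrv by blast
    \<comment> \<open>The reflected sequence varies with \<open>n\<close>; this instance is
      available because the threshold in \<open>bartlett_consistency\<close> is common to all
      sequences.\<close>
    have "\<exists>E\<in>sets M. measure M E < \<eta>5 \<and> (\<forall>\<omega>\<in>space M - E. \<forall>k. c * real n \<le> real k \<longrightarrow> k \<le> n \<longrightarrow>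
        \<bar>bartlett_form (\<lambda>i. Y (int (n + 1) - int i) \<omega>) k (q k) - lrv \<gamma>\<bar> \<le> \<delta>)"
      using elim(3)[THEN spec, THEN spec, THEN mp, OF reflect[of "int (n + 1)"]] .
    then obtain E5 where E5: "E5 \<in> sets M" "measure M E5 < \<eta>5" "\<And>\<omega> k. \<omega> \<in> space M - E5 \<Longrightarrow> c * real n \<le> real k \<Longrightarrow> k \<le> n \<Longrightarrow>
        \<bar>bartlett_form (\<lambda>i. Y (int (n + 1) - int i) \<omega>) k (q k) - \<sigma>\<^sup>2\<bar> \<le> \<delta>" unfolding lrv by blast
    define E1 where "E1 = {\<omega>\<in>space M. (\<Delta> n)\<^sup>2 * \<bar>real (khat (x n \<omega>) n) - real (nat \<lfloor>real n * \<theta>\<rfloor>)\<bar> > C1}"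
    have km: "(\<lambda>\<omega>. khat (x n \<omega>) n) \<in> M \<rightarrow>\<^sub>M count_space UNIV" by (rule measurable_khat[OF xm])
    have "(\<lambda>\<omega>. real (khat (x n \<omega>) n)) \<in> borel_measurable M" by (rule measurable_compose[OF km]) simp
    then have E1: "E1 \<in> sets M" "measure M E1 < \<eta>5" using C1[OF n(2)] unfolding E1_def by measurable
    define E where "E = E1 \<union> E2 \<union> E3 \<union> E4 \<union> E5"
    have "measure M E \<le> measure M E1 + measure M E2 + measure M E3 + measure M E4 + measure M E5"
      unfolding E_def using E1 E2 E3 E4 E5
      by (intro order_trans[OF measure_Un_le] add_mono order.refl sets.Un) auto
    also have "\<dots> < \<eta>" using E1(2) E2(2) E3(2) E4(2) E5(2) by (simp add: \<eta>5_def)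
    finally have pE: "measure M E < \<eta>" .
    have D: "real n * (\<Delta> n)\<^sup>2 > 0" "C / (real n * (\<Delta> n)\<^sup>2) \<le> \<epsilon> / 2" "C / sqrt (real n * (\<Delta> n)\<^sup>2) \<le> \<zeta>"
    proof -
      have b: "1 \<le> real n * (\<Delta> n)\<^sup>2" "2 * C / \<epsilon> \<le> real n * (\<Delta> n)\<^sup>2" "(C / \<zeta>)\<^sup>2 \<le> real n * (\<Delta> n)\<^sup>2"
        using elim(7) by (auto simp: B_def)
      show p: "real n * (\<Delta> n)\<^sup>2 > 0" using b(1) by linarith
      have "2 * C \<le> (real n * (\<Delta> n)\<^sup>2) * \<epsilon>" using b(2) by (simp only: pos_divide_le_eq[OF \<epsilon>(1)])
      then have "C \<le> \<epsilon> / 2 * (real n * (\<Delta> n)\<^sup>2)" by (simp add: mult_ac)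
      then show "C / (real n * (\<Delta> n)\<^sup>2) \<le> \<epsilon> / 2" by (simp only: pos_divide_le_eq[OF p])
      have "C / \<zeta> \<le> sqrt (real n * (\<Delta> n)\<^sup>2)" using b(3) by (rule real_le_rsqrt)
      then have "C \<le> sqrt (real n * (\<Delta> n)\<^sup>2) * \<zeta>" by (simp only: pos_divide_le_eq[OF \<zeta>])
      then have "C \<le> \<zeta> * sqrt (real n * (\<Delta> n)\<^sup>2)" by (simp only: mult.commute)
      moreover have "sqrt (real n * (\<Delta> n)\<^sup>2) > 0" using p by (simp only: real_sqrt_gt_0_iff)
      ultimately show "C / sqrt (real n * (\<Delta> n)\<^sup>2) \<le> \<zeta>" by (simp only: pos_divide_le_eq)
    qed
    have qn: "sqrt ((real (q n) + 1) / (c * real n) * (2 * C + 8 * R\<^sup>2 / c)) \<le> \<zeta> / 2"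
    proof -
      have "(real (q n) + 1) / (c * real n) = (1 / c) * ((real (q n) + 1) / real n)" by simp
      then show ?thesis using elim(6) by (simp only: less_imp_le)
    qed
    have hn: "1 / (c * real n) \<le> h / 2" using elim(5) by simp
    have main: "\<bar>T_n1 q (x n \<omega>) n - bridge_sup 0 \<theta> (?Z \<omega>) / \<sigma>\<bar> \<le> \<tau> \<and> \<bar>T_n2 q (x n \<omega>) n - bridge_sup \<theta> 1 (?Z \<omega>) / \<sigma>\<bar> \<le> \<tau>"
      if w: "\<omega> \<in> space M - E" for \<omega>
    proof (rule statistics_close_pointwise[OF \<theta> \<sigma> c_def R0 less_imp_le[OF C0] ba \<epsilon> n(1) less_imp_le[OF elim(4)] hn D q_mono qn,
        where \<delta>=\<delta> and y="\<lambda>i. Y (int i) \<omega>" and \<mu>=\<mu>])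
      show "\<delta> \<le> \<sigma> * \<zeta> / 2" by (simp add: \<delta>_def)
      show "?Z \<omega> \<in> cadlag01" by (rule S_path_cadlag)
      show "S_path n (nat \<lfloor>real n * (real k / real n)\<rfloor>) \<omega> = (\<Sum>i=1..k. Y (int i) \<omega>) / sqrt (real n)" for k
        using n(1) by (simp add: S_path_def)
      show "modulus h (?Z \<omega>) \<le> \<zeta>" by (rule less_imp_le, rule E3(3)) (use w in \<open>auto simp: E_def\<close>)
      show "sup_abs (?Z \<omega>) \<le> R" by (rule E2(3)) (use w in \<open>auto simp: E_def\<close>)
      show "x n \<omega> = (\<lambda>i. \<mu> + (if nat \<lfloor>real n * \<theta>\<rfloor> < i then \<Delta> n else 0) + Y (int i) \<omega>)" by (simp add: x_def)
      have "\<omega> \<in> space M" "\<omega> \<notin> E1" using w by (auto simp: E_def)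
      then have "(\<Delta> n)\<^sup>2 * \<bar>real (khat (x n \<omega>) n) - real (nat \<lfloor>real n * \<theta>\<rfloor>)\<bar> \<le> C1" by (simp add: E1_def)
      then show "(\<Delta> n)\<^sup>2 * \<bar>real (khat (x n \<omega>) n) - real (nat \<lfloor>real n * \<theta>\<rfloor>)\<bar> \<le> C" unfolding C_def by linarith
    next
      fix k assume k: "c * real n \<le> real k" "k \<le> n"
      show "\<bar>bartlett_form (\<lambda>i. Y (int i) \<omega>) k (q k) - \<sigma>\<^sup>2\<bar> \<le> \<delta>"
        by (rule E4(3)[OF _ k]) (use w in \<open>auto simp: E_def\<close>)
      have "\<bar>bartlett_form (\<lambda>i. Y (int (n + 1) - int i) \<omega>) k (q k) - \<sigma>\<^sup>2\<bar> \<le> \<delta>"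
        by (rule E5(3)[OF _ k]) (use w in \<open>auto simp: E_def\<close>)
      moreover have "bartlett_form (\<lambda>i. Y (int (n + 1) - int i) \<omega>) k (q k) = bartlett_form (\<lambda>i. Y (int (n + 1 - i)) \<omega>) k (q k)"
        by (rule bartlett_form_cong) (use k(2) in \<open>simp add: of_nat_diff\<close>)
      ultimately show "\<bar>bartlett_form (\<lambda>i. Y (int (n + 1 - i)) \<omega>) k (q k) - \<sigma>\<^sup>2\<bar> \<le> \<delta>" by simp
    qed
    have "E \<in> sets M" unfolding E_def using E1 E2 E3 E4 E5 by auto
    then show ?case using pE main by blast
  qed
qed

end

end

section \<open>Joint convergence of the two statistics\<close>

lemma bridge_sup_scale:
  assumes ab: "0 \<le> \<alpha>" "\<alpha> < \<beta>" "\<beta> \<le> 1" and z: "continuous_on {0..1} z" and \<sigma>: "\<sigma> > 0"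
  shows "bridge_sup \<alpha> \<beta> (\<lambda>t. \<sigma> * z t) / \<sigma> = bridge_sup \<alpha> \<beta> z"
proof -
  have b: "bridge_of (\<lambda>t. \<sigma> * z t) \<alpha> \<beta> u = \<sigma> * bridge_of z \<alpha> \<beta> u" for u
    by (simp add: bridge_of_def algebra_simps)
  have zc: "z \<in> cadlag01" "(\<lambda>t. \<sigma> * z t) \<in> cadlag01"
    by (rule continuous_in_cadlag01; intro continuous_intros z)+
  have "bridge_sup \<alpha> \<beta> (\<lambda>t. \<sigma> * z t) \<le> \<sigma> * bridge_sup \<alpha> \<beta> z"
  proof (rule bridge_sup_le)
    fix u :: real assume u: "u \<in> {0..1}"
    show "\<bar>bridge_of (\<lambda>t. \<sigma> * z t) \<alpha> \<beta> u\<bar> \<le> \<sigma> * bridge_sup \<alpha> \<beta> z"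
      unfolding b abs_mult using bridge_sup_ge[OF ab zc(1) u] \<sigma> by simp
  qed
  moreover have "bridge_sup \<alpha> \<beta> z \<le> bridge_sup \<alpha> \<beta> (\<lambda>t. \<sigma> * z t) / \<sigma>"
  proof (rule bridge_sup_le)
    fix u :: real assume u: "u \<in> {0..1}"
    show "\<bar>bridge_of z \<alpha> \<beta> u\<bar> \<le> bridge_sup \<alpha> \<beta> (\<lambda>t. \<sigma> * z t) / \<sigma>"
      using bridge_sup_ge[OF ab zc(2) u] \<sigma> unfolding b abs_mult by (simp add: pos_le_divide_eq mult.commute)
  qed
  ultimately show ?thesis using \<sigma> by (simp add: field_simps)
qed

text \<open>\<open>X n\<close> is the pair of bridge suprema of the rescaled path, divided by
  \<open>\<sigma>\<close>, with the split at the nonrandom time \<open>\<theta>\<close>. Its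
  convergence is that of a continuous functional, and the actual statistics differ from it by an
  amount negligible in probability.\<close>

theorem theorem2p1:
  fixes M :: "'a measure" and Y :: "int \<Rightarrow> 'a \<Rightarrow> real"
    and N :: "'b measure" and W :: "real \<Rightarrow> 'b \<Rightarrow> real" and \<sigma> :: real
    and \<mu> \<theta> :: real and \<Delta> :: "nat \<Rightarrow> real" and q :: "nat \<Rightarrow> nat"
  assumes probM: "prob_space M"
    and stat: "fourth_order_stationary M Y"
    and mean0: "\<forall>k. (\<integral>\<omega>. Y k \<omega> \<partial>M) = 0"
    and probN: "prob_space N" and wiener: "wiener_process01 N W" and sigma_pos: "\<sigma> > 0"
    and fclt: "conv_dist_D01 M
                 (\<lambda>n \<omega> t. (1 / sqrt (real n)) * (\<Sum>j\<in>{1..nat \<lfloor>real n * t\<rfloor>}. Y (int j) \<omega>))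
                 N (\<lambda>\<omega> t. \<sigma> * W t \<omega>)"
    and gamma_sum: "(\<lambda>j. \<bar>autocov M Y j\<bar>) summable_on UNIV"
    and kappa_sum: "\<exists>C. \<forall>h. (\<lambda>(r, s). \<bar>cumulant4 M Y h r s\<bar>) summable_on UNIV
                          \<and> (\<Sum>\<^sub>\<infinity>(r, s). \<bar>cumulant4 M Y h r s\<bar>) \<le> C"
    and theta: "0 < \<theta>" "\<theta> < 1"
    and Delta_div: "filterlim (\<lambda>n. real n * (\<Delta> n)\<^sup>2) at_top sequentially"
    and khat_OP: "\<forall>\<epsilon>>0. \<exists>C. \<exists>n0. \<forall>n\<ge>n0.
        measure M {\<omega>\<in>space M. (\<Delta> n)\<^sup>2 *
            \<bar>real (khat (\<lambda>i. \<mu> + (if i > nat \<lfloor>real n * \<theta>\<rfloor> then \<Delta> n else 0) + Y (int i) \<omega>) n)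
             - real (nat \<lfloor>real n * \<theta>\<rfloor>)\<bar> > C} < \<epsilon>"
    and q_Delta: "\<exists>C. \<forall>n. real (q n) * (\<Delta> n)\<^sup>2 \<le> C"
    and q_pos: "\<forall>n\<ge>1. q n \<ge> 1"
    and q_mono: "mono q"
    and q_doubling: "\<exists>C. \<forall>k. real (q (2 ^ (k + 1))) \<le> C * real (q (2 ^ k))"
    and q_inf: "filterlim q at_top sequentially"
    and q_log: "\<exists>C. \<forall>n. real (q n) * (ln (real n)) ^ 4 \<le> C * real n"
  shows "\<forall>(N' :: 'c measure) B1 B2. prob_space N' \<and> brownian_bridge N' B1 \<and> brownian_bridge N' B2
           \<and> prob_space.indep_var N' (PiM {0..1} (\<lambda>_. borel)) (path01 B1)
                                    (PiM {0..1} (\<lambda>_. borel)) (path01 B2) \<longrightarrow>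
         conv_dist_R2 M
           (\<lambda>n \<omega>. let x = (\<lambda>i. \<mu> + (if i > nat \<lfloor>real n * \<theta>\<rfloor> then \<Delta> n else 0) + Y (int i) \<omega>)
                   in (T_n1 q x n, T_n2 q x n))
           N' (\<lambda>\<omega>. (SUP t\<in>{0..1}. \<bar>B1 t \<omega>\<bar>, SUP t\<in>{0..1}. \<bar>B2 t \<omega>\<bar>))"
proof (intro allI impI, elim conjE)
  fix N' :: "'c measure" and B1 B2
  assume N': "prob_space N'" and B: "brownian_bridge N' B1" "brownian_bridge N' B2"
    and ind: "prob_space.indep_var N' (PiM {0..1} (\<lambda>_. borel)) (path01 B1) (PiM {0..1} (\<lambda>_. borel)) (path01 B2)"
  obtain C where "\<And>h. (\<lambda>(r, s). \<bar>cumulant4 M Y h r s\<bar>) summable_on UNIV"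
    "\<And>h. (\<Sum>\<^sub>\<infinity>(r, s). \<bar>cumulant4 M Y h r s\<bar>) \<le> C" using kappa_sum by blast
  then interpret weak_dep M Y "autocov M Y" "cumulant4 M Y" "\<Sum>\<^sub>\<infinity>j. \<bar>autocov M Y j\<bar>" C
    by (rule weak_dep_of_stationary[OF probM stat gamma_sum])
  note P = probN wiener sigma_pos fclt
  let ?Z = "\<lambda>n \<omega> t. S_path n (nat \<lfloor>real n * t\<rfloor>) \<omega>"
  let ?x = "\<lambda>n \<omega> i. \<mu> + (if i > nat \<lfloor>real n * \<theta>\<rfloor> then \<Delta> n else 0) + Y (int i) \<omega>"
  define X where "X n \<omega> = (bridge_sup 0 \<theta> (?Z n \<omega>) / \<sigma>, bridge_sup \<theta> 1 (?Z n \<omega>) / \<sigma>)" for n \<omega>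
  have o1: "(0::real) \<le> 0" "0 < \<theta>" "\<theta> \<le> 1" and o2: "0 \<le> \<theta>" "\<theta> < 1" "(1::real) \<le> 1" using theta by auto
  note c1 = bridge_sup_supnorm_continuous[OF o1] and c2 = bridge_sup_supnorm_continuous[OF o2]
  have m: "S_path n i \<in> borel_measurable M" for n i by (rule S_path_meas[OF P])
  have xm: "(\<lambda>\<omega>. ?x n \<omega> i) \<in> borel_measurable M" for n i by measurable
  have "conv_dist_R2 M (\<lambda>n \<omega>. (T_n1 q (?x n \<omega>) n, T_n2 q (?x n \<omega>) n)) N'
      (\<lambda>\<omega>. (SUP t\<in>{0..1}. \<bar>B1 t \<omega>\<bar>, SUP t\<in>{0..1}. \<bar>B2 t \<omega>\<bar>))"
  proof (rule slutsky_R2[where X=X])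
    show "prob_space M" by fact
    show "(\<lambda>\<omega>. (T_n1 q (?x n \<omega>) n, T_n2 q (?x n \<omega>) n)) \<in> borel_measurable M" for n
      by (rule measurable_T[OF xm])
    have "(\<lambda>\<omega>. bridge_sup 0 \<theta> (?Z n \<omega>)) \<in> borel_measurable M" "(\<lambda>\<omega>. bridge_sup \<theta> 1 (?Z n \<omega>)) \<in> borel_measurable M" for n
      by (rule measurable_supnorm_continuous_step[OF c1 m], rule measurable_supnorm_continuous_step[OF c2 m])
    then show "X n \<in> borel_measurable M" for n
      unfolding X_def[abs_def] by (intro borel_measurable_Pair borel_measurable_divide borel_measurable_const)
  next
    fix g :: "real \<times> real \<Rightarrow> real" assume g: "continuous_on UNIV g" and "bounded (range g)"
    then obtain A where A: "\<And>x. \<bar>g x\<bar> \<le> A" by (auto simp: bounded_iff)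
    have gs: "continuous_on UNIV (\<lambda>p. g (fst p / \<sigma>, snd p / \<sigma>))"
      by (rule continuous_on_compose2[OF g]) (use sigma_pos in \<open>auto intro!: continuous_intros\<close>)
    have "supnorm_continuous (\<lambda>z. g (bridge_sup 0 \<theta> z / \<sigma>, bridge_sup \<theta> 1 z / \<sigma>))"
      using supnorm_continuous_pair[OF gs c1 c2] by simp
    from conv_dist_D01_supnorm_continuous[OF probM probN S_path_conv[OF P] m sW_meas[OF P] sW_cont[OF P] this A]
    have "(\<lambda>n. \<integral>\<omega>. g (X n \<omega>) \<partial>M) \<longlonglongrightarrow> (\<integral>\<omega>. g (bridge_sup 0 \<theta> (\<lambda>t. \<sigma> * W t \<omega>) / \<sigma>, bridge_sup \<theta> 1 (\<lambda>t. \<sigma> * W t \<omega>) / \<sigma>) \<partial>N)"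
      unfolding X_def by simp
    also have "(\<integral>\<omega>. g (bridge_sup 0 \<theta> (\<lambda>t. \<sigma> * W t \<omega>) / \<sigma>, bridge_sup \<theta> 1 (\<lambda>t. \<sigma> * W t \<omega>) / \<sigma>) \<partial>N)
      = (\<integral>\<omega>. g (SUP t\<in>{0..1}. \<bar>bridge_of (\<lambda>t. W t \<omega>) 0 \<theta> t\<bar>, SUP t\<in>{0..1}. \<bar>bridge_of (\<lambda>t. W t \<omega>) \<theta> 1 t\<bar>) \<partial>N)"
    proof (rule Bochner_Integration.integral_cong[OF refl])
      fix \<omega> assume w: "\<omega> \<in> space N"
      show "g (bridge_sup 0 \<theta> (\<lambda>t. \<sigma> * W t \<omega>) / \<sigma>, bridge_sup \<theta> 1 (\<lambda>t. \<sigma> * W t \<omega>) / \<sigma>)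
        = g (SUP t\<in>{0..1}. \<bar>bridge_of (\<lambda>t. W t \<omega>) 0 \<theta> t\<bar>, SUP t\<in>{0..1}. \<bar>bridge_of (\<lambda>t. W t \<omega>) \<theta> 1 t\<bar>)"
        unfolding bridge_sup_scale[OF o1 W_cont[OF P w] sigma_pos] bridge_sup_scale[OF o2 W_cont[OF P w] sigma_pos]
        by (simp add: bridge_sup_def)
    qed
    \<comment> \<open>The passage from one Wiener path to two independent bridges on another
      probability space is an identity of laws.\<close>
    also have "\<dots> = (\<integral>\<omega>. g (SUP t\<in>{0..1}. \<bar>B1 t \<omega>\<bar>, SUP t\<in>{0..1}. \<bar>B2 t \<omega>\<bar>) \<partial>N')"
      by (rule bridge_suprema_law[OF probN wiener theta N' B ind g A])
    finally show "(\<lambda>n. \<integral>\<omega>. g (X n \<omega>) \<partial>M) \<longlonglongrightarrow> (\<integral>\<omega>. g (SUP t\<in>{0..1}. \<bar>B1 t \<omega>\<bar>, SUP t\<in>{0..1}. \<bar>B2 t \<omega>\<bar>) \<partial>N')" .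
  next
    fix \<eta> :: real assume \<eta>: "\<eta> > 0"
    obtain R where R: "R \<ge> 0" "eventually (\<lambda>n. \<exists>E\<in>sets M. measure M E < \<eta> \<and>
      (\<forall>\<omega>\<in>space M - E. sup_abs (?Z n \<omega>) \<le> R)) sequentially"
      using sup_abs_tight[OF P \<eta>] by blast
    define R' where "R' = 2 * R / sqrt (\<theta> - 0) / \<sigma> + 2 * R / sqrt (1 - \<theta>) / \<sigma>"
    have bs: "\<bar>bridge_sup \<alpha> \<beta> z / \<sigma>\<bar> \<le> 2 * R / sqrt (\<beta> - \<alpha>) / \<sigma>"
      if ab: "0 \<le> \<alpha>" "\<alpha> < \<beta>" "\<beta> \<le> 1" and z: "z \<in> cadlag01" "sup_abs z \<le> R" for \<alpha> \<beta> z
    proof -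
      have zR: "\<bar>z t\<bar> \<le> R" if "t \<in> {0..1}" for t using sup_abs_ge[OF z(1) that] z(2) by linarith
      have "bridge_sup \<alpha> \<beta> z \<le> 2 * R / sqrt (\<beta> - \<alpha>)" by (rule bridge_sup_le) (rule bridge_of_bound[OF ab _ zR])
      moreover have "0 \<le> bridge_sup \<alpha> \<beta> z" using bridge_sup_ge[OF ab z(1), of 0] by simp
      ultimately have "bridge_sup \<alpha> \<beta> z / \<sigma> \<le> 2 * R / sqrt (\<beta> - \<alpha>) / \<sigma>" "0 \<le> bridge_sup \<alpha> \<beta> z / \<sigma>"
        using sigma_pos by (intro divide_right_mono divide_nonneg_pos; simp)+
      then show ?thesis by (simp only: abs_of_nonneg)
    qed
    have "norm (X n \<omega>) \<le> R'" if "sup_abs (?Z n \<omega>) \<le> R" for n \<omega>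
    proof -
      have "norm (X n \<omega>) \<le> \<bar>bridge_sup 0 \<theta> (?Z n \<omega>) / \<sigma>\<bar> + \<bar>bridge_sup \<theta> 1 (?Z n \<omega>) / \<sigma>\<bar>"
        unfolding X_def norm_Pair real_norm_def power2_abs by (rule sqrt_sum_squares_le_sum_abs)
      also have "\<dots> \<le> R'" unfolding R'_def
        by (intro add_mono bs o1 o2 S_path_cadlag[OF P] that)
      finally show ?thesis .
    qed
    then show "\<exists>R. eventually (\<lambda>n. \<exists>E\<in>sets M. measure M E < \<eta> \<and> (\<forall>\<omega>\<in>space M - E. norm (X n \<omega>) \<le> R)) sequentially"
      using R(2) by (intro exI[of _ R']) (auto elim!: eventually_mono)
  next
    fix \<tau> \<eta> :: real assume \<tau>: "\<tau> > 0" and \<eta>: "\<eta> > 0"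
    \<comment> \<open>The distance in the plane is at most the sum of the coordinate distances, so
      each coordinate gets \<open>\<tau> / 2\<close>.\<close>
    have \<tau>2: "\<tau> / 2 > 0" using \<tau> by simp
    have "eventually (\<lambda>n. \<exists>E\<in>sets M. measure M E < \<eta> \<and> (\<forall>\<omega>\<in>space M - E.
       \<bar>T_n1 q (?x n \<omega>) n - bridge_sup 0 \<theta> (?Z n \<omega>) / \<sigma>\<bar> \<le> \<tau> / 2 \<and>
       \<bar>T_n2 q (?x n \<omega>) n - bridge_sup \<theta> 1 (?Z n \<omega>) / \<sigma>\<bar> \<le> \<tau> / 2)) sequentially"
      by (rule statistics_close[OF P theta Delta_div khat_OP q_mono q_doubling q_inf q_log \<tau>2 \<eta>])
    moreover have "dist (T_n1 q (?x n \<omega>) n, T_n2 q (?x n \<omega>) n) (X n \<omega>) \<le> \<tau>"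
      if "\<bar>T_n1 q (?x n \<omega>) n - bridge_sup 0 \<theta> (?Z n \<omega>) / \<sigma>\<bar> \<le> \<tau> / 2 \<and>
       \<bar>T_n2 q (?x n \<omega>) n - bridge_sup \<theta> 1 (?Z n \<omega>) / \<sigma>\<bar> \<le> \<tau> / 2" for n \<omega>
    proof -
      have "dist (T_n1 q (?x n \<omega>) n, T_n2 q (?x n \<omega>) n) (X n \<omega>)
        \<le> dist (T_n1 q (?x n \<omega>) n) (fst (X n \<omega>)) + dist (T_n2 q (?x n \<omega>) n) (snd (X n \<omega>))"
        unfolding dist_prod_def by (simp add: sqrt_sum_squares_le_sum)
      then show ?thesis using that unfolding dist_real_def X_def fst_conv snd_conv by linarith
    qed
    ultimately show "eventually (\<lambda>n. \<exists>E\<in>sets M. measure M E < \<eta> \<and>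
      (\<forall>\<omega>\<in>space M - E. dist (T_n1 q (?x n \<omega>) n, T_n2 q (?x n \<omega>) n) (X n \<omega>) \<le> \<tau>)) sequentially"
      by (auto elim!: eventually_mono)
  qed
  then show "conv_dist_R2 M (\<lambda>n \<omega>. let x = ?x n \<omega> in (T_n1 q x n, T_n2 q x n)) N'
      (\<lambda>\<omega>. (SUP t\<in>{0..1}. \<bar>B1 t \<omega>\<bar>, SUP t\<in>{0..1}. \<bar>B2 t \<omega>\<bar>))" by (simp add: Let_def)
qed

end
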